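(* Let $n\ge 3$. The set $\mathcal{M}_{0,n}$ of rational tropical curves with $n$ marked points admits the structure of an $(n-3)$-dimensional (smooth) tropical variety such that the edge-length functions are regular within each combinatorial type (that is, for every combinatorial type $\Gamma$ the edge-length functions on the subset $U_\Gamma\subset\mathcal{M}_{0,n}$ of curves of type $\Gamma$ are regular on $U_\Gamma$ with respect to the restriction of the structure sheaf). Furthermore, the space $\mathcal{M}_{0,n}$ can be tropically embedded in $\mathbb{R}^N$ for some $N$, i.e. $\mathcal{M}_{0,n}$ can be presented as a simply balanced polyhedral complex in $\mathbb{R}^N$.
   Context: **Tropical curves.** A rational tropical curve with $n\ge 3$ marked points is a connected finite tree $X$ with exactly $n$ leaves (edges ending at 1-valent vertices), marked bijectively by $1,\dots,n$, all of whose other vertices have valence at least 3, where every non-leaf (bounded) edge has a length in $(0,\infty)$ and every leaf has infinite length. $\mathcal{M}_{0,n}$ is the set of such curves up to isometry respecting the markings. The combinatorial type of $X$ is its class up to homeomorphism respecting the markings; for a combinatorial type $\Gamma$, $U_\Gamma\subset\mathcal{M}_{0,n}$ is the set of curves of type $\Gamma$. The length of a given bounded edge of $\Gamma$ is a function on $U_\Gamma$, called an edge-length function. If $\Gamma$ has $M$ bounded edges, the edge-length functions give a cone $\mathbb{R}_{\ge0}^M$; the faces of this cone are identified with the cones of the combinatorial types obtained by contracting some bounded edges to points. Gluing these cones makes $\mathcal{M}_{0,n}$ a topological space (a fan-like polyhedral complex). **Regular functions.** $\mathbb{T}=\mathbb{R}\cup\{-\infty\}$, and $\mathbb{T}^n\approx[-\infty,\infty)^n$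 carries the Euclidean topology. A tropical Laurent polynomial is a function $\mathbb{R}^n\to\mathbb{R}$, $f(x)=\max_j(a_j+j\cdot x)$, with $j$ ranging over a finite subset of $\mathbb{Z}^n$ and $a_j\in\mathbb{R}$. For $U\subset\mathbb{T}^n$ open, a continuous function $f:U\to\mathbb{T}$ is regular if $f|_{U\cap\mathbb{R}^n}$ is the restriction of a tropical Laurent polynomial. This gives the sheaf $\mathcal{O}_{\mathbb{T}^n}$ of regular functions; a subset $X\subset\mathbb{T}^n$ gets the induced sheaf $\mathcal{O}_X$ by restriction. **Polyhedral complexes.** A $k$-dimensional polyhedral complex in $\mathbb{R}^n$ (resp. $\mathbb{T}^n$) is a (resp. the closure in $\mathbb{T}^n$ of a) union of $k$-dimensional convex polyhedra in $\mathbb{R}^n$ (possibly unbounded, of rational slope) such that the intersection of any number of them is their common face. These polyhedra are the facets. Facets may carry positive integer weights; an unweighted complex has all weights 1. **Balancing.** Let $Y$ be a $k$-dimensional weighted polyhedral complex in $\mathbb{R}^N$ or $\mathbb{T}^N$. Let $E\subset Y\cap\mathbb{R}^N$ be a $(k-1)$-dimensional face and $F_1,\dots,F_l$ the facets adjacent to $E$, with weights $w_1,\dots,w_l$. Let $L\subset\mathbb{R}^N$ be an $(N-k)$-dimensional affine-linear subspace of integer slope that intersects $E$ (in its relative interior). For generic $v\in\mathbb{R}^N$, $F_j\cap(L+v)$ is empty or a single point. Let $\Lambda_{F_j},\Lambda_L\subset\mathbb{Z}^N$ be the integer vectors parallel to $F_j$ and to $L$, and let $\lambda_j$ be the product of $w_j$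 and the index of $\Lambda_{F_j}+\Lambda_L$ in $\mathbb{Z}^N$. $Y$ is balanced if for all $E$, $L$ and small generic $v$ the sum $\iota_L=\sum_{j:\,F_j\cap(L+v)\ne\emptyset}\lambda_j$ is independent of $v$. $Y$ is simply balanced if in addition, for every such $E$ and every $j$, one can find an $(N-k)$-dimensional affine-linear subspace $L\subset\mathbb{R}^N$ of integer slope that intersects $E$ in its relative interior, and a small generic vector $v\in\mathbb{R}^N$, such that $F_j\cap(L+v)\neq\emptyset$, $\iota_L=1$, and for every small $v$ there is an affine hyperplane $H_v\subset L$ such that $Y\cap(L+v)$ lies entirely on one side of $H_v+v$ in $L+v$ while $Y\cap(H_v+v)$ is a point. **Tropical varieties.** A topological space $X$ with a sheaf $\mathcal{O}_X$ of $\mathbb{T}$-valued functions is a (smooth) tropical variety of dimension $k$ if for every $x\in X$ there are an open $U\ni x$ and an open set $V$ in a simply balanced $k$-dimensional polyhedral complex $Y\subset\mathbb{T}^N$ such that $(U,\mathcal{O}_X|_U)$ and $(V,\mathcal{O}_Y|_V)$ are isomorphic. *)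

theory Defs
  imports "HOL-Analysis.Analysis" "HOL-Library.Function_Algebras"
begin

section \<open>The space \<open>\<real>\<^sup>N\<close>\<close>

text \<open>
  Ambient dimensions are existentially quantified, so \<open>\<real>\<^sup>N\<close> is modelled as in
  \<open>Euclidean_space N\<close>: sequences that vanish at all indices \<open>\<ge> N\<close>. The pointwise vector
  space structure makes \<open>span\<close>, \<open>dim\<close>, \<open>affine\<close> and \<open>face_of\<close> available for it.
\<close>

instantiation "fun" :: (type, real_vector) real_vector
begin

definition scaleR_fun :: "real \<Rightarrow> ('a \<Rightarrow> 'b) \<Rightarrow> 'a \<Rightarrow> 'b"
  where "scaleR_fun c f = (\<lambda>x. c *\<^sub>R f x)"

instance
  by standard (auto simp: scaleR_fun_def fun_eq_iff scaleR_add_right scaleR_add_left)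

end

definition Rn :: "nat \<Rightarrow> (nat \<Rightarrow> real) set"
  where "Rn N = topspace (Euclidean_space N)"

definition Zn :: "nat \<Rightarrow> (nat \<Rightarrow> real) set"
  where "Zn N = {z \<in> Rn N. \<forall>i. z i \<in> \<int>}"

definition dot :: "nat \<Rightarrow> (nat \<Rightarrow> real) \<Rightarrow> (nat \<Rightarrow> real) \<Rightarrow> real"
  where "dot N a x = (\<Sum>i<N. a i * x i)"

definition direction :: "(nat \<Rightarrow> real) set \<Rightarrow> (nat \<Rightarrow> real) set"
  where "direction S = span {x - y | x y. x \<in> S \<and> y \<in> S}"

text \<open>For nonempty \<open>S\<close> this is the dimension of the affine hull of \<open>S\<close>; the library's
  \<open>aff_dim\<close> is restricted to the class \<open>euclidean_space\<close>, and so is \<open>rel_interior\<close>.\<close>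

definition pdim :: "(nat \<Rightarrow> real) set \<Rightarrow> nat"
  where "pdim S = dim (direction S)"

definition relint :: "nat \<Rightarrow> (nat \<Rightarrow> real) set \<Rightarrow> (nat \<Rightarrow> real) set"
  where "relint N S = subtopology (Euclidean_space N) (affine hull S) interior_of S"

text \<open>The trace on small vectors of the complement of a finite union of proper affine subspaces.\<close>

definition small_generic :: "nat \<Rightarrow> (nat \<Rightarrow> real) filter"
  where "small_generic N =
    inf (nhdsin (Euclidean_space N) 0)
        (INF A\<in>{A. affine A \<and> A \<subset> Rn N}. principal (Rn N - A))"

lemma eventually_small_generic:
  "eventually P (small_generic N) \<longleftrightarrow>
     (\<exists>S \<A>. openin (Euclidean_space N) S \<and> 0 \<in> S \<and> finite \<A> \<and>
        (\<forall>A\<in>\<A>. affine A \<and> A \<subset> Rn N) \<and> (\<forall>v\<in>S - \<Union>\<A>. P v))"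
  (is "_ \<longleftrightarrow> ?R")
proof
  have z: "0 \<in> topspace (Euclidean_space N)"
    by (simp add: topspace_Euclidean_space)
  assume "eventually P (small_generic N)"
  then obtain Q Q' where Q: "eventually Q (nhdsin (Euclidean_space N) 0)"
    and Q': "eventually Q' (INF A\<in>{A. affine A \<and> A \<subset> Rn N}. principal (Rn N - A))"
    and PQ: "\<forall>x. Q x \<and> Q' x \<longrightarrow> P x"
    unfolding small_generic_def eventually_inf by (elim exE conjE)
  obtain S where S: "openin (Euclidean_space N) S" "0 \<in> S" "\<forall>x\<in>S. Q x"
    using Q z unfolding eventually_nhdsin by blast
  obtain X where X: "X \<subseteq> {A. affine A \<and> A \<subset> Rn N}" "finite X"
    "eventually Q' (INF A\<in>X. principal (Rn N - A))"
    using Q' unfolding eventually_INF[of Q' _ "{A. affine A \<and> A \<subset> Rn N}"] by (elim exE conjE)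
  have "eventually Q' (principal (\<Inter>A\<in>X. Rn N - A))"
    using X(3) by (simp add: INF_principal_finite[OF X(2)])
  then have "\<forall>x\<in>Rn N - \<Union>X. Q' x"
    by (simp add: eventually_principal)
  moreover have "S \<subseteq> Rn N"
    using openin_subset[OF S(1)] by (simp add: Rn_def)
  ultimately have "\<forall>v\<in>S - \<Union>X. P v"
    using S(3) PQ by blast
  then show ?R
    using S(1,2) X(1,2) by blast
next
  assume ?R
  then obtain S \<A> where S: "openin (Euclidean_space N) S" "0 \<in> S"
    and A: "finite \<A>" "\<forall>A\<in>\<A>. affine A \<and> A \<subset> Rn N" and P: "\<forall>v\<in>S - \<Union>\<A>. P v"
    by blast
  have "eventually (\<lambda>v. v \<in> S) (nhdsin (Euclidean_space N) 0)"
    using S unfolding eventually_nhdsin by blast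
  then have 1: "eventually (\<lambda>v. v \<in> S) (small_generic N)"
    unfolding small_generic_def by (rule filter_leD[OF inf_le1])
  have "eventually (\<lambda>v. v \<notin> A) (small_generic N)" if "A \<in> \<A>" for A
  proof -
    have "eventually (\<lambda>v. v \<notin> A) (INF A\<in>{A. affine A \<and> A \<subset> Rn N}. principal (Rn N - A))"
      by (rule eventually_INF1[of A]) (use A that in \<open>simp_all add: eventually_principal\<close>)
    then show ?thesis
      unfolding small_generic_def by (rule filter_leD[OF inf_le2])
  qed
  then have "eventually (\<lambda>v. \<forall>A\<in>\<A>. v \<notin> A) (small_generic N)"
    using A(1) by (simp add: eventually_ball_finite)
  with 1 show "eventually P (small_generic N)"
    by eventually_elim (use P in blast)
qed


section \<open>Polyhedral complexes and balancing\<close>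

text \<open>Convex polyhedra of rational slope.\<close>

definition rational_polyhedron :: "nat \<Rightarrow> (nat \<Rightarrow> real) set \<Rightarrow> bool"
  where "rational_polyhedron N P \<longleftrightarrow>
    (\<exists>A. finite A \<and> A \<subseteq> Zn N \<times> UNIV \<and> P = {x \<in> Rn N. \<forall>(a, b)\<in>A. dot N a x \<le> b})"

text \<open>
  A complex is given by its finite set of facets together with their weights; its support is
  \<open>\<Union>\<F>\<close>. The empty set counts as a face (as it does for \<open>face_of\<close>).
\<close>

definition polyhedral_complex ::
    "nat \<Rightarrow> nat \<Rightarrow> (nat \<Rightarrow> real) set set \<Rightarrow> ((nat \<Rightarrow> real) set \<Rightarrow> nat) \<Rightarrow> bool"
  where "polyhedral_complex N k \<F> w \<longleftrightarrow>
    finite \<F> \<and>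
    (\<forall>F\<in>\<F>. rational_polyhedron N F \<and> F \<noteq> {} \<and> pdim F = k \<and> w F \<ge> 1) \<and>
    (\<forall>\<G>\<subseteq>\<F>. \<forall>F\<in>\<G>. \<Inter>\<G> face_of F)"

definition codim1_face :: "nat \<Rightarrow> (nat \<Rightarrow> real) set set \<Rightarrow> (nat \<Rightarrow> real) set \<Rightarrow> bool"
  where "codim1_face k \<F> E \<longleftrightarrow> (\<exists>F\<in>\<F>. E face_of F) \<and> E \<noteq> {} \<and> pdim E + 1 = k"

definition adjacent_facets :: "(nat \<Rightarrow> real) set set \<Rightarrow> (nat \<Rightarrow> real) set \<Rightarrow> (nat \<Rightarrow> real) set set"
  where "adjacent_facets \<F> E = {F \<in> \<F>. E face_of F}"

definition integral_affine :: "nat \<Rightarrow> (nat \<Rightarrow> real) set \<Rightarrow> bool"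
  where "integral_affine N L \<longleftrightarrow> (\<exists>p\<in>Rn N. \<exists>B\<subseteq>Zn N. L = (+) p ` span B)"

definition transversal ::
    "nat \<Rightarrow> nat \<Rightarrow> (nat \<Rightarrow> real) set \<Rightarrow> (nat \<Rightarrow> real) set \<Rightarrow> bool"
  where "transversal N k E L \<longleftrightarrow>
    integral_affine N L \<and> pdim L + k = N \<and> L \<inter> relint N E \<noteq> {}"

definition parallel_lattice :: "nat \<Rightarrow> (nat \<Rightarrow> real) set \<Rightarrow> (nat \<Rightarrow> real) set"
  where "parallel_lattice N S = Zn N \<inter> direction S"

text \<open>The index of \<open>\<Lambda>\<^sub>F + \<Lambda>\<^sub>L\<close> in \<open>\<int>\<^sup>N\<close>. The junk value 0 for an infinite index is harmless:
  then \<open>L + v\<close> misses \<open>F\<close> for generic \<open>v\<close>.\<close>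

definition lattice_index :: "nat \<Rightarrow> (nat \<Rightarrow> real) set \<Rightarrow> (nat \<Rightarrow> real) set \<Rightarrow> nat"
  where "lattice_index N F L =
    card (Zn N // {(x, y). x \<in> Zn N \<and> y \<in> Zn N \<and>
      x - y \<in> {a + b | a b. a \<in> parallel_lattice N F \<and> b \<in> parallel_lattice N L}})"

definition iota ::
    "nat \<Rightarrow> (nat \<Rightarrow> real) set set \<Rightarrow> ((nat \<Rightarrow> real) set \<Rightarrow> nat) \<Rightarrow>
     (nat \<Rightarrow> real) set \<Rightarrow> (nat \<Rightarrow> real) set \<Rightarrow> (nat \<Rightarrow> real) \<Rightarrow> nat"
  where "iota N \<F> w E L v =
    (\<Sum>F\<in>{F \<in> adjacent_facets \<F> E. F \<inter> (+) v ` L \<noteq> {}}. w F * lattice_index N F L)"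

definition balanced ::
    "nat \<Rightarrow> nat \<Rightarrow> (nat \<Rightarrow> real) set set \<Rightarrow> ((nat \<Rightarrow> real) set \<Rightarrow> nat) \<Rightarrow> bool"
  where "balanced N k \<F> w \<longleftrightarrow>
    polyhedral_complex N k \<F> w \<and>
    (\<forall>E L. codim1_face k \<F> E \<and> transversal N k E L \<longrightarrow>
       (\<exists>c. \<forall>\<^sub>F v in small_generic N. iota N \<F> w E L v = c))"

text \<open>There is a hyperplane \<open>H = {x \<in> L. dot N a x = c}\<close> of \<open>L\<close> such that \<open>Y \<inter> (L + v)\<close> lies on
  one side of \<open>H + v\<close> and meets \<open>H + v\<close> in one point.\<close>

definition one_sided :: "nat \<Rightarrow> (nat \<Rightarrow> real) set \<Rightarrow> (nat \<Rightarrow> real) set \<Rightarrow> (nat \<Rightarrow> real) \<Rightarrow> bool"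
  where "one_sided N Y L v \<longleftrightarrow>
    (\<exists>a\<in>Rn N. \<exists>c. (\<exists>x\<in>L. \<exists>y\<in>L. dot N a x \<noteq> dot N a y) \<and>
       (\<forall>y\<in>Y \<inter> (+) v ` L. dot N a (y - v) \<le> c) \<and>
       (\<exists>p. Y \<inter> (+) v ` {x \<in> L. dot N a x = c} = {p}))"

definition simply_balanced ::
    "nat \<Rightarrow> nat \<Rightarrow> (nat \<Rightarrow> real) set set \<Rightarrow> ((nat \<Rightarrow> real) set \<Rightarrow> nat) \<Rightarrow> bool"
  where "simply_balanced N k \<F> w \<longleftrightarrow>
    balanced N k \<F> w \<and>
    (\<forall>E. codim1_face k \<F> E \<longrightarrow> (\<forall>F\<in>adjacent_facets \<F> E.
       \<exists>L. transversal N k E L \<and>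
         (\<exists>\<^sub>F v in small_generic N. F \<inter> (+) v ` L \<noteq> {}) \<and>
         (\<forall>\<^sub>F v in small_generic N. iota N \<F> w E L v = 1) \<and>
         (\<forall>\<^sub>F v in nhdsin (Euclidean_space N) 0. one_sided N (\<Union>\<F>) L v)))"


section \<open>Sheaves of \<open>\<T>\<close>-valued functions\<close>

text \<open>
  \<open>\<T>\<close> is \<open>ereal\<close> without \<open>\<infinity>\<close>. A section over \<open>U\<close> is represented by any total function with the
  right values on \<open>U\<close>; values outside \<open>U\<close> are irrelevant, by the second clause below.
\<close>

type_synonym 'a fun_sheaf = "'a set \<Rightarrow> ('a \<Rightarrow> ereal) set"

definition is_sheaf :: "'a topology \<Rightarrow> 'a fun_sheaf \<Rightarrow> bool"
  where "is_sheaf X \<O> \<longleftrightarrow> (\<forall>U. openin X U \<longrightarrow>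
    (\<forall>f\<in>\<O> U. (\<forall>x\<in>U. f x \<noteq> \<infinity>) \<and>
       (\<forall>g. (\<forall>x\<in>U. f x = g x) \<longrightarrow> g \<in> \<O> U) \<and>
       (\<forall>V. openin X V \<and> V \<subseteq> U \<longrightarrow> f \<in> \<O> V)) \<and>
    (\<forall>f. (\<forall>x\<in>U. \<exists>V. openin X V \<and> x \<in> V \<and> V \<subseteq> U \<and> f \<in> \<O> V) \<longrightarrow> f \<in> \<O> U))"

text \<open>Restriction to an arbitrary, not necessarily open, subset \<open>S\<close>: functions on an open subset
  \<open>U\<close> of \<open>S\<close> that are locally restrictions of sections over open subsets of \<open>X\<close>.\<close>

definition restrict_sheaf :: "'a topology \<Rightarrow> 'a fun_sheaf \<Rightarrow> 'a set \<Rightarrow> 'a fun_sheaf"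
  where "restrict_sheaf X \<O> S U =
    {f. \<forall>x\<in>U. \<exists>V g. openin X V \<and> x \<in> V \<and> V \<inter> S \<subseteq> U \<and> g \<in> \<O> V \<and> (\<forall>y\<in>V \<inter> S. f y = g y)}"

definition sheaf_iso ::
    "'a topology \<Rightarrow> 'a fun_sheaf \<Rightarrow> 'b topology \<Rightarrow> 'b fun_sheaf \<Rightarrow> ('a \<Rightarrow> 'b) \<Rightarrow> bool"
  where "sheaf_iso X \<O> Y \<O>' \<phi> \<longleftrightarrow>
    homeomorphic_map X Y \<phi> \<and>
    (\<forall>V. openin Y V \<longrightarrow> (\<forall>f. f \<in> \<O>' V \<longleftrightarrow> f \<circ> \<phi> \<in> \<O> {x \<in> topspace X. \<phi> x \<in> V}))"


section \<open>Regular functions and tropical varieties\<close>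

definition trop_space :: "nat \<Rightarrow> (nat \<Rightarrow> ereal) topology"
  where "trop_space N =
    subtopology (product_topology (\<lambda>_. euclidean) UNIV)
      {x. (\<forall>i. x i \<noteq> \<infinity>) \<and> (\<forall>i\<ge>N. x i = 0)}"

definition emb :: "(nat \<Rightarrow> real) \<Rightarrow> nat \<Rightarrow> ereal"
  where "emb x = (\<lambda>i. ereal (x i))"

definition laurent_polynomial :: "nat \<Rightarrow> ((nat \<Rightarrow> real) \<Rightarrow> real) \<Rightarrow> bool"
  where "laurent_polynomial N f \<longleftrightarrow>
    (\<exists>J a. finite J \<and> J \<noteq> {} \<and> J \<subseteq> Zn N \<and> (\<forall>x\<in>Rn N. f x = Max ((\<lambda>j. a j + dot N j x) ` J)))"

definition regular :: "nat \<Rightarrow> (nat \<Rightarrow> ereal) set \<Rightarrow> ((nat \<Rightarrow> ereal) \<Rightarrow> ereal) \<Rightarrow> bool"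
  where "regular N U f \<longleftrightarrow>
    continuous_map (subtopology (trop_space N) U) (top_of_set (- {\<infinity>})) f \<and>
    (\<exists>p. laurent_polynomial N p \<and> (\<forall>x\<in>Rn N. emb x \<in> U \<longrightarrow> f (emb x) = ereal (p x)))"

text \<open>Being the restriction of a single Laurent polynomial is not a local property, so the
  sheaf consists of the locally regular functions.\<close>

definition trop_sheaf :: "nat \<Rightarrow> (nat \<Rightarrow> ereal) fun_sheaf"
  where "trop_sheaf N U =
    {f. \<forall>x\<in>U. \<exists>V. openin (trop_space N) V \<and> x \<in> V \<and> V \<subseteq> U \<and> regular N V f}"

definition tropical_variety :: "nat \<Rightarrow> 'a topology \<Rightarrow> 'a fun_sheaf \<Rightarrow> bool"
  where "tropical_variety k X \<O> \<longleftrightarrow>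
    is_sheaf X \<O> \<and>
    (\<forall>x\<in>topspace X. \<exists>U N \<F> w V \<phi>.
       openin X U \<and> x \<in> U \<and> simply_balanced N k \<F> w \<and>
       (let Y = trop_space N closure_of (emb ` \<Union>\<F>);
            XY = subtopology (trop_space N) Y;
            \<O>Y = restrict_sheaf (trop_space N) (trop_sheaf N) Y
        in openin XY V \<and>
           sheaf_iso (subtopology X U) (restrict_sheaf X \<O> U)
                     (subtopology XY V) (restrict_sheaf XY \<O>Y V) \<phi>))"


section \<open>Rational tropical curves\<close>

text \<open>A metric tree is given by its vertices (without loss of generality natural numbers), its
  edges and their lengths; \<open>leaf i\<close> is the edge with marking \<open>i\<close>.\<close>

record curve =
  verts :: "nat set"
  edges :: "nat set set"
  elen :: "nat set \<Rightarrow> ereal"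
  leaf :: "nat \<Rightarrow> nat set"

definition is_tree :: "nat set \<Rightarrow> nat set set \<Rightarrow> bool"
  where "is_tree V E \<longleftrightarrow>
    finite V \<and> V \<noteq> {} \<and>
    (\<forall>e\<in>E. \<exists>u\<in>V. \<exists>v\<in>V. u \<noteq> v \<and> e = {u, v}) \<and>
    (\<forall>u\<in>V. \<forall>v\<in>V. (u, v) \<in> {(a, b). {a, b} \<in> E}\<^sup>*) \<and>
    \<not> (\<exists>p. length p \<ge> 3 \<and> distinct p \<and> (\<forall>i<length p. {p ! i, p ! (Suc i mod length p)} \<in> E))"

definition valence :: "curve \<Rightarrow> nat \<Rightarrow> nat"
  where "valence C v = card {e \<in> edges C. v \<in> e}"

definition leaf_edges :: "curve \<Rightarrow> nat set set"
  where "leaf_edges C = {e \<in> edges C. \<exists>v\<in>e. valence C v = 1}"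

definition bounded_edges :: "curve \<Rightarrow> nat set set"
  where "bounded_edges C = edges C - leaf_edges C"

definition rational_curve :: "nat \<Rightarrow> curve \<Rightarrow> bool"
  where "rational_curve n C \<longleftrightarrow>
    is_tree (verts C) (edges C) \<and>
    (\<forall>v\<in>verts C. valence C v = 1 \<or> valence C v \<ge> 3) \<and>
    bij_betw (leaf C) {1..n} (leaf_edges C) \<and>
    (\<forall>e\<in>leaf_edges C. elen C e = \<infinity>) \<and>
    (\<forall>e\<in>bounded_edges C. 0 < elen C e \<and> elen C e < \<infinity>)"

definition marked_iso :: "nat \<Rightarrow> curve \<Rightarrow> curve \<Rightarrow> (nat \<Rightarrow> nat) \<Rightarrow> bool"
  where "marked_iso n C D \<phi> \<longleftrightarrow>
    bij_betw \<phi> (verts C) (verts D) \<and>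
    edges D = (`) \<phi> ` edges C \<and>
    (\<forall>i\<in>{1..n}. leaf D i = \<phi> ` leaf C i)"

definition isometry_rel :: "nat \<Rightarrow> (curve \<times> curve) set"
  where "isometry_rel n = {(C, D). rational_curve n C \<and> rational_curve n D \<and>
    (\<exists>\<phi>. marked_iso n C D \<phi> \<and> (\<forall>e\<in>edges C. elen D (\<phi> ` e) = elen C e))}"

definition type_rel :: "nat \<Rightarrow> (curve \<times> curve) set"
  where "type_rel n = {(C, D). rational_curve n C \<and> rational_curve n D \<and> (\<exists>\<phi>. marked_iso n C D \<phi>)}"

definition moduli :: "nat \<Rightarrow> curve set set"
  where "moduli n = {C. rational_curve n C} // isometry_rel n"

definition comb_types :: "nat \<Rightarrow> curve set set"
  where "comb_types n = {C. rational_curve n C} // type_rel n"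

definition stratum :: "nat \<Rightarrow> curve set \<Rightarrow> curve set set"
  where "stratum n \<Gamma> = {x \<in> moduli n. x \<subseteq> \<Gamma>}"

text \<open>The length of the bounded edge \<open>e\<close> of a representative \<open>G\<close> of a combinatorial type, as a
  function on the stratum of that type. It does not depend on the choices of \<open>C\<close> and \<open>\<phi>\<close>, as an
  automorphism of a marked tree fixes every edge.\<close>

definition edge_length :: "nat \<Rightarrow> curve \<Rightarrow> nat set \<Rightarrow> curve set \<Rightarrow> ereal"
  where "edge_length n G e x = (THE r. \<exists>C\<in>x. \<exists>\<phi>. marked_iso n G C \<phi> \<and> r = elen C (\<phi> ` e))"

lemma rational_curve_edge_sub:
  assumes "rational_curve n C" "e \<in> edges C"
  shows "e \<subseteq> verts C"
proof -
  have "\<forall>e\<in>edges C. \<exists>u\<in>verts C. \<exists>v\<in>verts C. u \<noteq> v \<and> e = {u, v}"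
    using assms(1) by (simp add: rational_curve_def is_tree_def)
  then obtain u v where "u \<in> verts C" "v \<in> verts C" "e = {u, v}"
    using assms(2) by blast
  then show ?thesis
    by simp
qed

lemma rational_curve_leaf:
  assumes "rational_curve n C" "i \<in> {1..n}"
  shows "leaf C i \<in> edges C"
proof -
  have "bij_betw (leaf C) {1..n} (leaf_edges C)"
    using assms(1) by (simp add: rational_curve_def)
  then have "leaf C i \<in> leaf_edges C"
    using assms(2) by (rule bij_betwE[rule_format])
  then show ?thesis
    by (simp add: leaf_edges_def)
qed

lemma marked_iso_inverse:
  assumes C: "rational_curve n C" and \<phi>: "marked_iso n C D \<phi>"
  shows "marked_iso n D C (inv_into (verts C) \<phi>)"
    and "e \<in> edges C \<Longrightarrow> inv_into (verts C) \<phi> ` (\<phi> ` e) = e"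
proof -
  define \<psi> where "\<psi> = inv_into (verts C) \<phi>"
  have bij: "bij_betw \<phi> (verts C) (verts D)"
    using \<phi> by (simp add: marked_iso_def)
  have ed: "edges D = (`) \<phi> ` edges C"
    using \<phi> by (simp add: marked_iso_def)
  have lf: "leaf D i = \<phi> ` leaf C i" if "i \<in> {1..n}" for i
    using \<phi> that by (simp add: marked_iso_def)
  have cancel: "\<psi> ` (\<phi> ` e) = e" if "e \<in> edges C" for e
    unfolding \<psi>_def using rational_curve_edge_sub[OF C that]
    by (rule inv_into_image_cancel[OF bij_betw_imp_inj_on[OF bij]])
  have "(`) \<psi> ` edges D = (\<lambda>e. \<psi> ` (\<phi> ` e)) ` edges C"
    unfolding ed by (rule image_image)
  also have "\<dots> = (\<lambda>e. e) ` edges C"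
    by (rule image_cong[OF refl cancel])
  also have "\<dots> = edges C"
    by (rule image_ident)
  finally have 1: "edges C = (`) \<psi> ` edges D"
    by (rule sym)
  have 2: "leaf C i = \<psi> ` leaf D i" if "i \<in> {1..n}" for i
    by (simp only: cancel[OF rational_curve_leaf[OF C that]] lf[OF that])
  have 3: "bij_betw \<psi> (verts D) (verts C)"
    unfolding \<psi>_def by (rule bij_betw_inv_into[OF bij])
  show "marked_iso n D C (inv_into (verts C) \<phi>)"
    unfolding marked_iso_def \<psi>_def[symmetric] by (intro conjI ballI 1 2 3)
  show "e \<in> edges C \<Longrightarrow> inv_into (verts C) \<phi> ` (\<phi> ` e) = e"
    using cancel unfolding \<psi>_def .
qed

lemma marked_iso_comp:
  assumes "marked_iso n C D \<phi>" "marked_iso n D E \<psi>"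
  shows "marked_iso n C E (\<psi> \<circ> \<phi>)"
  unfolding marked_iso_def
proof (intro conjI ballI)
  show "bij_betw (\<psi> \<circ> \<phi>) (verts C) (verts E)"
    by (rule bij_betw_trans[of _ _ "verts D"]) (use assms in \<open>simp_all add: marked_iso_def\<close>)
  have "edges E = (`) \<psi> ` (`) \<phi> ` edges C"
    using assms by (simp add: marked_iso_def)
  also have "\<dots> = (\<lambda>e. \<psi> ` \<phi> ` e) ` edges C"
    by (rule image_image)
  finally show "edges E = (`) (\<psi> \<circ> \<phi>) ` edges C"
    unfolding image_comp .
  show "leaf E i = (\<psi> \<circ> \<phi>) ` leaf C i" if "i \<in> {1..n}" for i
    using assms that by (simp add: marked_iso_def image_comp)
qed

lemma marked_iso_id: "marked_iso n C C id"
  by (simp add: marked_iso_def)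

lemma type_rel_iff: "(C, D) \<in> type_rel n \<longleftrightarrow>
    rational_curve n C \<and> rational_curve n D \<and> (\<exists>\<phi>. marked_iso n C D \<phi>)"
  by (simp add: type_rel_def)

lemma isometry_rel_iff: "(C, D) \<in> isometry_rel n \<longleftrightarrow>
    rational_curve n C \<and> rational_curve n D \<and>
    (\<exists>\<phi>. marked_iso n C D \<phi> \<and> (\<forall>e\<in>edges C. elen D (\<phi> ` e) = elen C e))"
  by (simp add: isometry_rel_def)

lemma equiv_type_rel: "equiv {C. rational_curve n C} (type_rel n)"
proof (rule equivI)
  show "type_rel n \<subseteq> {C. rational_curve n C} \<times> {C. rational_curve n C}"
    by (rule subrelI) (simp add: type_rel_iff)
  show "refl_on {C. rational_curve n C} (type_rel n)"
    by (rule refl_onI) (use marked_iso_id in \<open>auto simp: type_rel_iff\<close>)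
  show "sym (type_rel n)"
    by (rule symI) (use marked_iso_inverse(1) in \<open>unfold type_rel_iff, blast\<close>)
  show "trans (type_rel n)"
    by (rule transI) (use marked_iso_comp in \<open>unfold type_rel_iff, blast\<close>)
qed

lemma equiv_isometry_rel: "equiv {C. rational_curve n C} (isometry_rel n)"
proof (rule equivI)
  show "isometry_rel n \<subseteq> {C. rational_curve n C} \<times> {C. rational_curve n C}"
    by (rule subrelI) (simp add: isometry_rel_iff)
  show "refl_on {C. rational_curve n C} (isometry_rel n)"
  proof (rule refl_onI)
    fix C assume "C \<in> {C. rational_curve n C}"
    moreover have "\<forall>e\<in>edges C. elen C (id ` e) = elen C e"
      by simp
    ultimately show "(C, C) \<in> isometry_rel n"
      using marked_iso_id[of n C] unfolding isometry_rel_iff by blast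
  qed
  show "sym (isometry_rel n)"
  proof (rule symI)
    fix C D assume "(C, D) \<in> isometry_rel n"
    then obtain \<phi> where r: "rational_curve n C" "rational_curve n D"
      and \<phi>: "marked_iso n C D \<phi>" and len: "\<forall>e\<in>edges C. elen D (\<phi> ` e) = elen C e"
      unfolding isometry_rel_iff by (elim conjE exE)
    have "elen C (inv_into (verts C) \<phi> ` e) = elen D e" if "e \<in> edges D" for e
    proof -
      have "e \<in> (`) \<phi> ` edges C"
        using \<phi> that by (simp add: marked_iso_def)
      then obtain e' where "e = \<phi> ` e'" "e' \<in> edges C"
        by (rule imageE)
      then show ?thesis
        using len by (simp add: marked_iso_inverse(2)[OF r(1) \<phi>])
    qed
    then show "(D, C) \<in> isometry_rel n"
      unfolding isometry_rel_iff using r marked_iso_inverse(1)[OF r(1) \<phi>] by blast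
  qed
  show "trans (isometry_rel n)"
  proof (rule transI)
    fix C D E assume CD: "(C, D) \<in> isometry_rel n" and DE: "(D, E) \<in> isometry_rel n"
    obtain \<phi> where C: "rational_curve n C" and \<phi>: "marked_iso n C D \<phi>"
      and l\<phi>: "\<forall>e\<in>edges C. elen D (\<phi> ` e) = elen C e"
      using CD unfolding isometry_rel_iff by (elim conjE exE)
    obtain \<psi> where E: "rational_curve n E" and \<psi>: "marked_iso n D E \<psi>"
      and l\<psi>: "\<forall>e\<in>edges D. elen E (\<psi> ` e) = elen D e"
      using DE unfolding isometry_rel_iff by (elim conjE exE)
    have "elen E ((\<psi> \<circ> \<phi>) ` e) = elen C e" if "e \<in> edges C" for e
    proof -
      have "\<phi> ` e \<in> edges D"
        using \<phi> that by (simp add: marked_iso_def)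
      then show ?thesis
        using l\<phi> l\<psi> that by (simp only: image_comp[symmetric])
    qed
    then show "(C, E) \<in> isometry_rel n"
      unfolding isometry_rel_iff using C E marked_iso_comp[OF \<phi> \<psi>] by blast
  qed
qed

text \<open>
  Nonnegative lengths on the bounded edges of a representative \<open>G\<close> of a combinatorial type form a
  cone (\<open>elen G\<close> plays no role). A point of the cone defines the isometry class of the curves
  obtained from \<open>G\<close> by contracting the edges of length 0 and giving the other bounded edges the
  prescribed lengths. The topology of the moduli space is the final one for these maps, that is, the
  one obtained by gluing all cones along their faces.
\<close>

definition type_cone :: "curve \<Rightarrow> (nat set \<Rightarrow> real) topology"
  where "type_cone G = product_topology (\<lambda>_. top_of_set {0..}) (bounded_edges G)"

definition contraction ::
    "nat \<Rightarrow> curve \<Rightarrow> (nat set \<Rightarrow> real) \<Rightarrow> curve \<Rightarrow> (nat \<Rightarrow> nat) \<Rightarrow> bool"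
  where "contraction n G l C \<pi> \<longleftrightarrow>
    (let Z = {e \<in> bounded_edges G. l e = 0} in
      \<pi> ` verts G = verts C \<and>
      (\<forall>u\<in>verts G. \<forall>v\<in>verts G. \<pi> u = \<pi> v \<longleftrightarrow> (u, v) \<in> {(a, b). {a, b} \<in> Z}\<^sup>*) \<and>
      edges C = (`) \<pi> ` (edges G - Z) \<and>
      (\<forall>i\<in>{1..n}. leaf C i = \<pi> ` leaf G i) \<and>
      (\<forall>e\<in>bounded_edges G - Z. elen C (\<pi> ` e) = ereal (l e)))"

definition cone_point :: "nat \<Rightarrow> curve \<Rightarrow> (nat set \<Rightarrow> real) \<Rightarrow> curve set"
  where "cone_point n G l = {C. rational_curve n C \<and> (\<exists>\<pi>. contraction n G l C \<pi>)}"

definition moduli_top :: "nat \<Rightarrow> curve set topology"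
  where "moduli_top n = topology (\<lambda>U. U \<subseteq> moduli n \<and>
    (\<forall>G. rational_curve n G \<longrightarrow> openin (type_cone G) {l \<in> topspace (type_cone G). cone_point n G l \<in> U}))"

lemma openin_moduli_top:
  "openin (moduli_top n) U \<longleftrightarrow> U \<subseteq> moduli n \<and>
    (\<forall>G. rational_curve n G \<longrightarrow> openin (type_cone G) {l \<in> topspace (type_cone G). cone_point n G l \<in> U})"
proof -
  let ?P = "\<lambda>U G. {l \<in> topspace (type_cone G). cone_point n G l \<in> U}"
  have Int: "?P (U \<inter> V) G = ?P U G \<inter> ?P V G" for U V G
    by blast
  have Union: "?P (\<Union>K) G = (\<Union>U\<in>K. ?P U G)" for K G
    by blast
  have "istopology (\<lambda>U. U \<subseteq> moduli n \<and>
    (\<forall>G. rational_curve n G \<longrightarrow> openin (type_cone G) (?P U G)))"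
    unfolding istopology_def
  proof (intro conjI allI impI)
    fix U V
    assume U: "U \<subseteq> moduli n \<and> (\<forall>G. rational_curve n G \<longrightarrow> openin (type_cone G) (?P U G))"
      and V: "V \<subseteq> moduli n \<and> (\<forall>G. rational_curve n G \<longrightarrow> openin (type_cone G) (?P V G))"
    show "U \<inter> V \<subseteq> moduli n"
      using U by blast
    show "openin (type_cone G) (?P (U \<inter> V) G)" if "rational_curve n G" for G
      unfolding Int using U V that by (intro openin_Int) blast+
  next
    fix K
    assume K: "\<forall>U\<in>K. U \<subseteq> moduli n \<and> (\<forall>G. rational_curve n G \<longrightarrow> openin (type_cone G) (?P U G))"
    show "\<Union>K \<subseteq> moduli n"
      using K by blast
    show "openin (type_cone G) (?P (\<Union>K) G)" if "rational_curve n G" for G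
      unfolding Union using K that by (intro openin_Union) blast
  qed
  from topology_inverse'[OF this] show ?thesis
    unfolding moduli_top_def by simp
qed

end

theory Submission
  imports Defs "HOL-Library.Nat_Bijection"
begin

text \<open>
  Root every curve at the leaf \<open>n\<close>. A bounded edge is then recorded by the set of the remaining
  leaves \<open>{1..<n}\<close> beyond it, and the edges of a curve form a laminar family. Isometry
  classes of curves thus correspond to nonnegative weights with laminar support on the sets
  \<open>S \<subset> {1..<n}\<close> with at least two elements. For a pair \<open>P\<close> of leaves let \<open>val P\<close> be the total weight of the
  sets containing \<open>P\<close>, an ultrametric. The embedding has the coordinates \<open>val P - val Q\<close>, so a set
  \<open>S\<close> spans the ray \<open>[P \<subseteq> S] - [Q \<subseteq> S]\<close>.

  Choosing for each \<open>S\<close> in a laminar family a pair separated exactly at \<open>S\<close>, the differences along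
  \<open>S\<close> and its cover are coordinates dual to the rays; hence the cones are unimodular. Around a
  codimension one cone there are three facets, from the resolutions \<open>A \<union> B\<close>, \<open>A \<union> C\<close>, \<open>B \<union> C\<close> of a
  4-valent vertex, and the sum of their rays lies in the cone's span, which gives the balancing
  condition. For simple balancing take the affine spaces that prescribe the dual coordinates of
  a facet: they prescribe the ultrametric on a spanning tree up to a constant, and among all such
  ultrametrics there is a smallest one, so that minus the sum of the coordinates over one base
  pair has a unique maximum.
\<close>

section \<open>Laminar families\<close>

text \<open>The coordinates are differences because \<open>{1..<n}\<close> is not cut off by a
  bounded edge: with \<open>val\<close> alone, the relation at a 4-valent vertex next to leaf
  \<open>n\<close> leaves over the all-ones vector, which a difference cancels. Points of different
  cones have to be compared in order to see that cones meet in common faces. This needs a formula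
  for the weight of \<open>S\<close> that does not know the support: the minimum of
  \<open>val P - val Q\<close> over pairs \<open>P\<close> inside \<open>S\<close> and pairs
  \<open>Q\<close> cut by \<open>S\<close>, truncated at 0. Balancing concerns every integral
  \<open>L\<close>. If no facet at the wall is transverse to \<open>L\<close>, generic translates
  miss them all. Otherwise an integral functional \<open>h\<close> that vanishes on the wall and on
  the directions of \<open>L\<close> makes each index a constant times the absolute value of
  \<open>h\<close> at the new ray, and the three values of \<open>h\<close> add up to 0. The moduli
  space carries a final topology, so openness of the embedding is not automatic. It comes from a
  finite closed cover by cones with the dual coordinates as local inverses. The structure sheaf is
  pulled back from the fan, and within one combinatorial type an edge length is a single
  coordinate.\<close>

definition laminar :: "'a set set \<Rightarrow> bool" where
  "laminar \<C> \<longleftrightarrow> (\<forall>A\<in>\<C>. \<forall>B\<in>\<C>. A \<subseteq> B \<or> B \<subseteq> A \<or> A \<inter> B = {})"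

lemma laminarD: "laminar \<C> \<Longrightarrow> A \<in> \<C> \<Longrightarrow> B \<in> \<C> \<Longrightarrow> x \<in> A \<Longrightarrow> x \<in> B \<Longrightarrow> A \<subseteq> B \<or> B \<subseteq> A"
  unfolding laminar_def by blast

lemma laminar_subset: "laminar \<C> \<Longrightarrow> \<D> \<subseteq> \<C> \<Longrightarrow> laminar \<D>"
  unfolding laminar_def by blast

text \<open>Members through a common point form a chain, so a minimal one lies inside all the
  others.\<close>

lemma laminar_Inter_mem:
  assumes "finite \<D>" "\<D> \<noteq> {}" "laminar \<D>" "x \<in> \<Inter>\<D>"
  shows "\<Inter>\<D> \<in> \<D>"
proof -
  obtain M where M: "M \<in> \<D>" "\<And>B. B \<in> \<D> \<Longrightarrow> B \<subseteq> M \<Longrightarrow> M = B"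
    using finite_has_minimal[OF assms(1,2)] by blast
  have "M \<subseteq> B" if "B \<in> \<D>" for B
    using laminarD[OF assms(3) M(1) that, of x] M(2)[OF that] M(1) that assms(4) by blast
  then have "\<Inter>\<D> = M" using M(1) by blast
  then show ?thesis using M(1) by simp
qed

text \<open>The parent of \<open>S\<close> in the forest of a laminar family. Intersecting all
  larger members makes it unique without a choice; for a maximal \<open>S\<close> the value is
  \<open>UNIV\<close>.\<close>

definition cover :: "'a set set \<Rightarrow> 'a set \<Rightarrow> 'a set" where
  "cover \<C> S = \<Inter>{T \<in> \<C>. S \<subset> T}"

definition envelope :: "'a set set \<Rightarrow> 'a set \<Rightarrow> 'a set" where
  "envelope \<C> S = \<Inter>{T \<in> \<C>. S \<subseteq> T}"

definition children :: "'a set set \<Rightarrow> 'a set \<Rightarrow> 'a set set" where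
  "children \<C> S = {T \<in> \<C>. T \<subset> S \<and> cover \<C> T = S}"

text \<open>A laminar family with a top element is a rooted tree. It occurs over
  \<open>{1..<n}\<close>, for the clusters and leaves of a curve, and over \<open>{1..n}\<close>,
  where the additional set is the outer end of leaf \<open>n\<close>.\<close>

locale hierarchy =
  fixes U :: "'a set" and \<C> :: "'a set set"
  assumes finite_U: "finite U"
    and sub_U: "\<And>S. S \<in> \<C> \<Longrightarrow> S \<subseteq> U"
    and nonempty: "\<And>S. S \<in> \<C> \<Longrightarrow> S \<noteq> {}"
    and laminar: "laminar \<C>"
    and U_mem: "U \<in> \<C>"
begin

lemma finite_C: "finite \<C>"
  by (rule finite_subset[of _ "Pow U"]) (use sub_U finite_U in auto)

lemma finite_mem: "S \<in> \<C> \<Longrightarrow> finite S"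
  using sub_U finite_U finite_subset by blast

lemma cover:
  assumes "S \<in> \<C>" "S \<noteq> U"
  shows "cover \<C> S \<in> \<C>" "S \<subset> cover \<C> S" "\<And>R. R \<in> \<C> \<Longrightarrow> S \<subset> R \<Longrightarrow> cover \<C> S \<subseteq> R"
proof -
  let ?D = "{T \<in> \<C>. S \<subset> T}"
  obtain x where x: "x \<in> S" using nonempty assms by blast
  have "U \<in> ?D" using U_mem sub_U assms by blast
  then have "\<Inter>?D \<in> ?D"
    by (intro laminar_Inter_mem[of _ x])
      (use finite_C x in \<open>auto intro: laminar_subset[OF laminar]\<close>)
  then show "cover \<C> S \<in> \<C>" "S \<subset> cover \<C> S" unfolding cover_def by blast+
  show "\<And>R. R \<in> \<C> \<Longrightarrow> S \<subset> R \<Longrightarrow> cover \<C> S \<subseteq> R" unfolding cover_def by blast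
qed

lemma envelope:
  assumes "S \<subseteq> U" "S \<noteq> {}"
  shows "envelope \<C> S \<in> \<C>" "S \<subseteq> envelope \<C> S" "\<And>R. R \<in> \<C> \<Longrightarrow> S \<subseteq> R \<Longrightarrow> envelope \<C> S \<subseteq> R"
proof -
  let ?D = "{T \<in> \<C>. S \<subseteq> T}"
  obtain x where x: "x \<in> S" using assms by blast
  have "U \<in> ?D" using U_mem assms by blast
  then have "\<Inter>?D \<in> ?D"
    by (intro laminar_Inter_mem[of _ x])
      (use finite_C x in \<open>auto intro: laminar_subset[OF laminar]\<close>)
  then show "envelope \<C> S \<in> \<C>" "S \<subseteq> envelope \<C> S" unfolding envelope_def by blast+
  show "\<And>R. R \<in> \<C> \<Longrightarrow> S \<subseteq> R \<Longrightarrow> envelope \<C> S \<subseteq> R" unfolding envelope_def by blast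
qed

lemma envelope_mem: "S \<in> \<C> \<Longrightarrow> envelope \<C> S = S"
  unfolding envelope_def by blast

lemma childrenD:
  assumes "T \<in> children \<C> S"
  shows "T \<in> \<C>" "T \<subset> S" "\<And>R. R \<in> \<C> \<Longrightarrow> T \<subset> R \<Longrightarrow> S \<subseteq> R"
  using assms unfolding children_def cover_def by blast+

lemma childrenI:
  assumes "S \<in> \<C>" "T \<in> \<C>" "T \<subset> S" "\<And>R. R \<in> \<C> \<Longrightarrow> T \<subset> R \<Longrightarrow> S \<subseteq> R"
  shows "T \<in> children \<C> S"
  using assms unfolding children_def cover_def by blast

lemma children_disjoint:
  assumes "T \<in> children \<C> S" "T' \<in> children \<C> S" "T \<noteq> T'"
  shows "T \<inter> T' = {}"
proof (rule ccontr)
  assume "T \<inter> T' \<noteq> {}"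
  then have "T \<subset> T' \<or> T' \<subset> T"
    using laminar childrenD(1)[OF assms(1)] childrenD(1)[OF assms(2)] assms(3)
    unfolding laminar_def by blast
  then show False
    using childrenD[OF assms(1)] childrenD[OF assms(2)] by blast
qed

text \<open>A maximal member between \<open>R\<close> and \<open>S\<close>, different from
  \<open>S\<close>, is the child wanted; laminarity compares it with every other candidate.\<close>

lemma sub_child:
  assumes "S \<in> \<C>" "R \<in> \<C>" "R \<subset> S"
  shows "\<exists>T\<in>children \<C> S. R \<subseteq> T"
proof -
  let ?D = "{T \<in> \<C>. R \<subseteq> T \<and> T \<subset> S}"
  have "finite ?D" "?D \<noteq> {}" using finite_C assms by auto
  then obtain M where M: "M \<in> ?D" "\<And>B. B \<in> ?D \<Longrightarrow> M \<subseteq> B \<Longrightarrow> M = B"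
    using finite_has_maximal by (metis (lifting))
  obtain x where x: "x \<in> R" using nonempty assms by blast
  have "M \<in> children \<C> S"
  proof (rule childrenI)
    fix B assume B: "B \<in> \<C>" "M \<subset> B"
    have "B \<subseteq> S \<or> S \<subseteq> B"
      by (rule laminarD[OF laminar, of _ _ x]) (use B M x assms in auto)
    then show "S \<subseteq> B" using M(2)[of B] M(1) B by blast
  qed (use M assms in auto)
  then show ?thesis using M(1) by blast
qed

text \<open>A member that contains a point of \<open>T\<close> and a point outside \<open>T\<close>
  strictly contains \<open>T\<close>, and every such member contains the parent \<open>S\<close>. A
  pair taken from two children therefore marks \<open>S\<close> among all members.\<close>

lemma child_separates:
  assumes "T \<in> children \<C> S" "T' \<in> children \<C> S" "T \<noteq> T'" "a \<in> T" "b \<in> T'" "R \<in> \<C>"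
  shows "{a, b} \<subseteq> R \<longleftrightarrow> S \<subseteq> R"
proof
  assume R: "{a, b} \<subseteq> R"
  have "T \<subseteq> R \<or> R \<subseteq> T"
    by (rule laminarD[OF laminar, of _ _ a]) (use assms R childrenD in auto)
  moreover have "b \<notin> T" using children_disjoint[OF assms(1-3)] assms by blast
  ultimately have "T \<subset> R" using R by auto
  then show "S \<subseteq> R" using childrenD[OF assms(1)] assms by blast
next
  assume "S \<subseteq> R" then show "{a, b} \<subseteq> R"
    using childrenD(2)[OF assms(1)] childrenD(2)[OF assms(2)] assms(4,5) by blast
qed

lemma finite_children: "finite (children \<C> S)"
  unfolding children_def using finite_C by simp

lemma cover_eq_iff: "S \<in> \<C> \<Longrightarrow> S \<noteq> U \<Longrightarrow> S \<in> children \<C> M \<longleftrightarrow> cover \<C> S = M"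
  unfolding children_def using cover by blast

end

locale full_hierarchy = hierarchy +
  assumes singletons: "\<And>x. x \<in> U \<Longrightarrow> {x} \<in> \<C>"
begin

lemma child_at:
  assumes "S \<in> \<C>" "x \<in> S" "S \<noteq> {x}"
  shows "\<exists>T\<in>children \<C> S. x \<in> T"
  using sub_child[OF assms(1) singletons[of x]] assms sub_U by blast

lemma Union_children:
  assumes "S \<in> \<C>" "2 \<le> card S"
  shows "\<Union>(children \<C> S) = S"
proof
  show "S \<subseteq> \<Union>(children \<C> S)"
  proof
    fix x assume "x \<in> S"
    then show "x \<in> \<Union>(children \<C> S)" using child_at[OF assms(1), of x] assms(2) by force
  qed
qed (use childrenD in blast)

lemma card_children_ge:
  assumes "S \<in> \<C>" "2 \<le> card S"
  shows "2 \<le> card (children \<C> S)"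
proof (rule ccontr)
  assume "\<not> 2 \<le> card (children \<C> S)"
  then have "card (children \<C> S) \<le> 1" by simp
  moreover have "children \<C> S \<noteq> {}"
    using Union_children[OF assms] nonempty[OF assms(1)] by auto
  ultimately have "card (children \<C> S) = 1"
    using card_0_eq[OF finite_children, of S] by linarith
  then obtain T where "children \<C> S = {T}" using card_1_singletonE by blast
  then show False using Union_children[OF assms] childrenD(2)[of T S] by auto
qed

lemma children_singleton: "card S \<le> 1 \<Longrightarrow> S \<in> \<C> \<Longrightarrow> children \<C> S = {}"
proof (rule ccontr)
  assume a: "card S \<le> 1" "S \<in> \<C>" "children \<C> S \<noteq> {}"
  then obtain T where T: "T \<in> children \<C> S" by blast
  have "card T < card S" "0 < card T"
    using childrenD(1,2)[OF T] finite_mem[OF a(2)] nonempty finite_mem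
    by (auto simp: psubset_card_mono card_gt_0_iff)
  then show False using a by simp
qed

text \<open>Every member except the root is a child of exactly one member, and sets with at most one
  element have no children.\<close>

lemma sum_card_children:
  "(\<Sum>S\<in>{S \<in> \<C>. 2 \<le> card S}. card (children \<C> S)) = card (\<C> - {U})"
proof -
  have "(\<Union>S\<in>{S \<in> \<C>. 2 \<le> card S}. children \<C> S) = \<C> - {U}"
  proof
    show "\<C> - {U} \<subseteq> (\<Union>S\<in>{S \<in> \<C>. 2 \<le> card S}. children \<C> S)"
    proof
      fix S assume S: "S \<in> \<C> - {U}"
      then have "S \<in> children \<C> (cover \<C> S)" using cover_eq_iff by blast
      moreover from this have "2 \<le> card (cover \<C> S)"
        using children_singleton[of "cover \<C> S"] cover(1) S by fastforce
      ultimately show "S \<in> (\<Union>S\<in>{S \<in> \<C>. 2 \<le> card S}. children \<C> S)"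
        using cover(1) S by auto
    qed
    show "(\<Union>S\<in>{S \<in> \<C>. 2 \<le> card S}. children \<C> S) \<subseteq> \<C> - {U}"
    proof
      fix T assume "T \<in> (\<Union>S\<in>{S \<in> \<C>. 2 \<le> card S}. children \<C> S)"
      then obtain S where "S \<in> \<C>" "T \<in> children \<C> S" by blast
      then show "T \<in> \<C> - {U}" using childrenD(1,2)[of T S] sub_U[of S] by blast
    qed
  qed
  moreover have "card (\<Union>S\<in>{S \<in> \<C>. 2 \<le> card S}. children \<C> S)
      = (\<Sum>S\<in>{S \<in> \<C>. 2 \<le> card S}. card (children \<C> S))"
    by (rule card_UN_disjoint)
      (use finite_C finite_children in \<open>auto simp: children_def\<close>)
  ultimately show ?thesis by simp
qed

end

section \<open>Clusters of leaves and the size of laminar families\<close>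

definition clusters :: "nat \<Rightarrow> nat set set" where
  "clusters n = {S. S \<subseteq> {1..<n} \<and> 2 \<le> card S \<and> S \<noteq> {1..<n}}"

definition hier :: "nat \<Rightarrow> nat set set \<Rightarrow> bool" where
  "hier n \<N> \<longleftrightarrow> \<N> \<subseteq> clusters n \<and> laminar \<N>"

definition ext :: "nat \<Rightarrow> nat set set \<Rightarrow> nat set set" where
  "ext n \<N> = insert {1..<n} \<N> \<union> (\<lambda>i. {i}) ` {1..<n}"

text \<open>The vertices of the tree rooted at leaf \<open>n\<close>: \<open>{1..n}\<close> stands
  for the outer end of that leaf and \<open>{1..<n}\<close> for its inner end. Since
  \<open>{n}\<close> is absent, the root has \<open>{1..<n}\<close> as its only child.\<close>

definition full :: "nat \<Rightarrow> nat set set \<Rightarrow> nat set set" where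
  "full n \<N> = insert {1..n} (ext n \<N>)"

lemma clustersD: "S \<in> clusters n \<Longrightarrow> S \<subseteq> {1..<n}" "S \<in> clusters n \<Longrightarrow> 2 \<le> card S"
  "S \<in> clusters n \<Longrightarrow> S \<noteq> {1..<n}" "S \<in> clusters n \<Longrightarrow> finite S"
  unfolding clusters_def by (auto intro: finite_subset)

lemma finite_clusters: "finite (clusters n)"
  by (rule finite_subset[of _ "Pow {1..<n}"]) (auto simp: clusters_def)

lemma hier_finite: "hier n \<N> \<Longrightarrow> finite \<N>"
  unfolding hier_def using finite_clusters finite_subset by blast

lemma hier_subset: "hier n \<N> \<Longrightarrow> \<M> \<subseteq> \<N> \<Longrightarrow> hier n \<M>"
  unfolding hier_def using laminar_subset by blast

lemma full_hierarchy_ext: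
  assumes "hier n \<N>" "2 \<le> n"
  shows "full_hierarchy {1..<n} (ext n \<N>)"
proof
  have N: "\<And>S. S \<in> \<N> \<Longrightarrow> S \<subseteq> {1..<n}" "\<And>S. S \<in> \<N> \<Longrightarrow> S \<noteq> {}"
    using assms unfolding hier_def clusters_def by fastforce+
  show sub: "\<And>S. S \<in> ext n \<N> \<Longrightarrow> S \<subseteq> {1..<n}" and "\<And>S. S \<in> ext n \<N> \<Longrightarrow> S \<noteq> {}"
    using N assms(2) unfolding ext_def by auto
  show "laminar (ext n \<N>)"
    unfolding laminar_def
  proof (intro ballI)
    fix A B assume AB: "A \<in> ext n \<N>" "B \<in> ext n \<N>"
    have "(A \<in> \<N> \<and> B \<in> \<N>) \<or> A = {1..<n} \<or> B = {1..<n} \<or> (\<exists>i. A = {i}) \<or> (\<exists>i. B = {i})"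
      using AB unfolding ext_def by blast
    then show "A \<subseteq> B \<or> B \<subseteq> A \<or> A \<inter> B = {}"
      using assms(1) sub[OF AB(1)] sub[OF AB(2)] unfolding hier_def laminar_def by (elim disjE) auto
  qed
qed (auto simp: ext_def)

lemma hierarchy_full:
  assumes "hier n \<N>" "2 \<le> n"
  shows "hierarchy {1..n} (full n \<N>)"
proof -
  interpret full_hierarchy "{1..<n}" "ext n \<N>" by (rule full_hierarchy_ext[OF assms])
  have s: "{1..<n} \<subseteq> {1..n}" by auto
  show ?thesis
  proof
    show "laminar (full n \<N>)"
    proof -
      have "A \<subseteq> {1..n}" if "A \<in> ext n \<N>" for A using sub_U[OF that] s by blast
      then show ?thesis
        using laminar unfolding laminar_def full_def by (intro ballI) (elim insertE; simp)
    qed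
    fix S assume "S \<in> full n \<N>"
    then consider "S = {1..n}" | "S \<in> ext n \<N>" unfolding full_def by blast
    then show "S \<subseteq> {1..n}" "S \<noteq> {}"
      using sub_U[of S] nonempty[of S] s assms(2) by (cases; auto)+
  qed (simp_all add: full_def)
qed

lemma ext_card_ge_2:
  assumes "hier n \<N>" "3 \<le> n"
  shows "{S \<in> ext n \<N>. 2 \<le> card S} = insert {1..<n} \<N>"
proof -
  have "2 \<le> card S" if "S \<in> \<N>" for S
    using that assms(1) unfolding hier_def clusters_def by blast
  moreover have "2 \<le> card {1..<n}" using assms(2) by simp
  moreover have "card {i} \<noteq> 2" "\<not> 2 \<le> card {i}" for i :: nat by simp_all
  ultimately show ?thesis unfolding ext_def by blast
qed

lemma card_ext:
  assumes "hier n \<N>" "3 \<le> n"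
  shows "card (ext n \<N> - {{1..<n}}) = card \<N> + (n - 1)"
proof -
  have "ext n \<N> - {{1..<n}} = \<N> \<union> (\<lambda>i. {i}) ` {1..<n}"
  proof -
    have "{1..<n} \<notin> (\<lambda>i. {i}) ` {1..<n}"
    proof
      assume "{1..<n} \<in> (\<lambda>i. {i}) ` {1..<n}"
      then obtain i where i: "{1..<n} = {i}" by blast
      have "card {1..<n} = 1" unfolding i by simp
      then show False using assms(2) by simp
    qed
    then show ?thesis using assms unfolding ext_def hier_def clusters_def by auto
  qed
  moreover have "\<N> \<inter> (\<lambda>i. {i}) ` {1..<n} = {}"
    using assms unfolding hier_def clusters_def by auto
  moreover have "card ((\<lambda>i. {i}) ` {1..<n}) = n - 1"
    by (subst card_image) (auto simp: inj_on_def)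
  ultimately show ?thesis
    by (simp add: card_Un_disjoint hier_finite[OF assms(1)])
qed

lemma sum_children_hier:
  assumes "hier n \<N>" "3 \<le> n"
  shows "(\<Sum>S\<in>insert {1..<n} \<N>. card (children (ext n \<N>) S)) = card \<N> + (n - 1)"
    and "card (insert {1..<n} \<N>) = card \<N> + 1"
    and "\<And>S. S \<in> insert {1..<n} \<N> \<Longrightarrow> 2 \<le> card (children (ext n \<N>) S)"
proof -
  interpret full_hierarchy "{1..<n}" "ext n \<N>"
    by (rule full_hierarchy_ext) (use assms in auto)
  show "(\<Sum>S\<in>insert {1..<n} \<N>. card (children (ext n \<N>) S)) = card \<N> + (n - 1)"
    using sum_card_children unfolding ext_card_ge_2[OF assms] card_ext[OF assms] .
  show "card (insert {1..<n} \<N>) = card \<N> + 1"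
    using hier_finite[OF assms(1)] assms(1) by (subst card_insert_disjoint) (auto simp: hier_def clusters_def)
  fix S assume "S \<in> insert {1..<n} \<N>"
  then have "S \<in> {S \<in> ext n \<N>. 2 \<le> card S}" unfolding ext_card_ge_2[OF assms] .
  then show "2 \<le> card (children (ext n \<N>) S)"
    using card_children_ge by blast
qed

text \<open>Every node has at least two children, so \<open>2 * (card \<N> + 1)\<close> is at most
  the number \<open>card \<N> + (n - 1)\<close> of members below the root.\<close>

lemma card_hier_le:
  assumes "hier n \<N>" "3 \<le> n"
  shows "card \<N> \<le> n - 3"
proof -
  have "(\<Sum>S\<in>insert {1..<n} \<N>. 2) \<le> (\<Sum>S\<in>insert {1..<n} \<N>. card (children (ext n \<N>) S))"
    by (rule sum_mono) (rule sum_children_hier(3)[OF assms])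
  then show ?thesis
    using assms(2) by (simp only: sum_children_hier(1)[OF assms] sum_constant sum_children_hier(2)[OF assms])
      simp
qed

lemma card_children_maximal:
  assumes "hier n \<N>" "3 \<le> n" "card \<N> = n - 3" "S \<in> insert {1..<n} \<N>"
  shows "card (children (ext n \<N>) S) = 2"
proof (rule ccontr)
  let ?f = "\<lambda>S. card (children (ext n \<N>) S)"
  assume "?f S \<noteq> 2"
  then have "2 < ?f S" using sum_children_hier(3)[OF assms(1,2,4)] by linarith
  then have "(\<Sum>S\<in>insert {1..<n} \<N>. 2) < (\<Sum>S\<in>insert {1..<n} \<N>. ?f S)"
    using hier_finite[OF assms(1)] sum_children_hier(3)[OF assms(1,2)] assms(4)
    by (intro sum_strict_mono_ex1) auto
  then show False
    using assms(2,3)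
    by (simp only: sum_children_hier(1)[OF assms(1,2)] sum_constant sum_children_hier(2)[OF assms(1,2)]) simp
qed

text \<open>The third child \<open>T''\<close> keeps \<open>T \<union> T'\<close> strictly below
  \<open>M\<close>, so the union is neither an old member nor all of \<open>{1..<n}\<close>. In the
  tree, a vertex of higher valence is resolved by a new edge.\<close>

lemma hier_insert_Un:
  assumes "hier n \<N>" "3 \<le> n" "M \<in> insert {1..<n} \<N>"
    and T: "T \<in> children (ext n \<N>) M" "T' \<in> children (ext n \<N>) M" "T \<noteq> T'"
    and "T'' \<in> children (ext n \<N>) M" "T'' \<noteq> T" "T'' \<noteq> T'"
  shows "hier n (insert (T \<union> T') \<N>)" "T \<union> T' \<notin> \<N>"
proof -
  interpret full_hierarchy "{1..<n}" "ext n \<N>"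
    by (rule full_hierarchy_ext) (use assms in auto)
  note ch = childrenD[OF T(1)] childrenD[OF T(2)] childrenD[OF assms(7)]
  have disj: "T \<inter> T' = {}" "T'' \<inter> T = {}" "T'' \<inter> T' = {}"
    using children_disjoint T assms(7-9) by blast+
  have ne: "T \<noteq> {}" "T' \<noteq> {}" "T'' \<noteq> {}" using nonempty ch by auto
  have fin: "finite T" "finite T'" using finite_mem ch by auto
  have "card (T \<union> T') = card T + card T'" using fin disj by (simp add: card_Un_disjoint)
  moreover have "0 < card T" "0 < card T'" using fin ne by (auto simp: card_gt_0_iff)
  ultimately have 2: "2 \<le> card (T \<union> T')" by linarith
  have sub: "T \<union> T' \<subseteq> M" "T'' \<inter> (T \<union> T') = {}" using ch(2) ch(5) disj by blast+
  have M: "M \<subseteq> {1..<n}" using assms(1,3) by (auto simp: hier_def clusters_def)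
  have c: "T \<union> T' \<in> clusters n"
    unfolding clusters_def using 2 sub M ne ch(8) by blast
  show nin: "T \<union> T' \<notin> \<N>"
  proof
    assume "T \<union> T' \<in> \<N>"
    then have "T \<union> T' \<in> ext n \<N>" unfolding ext_def by blast
    then have "M \<subseteq> T \<union> T'" using ch(3)[of "T \<union> T'"] ne disj by blast
    then show False using ch(8) sub(2) ne by blast
  qed
  have "A \<subseteq> T \<union> T' \<or> T \<union> T' \<subseteq> A \<or> A \<inter> (T \<union> T') = {}" if "A \<in> \<N>" for A
  proof -
    have A: "A \<in> ext n \<N>" using that unfolding ext_def by blast
    have "A \<subseteq> T \<or> T \<subset> A \<or> A \<inter> T = {}" "A \<subseteq> T' \<or> T' \<subset> A \<or> A \<inter> T' = {}"
      using laminar A ch(1) ch(4) unfolding laminar_def by blast+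
    then show ?thesis using ch(3)[OF A] ch(6)[OF A] sub by blast
  qed
  then show "hier n (insert (T \<union> T') \<N>)"
    using assms(1) c unfolding hier_def laminar_def by blast
qed

lemma obtain_two:
  assumes "2 \<le> card X"
  obtains a b where "a \<in> X" "b \<in> X" "a \<noteq> b"
proof -
  obtain Y where Y: "Y \<subseteq> X" "card Y = 2" by (rule obtain_subset_with_card_n[OF assms])
  obtain a b where "Y = {a, b}" "a \<noteq> b" using Y(2) by (auto simp: card_2_iff)
  then show ?thesis using that Y(1) by auto
qed

lemma obtain_three:
  assumes "3 \<le> card X"
  obtains a b c where "a \<in> X" "b \<in> X" "c \<in> X" "a \<noteq> b" "a \<noteq> c" "b \<noteq> c"
proof -
  obtain Y where Y: "Y \<subseteq> X" "card Y = 3" by (rule obtain_subset_with_card_n[OF assms])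
  obtain a b c where "Y = {a, b, c}" "a \<noteq> b" "b \<noteq> c" "a \<noteq> c" using Y(2) by (auto simp: card_3_iff)
  then show ?thesis using that Y(1) by auto
qed

lemma hier_extend:
  assumes "hier n \<N>" "3 \<le> n"
  shows "\<exists>\<M>. \<N> \<subseteq> \<M> \<and> hier n \<M> \<and> card \<M> = n - 3"
  using assms(1)
proof (induction "n - 3 - card \<N>" arbitrary: \<N>)
  case 0
  then show ?case using card_hier_le[OF 0(2) assms(2)] by auto
next
  case (Suc d)
  let ?f = "\<lambda>S. card (children (ext n \<N>) S)"
  \<comment> \<open>With at most two children everywhere the count would give at least
    \<open>n - 3\<close> clusters, so below that size some vertex can still be resolved.\<close>
  have "\<exists>S\<in>insert {1..<n} \<N>. 3 \<le> ?f S"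
  proof (rule ccontr)
    assume "\<not> ?thesis"
    then have "?f S \<le> 2" if "S \<in> insert {1..<n} \<N>" for S using that by fastforce
    then have "(\<Sum>S\<in>insert {1..<n} \<N>. ?f S) \<le> (\<Sum>S\<in>insert {1..<n} \<N>. 2)"
      by (rule sum_mono)
    then show False
      using Suc(2) by (simp only: sum_children_hier(1)[OF Suc(3) assms(2)] sum_constant
            sum_children_hier(2)[OF Suc(3) assms(2)]) simp
  qed
  then obtain S where S: "S \<in> insert {1..<n} \<N>" "3 \<le> ?f S" by blast
  obtain T T' T'' where "T \<in> children (ext n \<N>) S" "T' \<in> children (ext n \<N>) S"
      "T'' \<in> children (ext n \<N>) S" "T \<noteq> T'" "T \<noteq> T''" "T' \<noteq> T''"
    using obtain_three[OF S(2)] .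
  then have *: "hier n (insert (T \<union> T') \<N>)" "T \<union> T' \<notin> \<N>"
    using hier_insert_Un[OF Suc(3) assms(2) S(1)] by auto
  have "d = n - 3 - card (insert (T \<union> T') \<N>)"
    using Suc(2) *(2) hier_finite[OF Suc(3)] by simp
  then show ?case using Suc(1)[OF _ *(1)] by blast
qed

text \<open>In codimension one the child counts exceed two per node by 1 in total. Hence one node
  has three children and all others have two: this node is the 4-valent vertex, and its three
  resolutions are the clusters that can be added.\<close>

lemma ternary_node:
  assumes "hier n \<N>" "3 \<le> n" "card \<N> + 1 = n - 3"
  obtains M A B C where "M \<in> insert {1..<n} \<N>" "children (ext n \<N>) M = {A, B, C}"
    "A \<noteq> B" "A \<noteq> C" "B \<noteq> C" "{S. S \<notin> \<N> \<and> hier n (insert S \<N>)} = {A \<union> B, A \<union> C, B \<union> C}"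
proof -
  interpret full_hierarchy "{1..<n}" "ext n \<N>"
    by (rule full_hierarchy_ext) (use assms in auto)
  let ?f = "\<lambda>S. card (children (ext n \<N>) S)"
  let ?I = "insert {1..<n} \<N>"
  note sc = sum_children_hier[OF assms(1,2)]
  have finI: "finite ?I" using hier_finite[OF assms(1)] by simp
  have sum: "(\<Sum>S\<in>?I. ?f S) = 2 * card ?I + 1"
    unfolding sc(1,2) using assms(3) by simp
  have "\<exists>M\<in>?I. 2 < ?f M"
  proof (rule ccontr)
    assume "\<not> ?thesis"
    then have "(\<Sum>S\<in>?I. ?f S) \<le> (\<Sum>S\<in>?I. 2)" by (intro sum_mono) fastforce
    then show False unfolding sum by simp
  qed
  then obtain M where M: "M \<in> ?I" "2 < ?f M" by blast
  have split: "(\<Sum>S\<in>?I. ?f S) = ?f M + (\<Sum>S\<in>?I - {M}. ?f S)"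
    by (rule sum.remove[OF finI M(1)])
  have c': "card ?I = 1 + card (?I - {M})" using card_Suc_Diff1[OF finI M(1)] by simp
  have "(\<Sum>S\<in>?I - {M}. 2) \<le> (\<Sum>S\<in>?I - {M}. ?f S)"
    by (rule sum_mono) (use sc(3) in blast)
  then have fM: "?f M = 3" and rest: "(\<Sum>S\<in>?I - {M}. ?f S) = (\<Sum>S\<in>?I - {M}. 2)"
    using sum M(2) split c' by simp_all
  have two: "?f S = 2" if "S \<in> ?I" "S \<noteq> M" for S
  proof (rule ccontr)
    assume "?f S \<noteq> 2"
    then have "2 < ?f S" using sc(3)[OF that(1)] by linarith
    then have "(\<Sum>S\<in>?I - {M}. 2) < (\<Sum>S\<in>?I - {M}. ?f S)"
      using finI that sc(3) by (intro sum_strict_mono_ex1) auto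
    then show False using rest by simp
  qed
  obtain A B C where ABC: "children (ext n \<N>) M = {A, B, C}" "A \<noteq> B" "A \<noteq> C" "B \<noteq> C"
    using fM unfolding card_3_iff by blast
  have ch: "A \<in> children (ext n \<N>) M" "B \<in> children (ext n \<N>) M" "C \<in> children (ext n \<N>) M"
    using ABC by auto
  have "S \<in> {A \<union> B, A \<union> C, B \<union> C}" if S: "S \<notin> \<N>" "hier n (insert S \<N>)" for S
  proof -
    have Sc: "S \<in> clusters n" and lam: "laminar (insert S \<N>)" using S unfolding hier_def by auto
    have Sn: "S \<notin> ext n \<N>" using S(1) clustersD(2,3)[OF Sc] unfolding ext_def by auto
    have Sne: "S \<noteq> {}" "S \<subseteq> {1..<n}" using clustersD[OF Sc] by auto
    have lam': "R \<subseteq> S \<or> S \<subseteq> R \<or> R \<inter> S = {}" if "R \<in> ext n \<N>" for R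
      using that lam Sne unfolding ext_def laminar_def by fastforce
    \<comment> \<open>A cluster compatible with the family is a union of children of the smallest
      member \<open>E\<close> around it. It uses at least two of them but not all, so
      \<open>E\<close> has more than two children and must be \<open>M\<close>.\<close>
    define E where "E = envelope (ext n \<N>) S"
    note E = envelope[OF Sne(2,1), folded E_def]
    have SE: "S \<subset> E" using E Sn by blast
    have cS: "c \<subseteq> S \<or> c \<inter> S = {}" if "c \<in> children (ext n \<N>) E" for c
      using lam'[of c] childrenD[OF that] E(3)[of c] by blast
    have "card S < card E" using SE finite_mem[OF E(1)] by (simp add: psubset_card_mono)
    then have cE: "2 \<le> card E" using clustersD(2)[OF Sc] by linarith
    then have EI: "E \<in> ?I" using E(1) ext_card_ge_2[OF assms(1,2)] by blast
    define X where "X = {c \<in> children (ext n \<N>) E. c \<subseteq> S}"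
    have SX: "S = \<Union>X"
    proof
      show "S \<subseteq> \<Union>X"
      proof
        fix x assume "x \<in> S"
        then obtain c where "c \<in> children (ext n \<N>) E" "x \<in> c"
          using Union_children[OF E(1) cE] E(2) by blast
        then show "x \<in> \<Union>X" using cS[of c] \<open>x \<in> S\<close> unfolding X_def by blast
      qed
    qed (auto simp: X_def)
    have Xsub: "X \<subseteq> children (ext n \<N>) E" unfolding X_def by blast
    have "X \<noteq> children (ext n \<N>) E" using SX SE Union_children[OF E(1) cE] by blast
    then have lt: "card X < card (children (ext n \<N>) E)"
      using Xsub finite_children by (simp add: psubset_card_mono psubsetI)
    have finX: "finite X" using Xsub finite_children finite_subset by blast
    have "card X \<noteq> 0" using SX Sne finX by auto
    moreover have "card X \<noteq> 1"
    proof
      assume "card X = 1"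
      then obtain c where "X = {c}" using card_1_singletonE by blast
      then show False using SX Sn Xsub childrenD(1)[of c E] by auto
    qed
    ultimately have X2: "2 \<le> card X" by linarith
    have EM: "E = M" using two[OF EI] lt X2 by linarith
    have "card X = 2" using lt X2 fM unfolding EM by linarith
    then obtain u v where uv: "X = {u, v}" "u \<noteq> v" by (auto simp: card_2_iff)
    have "X \<subseteq> {A, B, C}" using Xsub EM ABC by simp
    then have "X = {A, B} \<or> X = {A, C} \<or> X = {B, C}"
      using uv unfolding uv(1) by (simp add: doubleton_eq_iff) metis
    then show ?thesis using SX by auto
  qed
  moreover have "S \<notin> \<N> \<and> hier n (insert S \<N>)" if "S \<in> {A \<union> B, A \<union> C, B \<union> C}" for S
    using that hier_insert_Un[OF assms(1,2) M(1)] ch ABC(2-4) by (metis empty_iff insert_iff)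
  ultimately have "{S. S \<notin> \<N> \<and> hier n (insert S \<N>)} = {A \<union> B, A \<union> C, B \<union> C}" by blast
  then show ?thesis using that[OF M(1) ABC] by blast
qed

section \<open>Weighted laminar families and ultrametrics\<close>

text \<open>\<open>p S\<close> is a pair of leaves whose smallest common member is \<open>S\<close>.
  For a binary family these pairs are the edges of a spanning tree on
  \<open>{1..<n}\<close>.\<close>

definition separator :: "nat \<Rightarrow> nat set set \<Rightarrow> (nat set \<Rightarrow> nat set) \<Rightarrow> bool" where
  "separator n \<N> p \<longleftrightarrow> (\<forall>S\<in>insert {1..<n} \<N>.
     p S \<subseteq> {1..<n} \<and> card (p S) = 2 \<and> (\<forall>R\<in>ext n \<N>. p S \<subseteq> R \<longleftrightarrow> S \<subseteq> R))"

lemma separator_exists: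
  assumes "hier n \<N>" "3 \<le> n"
  shows "\<exists>p. separator n \<N> p"
proof -
  interpret full_hierarchy "{1..<n}" "ext n \<N>"
    by (rule full_hierarchy_ext) (use assms in auto)
  have "\<exists>P. P \<subseteq> {1..<n} \<and> card P = 2 \<and> (\<forall>R\<in>ext n \<N>. P \<subseteq> R \<longleftrightarrow> S \<subseteq> R)"
    if S: "S \<in> insert {1..<n} \<N>" for S
  proof -
    have 2: "2 \<le> card (children (ext n \<N>) S)" by (rule sum_children_hier(3)[OF assms S])
    obtain T T' where T: "T \<in> children (ext n \<N>) S" "T' \<in> children (ext n \<N>) S" "T \<noteq> T'"
      using obtain_two[OF 2] .
    obtain a b where ab: "a \<in> T" "b \<in> T'" using T childrenD(1) nonempty by (meson ex_in_conv)
    have "a \<noteq> b" using ab T children_disjoint by blast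
    moreover have "{a, b} \<subseteq> {1..<n}" using ab T childrenD(1) sub_U by blast
    ultimately show ?thesis
      using child_separates[OF T ab] by (intro exI[of _ "{a, b}"]) auto
  qed
  then show ?thesis unfolding separator_def by (intro bchoice) blast
qed

text \<open>The Billera-Holmes-Vogtmann space of rooted trees with leaves \<open>{1..<n}\<close>,
  without leaf lengths: the support records the tree and the values record the edge lengths.\<close>

definition weights :: "nat \<Rightarrow> (nat set \<Rightarrow> real) set" where
  "weights n = {l. (\<forall>S. 0 \<le> l S) \<and> hier n {S. l S \<noteq> 0}}"

text \<open>On a pair of leaves this is a Gromov product based at the inner vertex of leaf
  \<open>n\<close>: the length of the common part of the two paths from there. Larger values mean
  closer leaves.\<close>

definition val :: "nat \<Rightarrow> (nat set \<Rightarrow> real) \<Rightarrow> nat set \<Rightarrow> real" where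
  "val n l P = (\<Sum>S\<in>{S \<in> clusters n. P \<subseteq> S}. l S)"

definition pairs :: "nat \<Rightarrow> nat set set" where
  "pairs n = {P. P \<subseteq> {1..<n} \<and> card P = 2}"

lemma finite_pairs: "finite (pairs n)"
  by (rule finite_subset[of _ "Pow {1..<n}"]) (auto simp: pairs_def)

lemma pairs_memI: "a \<in> {1..<n} \<Longrightarrow> b \<in> {1..<n} \<Longrightarrow> a \<noteq> b \<Longrightarrow> {a, b} \<in> pairs n"
  unfolding pairs_def by simp

lemma pairsE:
  assumes "P \<in> pairs n"
  obtains a b where "P = {a, b}" "a \<noteq> b" "a \<in> {1..<n}" "b \<in> {1..<n}"
proof -
  have "P \<subseteq> {1..<n}" "card P = 2" using assms unfolding pairs_def by auto
  then obtain a b where "P = {a, b}" "a \<noteq> b" by (auto simp: card_2_iff)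
  then show ?thesis using that[of a b] \<open>P \<subseteq> {1..<n}\<close> by simp
qed

lemma separator_pairs: "separator n \<N> p \<Longrightarrow> S \<in> insert {1..<n} \<N> \<Longrightarrow> p S \<in> pairs n"
  unfolding separator_def pairs_def by blast

lemma separator_ext: "separator n \<N> p \<Longrightarrow> S \<in> insert {1..<n} \<N> \<Longrightarrow> R \<in> ext n \<N> \<Longrightarrow>
    p S \<subseteq> R \<longleftrightarrow> S \<subseteq> R"
  unfolding separator_def by blast

lemma separator_sub: "separator n \<N> p \<Longrightarrow> S \<in> insert {1..<n} \<N> \<Longrightarrow> R \<in> insert {1..<n} \<N> \<Longrightarrow>
    p S \<subseteq> R \<longleftrightarrow> S \<subseteq> R"
  unfolding separator_def ext_def by blast

lemma val_support:
  assumes "hier n \<N>" "{S. l S \<noteq> 0} \<subseteq> \<N>"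
  shows "val n l P = (\<Sum>S\<in>{S \<in> \<N>. P \<subseteq> S}. l S)"
  unfolding val_def
  by (rule sum.mono_neutral_right) (use assms finite_clusters in \<open>auto simp: hier_def\<close>)

lemma val_mono_support:
  assumes "l \<in> weights n" "\<And>R. R \<in> clusters n \<Longrightarrow> l R \<noteq> 0 \<Longrightarrow> P \<subseteq> R \<Longrightarrow> Q \<subseteq> R"
  shows "val n l P \<le> val n l Q"
proof -
  have *: "val n l P = (\<Sum>S\<in>{S \<in> clusters n. P \<subseteq> S \<and> l S \<noteq> 0}. l S)"
    unfolding val_def by (rule sum.mono_neutral_right) (use finite_clusters in auto)
  show ?thesis unfolding * unfolding val_def
    by (rule sum_mono2) (use finite_clusters assms in \<open>auto simp: weights_def\<close>)
qed

lemma weights_laminarD: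
  assumes "l \<in> weights n" "l A \<noteq> 0" "l B \<noteq> 0" "x \<in> A" "x \<in> B"
  shows "A \<subseteq> B \<or> B \<subseteq> A"
proof -
  have "laminar {S. l S \<noteq> 0}" using assms unfolding weights_def hier_def by blast
  then show ?thesis by (rule laminarD) (use assms in auto)
qed

text \<open>The ultrametric inequality is reversed, since \<open>val\<close> measures closeness. A
  weighted set that contains \<open>a\<close> and \<open>b\<close> but not \<open>c\<close> lies, by
  laminarity, inside every weighted set around \<open>b\<close> and \<open>c\<close>, which then
  contains \<open>a\<close> as well.\<close>

lemma val_ultrametric:
  assumes "l \<in> weights n"
  shows "min (val n l {a, b}) (val n l {b, c}) \<le> val n l {a, c}"
proof (cases "\<exists>A. l A \<noteq> 0 \<and> {a, b} \<subseteq> A \<and> c \<notin> A")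
  case False
  then have "val n l {a, b} \<le> val n l {a, c}"
    by (intro val_mono_support[OF assms]) blast
  then show ?thesis by linarith
next
  case True
  then obtain A where A: "l A \<noteq> 0" "{a, b} \<subseteq> A" "c \<notin> A" by blast
  have "val n l {b, c} \<le> val n l {a, c}"
  proof (intro val_mono_support[OF assms])
    fix B assume B: "l B \<noteq> 0" "{b, c} \<subseteq> B"
    then show "{a, c} \<subseteq> B"
      using weights_laminarD[OF assms A(1) B(1), of b] A by blast
  qed
  then show ?thesis by linarith
qed

text \<open>Nothing lies strictly between \<open>S\<close> and its cover, so the members around
  \<open>P\<close> are those around \<open>Q\<close> together with \<open>S\<close>. All dual
  coordinates come from this difference.\<close>

lemma val_cover:
  assumes "hier n \<N>" "3 \<le> n" "{S. l S \<noteq> 0} \<subseteq> \<N>" "S \<in> \<N>"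
    "\<And>R. R \<in> ext n \<N> \<Longrightarrow> P \<subseteq> R \<longleftrightarrow> S \<subseteq> R"
    "\<And>R. R \<in> ext n \<N> \<Longrightarrow> Q \<subseteq> R \<longleftrightarrow> cover (ext n \<N>) S \<subseteq> R"
  shows "val n l P = val n l Q + l S"
proof -
  interpret full_hierarchy "{1..<n}" "ext n \<N>"
    by (rule full_hierarchy_ext) (use assms in auto)
  have S: "S \<in> ext n \<N>" "S \<noteq> {1..<n}"
    using assms(1,4) unfolding hier_def ext_def clusters_def by auto
  note c = cover[OF S]
  have sub: "R \<in> ext n \<N>" if "R \<in> \<N>" for R using that unfolding ext_def by blast
  have eq: "{R \<in> \<N>. P \<subseteq> R} = insert S {R \<in> \<N>. Q \<subseteq> R}"
  proof (intro equalityI subsetI)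
    fix R assume "R \<in> {R \<in> \<N>. P \<subseteq> R}"
    then have "R \<in> \<N>" "S \<subseteq> R" using assms(5)[OF sub] by auto
    then show "R \<in> insert S {R \<in> \<N>. Q \<subseteq> R}"
      using assms(6)[OF sub] c(3)[OF sub] by blast
  next
    fix R assume "R \<in> insert S {R \<in> \<N>. Q \<subseteq> R}"
    then have "R \<in> \<N>" "S \<subseteq> R" using assms(6)[OF sub] c(2) assms(4) by auto
    then show "R \<in> {R \<in> \<N>. P \<subseteq> R}" using assms(5)[OF sub] by blast
  qed
  have "S \<notin> {R \<in> \<N>. Q \<subseteq> R}" using assms(6)[OF S(1)] c by blast
  then show ?thesis
    unfolding val_support[OF assms(1,3)] eq using hier_finite[OF assms(1)] by simp
qed

lemma cover_mem:
  assumes "hier n \<N>" "3 \<le> n" "S \<in> \<N>"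
  shows "cover (ext n \<N>) S \<in> insert {1..<n} \<N>" "S \<subset> cover (ext n \<N>) S"
    "\<And>R. R \<in> insert {1..<n} \<N> \<Longrightarrow> S \<subset> R \<Longrightarrow> cover (ext n \<N>) S \<subseteq> R"
proof -
  interpret full_hierarchy "{1..<n}" "ext n \<N>"
    by (rule full_hierarchy_ext) (use assms in auto)
  have S: "S \<in> ext n \<N>" "S \<noteq> {1..<n}"
    using assms(1,3) unfolding hier_def ext_def clusters_def by auto
  have "card S < card (cover (ext n \<N>) S)"
    using cover[OF S] finite_mem by (simp add: psubset_card_mono)
  moreover have "2 \<le> card S" using assms unfolding hier_def clusters_def by blast
  ultimately have "cover (ext n \<N>) S \<in> {S \<in> ext n \<N>. 2 \<le> card S}" using cover(1)[OF S] by simp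
  then show "cover (ext n \<N>) S \<in> insert {1..<n} \<N>"
    using ext_card_ge_2[OF assms(1,2)] by simp
  show "S \<subset> cover (ext n \<N>) S" by (rule cover(2)[OF S])
  show "\<And>R. R \<in> insert {1..<n} \<N> \<Longrightarrow> S \<subset> R \<Longrightarrow> cover (ext n \<N>) S \<subseteq> R"
    using cover(3)[OF S] unfolding ext_def by blast
qed

section \<open>Recovering the weights from the ultrametric\<close>

definition crossing :: "nat \<Rightarrow> nat set \<Rightarrow> nat set set" where
  "crossing n S = {Q \<in> pairs n. Q \<inter> S \<noteq> {} \<and> \<not> Q \<subseteq> S}"

text \<open>Laminarity puts \<open>S\<close> strictly inside every weighted set that contains the
  cut pair \<open>Q\<close>. Such sets contain \<open>P\<close> too, and \<open>S\<close> itself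
  contains \<open>P\<close> but not \<open>Q\<close>.\<close>

lemma val_crossing_le:
  assumes l: "l \<in> weights n" and S: "S \<in> clusters n" and P: "P \<subseteq> S" and Q: "Q \<in> crossing n S"
    and pos: "0 < l S"
  shows "val n l Q + l S \<le> val n l P"
proof -
  have R: "S \<subset> R" if "l R \<noteq> 0" "Q \<subseteq> R" for R
  proof -
    obtain x where "x \<in> Q" "x \<in> S" using Q unfolding crossing_def by blast
    then have "R \<subseteq> S \<or> S \<subseteq> R" using weights_laminarD[OF l that(1), of S x] that pos by auto
    then show ?thesis using that Q unfolding crossing_def by blast
  qed
  have "val n l Q = (\<Sum>R\<in>{R \<in> clusters n. Q \<subseteq> R \<and> l R \<noteq> 0}. l R)"
    unfolding val_def by (rule sum.mono_neutral_right) (use finite_clusters in auto)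
  then have "val n l Q + l S = (\<Sum>R\<in>insert S {R \<in> clusters n. Q \<subseteq> R \<and> l R \<noteq> 0}. l R)"
    using R[of S] finite_clusters by (subst sum.insert) auto
  also have "\<dots> \<le> val n l P"
    unfolding val_def
  proof (rule sum_mono2)
    show "insert S {R \<in> clusters n. Q \<subseteq> R \<and> l R \<noteq> 0} \<subseteq> {S \<in> clusters n. P \<subseteq> S}"
      using R S P by blast
  qed (use finite_clusters l in \<open>auto simp: weights_def\<close>)
  finally show ?thesis .
qed

text \<open>If \<open>S\<close> is compatible with the support, \<open>P\<close> is separated at
  \<open>S\<close> and \<open>Q\<close> at its cover. Otherwise some weighted \<open>S'\<close>
  properly overlaps \<open>S\<close>. With \<open>a\<close> in both sets, \<open>b\<close> only in
  \<open>S\<close> and \<open>c\<close> only in \<open>S'\<close>, every weighted set around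
  \<open>a\<close> and \<open>b\<close> contains \<open>S'\<close> and hence
  \<open>c\<close>.\<close>

lemma val_crossing_eq:
  assumes n: "3 \<le> n" and l: "l \<in> weights n" and S: "S \<in> clusters n"
  shows "\<exists>P\<in>pairs n. \<exists>Q\<in>crossing n S. P \<subseteq> S \<and> val n l P \<le> val n l Q + l S"
proof (cases "hier n (insert S {S. l S \<noteq> 0})")
  case h: True
  let ?N = "insert S {S. l S \<noteq> 0}"
  interpret full_hierarchy "{1..<n}" "ext n ?N"
    by (rule full_hierarchy_ext) (use h n in auto)
  obtain p where p: "separator n ?N p" using separator_exists[OF h n] by blast
  define M where "M = cover (ext n ?N) S"
  have Se: "S \<in> ext n ?N" "S \<noteq> {1..<n}" using S unfolding ext_def clusters_def by auto
  note c = cover[OF Se, folded M_def]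
  have SM: "S \<in> children (ext n ?N) M" using cover_eq_iff[OF Se] M_def by blast
  obtain x where x: "x \<in> M" "x \<notin> S" using c by blast
  obtain T where T: "T \<in> children (ext n ?N) M" "x \<in> T"
    using child_at[OF c(1) x(1)] c(2) x nonempty[OF Se(1)] by blast
  have ST: "S \<noteq> T" using T x by blast
  obtain a where a: "a \<in> S" using nonempty[OF Se(1)] by blast
  have ax: "{a, x} \<subseteq> R \<longleftrightarrow> M \<subseteq> R" if "R \<in> ext n ?N" for R
    by (rule child_separates[OF SM T(1) ST a T(2) that])
  have "a \<in> M" using a c(2) by blast
  then have Q: "{a, x} \<in> crossing n S"
    unfolding crossing_def using x a sub_U[OF c(1)] by (auto intro!: pairs_memI)
  have "val n l (p S) = val n l {a, x} + l S"
  proof (rule val_cover[OF h n])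
    show "p S \<subseteq> R \<longleftrightarrow> S \<subseteq> R" if "R \<in> ext n ?N" for R
      using p that unfolding separator_def by blast
    show "{a, x} \<subseteq> R \<longleftrightarrow> cover (ext n ?N) S \<subseteq> R" if "R \<in> ext n ?N" for R
      using ax[OF that] M_def by simp
  qed auto
  moreover have "p S \<in> pairs n" using separator_pairs[OF p] by simp
  moreover have "p S \<subseteq> S" using separator_sub[OF p, of S S] by simp
  ultimately show ?thesis using Q by (intro bexI[of _ "p S"] bexI[of _ "{a, x}"]) auto
next
  case False
  have ll: "laminar {S. l S \<noteq> 0}" "{S. l S \<noteq> 0} \<subseteq> clusters n" using l unfolding weights_def hier_def by auto
  have "\<exists>S'. l S' \<noteq> 0 \<and> \<not> S \<subseteq> S' \<and> \<not> S' \<subseteq> S \<and> S \<inter> S' \<noteq> {}"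
  proof (rule ccontr)
    assume "\<not> ?thesis"
    then have "laminar (insert S {S. l S \<noteq> 0})"
      using ll(1) unfolding laminar_def by blast
    then show False using False ll(2) S unfolding hier_def by blast
  qed
  then obtain S' where S': "l S' \<noteq> 0" "\<not> S \<subseteq> S'" "\<not> S' \<subseteq> S" "S \<inter> S' \<noteq> {}" by blast
  then obtain a b c where abc: "a \<in> S" "a \<in> S'" "b \<in> S" "b \<notin> S'" "c \<in> S'" "c \<notin> S" by blast
  have "S' \<in> clusters n" using S'(1) ll(2) by blast
  then have sub: "S \<subseteq> {1..<n}" "S' \<subseteq> {1..<n}" using S unfolding clusters_def by blast+
  have "val n l {a, b} \<le> val n l {a, c}"
  proof (rule val_mono_support[OF l])
    fix R assume R: "l R \<noteq> 0" "{a, b} \<subseteq> R"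
    then have "R \<subseteq> S' \<or> S' \<subseteq> R" using weights_laminarD[OF l R(1) S'(1), of a] abc by auto
    then show "{a, c} \<subseteq> R" using abc R(2) by auto
  qed
  moreover have "0 \<le> l S" using l unfolding weights_def by blast
  moreover have "{a, b} \<in> pairs n" using abc sub by (intro pairs_memI) auto
  moreover have "{a, c} \<in> crossing n S"
  proof -
    have "{a, c} \<in> pairs n" using abc sub by (intro pairs_memI) auto
    then show ?thesis using abc unfolding crossing_def by auto
  qed
  ultimately show ?thesis using abc by (intro bexI[of _ "{a, b}"] bexI[of _ "{a, c}"]) auto
qed

text \<open>An isolation index in the style of Buneman. The formula does not refer to the support,
  so it compares weight vectors with different supports. The truncation serves clusters of weight 0,
  where the minimum may be negative.\<close>

lemma weight_eq_Min:
  assumes "3 \<le> n" "l \<in> weights n" "S \<in> clusters n"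
  shows "l S = max 0 (Min ((\<lambda>(P, Q). val n l P - val n l Q) ` ({P \<in> pairs n. P \<subseteq> S} \<times> crossing n S)))"
    (is "_ = max 0 (Min ?X)")
proof -
  obtain P Q where PQ: "P \<in> pairs n" "Q \<in> crossing n S" "P \<subseteq> S" "val n l P \<le> val n l Q + l S"
    using val_crossing_eq[OF assms] by blast
  have fin: "finite ?X" unfolding crossing_def using finite_pairs by simp
  have "val n l P - val n l Q \<in> ?X" using PQ by force
  then have 1: "Min ?X \<le> l S"
    using Min_le[OF fin] PQ(4) by fastforce
  have 2: "0 \<le> l S" using assms(2) unfolding weights_def by blast
  have 3: "l S \<le> Min ?X" if "l S \<noteq> 0"
  proof (rule Min.boundedI[OF fin])
    show "?X \<noteq> {}" using PQ by blast
    fix a assume "a \<in> ?X"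
    then obtain P Q where "a = val n l P - val n l Q" "P \<subseteq> S" "Q \<in> crossing n S" by auto
    then show "l S \<le> a"
      using val_crossing_le[OF assms(2,3), of P Q] that 2 by force
  qed
  show ?thesis using 1 2 3 by linarith
qed

text \<open>Two ultrametrics that agree up to a constant on a spanning tree separating a binary
  hierarchy: the one supported on the hierarchy is the smaller one.\<close>

lemma val_binary_minimal:
  assumes h: "hier n \<N>" and n: "3 \<le> n" and c: "card \<N> = n - 3" and p: "separator n \<N> p"
    and l: "l \<in> weights n" "{S. l S \<noteq> 0} \<subseteq> \<N>" and l': "l' \<in> weights n"
    and eq: "\<And>S. S \<in> insert {1..<n} \<N> \<Longrightarrow> val n l' (p S) = val n l (p S) + r"
    and P: "P \<in> pairs n"
  shows "val n l P + r \<le> val n l' P"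
proof -
  interpret full_hierarchy "{1..<n}" "ext n \<N>"
    by (rule full_hierarchy_ext) (use h n in auto)
  have mono: "val n l (p S) \<le> val n l (p R)"
    if S: "S \<in> insert {1..<n} \<N>" and R: "R \<in> insert {1..<n} \<N>" and RS: "R \<subseteq> S" for S R
  proof (rule val_mono_support[OF l(1)])
    fix A assume A: "l A \<noteq> 0" "p S \<subseteq> A"
    then have "A \<in> insert {1..<n} \<N>" using l(2) by blast
    then show "p R \<subseteq> A" using separator_sub[OF p S, of A] separator_sub[OF p R, of A] RS A(2) by blast
  qed
  \<comment> \<open>Induction from the leaves upwards: a pair inside a child is handled by that
    child, whose bound is at least the bound for \<open>S\<close> by \<open>mono\<close>.\<close>
  have main: "val n l (p S) + r \<le> val n l' {i, j}"
    if "S \<in> insert {1..<n} \<N>" "i \<in> S" "j \<in> S" "i \<noteq> j" for S i j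
    using that
  proof (induction "card S" arbitrary: S i j rule: less_induct)
    case less
    have 2: "card (children (ext n \<N>) S) = 2"
      by (rule card_children_maximal[OF h n c less(2)])
    have Se: "S \<in> ext n \<N>" "2 \<le> card S"
      using less(2) ext_card_ge_2[OF h n] by auto
    have inner: "val n l (p S) + r \<le> val n l' {i, j}"
      if T: "T \<in> children (ext n \<N>) S" and ij: "i \<in> T" "j \<in> T" "i \<noteq> j" for T i j
    proof -
      have "2 \<le> card T"
      proof -
        have "card {i, j} \<le> card T"
          by (rule card_mono) (use ij finite_mem[OF childrenD(1)[OF T]] in auto)
        then show ?thesis using ij(3) by simp
      qed
      then have Tm: "T \<in> insert {1..<n} \<N>"
        using ext_card_ge_2[OF h n] childrenD(1)[OF T] by blast
      have TS: "T \<subset> S" by (rule childrenD(2)[OF T])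
      then have "card T < card S" using finite_mem[OF Se(1)] by (simp add: psubset_card_mono)
      then have "val n l (p T) + r \<le> val n l' {i, j}" using less(1)[OF _ Tm] ij by blast
      then show ?thesis using mono[OF less(2) Tm] TS by force
    qed
    obtain A B where AB: "children (ext n \<N>) S = {A, B}" "A \<noteq> B"
      using 2 by (auto simp: card_2_iff)
    have UAB: "A \<union> B = S" using Union_children[OF Se] AB by simp
    have disj: "A \<inter> B = {}" using children_disjoint[of A S B] AB by auto
    have A: "A \<in> children (ext n \<N>) S" and B: "B \<in> children (ext n \<N>) S" using AB by auto
    have sep: "p S \<subseteq> R \<longleftrightarrow> S \<subseteq> R" if "R \<in> ext n \<N>" for R
      using p less(2) that unfolding separator_def by blast
    have pS: "p S \<in> pairs n" "p S \<subseteq> S" "\<not> p S \<subseteq> A" "\<not> p S \<subseteq> B"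
      using separator_pairs[OF p less(2)] sep[OF Se(1)] sep[OF childrenD(1)[OF A]]
        sep[OF childrenD(1)[OF B]] childrenD(2)[OF A] childrenD(2)[OF B] by auto
    obtain u v where uv: "p S = {u, v}" using pairsE[OF pS(1)] .
    obtain a b where ab: "p S = {a, b}" "a \<in> A" "b \<in> B"
    proof (cases "u \<in> A")
      case True
      then have "v \<in> B" using pS uv UAB by auto
      then show ?thesis using that[of u v] uv True by blast
    next
      case False
      then have "u \<in> B" "v \<in> A" using pS uv UAB by auto
      then show ?thesis using that[of v u] uv by (simp add: insert_commute)
    qed
    have pab: "val n l' {a, b} = val n l (p S) + r" using eq[OF less(2)] ab by simp
    \<comment> \<open>A pair across the two children is reached from the representative
      \<open>{a, b}\<close> by moving \<open>a\<close> to \<open>i\<close> inside \<open>A\<close>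
      and then \<open>b\<close> to \<open>j\<close> inside \<open>B\<close>. The ultrametric
      inequality preserves the lower bound at each move.\<close>
    have step: "val n l (p S) + r \<le> val n l' {i, j}" if "i \<in> A" "j \<in> B" for i j
    proof -
      have 1: "val n l (p S) + r \<le> val n l' {i, b}"
      proof (cases "i = a")
        case True then show ?thesis using pab by simp
      next
        case False
        then show ?thesis
          using inner[OF A that(1) ab(2)] val_ultrametric[OF l', of i a b] pab by linarith
      qed
      show ?thesis
      proof (cases "j = b")
        case True then show ?thesis using 1 by simp
      next
        case False
        then show ?thesis
          using inner[OF B ab(3) that(2)] val_ultrametric[OF l', of i b j] 1 by linarith
      qed
    qed
    consider "i \<in> A" "j \<in> A" | "i \<in> B" "j \<in> B" | "i \<in> A" "j \<in> B" | "i \<in> B" "j \<in> A"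
      using less(3,4) UAB by blast
    then show ?case
    proof cases
      case 1 then show ?thesis using inner[OF A] less(5) by blast
    next
      case 2 then show ?thesis using inner[OF B] less(5) by blast
    next
      case 3 then show ?thesis by (rule step)
    next
      case 4 then show ?thesis using step[of j i] by (simp add: insert_commute)
    qed
  qed
  have Pne: "P \<subseteq> {1..<n}" "P \<noteq> {}" using P unfolding pairs_def by auto
  define S where "S = envelope (ext n \<N>) P"
  note E = envelope[OF Pne, folded S_def]
  have "card P \<le> card S" by (rule card_mono[OF finite_mem[OF E(1)] E(2)])
  then have "2 \<le> card S" using P unfolding pairs_def by simp
  then have S: "S \<in> insert {1..<n} \<N>" using E(1) ext_card_ge_2[OF h n] by blast
  obtain i j where ij: "P = {i, j}" "i \<noteq> j" using pairsE[OF P] .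
  \<comment> \<open>Since \<open>l\<close> lives on the family, every weighted set around
    \<open>P\<close> contains its smallest member \<open>S\<close> and therefore the representative
    of \<open>S\<close>.\<close>
  have "val n l P \<le> val n l (p S)"
  proof (rule val_mono_support[OF l(1)])
    fix R assume "l R \<noteq> 0" "P \<subseteq> R"
    then have R: "R \<in> \<N>" using l(2) by blast
    then have "S \<subseteq> R" using E(3)[of R] \<open>P \<subseteq> R\<close> unfolding ext_def by blast
    then show "p S \<subseteq> R" using separator_sub[OF p S] R by blast
  qed
  then show ?thesis using main[OF S, of i j] ij E(2) by force
qed

section \<open>Unimodular simplicial cones\<close>

lemma scaleR_fun_apply [simp]: "(c *\<^sub>R f) x = c *\<^sub>R f x" for f :: "'a \<Rightarrow> 'b::real_vector"
  by (simp add: scaleR_fun_def)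

lemma sum_fun_apply: "(\<Sum>a\<in>A. f a) x = (\<Sum>a\<in>A. f a x)" for f :: "'c \<Rightarrow> 'a \<Rightarrow> 'b::comm_monoid_add"
  by (induction A rule: infinite_finite_induct) simp_all

lemma Rn_iff: "x \<in> Rn N \<longleftrightarrow> (\<forall>i\<ge>N. x i = 0)"
  by (simp add: Rn_def topspace_Euclidean_space)

text \<open>The product topology on functions induces the Euclidean one, so \<open>open\<close> and
  \<open>continuous_on\<close> become available.\<close>

lemma Euclidean_space_eq: "Euclidean_space N = top_of_set (Rn N)"
  unfolding Euclidean_space_def Rn_def topspace_Euclidean_space by (simp add: euclidean_product_topology)

lemma subspace_Rn: "subspace (Rn N)"
  by (simp add: subspace_def Rn_iff)

lemma Zn_iff: "z \<in> Zn N \<longleftrightarrow> z \<in> Rn N \<and> (\<forall>i. z i \<in> \<int>)"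
  by (simp add: Zn_def)

lemma Zn_add: "x \<in> Zn N \<Longrightarrow> y \<in> Zn N \<Longrightarrow> x + y \<in> Zn N"
  and Zn_diff: "x \<in> Zn N \<Longrightarrow> y \<in> Zn N \<Longrightarrow> x - y \<in> Zn N"
  and Zn_0: "0 \<in> Zn N"
  and Zn_scale: "x \<in> Zn N \<Longrightarrow> c \<in> \<int> \<Longrightarrow> c *\<^sub>R x \<in> Zn N"
  by (auto simp: Zn_iff Rn_iff)

lemma Zn_sum: "(\<And>a. a \<in> A \<Longrightarrow> f a \<in> Zn N) \<Longrightarrow> sum f A \<in> Zn N"
  by (induction A rule: infinite_finite_induct) (auto simp: Zn_0 Zn_add)

definition unit_fun :: "nat \<Rightarrow> nat \<Rightarrow> real" where
  "unit_fun i = (\<lambda>j. if j = i then 1 else 0)"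

lemma unit_fun_Zn: "i < N \<Longrightarrow> unit_fun i \<in> Zn N"
  by (auto simp: Zn_iff Rn_iff unit_fun_def)

lemma unit_fun_Rn: "i < N \<Longrightarrow> unit_fun i \<in> Rn N"
  by (auto simp: Rn_iff unit_fun_def)

lemma sum_unit_fun: "finite A \<Longrightarrow> (\<Sum>i\<in>A. c i *\<^sub>R unit_fun i) = (\<lambda>j. if j \<in> A then c j else 0)"
  by (rule ext) (simp add: sum_fun_apply unit_fun_def if_distrib cong: if_cong)

lemma Rn_expand: "x \<in> Rn N \<Longrightarrow> x = (\<Sum>i<N. x i *\<^sub>R unit_fun i)"
  by (subst sum_unit_fun) (auto simp: Rn_iff)

lemma linear_Rn:
  fixes f :: "(nat \<Rightarrow> real) \<Rightarrow> 'b::real_vector"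
  assumes "linear f" "x \<in> Rn N"
  shows "f x = (\<Sum>i<N. x i *\<^sub>R f (unit_fun i))"
  by (subst Rn_expand[OF assms(2)]) (simp add: linear_sum[OF assms(1)] linear_scale[OF assms(1)])

lemma span_unit_fun:
  assumes "finite A"
  shows "span (unit_fun ` A) = {x. \<forall>j. j \<notin> A \<longrightarrow> x j = 0}"
proof
  have "subspace {x. \<forall>j. j \<notin> A \<longrightarrow> x j = (0::real)}" by (simp add: subspace_def)
  then show "span (unit_fun ` A) \<subseteq> {x. \<forall>j. j \<notin> A \<longrightarrow> x j = 0}"
    by (intro span_minimal) (auto simp: unit_fun_def)
  show "{x. \<forall>j. j \<notin> A \<longrightarrow> x j = 0} \<subseteq> span (unit_fun ` A)"
  proof
    fix x :: "nat \<Rightarrow> real" assume "x \<in> {x. \<forall>j. j \<notin> A \<longrightarrow> x j = 0}"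
    then have "x = (\<Sum>i\<in>A. x i *\<^sub>R unit_fun i)" by (auto simp: sum_unit_fun[OF assms])
    moreover have "(\<Sum>i\<in>A. x i *\<^sub>R unit_fun i) \<in> span (unit_fun ` A)"
      by (intro span_sum span_scale span_base) auto
    ultimately show "x \<in> span (unit_fun ` A)" by simp
  qed
qed

lemma Rn_span: "Rn N = span (unit_fun ` {..<N})"
  by (auto simp: span_unit_fun Rn_iff)

text \<open>Integral vectors whose entries at the positions \<open>m i\<close> form an identity
  matrix. This is a simple form of unimodularity: the coefficients of a vector of the span are
  entries of that vector, hence integers if the vector is integral.\<close>

definition dual_system :: "nat \<Rightarrow> 'i set \<Rightarrow> ('i \<Rightarrow> nat \<Rightarrow> real) \<Rightarrow> ('i \<Rightarrow> nat) \<Rightarrow> bool" where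
  "dual_system N A r m \<longleftrightarrow> finite A \<and> (\<forall>i\<in>A. r i \<in> Zn N) \<and> (\<forall>i\<in>A. m i < N) \<and>
     (\<forall>i\<in>A. \<forall>j\<in>A. r i (m j) = of_bool (i = j))"

definition scone :: "('i \<Rightarrow> nat \<Rightarrow> real) \<Rightarrow> 'i set \<Rightarrow> (nat \<Rightarrow> real) set" where
  "scone r A = {\<Sum>i\<in>A. c i *\<^sub>R r i | c. \<forall>i\<in>A. 0 \<le> c i}"

lemma dual_system_subset: "dual_system N A r m \<Longrightarrow> B \<subseteq> A \<Longrightarrow> dual_system N B r m"
  unfolding dual_system_def using finite_subset by blast

lemma dual_system_unit: "finite A \<Longrightarrow> A \<subseteq> {..<N} \<Longrightarrow> dual_system N A unit_fun (\<lambda>i. i)"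
  unfolding dual_system_def
  by (intro conjI ballI) (auto intro: unit_fun_Zn, auto simp: unit_fun_def)

lemma dual_coord:
  assumes "dual_system N A r m" "j \<in> A"
  shows "(\<Sum>i\<in>A. c i *\<^sub>R r i) (m j) = c j"
proof -
  have "(\<Sum>i\<in>A. c i *\<^sub>R r i) (m j) = (\<Sum>i\<in>A. if i = j then c i else 0)"
    unfolding sum_fun_apply
    by (rule sum.cong) (use assms in \<open>auto simp: dual_system_def\<close>)
  then show ?thesis using assms by (simp add: dual_system_def)
qed

lemma dual_coord_subset:
  assumes "dual_system N A r m" "j \<in> A" "B \<subseteq> A"
  shows "(\<Sum>i\<in>B. c i *\<^sub>R r i) (m j) = (if j \<in> B then c j else 0)"
proof -
  have "(\<Sum>i\<in>B. c i *\<^sub>R r i) = (\<Sum>i\<in>A. (if i \<in> B then c i else 0) *\<^sub>R r i)"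
    by (rule sum.mono_neutral_cong_left) (use assms in \<open>auto simp: dual_system_def\<close>)
  then show ?thesis using dual_coord[OF assms(1,2)] by simp
qed

lemma linear_coord: "linear (\<lambda>x::nat \<Rightarrow> real. x i)"
  by (rule linearI) auto

context
  fixes N A r m assumes d: "dual_system N A r m"
begin

lemma dual_finite: "finite A"
  using d by (simp add: dual_system_def)

lemma dual_span_iff: "x \<in> span (r ` A) \<longleftrightarrow> x = (\<Sum>i\<in>A. x (m i) *\<^sub>R r i)"
proof
  assume "x \<in> span (r ` A)"
  then show "x = (\<Sum>i\<in>A. x (m i) *\<^sub>R r i)"
  proof (induction rule: span_induct)
    case base
    have "c *\<^sub>R x = (\<Sum>i\<in>A. (c *\<^sub>R x) (m i) *\<^sub>R r i)" if "x = (\<Sum>i\<in>A. x (m i) *\<^sub>R r i)" for c x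
      by (subst that) (simp add: scaleR_sum_right)
    moreover have "x + y = (\<Sum>i\<in>A. (x + y) (m i) *\<^sub>R r i)"
      if "x = (\<Sum>i\<in>A. x (m i) *\<^sub>R r i)" "y = (\<Sum>i\<in>A. y (m i) *\<^sub>R r i)" for x y
      by (subst that(1), subst that(2)) (simp add: scaleR_add_left sum.distrib)
    ultimately show ?case
      by (intro subspaceI; unfold mem_Collect_eq) (simp, blast, blast)
  next
    case (step x)
    then obtain j where j: "j \<in> A" "x = r j" by blast
    have "(\<Sum>i\<in>A. r j (m i) *\<^sub>R r i) = (\<Sum>i\<in>A. if i = j then r j else 0)"
      by (rule sum.cong) (use d j in \<open>auto simp: dual_system_def\<close>)
    also have "\<dots> = r j" using j(1) dual_finite by simp
    finally show ?case unfolding j(2) by (rule sym)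
  qed
next
  assume "x = (\<Sum>i\<in>A. x (m i) *\<^sub>R r i)"
  moreover have "(\<Sum>i\<in>A. x (m i) *\<^sub>R r i) \<in> span (r ` A)"
    by (intro span_sum span_scale span_base) auto
  ultimately show "x \<in> span (r ` A)" by simp
qed

lemma sum_in_span: "(\<Sum>i\<in>A. c i *\<^sub>R r i) \<in> span (r ` A)"
  by (intro span_sum span_scale span_base) auto

lemma dual_inj: "inj_on r A"
proof (rule inj_onI)
  fix i j assume ij: "i \<in> A" "j \<in> A" "r i = r j"
  have "of_bool (i = i) = r i (m i)" using d ij(1) unfolding dual_system_def by fastforce
  also have "\<dots> = r j (m i)" using ij(3) by (rule fun_cong)
  also have "\<dots> = of_bool (j = i)" using d ij(1,2) unfolding dual_system_def by blast
  finally show "i = j" by (cases "j = i") simp_all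
qed

lemma dual_independent: "independent (r ` A)"
proof -
  have fin: "finite (r ` A)" using dual_finite by simp
  have "u v = 0" if s: "(\<Sum>v\<in>r ` A. u v *\<^sub>R v) = 0" and v: "v \<in> r ` A" for u v
  proof -
    obtain j where j: "j \<in> A" "v = r j" using v by blast
    have "(\<Sum>i\<in>A. u (r i) *\<^sub>R r i) = 0" using s by (simp add: sum.reindex[OF dual_inj])
    then have "(\<Sum>i\<in>A. u (r i) *\<^sub>R r i) (m j) = 0" by simp
    then show ?thesis using dual_coord[OF d j(1), of "\<lambda>i. u (r i)"] j by simp
  qed
  then show ?thesis unfolding dependent_finite[OF fin] by blast
qed

lemma dual_dim: "dim (span (r ` A)) = card A"
  using dim_span_eq_card_independent[OF dual_independent] card_image[OF dual_inj] by simp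

lemma scone_iff: "x \<in> scone r A \<longleftrightarrow> x = (\<Sum>i\<in>A. x (m i) *\<^sub>R r i) \<and> (\<forall>i\<in>A. 0 \<le> x (m i))"
proof
  assume "x \<in> scone r A"
  then obtain c where c: "x = (\<Sum>i\<in>A. c i *\<^sub>R r i)" "\<forall>i\<in>A. 0 \<le> c i" unfolding scone_def by blast
  have "x (m i) = c i" if "i \<in> A" for i unfolding c(1) by (rule dual_coord[OF d that])
  then show "x = (\<Sum>i\<in>A. x (m i) *\<^sub>R r i) \<and> (\<forall>i\<in>A. 0 \<le> x (m i))"
    using c by (auto intro!: sum.cong)
next
  assume "x = (\<Sum>i\<in>A. x (m i) *\<^sub>R r i) \<and> (\<forall>i\<in>A. 0 \<le> x (m i))"
  then show "x \<in> scone r A" unfolding scone_def by (intro CollectI exI[of _ "\<lambda>i. x (m i)"])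
qed

lemma scone_span: "x \<in> scone r A \<Longrightarrow> x \<in> span (r ` A)"
  unfolding scone_iff dual_span_iff by blast

lemma scone_iff_span: "x \<in> scone r A \<longleftrightarrow> x \<in> span (r ` A) \<and> (\<forall>i\<in>A. 0 \<le> x (m i))"
  unfolding scone_iff dual_span_iff by blast

lemma span_Rn: "span (r ` A) \<subseteq> Rn N"
  by (rule span_minimal) (use d subspace_Rn in \<open>auto simp: dual_system_def Zn_iff\<close>)

lemma ray_scone: "i \<in> A \<Longrightarrow> r i \<in> scone r A"
  unfolding scone_iff_span using d by (auto simp: dual_system_def intro: span_base)

lemma zero_scone: "0 \<in> scone r A"
  unfolding scone_iff_span by (simp add: span_zero)

lemma direction_scone: "direction (scone r A) = span (r ` A)"
proof
  show "direction (scone r A) \<subseteq> span (r ` A)"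
    unfolding direction_def
    by (rule span_minimal) (auto intro: span_diff scone_span subspace_span)
  show "span (r ` A) \<subseteq> direction (scone r A)"
    unfolding direction_def
  proof (rule span_mono, rule image_subsetI)
    fix i assume "i \<in> A"
    then show "r i \<in> {x - y |x y. x \<in> scone r A \<and> y \<in> scone r A}"
      using ray_scone zero_scone by (intro CollectI exI[of _ "r i"] exI[of _ 0]) simp
  qed
qed

lemma pdim_scone: "pdim (scone r A) = card A"
  by (simp add: pdim_def direction_scone dual_dim del: dim_span)

lemma rational_scone: "rational_polyhedron N (scone r A)"
proof -
  \<comment> \<open>The functional \<open>?e j\<close> measures how far entry \<open>j\<close> of
    \<open>x\<close> is from the entry predicted by the coefficients \<open>x (m i)\<close>. It is
    integral, and within \<open>Rn N\<close> all of them vanish exactly on the span.\<close>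
  let ?e = "\<lambda>j. unit_fun j - (\<Sum>i\<in>A. r i j *\<^sub>R unit_fun (m i))"
  let ?A = "(\<lambda>j. (?e j, 0)) ` {..<N} \<union> (\<lambda>j. (- ?e j, 0::real)) ` {..<N} \<union> (\<lambda>i. (- unit_fun (m i), 0)) ` A"
  have mi: "m i < N" if "i \<in> A" for i using d that by (simp add: dual_system_def)
  have e: "?e j \<in> Zn N" if "j < N" for j
    by (intro Zn_diff unit_fun_Zn that Zn_sum Zn_scale mi) (use d in \<open>auto simp: dual_system_def Zn_iff\<close>)
  have neg: "- z \<in> Zn N" if "z \<in> Zn N" for z using Zn_scale[OF that, of "-1"] by simp
  have du: "dot N (unit_fun j) x = x j" if "j < N" for j x
    unfolding dot_def unit_fun_def using that by (simp add: if_distrib if_distribR cong: if_cong)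
  have dneg: "dot N (- z) x = - dot N z x" for z x by (simp add: dot_def sum_negf)
  have de: "dot N (?e j) x = x j - (\<Sum>i\<in>A. x (m i) *\<^sub>R r i) j" if "j < N" for j x
  proof -
    have "dot N (?e j) x = dot N (unit_fun j) x - dot N (\<Sum>i\<in>A. r i j *\<^sub>R unit_fun (m i)) x"
      by (simp add: dot_def left_diff_distrib sum_subtractf)
    also have "dot N (\<Sum>i\<in>A. r i j *\<^sub>R unit_fun (m i)) x = (\<Sum>i\<in>A. r i j * dot N (unit_fun (m i)) x)"
      unfolding dot_def sum_fun_apply scaleR_fun_apply sum_distrib_right sum_distrib_left
      by (subst sum.swap) (simp add: mult.assoc)
    also have "\<dots> = (\<Sum>i\<in>A. x (m i) *\<^sub>R r i) j"
      unfolding sum_fun_apply by (rule sum.cong) (simp_all add: du mi)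
    finally show ?thesis unfolding du[OF that] .
  qed
  have r0: "(\<Sum>i\<in>A. x (m i) *\<^sub>R r i) j = 0" if "j \<ge> N" for j x
    unfolding sum_fun_apply using d that by (auto intro!: sum.neutral simp: dual_system_def Zn_iff Rn_iff)
  have "finite ?A" using dual_finite by simp
  moreover have "?A \<subseteq> Zn N \<times> UNIV"
    using e neg[OF e] neg[OF unit_fun_Zn[OF mi]] by (auto simp del: minus_diff_eq)
  moreover have "scone r A = {x \<in> Rn N. \<forall>(a, b)\<in>?A. dot N a x \<le> b}"
  proof (intro equalityI subsetI)
    fix x assume x: "x \<in> scone r A"
    then have xe: "x j = (\<Sum>i\<in>A. x (m i) *\<^sub>R r i) j" for j using scone_iff by metis
    have "x \<in> Rn N" using x scone_span span_Rn by blast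
    moreover have "dot N (unit_fun (m i)) x \<ge> 0" if "i \<in> A" for i
      using x that unfolding scone_iff by (simp add: du mi)
    moreover have "dot N (?e j) x = 0" if "j < N" for j
      unfolding de[OF that] using xe[of j] by linarith
    ultimately show "x \<in> {x \<in> Rn N. \<forall>(a, b)\<in>?A. dot N a x \<le> b}"
      by (auto simp: dneg simp del: minus_diff_eq)
  next
    fix x assume x: "x \<in> {x \<in> Rn N. \<forall>(a, b)\<in>?A. dot N a x \<le> b}"
    then have c: "\<And>j. j < N \<Longrightarrow> dot N (?e j) x \<le> 0" "\<And>j. j < N \<Longrightarrow> dot N (- ?e j) x \<le> 0"
        "\<And>i. i \<in> A \<Longrightarrow> dot N (- unit_fun (m i)) x \<le> 0" and xR: "x \<in> Rn N"
      by auto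
    have "x j = (\<Sum>i\<in>A. x (m i) *\<^sub>R r i) j" for j
    proof (cases "j < N")
      case True
      then show ?thesis using c(1)[OF True] c(2)[OF True] unfolding dneg de[OF True] by linarith
    next
      case False
      then show ?thesis using r0[of j x] xR by (simp add: Rn_iff)
    qed
    moreover have "0 \<le> x (m i)" if "i \<in> A" for i
      using c(3)[OF that] unfolding dneg du[OF mi[OF that]] by simp
    ultimately show "x \<in> scone r A" unfolding scone_iff by blast
  qed
  ultimately show ?thesis
    unfolding rational_polyhedron_def by (intro exI[of _ ?A] conjI)
qed

lemma convex_scone: "convex (scone r A)"
proof (rule convexI)
  fix x y :: "nat \<Rightarrow> real" and u v :: real
  assume "x \<in> scone r A" "y \<in> scone r A" "0 \<le> u" "0 \<le> v" "u + v = 1"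
  then show "u *\<^sub>R x + v *\<^sub>R y \<in> scone r A"
    unfolding scone_iff_span by (auto intro: span_add span_scale)
qed

lemma scone_subset_iff:
  assumes "B \<subseteq> A"
  shows "x \<in> scone r B \<longleftrightarrow> x \<in> scone r A \<and> (\<forall>i\<in>A - B. x (m i) = 0)"
proof -
  note dB = dual_system_subset[OF d assms]
  show ?thesis
  proof
    assume x: "x \<in> scone r B"
    then obtain c where c: "x = (\<Sum>i\<in>B. c i *\<^sub>R r i)" "\<forall>i\<in>B. 0 \<le> c i" unfolding scone_def by blast
    have xm: "x (m i) = (if i \<in> B then c i else 0)" if "i \<in> A" for i
      unfolding c(1) by (rule dual_coord_subset[OF d that assms])
    have "x \<in> span (r ` A)"
      unfolding c(1) by (intro span_sum span_scale span_base) (use assms in auto)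
    then show "x \<in> scone r A \<and> (\<forall>i\<in>A - B. x (m i) = 0)"
      unfolding scone_iff_span using xm c(2) by auto
  next
    assume x: "x \<in> scone r A \<and> (\<forall>i\<in>A - B. x (m i) = 0)"
    have "x = (\<Sum>i\<in>A. x (m i) *\<^sub>R r i)" using x unfolding scone_iff by blast
    also have "\<dots> = (\<Sum>i\<in>B. x (m i) *\<^sub>R r i)"
      by (rule sum.mono_neutral_right) (use x assms dual_finite in auto)
    finally show "x \<in> scone r B"
      unfolding scone_def using x assms unfolding scone_iff
      by (intro CollectI exI[of _ "\<lambda>i. x (m i)"]) blast
  qed
qed

end

text \<open>The coefficients outside \<open>B\<close> are nonnegative on the cone and vanish at
  \<open>x\<close>, so they vanish at both ends of any segment with \<open>x\<close> in its
  interior.\<close>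

lemma face_scone:
  assumes d: "dual_system N A r m" and B: "B \<subseteq> A"
  shows "scone r B face_of scone r A"
  unfolding face_of_def
proof (intro conjI ballI impI)
  note iff = scone_subset_iff[OF d B]
  show "scone r B \<subseteq> scone r A" using iff by blast
  show "convex (scone r B)" by (rule convex_scone[OF dual_system_subset[OF d B]])
  fix a b x assume a: "a \<in> scone r A" and b: "b \<in> scone r A" and x: "x \<in> scone r B"
    and "x \<in> open_segment a b"
  then obtain u where u: "0 < u" "u < 1" "x = (1 - u) *\<^sub>R a + u *\<^sub>R b" unfolding in_segment by blast
  have "a (m i) = 0 \<and> b (m i) = 0" if i: "i \<in> A - B" for i
  proof -
    have "0 \<le> a (m i)" "0 \<le> b (m i)" using a b i unfolding scone_iff_span[OF d] by auto
    moreover have "(1 - u) * a (m i) + u * b (m i) = 0" using x i u(3) unfolding iff by auto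
    moreover have "0 \<le> (1 - u) * a (m i)" "0 \<le> u * b (m i)" using u calculation by simp_all
    ultimately have "(1 - u) * a (m i) = 0" "u * b (m i) = 0" by linarith+
    then show ?thesis using u by simp
  qed
  then show "a \<in> scone r B" "b \<in> scone r B" unfolding iff using a b by auto
qed

lemma scone_perturb:
  assumes d: "dual_system N A r m" and x: "x \<in> span (r ` A)" and pos: "\<And>i. i \<in> A \<Longrightarrow> 0 < x (m i)"
    and y: "y \<in> span (r ` A)"
  shows "\<exists>e>0. x + e *\<^sub>R y \<in> scone r A"
proof -
  \<comment> \<open>The denominator \<open>1 + |y (m i)|\<close> is never 0, and the inserted 1
    covers an empty \<open>A\<close>.\<close>
  define e where "e = Min (insert 1 ((\<lambda>i. x (m i) / (1 + \<bar>y (m i)\<bar>)) ` A))"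
  have fin: "finite (insert 1 ((\<lambda>i. x (m i) / (1 + \<bar>y (m i)\<bar>)) ` A))"
    using dual_finite[OF d] by simp
  have e0: "0 < e" unfolding e_def using fin pos by (subst Min_gr_iff) (auto intro!: divide_pos_pos)
  have "0 \<le> x (m i) + e * y (m i)" if i: "i \<in> A" for i
  proof -
    have "e \<le> x (m i) / (1 + \<bar>y (m i)\<bar>)" unfolding e_def by (rule Min_le[OF fin]) (use i in blast)
    then have "e * (1 + \<bar>y (m i)\<bar>) \<le> x (m i)" by (simp add: pos_le_divide_eq)
    moreover have "e * \<bar>y (m i)\<bar> \<le> e * (1 + \<bar>y (m i)\<bar>)" using e0 by simp
    moreover have "- (e * \<bar>y (m i)\<bar>) \<le> e * y (m i)"
      using e0 abs_ge_minus_self[of "e * y (m i)"] by (simp add: abs_mult)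
    ultimately show ?thesis by linarith
  qed
  then show ?thesis
    using e0 x y unfolding scone_iff_span[OF d] by (intro exI[of _ e]) (auto intro: span_add span_scale)
qed

text \<open>\<open>B\<close> collects the coefficients that are positive somewhere on the face.
  Averaging yields a point \<open>x\<close> of the face at which all of them are positive. The
  segment from any \<open>y\<close> in \<open>scone r B\<close> to \<open>x\<close> can be prolonged
  beyond \<open>x\<close> inside the cone, so \<open>y\<close> belongs to the face.\<close>

lemma face_scone_eq:
  assumes d: "dual_system N A r m" and E: "E face_of scone r A" "E \<noteq> {}"
  shows "\<exists>B\<subseteq>A. E = scone r B"
proof -
  define B where "B = {i \<in> A. \<exists>x\<in>E. 0 < x (m i)}"
  have BA: "B \<subseteq> A" unfolding B_def by blast
  have EA: "E \<subseteq> scone r A" and cE: "convex E" using E unfolding face_of_def by auto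
  have nonneg: "0 \<le> x (m i)" if "x \<in> E" "i \<in> A" for x i
  proof -
    have "x \<in> scone r A" using EA that(1) by blast
    then show ?thesis using that(2) scone_iff_span[OF d, of x] by blast
  qed
  note iff = scone_subset_iff[OF d BA]
  have EB: "E \<subseteq> scone r B"
  proof
    fix x assume x: "x \<in> E"
    have "x (m i) = 0" if "i \<in> A - B" for i
    proof -
      have "0 \<le> x (m i)" using nonneg[OF x] that by blast
      moreover have "\<not> 0 < x (m i)" using that x unfolding B_def by blast
      ultimately show ?thesis by linarith
    qed
    then show "x \<in> scone r B" unfolding iff using x EA by blast
  qed
  have "\<exists>x\<in>E. \<forall>i\<in>C. 0 < x (m i)" if "finite C" "C \<subseteq> B" for C
    using that
  proof (induction C rule: finite_induct)
    case empty
    then show ?case using E(2) by blast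
  next
    case (insert j C)
    then obtain x where x: "x \<in> E" "\<forall>i\<in>C. 0 < x (m i)" by blast
    obtain y where y: "y \<in> E" "0 < y (m j)" using insert(4) unfolding B_def by blast
    have "(1/2) *\<^sub>R x + (1/2) *\<^sub>R y \<in> E" by (rule convexD[OF cE x(1) y(1)]) auto
    moreover have "0 < ((1/2) *\<^sub>R x + (1/2) *\<^sub>R y) (m i)" if "i \<in> insert j C" for i
    proof -
      have "i \<in> A" using that insert(4) BA by blast
      then have "0 \<le> x (m i)" "0 \<le> y (m i)" using nonneg x y by auto
      moreover have "0 < x (m i) \<or> 0 < y (m i)" using that x y by auto
      ultimately show ?thesis by auto
    qed
    ultimately show ?case by blast
  qed
  from this[of B] obtain x where x: "x \<in> E" "\<forall>i\<in>B. 0 < x (m i)"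
    using dual_finite[OF d] BA finite_subset by blast
  note dB = dual_system_subset[OF d BA]
  have "scone r B \<subseteq> E"
  proof
    fix y assume y: "y \<in> scone r B"
    have xs: "x \<in> span (r ` B)" and ys: "y \<in> span (r ` B)"
      using scone_span[OF dB] EB x y by auto
    obtain e where e: "0 < e" "x + e *\<^sub>R (x - y) \<in> scone r B"
      using scone_perturb[OF dB xs _ span_diff[OF xs ys]] x by blast
    let ?z = "x + e *\<^sub>R (x - y)"
    show "y \<in> E"
    proof (cases "x = y")
      case False
      \<comment> \<open>The point \<open>x\<close> divides the segment from \<open>?z\<close> to
        \<open>y\<close> in the ratio \<open>e\<close> to 1.\<close>
      have eq: "(1 - e / (1 + e)) *\<^sub>R ?z + (e / (1 + e)) *\<^sub>R y = x"
      proof -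
        have "1 - e / (1 + e) = 1 / (1 + e)" using e by (simp add: field_simps)
        then have "(1 - e / (1 + e)) *\<^sub>R ?z + (e / (1 + e)) *\<^sub>R y = (1 / (1 + e)) *\<^sub>R (?z + e *\<^sub>R y)"
          by (simp add: scaleR_add_right)
        also have "?z + e *\<^sub>R y = (1 + e) *\<^sub>R x" by (simp add: algebra_simps)
        also have "(1 / (1 + e)) *\<^sub>R (1 + e) *\<^sub>R x = x" using e(1) by simp
        finally show ?thesis .
      qed
      have zy: "?z \<noteq> y"
      proof
        assume "?z = y"
        then have "(1 + e) *\<^sub>R (x - y) = 0" by (simp add: algebra_simps)
        then show False using False e by simp
      qed
      then have "x \<in> open_segment ?z y"
        unfolding in_segment
      proof (intro conjI exI)
        show "?z \<noteq> y" by (rule zy)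
        show "x = (1 - e / (1 + e)) *\<^sub>R ?z + (e / (1 + e)) *\<^sub>R y" by (rule eq[symmetric])
        show "0 < e / (1 + e)" "e / (1 + e) < 1" using e(1) by simp_all
      qed
      moreover have "?z \<in> scone r A" "y \<in> scone r A" using e y iff by auto
      ultimately show ?thesis using face_ofD[OF E(1)] x(1) by blast
    qed (use x in simp)
  qed
  then show ?thesis using EB BA by blast
qed

lemma affine_hull_scone:
  assumes "dual_system N A r m"
  shows "affine hull scone r A = span (r ` A)"
proof -
  have "0 \<in> affine hull scone r A" by (rule hull_inc[OF zero_scone[OF assms]])
  then have "affine hull scone r A = span (scone r A)" by (rule affine_hull_span_0)
  also have "\<dots> = span (r ` A)"
  proof
    show "span (scone r A) \<subseteq> span (r ` A)"
      by (rule span_minimal) (use scone_span[OF assms] subspace_span in auto)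
    show "span (r ` A) \<subseteq> span (scone r A)"
      by (rule span_mono) (use ray_scone[OF assms] in auto)
  qed
  finally show ?thesis .
qed

lemma relint_scone:
  assumes d: "dual_system N A r m"
  shows "x \<in> relint N (scone r A) \<longleftrightarrow> x \<in> span (r ` A) \<and> (\<forall>i\<in>A. 0 < x (m i))"
proof -
  let ?W = "span (r ` A)"
  have eq: "subtopology (Euclidean_space N) ?W = top_of_set ?W"
    unfolding Euclidean_space_eq subtopology_subtopology using span_Rn[OF d] by (simp add: Int_absorb1)
  have rel: "relint N (scone r A) = top_of_set ?W interior_of scone r A"
    unfolding relint_def affine_hull_scone[OF d] eq ..
  have ci: "continuous_on UNIV (\<lambda>y::nat \<Rightarrow> real. y (m i))" for i
    by (rule continuous_on_product_coordinates)
  show ?thesis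
  proof
    assume "x \<in> relint N (scone r A)"
    then obtain T where T: "openin (top_of_set ?W) T" "x \<in> T" "T \<subseteq> scone r A"
      unfolding rel interior_of_def by blast
    then obtain V where V: "open V" "T = ?W \<inter> V" by (auto simp: openin_open)
    have xW: "x \<in> ?W" using T V by blast
    have "0 < x (m i)" if i: "i \<in> A" for i
    proof (rule ccontr)
      \<comment> \<open>A step back along \<open>r i\<close> makes this coefficient negative and
        leaves the cone, although a relatively open set around \<open>x\<close> stays
        inside.\<close>
      assume "\<not> 0 < x (m i)"
      have "continuous_on UNIV (\<lambda>t::real. x - t *\<^sub>R r i)"
        by (rule continuous_on_coordinatewise_then_product) (auto intro!: continuous_intros)
      then have "open ((\<lambda>t::real. x - t *\<^sub>R r i) -` V)" using V(1) by (rule open_vimage[rotated])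
      moreover have "0 \<in> (\<lambda>t::real. x - t *\<^sub>R r i) -` V" using T V by simp
      ultimately obtain e where e: "0 < e" "ball 0 e \<subseteq> (\<lambda>t::real. x - t *\<^sub>R r i) -` V"
        unfolding open_contains_ball by blast
      have "e / 2 \<in> ball 0 e" using e(1) by (simp add: dist_norm)
      then have "x - (e/2) *\<^sub>R r i \<in> V" using e(2) by blast
      moreover have "x - (e/2) *\<^sub>R r i \<in> ?W"
        using xW i by (intro span_diff span_scale) (auto intro: span_base)
      ultimately have "x - (e/2) *\<^sub>R r i \<in> scone r A" using T V by blast
      then have "0 \<le> (x - (e/2) *\<^sub>R r i) (m i)" using i unfolding scone_iff_span[OF d] by blast
      moreover have "r i (m i) = 1" using d i by (simp add: dual_system_def)
      ultimately show False using \<open>\<not> 0 < x (m i)\<close> e(1) by simp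
    qed
    then show "x \<in> ?W \<and> (\<forall>i\<in>A. 0 < x (m i))" using xW by blast
  next
    assume x: "x \<in> ?W \<and> (\<forall>i\<in>A. 0 < x (m i))"
    let ?V = "\<Inter>i\<in>A. (\<lambda>y::nat \<Rightarrow> real. y (m i)) -` {0<..}"
    have "open ?V"
      by (intro open_INT dual_finite[OF d] ballI open_vimage ci open_greaterThan)
    then have "openin (top_of_set ?W) (?W \<inter> ?V)" by (rule openin_open_Int)
    moreover have "?W \<inter> ?V \<subseteq> scone r A"
      unfolding scone_iff_span[OF d] subset_iff by auto
    moreover have "x \<in> ?W \<inter> ?V" using x by simp
    ultimately show "x \<in> relint N (scone r A)" unfolding rel interior_of_def by blast
  qed
qed

text \<open>Unimodularity: the coefficients of an integral vector of the span are entries of that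
  vector.\<close>

lemma parallel_lattice_scone:
  assumes d: "dual_system N A r m"
  shows "z \<in> parallel_lattice N (scone r A) \<longleftrightarrow> (\<exists>c. (\<forall>i\<in>A. c i \<in> \<int>) \<and> z = (\<Sum>i\<in>A. c i *\<^sub>R r i))"
proof
  assume "z \<in> parallel_lattice N (scone r A)"
  then have "z \<in> Zn N" "z \<in> span (r ` A)"
    unfolding parallel_lattice_def direction_scone[OF d] by auto
  then have "z \<in> Zn N" "z = (\<Sum>i\<in>A. z (m i) *\<^sub>R r i)"
    using dual_span_iff[OF d, of z] by blast+
  then show "\<exists>c. (\<forall>i\<in>A. c i \<in> \<int>) \<and> z = (\<Sum>i\<in>A. c i *\<^sub>R r i)"
    by (intro exI[of _ "\<lambda>i. z (m i)"]) (auto simp: Zn_iff)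
next
  assume "\<exists>c. (\<forall>i\<in>A. c i \<in> \<int>) \<and> z = (\<Sum>i\<in>A. c i *\<^sub>R r i)"
  then obtain c where c: "\<forall>i\<in>A. c i \<in> \<int>" "z = (\<Sum>i\<in>A. c i *\<^sub>R r i)" by blast
  have "z \<in> Zn N" unfolding c(2) by (intro Zn_sum Zn_scale) (use c d in \<open>auto simp: dual_system_def\<close>)
  then show "z \<in> parallel_lattice N (scone r A)"
    unfolding parallel_lattice_def direction_scone[OF d] using sum_in_span[OF d] c by auto
qed

section \<open>The fan of laminar families\<close>

text \<open>All ordered pairs of pairs, the diagonal included. A diagonal coordinate is 0 on the
  whole fan; it later serves as a direction in which a linear functional is certainly not
  constant.\<close>

definition coords :: "nat \<Rightarrow> (nat set \<times> nat set) set" where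
  "coords n = pairs n \<times> pairs n"

definition amb :: "nat \<Rightarrow> nat" where
  "amb n = card (coords n)"

definition quad :: "nat \<Rightarrow> nat \<Rightarrow> nat set \<times> nat set" where
  "quad n m = from_nat_into (coords n) m"

definition qidx :: "nat \<Rightarrow> nat set \<times> nat set \<Rightarrow> nat" where
  "qidx n q = to_nat_on (coords n) q"

lemma finite_coords: "finite (coords n)"
  unfolding coords_def using finite_pairs by simp

lemma quad_qidx: "q \<in> coords n \<Longrightarrow> quad n (qidx n q) = q"
  unfolding quad_def qidx_def by (simp add: countable_finite finite_coords)

lemma qidx_less: "q \<in> coords n \<Longrightarrow> qidx n q < amb n"
  unfolding amb_def qidx_def using to_nat_on_finite[OF finite_coords, of n] by (auto dest: bij_betwE)

lemma quad_mem: "m < amb n \<Longrightarrow> quad n m \<in> coords n"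
  unfolding quad_def amb_def by (rule from_nat_into) auto

definition ray :: "nat \<Rightarrow> nat set \<Rightarrow> nat \<Rightarrow> real" where
  "ray n S = (\<lambda>m. if m < amb n then of_bool (fst (quad n m) \<subseteq> S) - of_bool (snd (quad n m) \<subseteq> S) else 0)"

definition pt :: "nat \<Rightarrow> (nat set \<Rightarrow> real) \<Rightarrow> nat \<Rightarrow> real" where
  "pt n l = (\<lambda>m. if m < amb n then val n l (fst (quad n m)) - val n l (snd (quad n m)) else 0)"

lemma pt_qidx: "P \<in> pairs n \<Longrightarrow> Q \<in> pairs n \<Longrightarrow> pt n l (qidx n (P, Q)) = val n l P - val n l Q"
  unfolding pt_def using qidx_less[of "(P, Q)" n] quad_qidx[of "(P, Q)" n] by (simp add: coords_def)

lemma ray_qidx: "P \<in> pairs n \<Longrightarrow> Q \<in> pairs n \<Longrightarrow> ray n S (qidx n (P, Q)) = of_bool (P \<subseteq> S) - of_bool (Q \<subseteq> S)"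
  unfolding ray_def using qidx_less[of "(P, Q)" n] quad_qidx[of "(P, Q)" n] by (simp add: coords_def)

lemma ray_Zn: "ray n S \<in> Zn (amb n)"
  unfolding Zn_iff Rn_iff ray_def by auto

lemma pt_sum:
  assumes "hier n \<N>" "{S. l S \<noteq> 0} \<subseteq> \<N>"
  shows "pt n l = (\<Sum>S\<in>\<N>. l S *\<^sub>R ray n S)"
proof (rule ext)
  fix m
  have v: "val n l P = (\<Sum>S\<in>\<N>. l S * of_bool (P \<subseteq> S))" for P
    unfolding val_support[OF assms]
    by (rule sum.mono_neutral_cong_left) (use hier_finite[OF assms(1)] in auto)
  show "pt n l m = (\<Sum>S\<in>\<N>. l S *\<^sub>R ray n S) m"
    unfolding sum_fun_apply pt_def ray_def v
    by (simp add: sum_subtractf[symmetric] right_diff_distrib)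
qed

text \<open>The position that compares the representative of \<open>S\<close> with that of its
  cover; by \<open>val_cover\<close> the entry there is the weight of \<open>S\<close>.\<close>

definition dcoord :: "nat \<Rightarrow> nat set set \<Rightarrow> (nat set \<Rightarrow> nat set) \<Rightarrow> nat set \<Rightarrow> nat" where
  "dcoord n \<N> p S = qidx n (p S, p (cover (ext n \<N>) S))"

text \<open>At the position for \<open>S\<close>, the ray of \<open>R\<close> has as entry the
  indicator of \<open>S \<subseteq> R\<close> minus the indicator of \<open>S \<subset> R\<close>,
  because a member strictly above \<open>S\<close> contains the cover of \<open>S\<close>. The
  difference is 1 for \<open>R = S\<close> and 0 otherwise.\<close>

lemma dual_rays:
  assumes h: "hier n \<N>" and n: "3 \<le> n" and p: "separator n \<N> p"
  shows "dual_system (amb n) \<N> (ray n) (dcoord n \<N> p)"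
  unfolding dual_system_def
proof (intro conjI ballI)
  fix S assume S: "S \<in> \<N>"
  note c = cover_mem[OF h n S]
  have P: "p S \<in> pairs n" "p (cover (ext n \<N>) S) \<in> pairs n"
    using separator_pairs[OF p] S c(1) by auto
  show "dcoord n \<N> p S < amb n"
    unfolding dcoord_def by (rule qidx_less) (use P in \<open>simp add: coords_def\<close>)
  fix R assume R: "R \<in> \<N>"
  have 1: "p S \<subseteq> R \<longleftrightarrow> S \<subseteq> R" using separator_sub[OF p] S R by blast
  have 2: "p (cover (ext n \<N>) S) \<subseteq> R \<longleftrightarrow> S \<subset> R"
    using separator_sub[OF p c(1), of R] R c(2) c(3)[of R] by blast
  show "ray n R (dcoord n \<N> p S) = of_bool (R = S)"
    unfolding dcoord_def ray_qidx[OF P] 1 2 by auto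
qed (use hier_finite[OF h] ray_Zn in auto)

lemma scone_pt:
  assumes h: "hier n \<N>"
  shows "x \<in> scone (ray n) \<N> \<longleftrightarrow> (\<exists>l\<in>weights n. {S. l S \<noteq> 0} \<subseteq> \<N> \<and> x = pt n l)"
proof
  assume "x \<in> scone (ray n) \<N>"
  then obtain c where c: "x = (\<Sum>S\<in>\<N>. c S *\<^sub>R ray n S)" "\<forall>S\<in>\<N>. 0 \<le> c S"
    unfolding scone_def by blast
  let ?l = "\<lambda>S. if S \<in> \<N> then c S else 0"
  have s: "{S. ?l S \<noteq> 0} \<subseteq> \<N>" by auto
  have "?l \<in> weights n" using c(2) hier_subset[OF h s] unfolding weights_def by auto
  moreover have "x = pt n ?l" unfolding pt_sum[OF h s] c(1) by (rule sum.cong) auto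
  ultimately show "\<exists>l\<in>weights n. {S. l S \<noteq> 0} \<subseteq> \<N> \<and> x = pt n l"
    using s by (intro bexI[of _ ?l] conjI)
next
  assume "\<exists>l\<in>weights n. {S. l S \<noteq> 0} \<subseteq> \<N> \<and> x = pt n l"
  then obtain l where l: "l \<in> weights n" "{S. l S \<noteq> 0} \<subseteq> \<N>" "x = pt n l" by blast
  have "\<forall>S\<in>\<N>. 0 \<le> l S" using l(1) unfolding weights_def by blast
  then show "x \<in> scone (ray n) \<N>"
    unfolding scone_def l(3) pt_sum[OF h l(2)] by (intro CollectI exI[of _ l]) simp
qed

lemma weight_from_pt:
  assumes "3 \<le> n" "l \<in> weights n" "S \<in> clusters n"
  shows "l S = max 0 (Min ((\<lambda>q. pt n l (qidx n q)) ` ({P \<in> pairs n. P \<subseteq> S} \<times> crossing n S)))"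
proof -
  have "(\<lambda>(P, Q). val n l P - val n l Q) ` ({P \<in> pairs n. P \<subseteq> S} \<times> crossing n S)
      = (\<lambda>q. pt n l (qidx n q)) ` ({P \<in> pairs n. P \<subseteq> S} \<times> crossing n S)"
    by (rule image_cong) (auto simp: pt_qidx crossing_def)
  then show ?thesis using weight_eq_Min[OF assms] by simp
qed

lemma pt_inj:
  assumes "3 \<le> n" "l \<in> weights n" "l' \<in> weights n" "pt n l = pt n l'"
  shows "l = l'"
proof
  fix S
  show "l S = l' S"
  proof (cases "S \<in> clusters n")
    case True
    show ?thesis
      unfolding weight_from_pt[OF assms(1,2) True] weight_from_pt[OF assms(1,3) True] assms(4) ..
  next
    case False
    then have "l S = 0" "l' S = 0" using assms(2,3) unfolding weights_def hier_def by blast+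
    then show ?thesis by simp
  qed
qed

definition facets :: "nat \<Rightarrow> nat set set set" where
  "facets n = {\<N>. hier n \<N> \<and> card \<N> = n - 3}"

definition fan :: "nat \<Rightarrow> (nat \<Rightarrow> real) set set" where
  "fan n = scone (ray n) ` facets n"

lemma finite_facets: "finite (facets n)"
  by (rule finite_subset[of _ "Pow (clusters n)"]) (auto simp: facets_def hier_def finite_clusters)

lemma Union_fan:
  assumes "3 \<le> n"
  shows "\<Union>(fan n) = pt n ` weights n"
proof (intro equalityI subsetI)
  fix x assume "x \<in> \<Union>(fan n)"
  then show "x \<in> pt n ` weights n" unfolding fan_def facets_def using scone_pt by auto
next
  fix x assume "x \<in> pt n ` weights n"
  then obtain l where l: "l \<in> weights n" "x = pt n l" by blast
  then have "hier n {S. l S \<noteq> 0}" unfolding weights_def by blast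
  then obtain \<M> where "{S. l S \<noteq> 0} \<subseteq> \<M>" "hier n \<M>" "card \<M> = n - 3"
    using hier_extend assms by blast
  then show "x \<in> \<Union>(fan n)" unfolding fan_def facets_def using scone_pt l by blast
qed

lemma ray_pt: "S \<in> clusters n \<Longrightarrow> ray n S = pt n (\<lambda>R. of_bool (R = S)) \<and> (\<lambda>R. of_bool (R = S)) \<in> weights n"
proof -
  assume S: "S \<in> clusters n"
  have h: "hier n {S}" using S unfolding hier_def laminar_def by simp
  have s: "{R. of_bool (R = S) \<noteq> (0::real)} \<subseteq> {S}" by auto
  have "pt n (\<lambda>R. of_bool (R = S)) = ray n S" by (subst pt_sum[OF h s]) simp
  moreover have "(\<lambda>R. of_bool (R = S)) \<in> weights n"
    unfolding weights_def using hier_subset[OF h s] by auto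
  ultimately show ?thesis by simp
qed

lemma ray_mem_scone:
  assumes "3 \<le> n" "hier n \<M>" "S \<in> clusters n" "ray n S \<in> scone (ray n) \<M>"
  shows "S \<in> \<M>"
proof -
  obtain l where l: "l \<in> weights n" "{S. l S \<noteq> 0} \<subseteq> \<M>" "ray n S = pt n l"
    using assms(4) scone_pt[OF assms(2)] by blast
  have "l = (\<lambda>R. of_bool (R = S))"
    by (rule pt_inj[OF assms(1) l(1)]) (use ray_pt[OF assms(3)] l(3) in auto)
  then show ?thesis using l(2) by auto
qed

lemma scone_subset_iff_hier:
  assumes "3 \<le> n" "hier n \<N>" "hier n \<M>"
  shows "scone (ray n) \<N> \<subseteq> scone (ray n) \<M> \<longleftrightarrow> \<N> \<subseteq> \<M>"
proof
  assume s: "scone (ray n) \<N> \<subseteq> scone (ray n) \<M>"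
  obtain p where p: "separator n \<N> p" using separator_exists assms by blast
  show "\<N> \<subseteq> \<M>"
  proof
    fix S assume S: "S \<in> \<N>"
    then have "ray n S \<in> scone (ray n) \<M>"
      using s ray_scone[OF dual_rays[OF assms(2,1) p]] by blast
    then show "S \<in> \<M>" using ray_mem_scone[OF assms(1,3)] S assms(2) unfolding hier_def by blast
  qed
next
  assume "\<N> \<subseteq> \<M>"
  then show "scone (ray n) \<N> \<subseteq> scone (ray n) \<M>"
    using scone_pt[OF assms(2)] scone_pt[OF assms(3)] by blast
qed

lemma scone_eq_iff_hier:
  assumes "3 \<le> n" "hier n \<N>" "hier n \<M>"
  shows "scone (ray n) \<N> = scone (ray n) \<M> \<longleftrightarrow> \<N> = \<M>"
  using scone_subset_iff_hier[OF assms] scone_subset_iff_hier[OF assms(1,3,2)] by blast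

text \<open>By injectivity of \<open>pt\<close> a common point has only one weight vector, so its
  support lies in every family. This is what makes cones meet in faces.\<close>

lemma Inter_scone:
  assumes "3 \<le> n" "H \<noteq> {}" "\<And>\<N>. \<N> \<in> H \<Longrightarrow> hier n \<N>"
  shows "\<Inter>(scone (ray n) ` H) = scone (ray n) (\<Inter>H)"
proof -
  obtain \<N>0 where N0: "\<N>0 \<in> H" using assms(2) by blast
  have hI: "hier n (\<Inter>H)" by (rule hier_subset[OF assms(3)[OF N0]]) (use N0 in blast)
  show ?thesis
  proof (intro equalityI subsetI)
    fix x assume x: "x \<in> \<Inter>(scone (ray n) ` H)"
    then obtain l where l: "l \<in> weights n" "{S. l S \<noteq> 0} \<subseteq> \<N>0" "x = pt n l"
      using scone_pt[OF assms(3)[OF N0]] N0 by blast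
    have "{S. l S \<noteq> 0} \<subseteq> \<N>" if "\<N> \<in> H" for \<N>
    proof -
      have "x \<in> scone (ray n) \<N>" using x that by blast
      then obtain l' where l': "l' \<in> weights n" "{S. l' S \<noteq> 0} \<subseteq> \<N>" "x = pt n l'"
        using scone_pt[OF assms(3)[of \<N>], of x] \<open>\<N> \<in> H\<close> by blast
      have "l' = l" by (rule pt_inj[OF assms(1) l'(1) l(1)]) (use l(3) l'(3) in simp)
      then show ?thesis using l'(2) by simp
    qed
    then have "{S. l S \<noteq> 0} \<subseteq> \<Inter>H" by blast
    then show "x \<in> scone (ray n) (\<Inter>H)" using scone_pt[OF hI, of x] l by blast
  next
    fix x assume "x \<in> scone (ray n) (\<Inter>H)"
    then have "x \<in> scone (ray n) \<N>" if "\<N> \<in> H" for \<N>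
      using scone_subset_iff_hier[OF assms(1) hI assms(3)[OF that]] that by blast
    then show "x \<in> \<Inter>(scone (ray n) ` H)" by blast
  qed
qed

lemma polyhedral_complex_fan:
  assumes n: "3 \<le> n"
  shows "polyhedral_complex (amb n) (n - 3) (fan n) (\<lambda>_. 1)"
proof -
  have d: "\<exists>m. dual_system (amb n) \<N> (ray n) m" if "\<N> \<in> facets n" for \<N>
    using that dual_rays n separator_exists unfolding facets_def by blast
  have "\<Inter>\<G> face_of F" if G: "\<G> \<subseteq> fan n" "F \<in> \<G>" for \<G> F
  proof -
    obtain H where H: "H \<subseteq> facets n" "\<G> = scone (ray n) ` H"
      using G(1) unfolding fan_def by (auto simp: subset_image_iff)
    then obtain \<N> where N: "\<N> \<in> H" "F = scone (ray n) \<N>" using G(2) by blast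
    have hH: "\<And>\<M>. \<M> \<in> H \<Longrightarrow> hier n \<M>" using H(1) unfolding facets_def by blast
    have H0: "H \<noteq> {}" using N by blast
    have eq: "\<Inter>\<G> = scone (ray n) (\<Inter>H)" unfolding H(2) by (rule Inter_scone[OF n H0 hH])
    obtain m where "dual_system (amb n) \<N> (ray n) m" using d N(1) H(1) by blast
    then show ?thesis unfolding eq N(2) by (rule face_scone) (use N in blast)
  qed
  moreover have "rational_polyhedron (amb n) F \<and> F \<noteq> {} \<and> pdim F = n - 3" if "F \<in> fan n" for F
  proof -
    obtain \<N> where N: "\<N> \<in> facets n" "F = scone (ray n) \<N>"
      using \<open>F \<in> fan n\<close> unfolding fan_def by blast
    obtain m where m: "dual_system (amb n) \<N> (ray n) m" using d N(1) by blast
    show ?thesis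
      unfolding N(2) using rational_scone[OF m] zero_scone[OF m] pdim_scone[OF m] N(1)
      by (auto simp: facets_def)
  qed
  ultimately show ?thesis
    unfolding polyhedral_complex_def using finite_facets by (simp add: fan_def)
qed

lemma codim1_face_fan:
  assumes n: "3 \<le> n" and E: "codim1_face (n - 3) (fan n) E"
  obtains \<N> where "hier n \<N>" "card \<N> + 1 = n - 3" "E = scone (ray n) \<N>"
proof -
  obtain F where F: "F \<in> fan n" "E face_of F" "E \<noteq> {}" "pdim E + 1 = n - 3"
    using E unfolding codim1_face_def by blast
  obtain \<M> where M: "hier n \<M>" "F = scone (ray n) \<M>" using F(1) unfolding fan_def facets_def by blast
  obtain p where p: "separator n \<M> p" using separator_exists[OF M(1) n] by blast
  note d = dual_rays[OF M(1) n p]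
  obtain \<N> where N: "\<N> \<subseteq> \<M>" "E = scone (ray n) \<N>"
    using face_scone_eq[OF d] F M by blast
  have "card \<N> + 1 = n - 3"
    using F(4) pdim_scone[OF dual_system_subset[OF d N(1)]] N(2) by simp
  then show ?thesis using that[OF hier_subset[OF M(1) N(1)]] N(2) by blast
qed

text \<open>Inclusion of cones is inclusion of families, so a facet around the wall has exactly one
  additional cluster.\<close>

lemma adjacent_facets_fan:
  assumes n: "3 \<le> n" and h: "hier n \<N>" and c: "card \<N> + 1 = n - 3"
  shows "adjacent_facets (fan n) (scone (ray n) \<N>) =
    (\<lambda>S. scone (ray n) (insert S \<N>)) ` {S. S \<notin> \<N> \<and> hier n (insert S \<N>)}"
proof (intro equalityI subsetI)
  fix F assume F: "F \<in> adjacent_facets (fan n) (scone (ray n) \<N>)"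
  then obtain \<M> where M: "hier n \<M>" "card \<M> = n - 3" "F = scone (ray n) \<M>"
    unfolding adjacent_facets_def fan_def facets_def by blast
  have "scone (ray n) \<N> \<subseteq> scone (ray n) \<M>"
    using F M(3) unfolding adjacent_facets_def face_of_def by blast
  then have sub: "\<N> \<subseteq> \<M>" using scone_subset_iff_hier[OF n h M(1)] by blast
  have "card (\<M> - \<N>) = 1"
    using card_Diff_subset[OF hier_finite[OF h] sub] M(2) c by simp
  then obtain S where "\<M> - \<N> = {S}" using card_1_singletonE by blast
  then have "\<M> = insert S \<N>" "S \<notin> \<N>" using sub by auto
  then show "F \<in> (\<lambda>S. scone (ray n) (insert S \<N>)) ` {S. S \<notin> \<N> \<and> hier n (insert S \<N>)}"
    using M by blast
next
  fix F assume "F \<in> (\<lambda>S. scone (ray n) (insert S \<N>)) ` {S. S \<notin> \<N> \<and> hier n (insert S \<N>)}"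
  then obtain S where S: "S \<notin> \<N>" "hier n (insert S \<N>)" "F = scone (ray n) (insert S \<N>)" by blast
  obtain p where p: "separator n (insert S \<N>) p" using separator_exists[OF S(2) n] by blast
  have "scone (ray n) \<N> face_of F"
    unfolding S(3) by (rule face_scone[OF dual_rays[OF S(2) n p]]) blast
  moreover have "insert S \<N> \<in> facets n"
    using S(1,2) c hier_finite[OF h] unfolding facets_def by simp
  ultimately show "F \<in> adjacent_facets (fan n) (scone (ray n) \<N>)"
    unfolding adjacent_facets_def fan_def using S(3) by blast
qed

text \<open>Every pair lies in \<open>{1..<n}\<close>, so the two terms of each coordinate cancel.
  Together with the vanishing for singletons this covers the 4-valent vertices that are ends of
  leaves.\<close>

lemma ray_full: "ray n {1..<n} = 0"
proof (rule ext)
  fix m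
  show "ray n {1..<n} m = 0 m"
  proof (cases "m < amb n")
    case True
    then show ?thesis using quad_mem[OF True] unfolding ray_def coords_def pairs_def by auto
  qed (simp add: ray_def)
qed

lemma ray_singleton: "ray n {i} = 0"
proof (rule ext)
  fix m
  have *: "\<not> P \<subseteq> {i}" if "P \<in> pairs n" for P
  proof
    assume "P \<subseteq> {i}"
    then have "card P \<le> card {i}" by (intro card_mono) auto
    then show False using that unfolding pairs_def by simp
  qed
  show "ray n {i} m = 0 m"
  proof (cases "m < amb n")
    case True
    then have "fst (quad n m) \<in> pairs n" "snd (quad n m) \<in> pairs n"
      using quad_mem[OF True] unfolding coords_def by auto
    then show ?thesis using * unfolding ray_def by simp
  qed (simp add: ray_def)
qed

lemma ray_ext_span: "S \<in> ext n \<N> \<Longrightarrow> ray n S \<in> span (ray n ` \<N>)"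
proof -
  assume "S \<in> ext n \<N>"
  then consider "S \<in> \<N>" | "ray n S = 0" unfolding ext_def using ray_full ray_singleton by auto
  then show ?thesis by cases (auto simp: span_zero intro: span_base)
qed

text \<open>Both sides count a pair inside one of the three sets twice, a pair across two of them
  once, and any other pair not at all.\<close>

lemma ray_ternary:
  assumes "A \<inter> B = {}" "A \<inter> C = {}" "B \<inter> C = {}"
  shows "ray n (A \<union> B) + ray n (A \<union> C) + ray n (B \<union> C) = ray n (A \<union> B \<union> C) + ray n A + ray n B + ray n C"
proof (rule ext)
  fix m
  have *: "(of_bool (P \<subseteq> A \<union> B) + of_bool (P \<subseteq> A \<union> C) + of_bool (P \<subseteq> B \<union> C) :: real) =
      of_bool (P \<subseteq> A \<union> B \<union> C) + of_bool (P \<subseteq> A) + of_bool (P \<subseteq> B) + of_bool (P \<subseteq> C)"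
    if P: "P \<in> pairs n" for P
  proof -
    obtain u v where uv: "P = {u, v}" using pairsE[OF P] .
    show ?thesis
      unfolding uv using assms
      by (cases "u \<in> A"; cases "u \<in> B"; cases "u \<in> C"; cases "v \<in> A"; cases "v \<in> B"; cases "v \<in> C") auto
  qed
  show "(ray n (A \<union> B) + ray n (A \<union> C) + ray n (B \<union> C)) m
      = (ray n (A \<union> B \<union> C) + ray n A + ray n B + ray n C) m"
  proof (cases "m < amb n")
    case True
    then have "fst (quad n m) \<in> pairs n" "snd (quad n m) \<in> pairs n"
      using quad_mem[OF True] unfolding coords_def by auto
    from *[OF this(1)] *[OF this(2)] True show ?thesis
      unfolding ray_def by simp
  qed (simp add: ray_def)
qed

section \<open>Balancing\<close>

lemma card_quotient_transversal:
  assumes "equiv A r" "T \<subseteq> A" "\<And>x. x \<in> A \<Longrightarrow> \<exists>t\<in>T. (x, t) \<in> r"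
    "\<And>s t. s \<in> T \<Longrightarrow> t \<in> T \<Longrightarrow> (s, t) \<in> r \<Longrightarrow> s = t"
  shows "card (A // r) = card T"
proof -
  have "bij_betw (\<lambda>t. r `` {t}) T (A // r)"
    unfolding bij_betw_def
  proof
    show "inj_on (\<lambda>t. r `` {t}) T"
    proof (rule inj_onI)
      fix s t assume st: "s \<in> T" "t \<in> T" "r `` {s} = r `` {t}"
      then have "(s, t) \<in> r" using eq_equiv_class_iff[OF assms(1)] assms(2) by blast
      then show "s = t" using assms(4) st by blast
    qed
    show "(\<lambda>t. r `` {t}) ` T = A // r"
    proof
      show "(\<lambda>t. r `` {t}) ` T \<subseteq> A // r" using assms(2) by (auto intro: quotientI)
      show "A // r \<subseteq> (\<lambda>t. r `` {t}) ` T"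
      proof
        fix X assume "X \<in> A // r"
        then obtain x where x: "x \<in> A" "X = r `` {x}" by (rule quotientE)
        obtain t where t: "t \<in> T" "(x, t) \<in> r" using assms(3)[OF x(1)] by blast
        then have "r `` {x} = r `` {t}" by (intro equiv_class_eq[OF assms(1)])
        then show "X \<in> (\<lambda>t. r `` {t}) ` T" using x t by blast
      qed
    qed
  qed
  then show ?thesis using bij_betw_same_card by fastforce
qed

lemma transversal_exists:
  assumes "equiv A r"
  shows "\<exists>T\<subseteq>A. (\<forall>x\<in>A. \<exists>t\<in>T. (x, t) \<in> r) \<and> (\<forall>s\<in>T. \<forall>t\<in>T. (s, t) \<in> r \<longrightarrow> s = t)"
proof -
  define f where "f X = (SOME x. x \<in> X)" for X :: "'a set"
  have f: "f X \<in> X" "f X \<in> A" if X: "X \<in> A // r" for X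
  proof -
    have "X \<noteq> {}" using in_quotient_imp_non_empty[OF assms X] .
    then show "f X \<in> X" unfolding f_def by (simp add: some_in_eq)
    then show "f X \<in> A" using in_quotient_imp_subset[OF assms X] by blast
  qed
  show ?thesis
  proof (intro exI[of _ "f ` (A // r)"] conjI ballI impI)
    show "f ` (A // r) \<subseteq> A" using f by blast
    fix x assume x: "x \<in> A"
    then have X: "r `` {x} \<in> A // r" by (rule quotientI)
    have "(x, f (r `` {x})) \<in> r" using f(1)[OF X] by blast
    then show "\<exists>t\<in>f ` (A // r). (x, t) \<in> r" using X by blast
  next
    fix s t assume "s \<in> f ` (A // r)" "t \<in> f ` (A // r)" and r: "(s, t) \<in> r"
    then obtain X Y where XY: "X \<in> A // r" "Y \<in> A // r" "s = f X" "t = f Y" by blast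
    then have "X = Y" using quotient_eqI[OF assms XY(1,2)] f(1) r by blast
    then show "s = t" using XY by simp
  qed
qed

definition lat_rel :: "'a::ab_group_add set \<Rightarrow> 'a set \<Rightarrow> ('a \<times> 'a) set" where
  "lat_rel K Q = {(x, y). x \<in> K \<and> y \<in> K \<and> x - y \<in> Q}"

lemma equiv_lat_rel:
  assumes "0 \<in> Q" "\<And>x y. x \<in> Q \<Longrightarrow> y \<in> Q \<Longrightarrow> x - y \<in> Q"
  shows "equiv K (lat_rel K Q)"
proof (rule equivI)
  show "lat_rel K Q \<subseteq> K \<times> K" unfolding lat_rel_def by blast
  show "refl_on K (lat_rel K Q)" unfolding lat_rel_def refl_on_def using assms(1) by auto
  show "sym (lat_rel K Q)"
  proof (rule symI)
    fix x y assume "(x, y) \<in> lat_rel K Q"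
    then show "(y, x) \<in> lat_rel K Q" using assms(2)[OF assms(1), of "x - y"] by (simp add: lat_rel_def)
  qed
  show "trans (lat_rel K Q)"
  proof (rule transI)
    fix x y z assume "(x, y) \<in> lat_rel K Q" "(y, z) \<in> lat_rel K Q"
    then show "(x, z) \<in> lat_rel K Q"
      using assms(2)[of "x - y" "0 - (y - z)"] assms(2)[OF assms(1), of "y - z"]
      by (simp add: lat_rel_def algebra_simps)
  qed
qed

text \<open>Representatives are \<open>t + i z0\<close> with \<open>t\<close> in \<open>T\<close>,
  for the kernel of \<open>h\<close> modulo \<open>Q\<close>, and \<open>i\<close> below the
  absolute value of \<open>h u\<close>, for the residues modulo \<open>h u\<close>. For an infinite
  \<open>T\<close> both sides are 0.\<close>

lemma card_quotient_extend:
  fixes h :: "(nat \<Rightarrow> real) \<Rightarrow> real"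
  assumes h: "linear h" "\<And>z. z \<in> Zn N \<Longrightarrow> h z \<in> \<int>" "z0 \<in> Zn N" "h z0 = 1"
    and Q: "Q \<subseteq> Zn N" "\<And>x. x \<in> Q \<Longrightarrow> h x = 0" "0 \<in> Q" "\<And>x y. x \<in> Q \<Longrightarrow> y \<in> Q \<Longrightarrow> x - y \<in> Q"
    and u: "u \<in> Zn N" "h u \<noteq> 0"
    and T: "T \<subseteq> Zn N" "\<And>t. t \<in> T \<Longrightarrow> h t = 0"
      "\<And>x. x \<in> Zn N \<Longrightarrow> h x = 0 \<Longrightarrow> \<exists>t\<in>T. x - t \<in> Q"
      "\<And>s t. s \<in> T \<Longrightarrow> t \<in> T \<Longrightarrow> s - t \<in> Q \<Longrightarrow> s = t"
    and R: "R = {q + of_int j *\<^sub>R u | q j. q \<in> Q}"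
  shows "card (Zn N // lat_rel (Zn N) R) = card T * nat \<bar>\<lfloor>h u\<rfloor>\<bar>"
proof -
  obtain k where k: "h u = of_int k" using h(2)[OF u(1)] by (rule Ints_cases)
  have k0: "k \<noteq> 0" using u(2) k by simp
  let ?m = "nat \<bar>k\<bar>"
  note hl = linear_add[OF h(1)] linear_diff[OF h(1)] linear_scale[OF h(1)]
  have R0: "0 \<in> R" unfolding R using Q(3) by (intro CollectI exI[of _ 0]) auto
  have Rd: "x - y \<in> R" if xy: "x \<in> R" "y \<in> R" for x y
  proof -
    obtain q j q' j' where e: "x = q + of_int j *\<^sub>R u" "q \<in> Q" "y = q' + of_int j' *\<^sub>R u" "q' \<in> Q"
      using xy unfolding R by blast
    have "x - y = (q - q') + of_int (j - j') *\<^sub>R u" unfolding e by (simp add: scaleR_diff_left)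
    then show ?thesis unfolding R using Q(4)[OF e(2,4)] by blast
  qed
  define f where "f = (\<lambda>(t, i::nat). t + real i *\<^sub>R z0)"
  have uniq: "s = t \<and> i = j"
    if st: "s \<in> T" "t \<in> T" "i < ?m" "j < ?m" and d: "f (s, i) - f (t, j) \<in> R" for s t i j
  proof -
    obtain q l where q: "q \<in> Q" "f (s, i) - f (t, j) = q + of_int l *\<^sub>R u" using d unfolding R by blast
    have "h (f (s, i) - f (t, j)) = real i - real j"
      unfolding f_def using T(2) st by (simp add: hl h(4))
    moreover have "h (q + of_int l *\<^sub>R u) = of_int l * of_int k" using Q(2)[OF q(1)] k by (simp add: hl)
    ultimately have "real i - real j = of_int l * of_int k" using q(2) by simp
    then have e: "int i - int j = l * k" by (metis of_int_diff of_int_eq_iff of_int_mult of_int_of_nat_eq)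
    \<comment> \<open>Both indices lie below \<open>?m\<close>, whereas a nonzero multiple of
      \<open>k\<close> has absolute value at least \<open>?m\<close>.\<close>
    have "l = 0"
    proof (rule ccontr)
      assume "l \<noteq> 0"
      then have "\<bar>k\<bar> \<le> \<bar>l * k\<bar>" using mult_right_mono[of 1 "\<bar>l\<bar>" "\<bar>k\<bar>"] by (simp add: abs_mult)
      then show False using e st by linarith
    qed
    then have "i = j" using e by simp
    moreover have "s - t \<in> Q" using q \<open>l = 0\<close> \<open>i = j\<close> unfolding f_def by simp
    ultimately show ?thesis using T(4) st by blast
  qed
  have "card (Zn N // lat_rel (Zn N) R) = card (f ` (T \<times> {..<?m}))"
  proof (rule card_quotient_transversal[OF equiv_lat_rel[OF R0 Rd]])
    have fZ: "f (t, i) \<in> Zn N" if "t \<in> T" for t i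
      unfolding f_def using that T(1) h(3) by (auto intro!: Zn_add Zn_scale)
    then show "f ` (T \<times> {..<?m}) \<subseteq> Zn N" by auto
    fix x assume x: "x \<in> Zn N"
    obtain a where a: "h x = of_int a" using h(2)[OF x] by (rule Ints_cases)
    \<comment> \<open>As \<open>h u\<close> may be negative, the remainder is taken modulo its
      absolute value and the sign goes into the quotient.\<close>
    define r where "r = a mod \<bar>k\<bar>"
    have r: "0 \<le> r" "r < \<bar>k\<bar>" unfolding r_def using k0 by simp_all
    obtain b where b: "a = r + b * k"
    proof -
      have "a = r + \<bar>k\<bar> * (a div \<bar>k\<bar>)" unfolding r_def by simp
      also have "\<bar>k\<bar> * (a div \<bar>k\<bar>) = (sgn k * (a div \<bar>k\<bar>)) * k" by (simp add: abs_sgn mult.assoc mult.commute)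
      finally show ?thesis using that by blast
    qed
    let ?y = "x - of_int b *\<^sub>R u - real (nat r) *\<^sub>R z0"
    have "?y \<in> Zn N" by (intro Zn_diff Zn_scale x u h) auto
    moreover have "h ?y = 0" using r by (simp add: hl a b k h(4))
    ultimately obtain t where t: "t \<in> T" "?y - t \<in> Q" using T(3) by blast
    have "x - f (t, nat r) = (?y - t) + of_int b *\<^sub>R u" unfolding f_def by simp
    then have "x - f (t, nat r) \<in> R" unfolding R using t(2) by blast
    moreover have "(t, nat r) \<in> T \<times> {..<?m}" using t(1) r by simp
    ultimately show "\<exists>t\<in>f ` (T \<times> {..<?m}). (x, t) \<in> lat_rel (Zn N) R"
      unfolding lat_rel_def using x fZ[OF t(1), of "nat r"] by blast
  next
    fix s t assume "s \<in> f ` (T \<times> {..<?m})" "t \<in> f ` (T \<times> {..<?m})" "(s, t) \<in> lat_rel (Zn N) R"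
    then show "s = t" using uniq unfolding lat_rel_def by auto
  qed
  also have "\<dots> = card (T \<times> {..<?m})"
  proof (rule card_image, rule inj_onI)
    fix a b assume "a \<in> T \<times> {..<?m}" "b \<in> T \<times> {..<?m}" "f a = f b"
    then show "a = b" using uniq[of "fst a" "fst b" "snd a" "snd b"] R0 by auto
  qed
  also have "\<dots> = card T * nat \<bar>\<lfloor>h u\<rfloor>\<bar>" by (simp add: card_cartesian_product k)
  finally show ?thesis .
qed

lemma eventually_nhdsin_Euclidean_0:
  "eventually P (nhdsin (Euclidean_space N) 0) \<longleftrightarrow>
    (\<exists>S. openin (Euclidean_space N) S \<and> 0 \<in> S \<and> (\<forall>v\<in>S. P v))"
  by (simp add: eventually_nhdsin topspace_Euclidean_space)

lemma small_generic_nhds: "eventually P (nhdsin (Euclidean_space N) 0) \<Longrightarrow> eventually P (small_generic N)"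
  unfolding eventually_small_generic eventually_nhdsin_Euclidean_0
  by (metis Diff_iff empty_iff finite.emptyI)

lemma openin_Rn: "openin (Euclidean_space N) (Rn N)"
  unfolding Rn_def by (rule openin_topspace)

lemma zero_Rn: "0 \<in> Rn N"
  by (simp add: Rn_iff)

lemma eventually_Rn: "eventually (\<lambda>v. v \<in> Rn N) (nhdsin (Euclidean_space N) 0)"
  unfolding eventually_nhdsin_Euclidean_0 using openin_Rn zero_Rn by blast

lemma small_generic_avoid:
  assumes "affine A" "A \<subset> Rn N"
  shows "eventually (\<lambda>v. v \<notin> A) (small_generic N)"
  unfolding eventually_small_generic
  by (intro exI[of _ "Rn N"] exI[of _ "{A}"]) (use assms openin_Rn zero_Rn in simp)

text \<open>A linear functional on all sequences can be discontinuous. On \<open>Rn N\<close> it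
  agrees with a finite combination of coordinates, which is continuous.\<close>

lemma eventually_linear_small:
  fixes g :: "(nat \<Rightarrow> real) \<Rightarrow> real"
  assumes "linear g" "0 < e"
  shows "eventually (\<lambda>v. \<bar>g v\<bar> < e) (nhdsin (Euclidean_space N) 0)"
proof -
  let ?g = "\<lambda>v::nat \<Rightarrow> real. \<Sum>i<N. v i * g (unit_fun i)"
  have "continuous_on UNIV ?g"
    by (intro continuous_intros continuous_on_product_coordinates)
  then have "open ((\<lambda>v. \<bar>?g v\<bar>) -` {..<e})"
    by (intro open_vimage) (auto intro!: continuous_intros)
  then have "openin (Euclidean_space N) (Rn N \<inter> ((\<lambda>v. \<bar>?g v\<bar>) -` {..<e}))"
    unfolding Euclidean_space_eq by (rule openin_open_Int)
  moreover have "0 \<in> Rn N \<inter> ((\<lambda>v. \<bar>?g v\<bar>) -` {..<e})" using assms(2) by (simp add: Rn_iff)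
  moreover have "\<bar>g v\<bar> < e" if "v \<in> Rn N \<inter> ((\<lambda>v. \<bar>?g v\<bar>) -` {..<e})" for v
    using that linear_Rn[OF assms(1), of v N] by simp
  ultimately show ?thesis unfolding eventually_nhdsin_Euclidean_0 by blast
qed

lemma direction_translate:
  assumes "subspace D"
  shows "direction ((+) q ` D) = D"
proof -
  have "{x - y |x y. x \<in> (+) q ` D \<and> y \<in> (+) q ` D} = D"
  proof (intro equalityI subsetI)
    fix z assume "z \<in> {x - y |x y. x \<in> (+) q ` D \<and> y \<in> (+) q ` D}"
    then obtain a b where "z = (q + a) - (q + b)" "a \<in> D" "b \<in> D" by blast
    then show "z \<in> D" using subspace_diff[OF assms, of a b] by simp
  next
    fix z assume "z \<in> D"
    then show "z \<in> {x - y |x y. x \<in> (+) q ` D \<and> y \<in> (+) q ` D}"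
      using subspace_0[OF assms] by (intro CollectI exI[of _ "q + z"] exI[of _ "q + 0"]) auto
  qed
  then show ?thesis unfolding direction_def using assms by (simp add: span_eq_iff)
qed

text \<open>A codimension one cone with a transverse space \<open>q + D\<close>. The functional
  \<open>h\<close> vanishes on the wall and on \<open>D\<close> and maps the integral vectors onto
  the integers; \<open>\<omega> R\<close> is the coefficient of the ray of \<open>R\<close>;
  \<open>T\<close> represents the integral vectors in the kernel of \<open>h\<close> modulo the
  lattices of the wall and of \<open>D\<close>.\<close>

locale wall =
  fixes n :: nat and \<N> :: "nat set set" and q D h \<omega> z0 T
  assumes n: "3 \<le> n" and hN: "hier n \<N>" and cN: "card \<N> + 1 = n - 3"
    and D: "subspace D" "D \<subseteq> Rn (amb n)"
    and q: "q \<in> relint (amb n) (scone (ray n) \<N>)"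
    and h: "linear h" "\<And>x. x \<in> D \<Longrightarrow> h x = (0::real)" "\<And>R. R \<in> \<N> \<Longrightarrow> h (ray n R) = 0"
    and \<omega>: "\<And>R. R \<in> \<N> \<Longrightarrow> linear (\<omega> R)" "\<And>R x. R \<in> \<N> \<Longrightarrow> x \<in> D \<Longrightarrow> \<omega> R x = (0::real)"
      "\<And>R R'. R \<in> \<N> \<Longrightarrow> R' \<in> \<N> \<Longrightarrow> \<omega> R (ray n R') = of_bool (R = R')"
    and ker: "\<And>x. x \<in> Rn (amb n) \<Longrightarrow> h x = 0 \<Longrightarrow> x - (\<Sum>R\<in>\<N>. \<omega> R x *\<^sub>R ray n R) \<in> D"
    and hZ: "\<And>z. z \<in> Zn (amb n) \<Longrightarrow> h z \<in> \<int>" "z0 \<in> Zn (amb n)" "h z0 = 1"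
    and T: "T \<subseteq> Zn (amb n)" "\<And>t. t \<in> T \<Longrightarrow> h t = 0"
      "\<And>x. x \<in> Zn (amb n) \<Longrightarrow> h x = 0 \<Longrightarrow>
         \<exists>t\<in>T. x - t \<in> {a + b | a b. a \<in> parallel_lattice (amb n) (scone (ray n) \<N>) \<and> b \<in> Zn (amb n) \<inter> D}"
      "\<And>s t. s \<in> T \<Longrightarrow> t \<in> T \<Longrightarrow>
         s - t \<in> {a + b | a b. a \<in> parallel_lattice (amb n) (scone (ray n) \<N>) \<and> b \<in> Zn (amb n) \<inter> D} \<Longrightarrow> s = t"
begin

abbreviation "US \<equiv> {S. S \<notin> \<N> \<and> hier n (insert S \<N>)}"
abbreviation "facet S \<equiv> scone (ray n) (insert S \<N>)"

lemma finite_N: "finite \<N>" by (rule hier_finite[OF hN])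

lemma finite_US: "finite US"
  by (rule finite_subset[OF _ finite_clusters[of n]]) (auto simp: hier_def)

lemma dual_N: "\<exists>m. dual_system (amb n) \<N> (ray n) m"
  using separator_exists[OF hN n] dual_rays[OF hN n] by blast

lemma dual_facet: "S \<in> US \<Longrightarrow> \<exists>m. dual_system (amb n) (insert S \<N>) (ray n) m"
  using separator_exists[OF _ n] dual_rays[OF _ n] by blast

lemma h_span: "x \<in> span (ray n ` \<N>) \<Longrightarrow> h x = 0"
  using linear_eq_0_on_span[OF h(1), of "ray n ` \<N>"] h(3) by blast

text \<open>The three rays around the wall add up to the rays of \<open>M\<close>, \<open>A\<close>,
  \<open>B\<close> and \<open>C\<close>. Each of these four is a ray of the wall or 0, so
  \<open>h\<close> kills the sum.\<close>

lemma h_sum: "(\<Sum>S\<in>US. h (ray n S)) = 0"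
proof -
  obtain M A B C where M: "M \<in> insert {1..<n} \<N>" "children (ext n \<N>) M = {A, B, C}"
    "A \<noteq> B" "A \<noteq> C" "B \<noteq> C" "US = {A \<union> B, A \<union> C, B \<union> C}"
    by (rule ternary_node[OF hN n cN])
  interpret full_hierarchy "{1..<n}" "ext n \<N>" by (rule full_hierarchy_ext) (use hN n in auto)
  have ch: "A \<in> children (ext n \<N>) M" "B \<in> children (ext n \<N>) M" "C \<in> children (ext n \<N>) M"
    using M by auto
  have disj: "A \<inter> B = {}" "A \<inter> C = {}" "B \<inter> C = {}" using children_disjoint ch M(3-5) by auto
  have ne: "A \<noteq> {}" "B \<noteq> {}" "C \<noteq> {}" using nonempty childrenD(1) ch by blast+
  have Mext: "M \<in> {S \<in> ext n \<N>. 2 \<le> card S}" using M(1) unfolding ext_card_ge_2[OF hN n] .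
  then have "M = A \<union> B \<union> C" using Union_children[of M] M(2) by auto
  have h0: "h (ray n R) = 0" if "R \<in> ext n \<N>" for R by (rule h_span[OF ray_ext_span[OF that]])
  have neq: "A \<union> B \<noteq> A \<union> C" "A \<union> B \<noteq> B \<union> C" "A \<union> C \<noteq> B \<union> C"
    using disj ne by blast+
  have "(\<Sum>S\<in>US. h (ray n S)) = h (ray n (A \<union> B)) + h (ray n (A \<union> C)) + h (ray n (B \<union> C))"
    unfolding M(6) using neq by simp
  also have "\<dots> = h (ray n (A \<union> B) + ray n (A \<union> C) + ray n (B \<union> C))"
    by (simp add: linear_add[OF h(1)])
  also have "\<dots> = h (ray n M + ray n A + ray n B + ray n C)"
    unfolding ray_ternary[OF disj] \<open>M = A \<union> B \<union> C\<close> ..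
  also have "\<dots> = 0"
    using h0[of M] h0[of A] h0[of B] h0[of C] Mext ch[THEN childrenD(1)] by (simp add: linear_add[OF h(1)])
  finally show ?thesis .
qed

text \<open>The facet is unimodular, so its lattice consists of the lattice of the wall and the
  integral multiples of the new ray.\<close>

lemma index_facet:
  assumes S: "S \<in> US" and hS: "h (ray n S) \<noteq> 0"
  shows "lattice_index (amb n) (facet S) ((+) q ` D) = card T * nat \<bar>\<lfloor>h (ray n S)\<rfloor>\<bar>"
proof -
  let ?N = "amb n"
  let ?Q = "{a + b | a b. a \<in> parallel_lattice ?N (scone (ray n) \<N>) \<and> b \<in> Zn ?N \<inter> D}"
  obtain m where m: "dual_system ?N \<N> (ray n) m" using dual_N by blast
  obtain m' where m': "dual_system ?N (insert S \<N>) (ray n) m'" using dual_facet[OF S] by blast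
  have SN: "S \<notin> \<N>" using S by simp
  have PL: "parallel_lattice ?N ((+) q ` D) = Zn ?N \<inter> D"
    unfolding parallel_lattice_def direction_translate[OF D(1)] ..
  have P: "parallel_lattice ?N (scone (ray n) \<N>) = Zn ?N \<inter> span (ray n ` \<N>)"
    unfolding parallel_lattice_def direction_scone[OF m] ..
  have eq: "{a + b | a b. a \<in> parallel_lattice ?N (facet S) \<and> b \<in> parallel_lattice ?N ((+) q ` D)}
      = {x + of_int j *\<^sub>R ray n S | x j. x \<in> ?Q}"
  proof (intro equalityI subsetI)
    fix x assume "x \<in> {a + b | a b. a \<in> parallel_lattice ?N (facet S) \<and> b \<in> parallel_lattice ?N ((+) q ` D)}"
    then obtain a b where ab: "x = a + b" "a \<in> parallel_lattice ?N (facet S)" "b \<in> Zn ?N \<inter> D"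
      unfolding PL by blast
    obtain c where c: "\<forall>i\<in>insert S \<N>. c i \<in> \<int>" "a = (\<Sum>i\<in>insert S \<N>. c i *\<^sub>R ray n i)"
      using ab(2) unfolding parallel_lattice_scone[OF m'] by blast
    obtain j where j: "c S = of_int j" using c(1) by (auto elim: Ints_cases)
    have a: "(\<Sum>i\<in>\<N>. c i *\<^sub>R ray n i) \<in> parallel_lattice ?N (scone (ray n) \<N>)"
      unfolding parallel_lattice_scone[OF m] using c(1) by blast
    have "x = ((\<Sum>i\<in>\<N>. c i *\<^sub>R ray n i) + b) + of_int j *\<^sub>R ray n S"
      unfolding ab(1) c(2) using SN finite_N j by (simp add: algebra_simps)
    then show "x \<in> {x + of_int j *\<^sub>R ray n S | x j. x \<in> ?Q}" using a ab(3) by blast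
  next
    fix x assume "x \<in> {x + of_int j *\<^sub>R ray n S | x j. x \<in> ?Q}"
    then obtain a b j where ab: "x = (a + b) + of_int j *\<^sub>R ray n S"
      "a \<in> parallel_lattice ?N (scone (ray n) \<N>)" "b \<in> Zn ?N \<inter> D" by blast
    obtain c where c: "\<forall>i\<in>\<N>. c i \<in> \<int>" "a = (\<Sum>i\<in>\<N>. c i *\<^sub>R ray n i)"
      using ab(2) unfolding parallel_lattice_scone[OF m] by blast
    let ?c = "\<lambda>i. if i = S then of_int j else c i"
    have "(\<Sum>i\<in>insert S \<N>. ?c i *\<^sub>R ray n i) = of_int j *\<^sub>R ray n S + (\<Sum>i\<in>\<N>. ?c i *\<^sub>R ray n i)"
      using SN finite_N by simp
    also have "(\<Sum>i\<in>\<N>. ?c i *\<^sub>R ray n i) = a"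
      unfolding c(2) by (rule sum.cong) (use SN in auto)
    finally have "a + of_int j *\<^sub>R ray n S = (\<Sum>i\<in>insert S \<N>. ?c i *\<^sub>R ray n i)"
      unfolding add.commute[of a] by (rule sym)
    moreover have "\<forall>i\<in>insert S \<N>. ?c i \<in> \<int>" using c(1) by simp
    ultimately have "a + of_int j *\<^sub>R ray n S \<in> parallel_lattice ?N (facet S)"
      unfolding parallel_lattice_scone[OF m'] by (intro exI[of _ ?c] conjI)
    moreover have "x = (a + of_int j *\<^sub>R ray n S) + b" unfolding ab(1) by (simp add: algebra_simps)
    ultimately show "x \<in> {a + b | a b. a \<in> parallel_lattice ?N (facet S) \<and> b \<in> parallel_lattice ?N ((+) q ` D)}"
      unfolding PL using ab(3) by blast
  qed
  have "lattice_index ?N (facet S) ((+) q ` D) = card (Zn ?N // lat_rel (Zn ?N) {x + of_int j *\<^sub>R ray n S | x j. x \<in> ?Q})"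
    unfolding lattice_index_def lat_rel_def eq ..
  also have "\<dots> = card T * nat \<bar>\<lfloor>h (ray n S)\<rfloor>\<bar>"
  proof (rule card_quotient_extend[OF h(1) hZ _ _ _ _ ray_Zn hS T refl])
    show "?Q \<subseteq> Zn ?N" unfolding P by (auto intro: Zn_add)
    show "h x = 0" if "x \<in> ?Q" for x
      using that h(2) h_span unfolding P by (auto simp: linear_add[OF h(1)])
    show "0 \<in> ?Q" unfolding P using Zn_0 span_zero subspace_0[OF D(1)]
      by (intro CollectI exI[of _ 0]) simp
    show "x - y \<in> ?Q" if xy: "x \<in> ?Q" "y \<in> ?Q" for x y
    proof -
      obtain a b a' b' where e: "x = a + b" "a \<in> Zn ?N \<inter> span (ray n ` \<N>)" "b \<in> Zn ?N \<inter> D"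
        "y = a' + b'" "a' \<in> Zn ?N \<inter> span (ray n ` \<N>)" "b' \<in> Zn ?N \<inter> D"
        using xy unfolding P by blast
      have "x - y = (a - a') + (b - b')" unfolding e by simp
      moreover have "a - a' \<in> Zn ?N \<inter> span (ray n ` \<N>)" using e by (auto intro: Zn_diff span_diff)
      moreover have "b - b' \<in> Zn ?N \<inter> D" using e by (auto intro: Zn_diff subspace_diff[OF D(1)])
      ultimately show ?thesis unfolding P by blast
    qed
  qed
  finally show ?thesis .
qed

text \<open>Applying \<open>h\<close> to a common point shows that the new ray has the coefficient
  \<open>h v / h (ray n S)\<close>. Conversely, if this is positive, the other coefficients differ
  from those of \<open>q\<close> by amounts linear in \<open>v\<close>; they are positive at
  \<open>q\<close> and stay nonnegative for small \<open>v\<close>.\<close>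

lemma meets_facet:
  "\<forall>\<^sub>F v in small_generic (amb n). \<forall>S\<in>US. facet S \<inter> (+) v ` (+) q ` D \<noteq> {} \<longleftrightarrow> 0 < h (ray n S) * h v"
proof -
  let ?N = "amb n"
  obtain m where m: "dual_system ?N \<N> (ray n) m" using dual_N by blast
  have qs: "q \<in> span (ray n ` \<N>)" "\<And>R. R \<in> \<N> \<Longrightarrow> 0 < q (m R)"
    using q unfolding relint_scone[OF m] by auto
  have hq: "h q = 0" by (rule h_span[OF qs(1)])
  let ?g = "\<lambda>S R v. \<omega> R (v - (h v / h (ray n S)) *\<^sub>R ray n S)"
  have lin: "linear (?g S R)" if "R \<in> \<N>" for S R
    by (rule linearI)
      (simp_all add: linear_diff[OF \<omega>(1)[OF that]] linear_scale[OF \<omega>(1)[OF that]] linear_add[OF \<omega>(1)[OF that]]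
        linear_add[OF h(1)] linear_scale[OF h(1)] algebra_simps add_divide_distrib)
  have "\<forall>\<^sub>F v in nhdsin (Euclidean_space ?N) 0. \<forall>S\<in>US. \<forall>R\<in>\<N>. \<bar>?g S R v\<bar> < q (m R)"
    using finite_US finite_N qs(2) lin by (intro eventually_ball_finite ballI eventually_linear_small) auto
  then have e1: "\<forall>\<^sub>F v in small_generic ?N. \<forall>S\<in>US. \<forall>R\<in>\<N>. \<bar>?g S R v\<bar> < q (m R)"
    by (rule small_generic_nhds)
  have e2: "\<forall>\<^sub>F v in small_generic ?N. v \<in> Rn ?N" by (rule small_generic_nhds[OF eventually_Rn])
  \<comment> \<open>The genericity needed is \<open>h v \<noteq> 0\<close>.\<close>
  let ?K = "{v \<in> Rn ?N. h v = 0}"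
  have "subspace ?K"
    using subspace_Rn[of ?N]
    by (auto simp: subspace_def linear_add[OF h(1)] linear_scale[OF h(1)] linear_0[OF h(1)])
  moreover have "?K \<subset> Rn ?N"
  proof -
    have "z0 \<in> Rn ?N" "h z0 \<noteq> 0" using hZ(2,3) by (auto simp: Zn_iff)
    then show ?thesis by blast
  qed
  ultimately have e3: "\<forall>\<^sub>F v in small_generic ?N. v \<notin> ?K"
    by (intro small_generic_avoid subspace_imp_affine)
  show ?thesis
    using e1 e2 e3
  proof eventually_elim
    case (elim v)
    have v: "v \<in> Rn ?N" "h v \<noteq> 0" using elim by auto
    show ?case
    proof
      fix S assume S: "S \<in> US"
      obtain m' where m': "dual_system ?N (insert S \<N>) (ray n) m'" using dual_facet[OF S] by blast
      have SN: "S \<notin> \<N>" using S by simp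
      let ?u = "ray n S"
      show "facet S \<inter> (+) v ` (+) q ` D \<noteq> {} \<longleftrightarrow> 0 < h ?u * h v"
      proof
        assume "facet S \<inter> (+) v ` (+) q ` D \<noteq> {}"
        then obtain d where d: "d \<in> D" "v + (q + d) \<in> facet S" by blast
        then obtain c where c: "v + (q + d) = (\<Sum>i\<in>insert S \<N>. c i *\<^sub>R ray n i)" "\<forall>i\<in>insert S \<N>. 0 \<le> c i"
          unfolding scone_def by blast
        have "h (v + (q + d)) = (\<Sum>i\<in>insert S \<N>. c i * h (ray n i))"
          unfolding c(1) by (simp only: linear_sum[OF h(1)] linear_scale[OF h(1)] real_scaleR_def)
        also have "\<dots> = c S * h ?u" using SN finite_N h(3) by simp
        finally have e: "h v = c S * h ?u" using hq h(2)[OF d(1)] by (simp add: linear_add[OF h(1)])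
        then have "c S \<noteq> 0" "h ?u \<noteq> 0" using v(2) by auto
        then have "0 < c S" "0 < h ?u * h ?u" using c(2) by (auto simp: zero_less_mult_iff not_less less_le)
        then have "0 < c S * (h ?u * h ?u)" by (rule mult_pos_pos)
        then show "0 < h ?u * h v" unfolding e by (simp add: algebra_simps)
      next
        assume pos: "0 < h ?u * h v"
        then have hu: "h ?u \<noteq> 0" by auto
        let ?c = "h v / h ?u"
        have c0: "0 \<le> ?c" using pos by (auto simp: zero_less_mult_iff zero_le_divide_iff)
        let ?y = "v - ?c *\<^sub>R ?u"
        have "?y \<in> Rn ?N"
          using v(1) ray_Zn[of n S] subspace_Rn[of ?N] by (auto simp: Zn_iff intro: subspace_diff subspace_scale)
        moreover have "h ?y = 0" using hu by (simp add: linear_diff[OF h(1)] linear_scale[OF h(1)])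
        ultimately have d: "?y - (\<Sum>R\<in>\<N>. \<omega> R ?y *\<^sub>R ray n R) \<in> D" (is "?d \<in> D") by (rule ker)
        have md: "- ?d \<in> D" using subspace_neg[OF D(1) d] .
        have qe: "q = (\<Sum>R\<in>\<N>. q (m R) *\<^sub>R ray n R)" using qs(1) dual_span_iff[OF m] by blast
        let ?k = "\<lambda>R. if R = S then ?c else q (m R) + \<omega> R ?y"
        have "v + (q + - (v - c - w)) = c + (q + w)" for v q c w :: "nat \<Rightarrow> real" by simp
        then have "v + (q + - ?d) = ?c *\<^sub>R ?u + (q + (\<Sum>R\<in>\<N>. \<omega> R ?y *\<^sub>R ray n R))" .
        also have "q + (\<Sum>R\<in>\<N>. \<omega> R ?y *\<^sub>R ray n R) = (\<Sum>R\<in>\<N>. (q (m R) + \<omega> R ?y) *\<^sub>R ray n R)"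
          by (subst qe) (simp only: scaleR_add_left sum.distrib)
        also have "?c *\<^sub>R ?u + (\<Sum>R\<in>\<N>. (q (m R) + \<omega> R ?y) *\<^sub>R ray n R) = (\<Sum>R\<in>insert S \<N>. ?k R *\<^sub>R ray n R)"
          using SN finite_N by (simp add: sum.insert) (intro sum.cong, auto)
        finally have eq: "v + (q + - ?d) = (\<Sum>R\<in>insert S \<N>. ?k R *\<^sub>R ray n R)" .
        have "\<forall>R\<in>insert S \<N>. 0 \<le> ?k R"
        proof
          fix R assume R: "R \<in> insert S \<N>"
          show "0 \<le> ?k R"
          proof (cases "R = S")
            case True then show ?thesis using c0 by simp
          next
            case False
            then have "\<bar>\<omega> R ?y\<bar> < q (m R)" using elim(1) S R by blast
            then show ?thesis using False by simp
          qed
        qed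
        then have "v + (q + - ?d) \<in> facet S"
          unfolding scone_def eq by (intro CollectI exI[of _ ?k] conjI refl)
        then show "facet S \<inter> (+) v ` (+) q ` D \<noteq> {}" using md by blast
      qed
    qed
  qed
qed

lemma eventually_iota:
  "\<forall>\<^sub>F v in small_generic (amb n).
     iota (amb n) (fan n) (\<lambda>_. 1) (scone (ray n) \<N>) ((+) q ` D) v
     = card T * (\<Sum>S\<in>US. nat \<lfloor>max 0 (h (ray n S))\<rfloor>)"
proof -
  let ?N = "amb n"
  let ?K = "{v \<in> Rn ?N. h v = 0}"
  have "subspace ?K"
    using subspace_Rn[of ?N]
    by (auto simp: subspace_def linear_add[OF h(1)] linear_scale[OF h(1)] linear_0[OF h(1)])
  moreover have "?K \<subset> Rn ?N"
  proof -
    have "z0 \<in> Rn ?N" "h z0 \<noteq> 0" using hZ(2,3) by (auto simp: Zn_iff)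
    then show ?thesis by blast
  qed
  ultimately have e3: "\<forall>\<^sub>F v in small_generic ?N. v \<notin> ?K"
    by (intro small_generic_avoid subspace_imp_affine)
  have e2: "\<forall>\<^sub>F v in small_generic ?N. v \<in> Rn ?N" by (rule small_generic_nhds[OF eventually_Rn])
  have inj: "inj_on facet US"
  proof (rule inj_onI)
    fix S S' assume "S \<in> US" "S' \<in> US" "facet S = facet S'"
    then have "insert S \<N> = insert S' \<N>" using scone_eq_iff_hier[OF n] by blast
    then show "S = S'" using \<open>S \<in> US\<close> \<open>S' \<in> US\<close> by blast
  qed
  have hint: "h (ray n S) = of_int \<lfloor>h (ray n S)\<rfloor>" for S
    using hZ(1)[OF ray_Zn[of n S]] by (auto elim: Ints_cases)
  have sum0: "(\<Sum>S\<in>US. \<lfloor>h (ray n S)\<rfloor>) = 0"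
  proof -
    have "of_int (\<Sum>S\<in>US. \<lfloor>h (ray n S)\<rfloor>) = (\<Sum>S\<in>US. h (ray n S))"
      unfolding of_int_sum by (rule sum.cong[OF refl]) (rule hint[symmetric])
    then show ?thesis unfolding h_sum by (simp only: of_int_eq_0_iff)
  qed
  \<comment> \<open>For \<open>h v > 0\<close> the facets with positive value of \<open>h\<close>
    count, for \<open>h v < 0\<close> those with negative value. The values sum to 0, so both totals
    agree: this is the balancing.\<close>
  have posneg: "(\<Sum>S\<in>US. nat \<lfloor>max 0 (h (ray n S))\<rfloor>) = (\<Sum>S\<in>US. nat (- \<lfloor>h (ray n S)\<rfloor>))"
  proof -
    have "int (\<Sum>S\<in>US. nat \<lfloor>max 0 (h (ray n S))\<rfloor>) - int (\<Sum>S\<in>US. nat (- \<lfloor>h (ray n S)\<rfloor>))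
        = (\<Sum>S\<in>US. \<lfloor>h (ray n S)\<rfloor>)"
      unfolding of_nat_sum sum_subtractf[symmetric]
    proof (rule sum.cong[OF refl])
      fix S
      show "int (nat \<lfloor>max 0 (h (ray n S))\<rfloor>) - int (nat (- \<lfloor>h (ray n S)\<rfloor>)) = \<lfloor>h (ray n S)\<rfloor>"
        by (subst hint, cases "0 \<le> \<lfloor>h (ray n S)\<rfloor>") (auto simp: max_def)
    qed
    then show ?thesis unfolding sum0 by linarith
  qed
  show ?thesis
    using meets_facet e2 e3
  proof eventually_elim
    case (elim v)
    have v: "h v \<noteq> 0" using elim by auto
    let ?X = "{S \<in> US. 0 < h (ray n S) * h v}"
    have "{F \<in> adjacent_facets (fan n) (scone (ray n) \<N>). F \<inter> (+) v ` (+) q ` D \<noteq> {}} = facet ` ?X"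
      unfolding adjacent_facets_fan[OF n hN cN] using elim(1) by blast
    then have "iota ?N (fan n) (\<lambda>_. 1) (scone (ray n) \<N>) ((+) q ` D) v
        = (\<Sum>F\<in>facet ` ?X. 1 * lattice_index ?N F ((+) q ` D))"
      unfolding iota_def by (simp only:)
    also have "\<dots> = (\<Sum>S\<in>?X. lattice_index ?N (facet S) ((+) q ` D))"
      by (subst sum.reindex) (auto intro: inj_on_subset[OF inj])
    also have "\<dots> = (\<Sum>S\<in>?X. card T * nat \<bar>\<lfloor>h (ray n S)\<rfloor>\<bar>)"
      by (rule sum.cong[OF refl], rule index_facet) auto
    also have "\<dots> = card T * (\<Sum>S\<in>?X. nat \<bar>\<lfloor>h (ray n S)\<rfloor>\<bar>)" by (simp add: sum_distrib_left)
    also have "(\<Sum>S\<in>?X. nat \<bar>\<lfloor>h (ray n S)\<rfloor>\<bar>) = (\<Sum>S\<in>US. nat \<lfloor>max 0 (h (ray n S))\<rfloor>)"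
    proof (cases "0 < h v")
      case True
      show ?thesis
        by (rule sum.mono_neutral_cong_left) (use finite_US True in \<open>auto simp: zero_less_mult_iff max_def\<close>)
    next
      case False
      then have hv: "h v < 0" using v by simp
      have "(\<Sum>S\<in>?X. nat \<bar>\<lfloor>h (ray n S)\<rfloor>\<bar>) = (\<Sum>S\<in>US. nat (- \<lfloor>h (ray n S)\<rfloor>))"
      proof (rule sum.mono_neutral_cong_left)
        show "\<forall>i\<in>US - ?X. nat (- \<lfloor>h (ray n i)\<rfloor>) = 0"
          using hv by (auto simp: zero_less_mult_iff not_less)
        show "nat \<bar>\<lfloor>h (ray n x)\<rfloor>\<bar> = nat (- \<lfloor>h (ray n x)\<rfloor>)" if "x \<in> ?X" for x
        proof -
          have "h (ray n x) < 0" using that hv by (auto simp: zero_less_mult_iff)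
          then show ?thesis by simp
        qed
      qed (use finite_US in auto)
      then show ?thesis using posneg by simp
    qed
    finally show ?case .
  qed
qed

end

section \<open>Arbitrary integral transverse spaces\<close>

lemma dual_basis:
  fixes B :: "'a::real_vector set"
  assumes "independent B"
  shows "\<exists>\<omega>. \<forall>b\<in>B. linear (\<omega> b) \<and> (\<forall>b'\<in>B. \<omega> b b' = (of_bool (b = b') :: real))"
proof (rule bchoice, rule ballI)
  fix b assume "b \<in> B"
  show "\<exists>g. linear g \<and> (\<forall>b'\<in>B. g b' = (of_bool (b = b') :: real))"
    using linear_independent_extend[OF assms, of "\<lambda>b'. of_bool (b = b')"] by blast
qed

lemma basis_expand:
  fixes B :: "'a::real_vector set"
  assumes "finite B" and \<omega>: "\<forall>b\<in>B. linear (\<omega> b) \<and> (\<forall>b'\<in>B. \<omega> b b' = (of_bool (b = b') :: real))"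
    and x: "x \<in> span B"
  shows "x = (\<Sum>b\<in>B. \<omega> b x *\<^sub>R b)"
proof (rule linear_eq_on_span[of "\<lambda>x. x" _ B, OF _ _ _ x])
  show "linear (\<lambda>x::'a. x)" by (rule linear_id[unfolded id_def])
  show "linear (\<lambda>x. \<Sum>b\<in>B. \<omega> b x *\<^sub>R b)"
    by (intro linear_compose_sum ballI linear_compose[of "\<omega> _" "\<lambda>c. c *\<^sub>R _", unfolded comp_def] linear_scale_left)
      (use \<omega> in auto)
  fix c assume c: "c \<in> B"
  have "(\<Sum>b\<in>B. \<omega> b c *\<^sub>R b) = (\<Sum>b\<in>B. if b = c then b else 0)"
    by (rule sum.cong) (use \<omega> c in auto)
  then show "c = (\<Sum>b\<in>B. \<omega> b c *\<^sub>R b)" using assms(1) c by simp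
qed

lemma finite_box: "finite {z \<in> Zn N. \<forall>i<N. \<bar>z i\<bar> \<le> K}"
proof (rule finite_subset)
  let ?F = "\<lambda>f i. if i < N then real_of_int (f i) else 0"
  show "{z \<in> Zn N. \<forall>i<N. \<bar>z i\<bar> \<le> K} \<subseteq> ?F ` ({..<N} \<rightarrow>\<^sub>E {- \<lceil>K\<rceil>..\<lceil>K\<rceil>})"
  proof
    fix z assume z: "z \<in> {z \<in> Zn N. \<forall>i<N. \<bar>z i\<bar> \<le> K}"
    let ?f = "\<lambda>i\<in>{..<N}. \<lfloor>z i\<rfloor>"
    have "z = ?F ?f"
    proof
      fix i
      have "z i \<in> \<int>" using z by (simp add: Zn_iff)
      then show "z i = ?F ?f i" using z by (auto simp: Zn_iff Rn_iff elim: Ints_cases)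
    qed
    moreover have "?f \<in> {..<N} \<rightarrow>\<^sub>E {- \<lceil>K\<rceil>..\<lceil>K\<rceil>}"
    proof (rule PiE_I)
      fix i assume i: "i \<in> {..<N}"
      have "z i \<in> \<int>" using z by (simp add: Zn_iff)
      then obtain a where a: "z i = of_int a" by (rule Ints_cases)
      have "\<bar>of_int a\<bar> \<le> K" using z i a by force
      then have "\<bar>a\<bar> \<le> \<lceil>K\<rceil>" by (metis ceiling_mono ceiling_of_int of_int_abs)
      then show "?f i \<in> {- \<lceil>K\<rceil>..\<lceil>K\<rceil>}" using i a by (simp add: abs_le_iff)
    qed auto
    ultimately show "z \<in> ?F ` ({..<N} \<rightarrow>\<^sub>E {- \<lceil>K\<rceil>..\<lceil>K\<rceil>})" by blast
  qed
  show "finite (?F ` ({..<N} \<rightarrow>\<^sub>E {- \<lceil>K\<rceil>..\<lceil>K\<rceil>}))"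
    by (intro finite_imageI finite_PiE) auto
qed

text \<open>A coordinate functional of an integral basis takes values in a cyclic group on the integral
  points: up to the lattice of the basis, there are only finitely many of them.\<close>

lemma integral_coordinate_discrete:
  assumes fin: "finite B" and BZ: "B \<subseteq> Zn N" and sp: "span B = Rn N" and u: "u \<in> B"
    and \<omega>: "\<forall>b\<in>B. linear (\<omega> b) \<and> (\<forall>b'\<in>B. \<omega> b b' = (of_bool (b = b') :: real))"
  shows "\<exists>d>0. \<exists>z0\<in>Zn N. \<omega> u z0 = d \<and> (\<forall>z\<in>Zn N. \<exists>j::int. \<omega> u z = of_int j * d)"
proof -
  define P where "P = {\<omega> u z | z. z \<in> Zn N \<and> 0 < \<omega> u z \<and> \<omega> u z \<le> 1}"
  have lin: "linear (\<omega> b)" if "b \<in> B" for b using \<omega> that by blast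
  note lu = lin[OF u]
  let ?K = "\<Sum>b\<in>B. \<Sum>i<N. \<bar>b i\<bar>"
  have "P \<subseteq> \<omega> u ` {z \<in> Zn N. \<forall>i<N. \<bar>z i\<bar> \<le> ?K}"
  proof
    fix g assume "g \<in> P"
    then obtain z where z: "g = \<omega> u z" "z \<in> Zn N" "0 < \<omega> u z" "\<omega> u z \<le> 1" unfolding P_def by blast
    \<comment> \<open>Removing the integral parts of all other coefficients leaves
      \<open>\<omega> u\<close> unchanged and moves \<open>z\<close> into a bounded box.\<close>
    let ?y = "\<Sum>b\<in>B - {u}. of_int \<lfloor>\<omega> b z\<rfloor> *\<^sub>R b"
    have \<omega>y: "\<omega> c ?y = (if c = u then 0 else of_int \<lfloor>\<omega> c z\<rfloor>)" if c: "c \<in> B" for c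
    proof -
      have "\<omega> c ?y = (\<Sum>b\<in>B - {u}. of_int \<lfloor>\<omega> b z\<rfloor> * \<omega> c b)"
        by (simp add: linear_sum[OF lin[OF c]] linear_scale[OF lin[OF c]])
      also have "\<dots> = (\<Sum>b\<in>B - {u}. if b = c then of_int \<lfloor>\<omega> b z\<rfloor> else 0)"
        by (rule sum.cong) (use \<omega> c in auto)
      finally show ?thesis using fin c by simp
    qed
    have yZ: "z - ?y \<in> Zn N" by (intro Zn_diff z Zn_sum Zn_scale) (use BZ in auto)
    have small: "\<bar>\<omega> c (z - ?y)\<bar> \<le> 1" if c: "c \<in> B" for c
    proof (cases "c = u")
      case True
      then show ?thesis using z(3,4) \<omega>y[OF u] by (simp add: linear_diff[OF lu])
    next
      case False
      have e: "\<omega> c (z - ?y) = \<omega> c z - of_int \<lfloor>\<omega> c z\<rfloor>"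
        using False \<omega>y[OF c] by (simp add: linear_diff[OF lin[OF c]])
      show ?thesis unfolding e by linarith
    qed
    have "\<bar>(z - ?y) i\<bar> \<le> ?K" if i: "i < N" for i
    proof -
      have "z - ?y \<in> span B" using yZ sp by (simp add: Zn_iff)
      then have "z - ?y = (\<Sum>b\<in>B. \<omega> b (z - ?y) *\<^sub>R b)" by (rule basis_expand[OF fin \<omega>])
      then have "(z - ?y) i = (\<Sum>b\<in>B. \<omega> b (z - ?y) *\<^sub>R b) i" by (rule arg_cong)
      also have "\<dots> = (\<Sum>b\<in>B. \<omega> b (z - ?y) * b i)" by (simp only: sum_fun_apply scaleR_fun_apply real_scaleR_def)
      finally have "\<bar>(z - ?y) i\<bar> \<le> (\<Sum>b\<in>B. \<bar>\<omega> b (z - ?y) * b i\<bar>)" by (simp only: sum_abs)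
      also have "\<dots> \<le> ?K"
      proof (rule sum_mono)
        fix b assume b: "b \<in> B"
        have "\<bar>\<omega> b (z - ?y) * b i\<bar> \<le> 1 * \<bar>b i\<bar>"
          unfolding abs_mult by (rule mult_right_mono[OF small[OF b]]) simp
        also have "\<dots> \<le> (\<Sum>i<N. \<bar>b i\<bar>)" using member_le_sum[of i "{..<N}" "\<lambda>i. \<bar>b i\<bar>"] i by simp
        finally show "\<bar>\<omega> b (z - ?y) * b i\<bar> \<le> (\<Sum>i<N. \<bar>b i\<bar>)" .
      qed
      finally show ?thesis .
    qed
    moreover have "g = \<omega> u (z - ?y)" using z(1) \<omega>y[OF u] by (simp add: linear_diff[OF lu])
    ultimately show "g \<in> \<omega> u ` {z \<in> Zn N. \<forall>i<N. \<bar>z i\<bar> \<le> ?K}" using yZ by blast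
  qed
  then have finP: "finite P" using finite_box finite_surj by blast
  have "1 = \<omega> u u" using \<omega> u by simp
  then have P1: "1 \<in> P" unfolding P_def using u BZ by force
  \<comment> \<open>The smallest positive value generates all the others, by division with
    remainder.\<close>
  define d where "d = Min P"
  have dP: "d \<in> P" unfolding d_def using finP P1 by (intro Min_in) auto
  then obtain z0 where z0: "z0 \<in> Zn N" "\<omega> u z0 = d" "0 < d" "d \<le> 1" unfolding P_def by auto
  have "\<exists>j::int. \<omega> u z = of_int j * d" if z: "z \<in> Zn N" for z
  proof -
    let ?j = "\<lfloor>\<omega> u z / d\<rfloor>"
    let ?r = "\<omega> u z - of_int ?j * d"
    have r: "0 \<le> ?r" "?r < d"
      using floor_divide_lower[OF z0(3), of "\<omega> u z"] floor_divide_upper[OF z0(3), of "\<omega> u z"]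
      by (simp_all add: algebra_simps)
    have "?r = \<omega> u (z - of_int ?j *\<^sub>R z0)" using z0(2) by (simp add: linear_diff[OF lu] linear_scale[OF lu])
    moreover have "z - of_int ?j *\<^sub>R z0 \<in> Zn N" using z z0(1) by (intro Zn_diff Zn_scale) auto
    ultimately have "?r \<in> P" if "0 < ?r" unfolding P_def using that r z0(4) by force
    moreover have "?r \<notin> P" using Min_le[OF finP, of ?r] r(2) unfolding d_def by auto
    ultimately have "?r = 0" using r(1) by linarith
    then show ?thesis by (intro exI[of _ ?j]) simp
  qed
  then show ?thesis using z0 by blast
qed

lemma lattice_sum_group:
  assumes "subspace V" "subspace D"
  shows "0 \<in> {a + b | a b. a \<in> Zn N \<inter> V \<and> b \<in> Zn N \<inter> D}"
    and "x \<in> {a + b | a b. a \<in> Zn N \<inter> V \<and> b \<in> Zn N \<inter> D} \<Longrightarrow>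
      y \<in> {a + b | a b. a \<in> Zn N \<inter> V \<and> b \<in> Zn N \<inter> D} \<Longrightarrow>
      x - y \<in> {a + b | a b. a \<in> Zn N \<inter> V \<and> b \<in> Zn N \<inter> D}"
proof -
  show "0 \<in> {a + b | a b. a \<in> Zn N \<inter> V \<and> b \<in> Zn N \<inter> D}"
    using subspace_0[OF assms(1)] subspace_0[OF assms(2)] Zn_0 by (intro CollectI exI[of _ 0]) simp
  assume "x \<in> {a + b | a b. a \<in> Zn N \<inter> V \<and> b \<in> Zn N \<inter> D}" "y \<in> {a + b | a b. a \<in> Zn N \<inter> V \<and> b \<in> Zn N \<inter> D}"
  then obtain a b a' b' where e: "x = a + b" "a \<in> Zn N \<inter> V" "b \<in> Zn N \<inter> D"
    "y = a' + b'" "a' \<in> Zn N \<inter> V" "b' \<in> Zn N \<inter> D" by blast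
  have "x - y = (a - a') + (b - b')" unfolding e by simp
  moreover have "a - a' \<in> Zn N \<inter> V" using e by (auto intro: Zn_diff subspace_diff[OF assms(1)])
  moreover have "b - b' \<in> Zn N \<inter> D" using e by (auto intro: Zn_diff subspace_diff[OF assms(2)])
  ultimately show "x - y \<in> {a + b | a b. a \<in> Zn N \<inter> V \<and> b \<in> Zn N \<inter> D}" by blast
qed

lemma dim_Rn: "dim (Rn N) = N"
  unfolding Rn_span using dual_dim[OF dual_system_unit[of "{..<N}" N]] by simp

text \<open>The rays of a facet transverse to \<open>L\<close>, together with directions of
  \<open>L\<close>, form a basis of the ambient space. Its dual basis supplies the coefficients
  \<open>\<omega>\<close> and, up to a factor, the functional \<open>h\<close> of a wall.\<close>

lemma iota_constant_spanning:
  assumes n: "3 \<le> n" and hN: "hier n \<N>" and cN: "card \<N> + 1 = n - 3"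
    and S: "S \<notin> \<N>" "hier n (insert S \<N>)"
    and B0: "B0 \<subseteq> Zn (amb n)" and dimD: "dim (span B0) + (n - 3) = amb n"
    and q: "q \<in> relint (amb n) (scone (ray n) \<N>)"
    and span: "Rn (amb n) \<subseteq> span (ray n ` insert S \<N> \<union> span B0)"
  shows "\<exists>c. \<forall>\<^sub>F v in small_generic (amb n).
     iota (amb n) (fan n) (\<lambda>_. 1) (scone (ray n) \<N>) ((+) q ` span B0) v = c"
proof -
  let ?N = "amb n"
  let ?X = "ray n ` insert S \<N>"
  obtain m where m: "dual_system ?N (insert S \<N>) (ray n) m"
    using separator_exists[OF S(2) n] dual_rays[OF S(2) n] by blast
  have mN: "dual_system ?N \<N> (ray n) m" by (rule dual_system_subset[OF m]) blast
  note inj = dual_inj[OF m]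
  obtain Bd where Bd: "Bd \<subseteq> B0" "independent Bd" "B0 \<subseteq> span Bd"
    using maximal_independent_subset by blast
  have spBd: "span Bd = span B0"
    by (rule antisym[OF span_mono[OF Bd(1)] span_minimal[OF Bd(3) subspace_span]])
  obtain B where B: "?X \<subseteq> B" "B \<subseteq> ?X \<union> Bd" "independent B" "?X \<union> Bd \<subseteq> span B"
    using maximal_independent_subset_extend[OF _ dual_independent[OF m], of "?X \<union> Bd"] by blast
  have XR: "?X \<union> B0 \<subseteq> Zn ?N" using ray_Zn B0 by auto
  then have XRn: "?X \<union> B0 \<subseteq> Rn ?N" by (auto simp: Zn_iff)
  have "span (?X \<union> span B0) \<subseteq> span B"
    by (rule span_minimal) (use B(4) span_mono[of Bd "span B"] spBd in \<open>auto simp: span_span\<close>)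
  then have "Rn ?N \<subseteq> span B" using span by blast
  moreover have "B \<subseteq> Rn ?N" using B(2) Bd(1) XRn by blast
  then have "span B \<subseteq> Rn ?N" by (rule span_minimal[OF _ subspace_Rn])
  ultimately have spB: "span B = Rn ?N" by blast
  have finb: "finite C \<and> card C \<le> ?N" if "independent C" "C \<subseteq> Rn ?N" for C
    using independent_span_bound[of "unit_fun ` {..<?N}" C] that unfolding Rn_span
    by (metis card_image_le card_lessThan finite_imageI finite_lessThan order_trans)
  have finB: "finite B" using finb[OF B(3)] B(2) Bd(1) XRn by blast
  have finBd: "finite Bd" using finb[OF Bd(2)] Bd(1) XRn by blast
  have cB: "card B = ?N" using dim_span_eq_card_independent[OF B(3)] spB dim_Rn by simp
  have cBd: "card Bd + (n - 3) = ?N" using dim_span_eq_card_independent[OF Bd(2)] spBd dimD by simp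
  have cX: "card ?X = n - 3" using card_image[OF inj] S(1) hier_finite[OF hN] cN by simp
  \<comment> \<open>The dimensions add up, so completing the rays to a basis uses every vector of
    \<open>Bd\<close>.\<close>
  have "card (B - ?X) = card Bd" using card_Diff_subset[OF _ B(1)] hier_finite[OF hN] cB cX cBd by simp
  then have BX: "B - ?X = Bd"
    using B(2) finBd by (intro card_subset_eq) auto
  obtain \<omega> where \<omega>: "\<forall>b\<in>B. linear (\<omega> b) \<and> (\<forall>b'\<in>B. \<omega> b b' = (of_bool (b = b') :: real))"
    using dual_basis[OF B(3)] by blast
  have BZ: "B \<subseteq> Zn ?N" using B(2) Bd(1) XR by blast
  let ?u = "ray n S"
  have uB: "?u \<in> B" using B(1) by blast
  have RB: "ray n R \<in> B" if "R \<in> \<N>" for R using that B(1) by blast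
  obtain d z0 where d: "0 < d" "z0 \<in> Zn ?N" "\<omega> ?u z0 = d" "\<forall>z\<in>Zn ?N. \<exists>j::int. \<omega> ?u z = of_int j * d"
    using integral_coordinate_discrete[OF finB BZ spB uB \<omega>] by blast
  \<comment> \<open>Division by the generator \<open>d\<close> makes \<open>h\<close> map the
    integral vectors onto the integers.\<close>
  define h where "h x = \<omega> ?u x / d" for x
  have lin: "linear (\<omega> b)" if "b \<in> B" for b using \<omega> that by blast
  have hl: "linear h"
    unfolding h_def by (rule linearI)
      (simp_all add: linear_add[OF lin[OF uB]] linear_scale[OF lin[OF uB]] add_divide_distrib)
  have zeroD: "\<omega> b x = 0" if b: "b \<in> ?X" and x: "x \<in> span B0" for b x
  proof -
    have "\<omega> b x = 0"
    proof (rule linear_eq_0_on_span[of "\<omega> b" Bd])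
      show "linear (\<omega> b)" using lin b B(1) by blast
      show "\<omega> b y = 0" if y: "y \<in> Bd" for y
      proof -
        have "y \<in> B" "y \<noteq> b" "b \<in> B" using y b BX B(1) by blast+
        then show ?thesis using \<omega> by auto
      qed
    qed (use x spBd in auto)
    then show ?thesis .
  qed
  have neq: "ray n R = ray n R' \<longleftrightarrow> R = R'" if "R \<in> insert S \<N>" "R' \<in> insert S \<N>" for R R'
    using inj that by (meson inj_onD)
  define Q where "Q = {a + b | a b. a \<in> Zn ?N \<inter> span (ray n ` \<N>) \<and> b \<in> Zn ?N \<inter> span B0}"
  have Q: "Q = {a + b | a b. a \<in> parallel_lattice ?N (scone (ray n) \<N>) \<and> b \<in> Zn ?N \<inter> span B0}"
    unfolding Q_def parallel_lattice_def direction_scone[OF mN] ..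
  let ?K = "{z \<in> Zn ?N. h z = 0}"
  have eqv: "equiv ?K (lat_rel ?K Q)"
    unfolding Q_def
  proof (rule equiv_lat_rel, goal_cases)
    case 1 show ?case by (rule lattice_sum_group(1)[OF subspace_span subspace_span])
  next
    case (2 x y) then show ?case by (rule lattice_sum_group(2)[OF subspace_span subspace_span])
  qed
  obtain T where T: "T \<subseteq> ?K" "\<forall>x\<in>?K. \<exists>t\<in>T. (x, t) \<in> lat_rel ?K Q"
    "\<forall>s\<in>T. \<forall>t\<in>T. (s, t) \<in> lat_rel ?K Q \<longrightarrow> s = t"
    using transversal_exists[OF eqv] by (elim exE conjE)
  interpret wall n \<N> q "span B0" h "\<lambda>R. \<omega> (ray n R)" z0 T
  proof (rule wall.intro)
    show "span B0 \<subseteq> Rn ?N" by (rule span_minimal) (use XRn subspace_Rn in auto)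
    show "h x = 0" if "x \<in> span B0" for x using zeroD[of ?u x] that by (simp add: h_def)
    show "h (ray n R) = 0" if "R \<in> \<N>" for R
    proof -
      have "?u \<noteq> ray n R" using neq[of S R] that S(1) by auto
      then show ?thesis using \<omega> uB RB[OF that] by (simp add: h_def)
    qed
    show "linear (\<omega> (ray n R))" if "R \<in> \<N>" for R using lin RB[OF that] by blast
    show "\<omega> (ray n R) x = 0" if "R \<in> \<N>" "x \<in> span B0" for R x using zeroD[of "ray n R" x] that by blast
    show "\<omega> (ray n R) (ray n R') = of_bool (R = R')" if "R \<in> \<N>" "R' \<in> \<N>" for R R'
      using \<omega> RB that neq[of R R'] by auto
    show "x - (\<Sum>R\<in>\<N>. \<omega> (ray n R) x *\<^sub>R ray n R) \<in> span B0" if x: "x \<in> Rn ?N" "h x = 0" for x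
    proof -
      have "x = (\<Sum>b\<in>B. \<omega> b x *\<^sub>R b)" by (rule basis_expand[OF finB \<omega>]) (use x spB in simp)
      also have "\<dots> = (\<Sum>b\<in>Bd. \<omega> b x *\<^sub>R b) + (\<Sum>b\<in>?X. \<omega> b x *\<^sub>R b)"
        using sum.subset_diff[OF B(1) finB, of "\<lambda>b. \<omega> b x *\<^sub>R b"] unfolding BX .
      also have "(\<Sum>b\<in>?X. \<omega> b x *\<^sub>R b) = (\<Sum>R\<in>insert S \<N>. \<omega> (ray n R) x *\<^sub>R ray n R)"
        by (rule sum.reindex[OF inj, unfolded comp_def])
      also have "\<dots> = (\<Sum>R\<in>\<N>. \<omega> (ray n R) x *\<^sub>R ray n R)"
        using x(2) d(1) S(1) hier_finite[OF hN] by (simp add: h_def)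
      finally have "x - (\<Sum>R\<in>\<N>. \<omega> (ray n R) x *\<^sub>R ray n R) = (\<Sum>b\<in>Bd. \<omega> b x *\<^sub>R b)"
        by (simp only: diff_eq_eq)
      also have "\<dots> \<in> span B0" unfolding spBd[symmetric] by (intro span_sum span_scale span_base)
      finally show ?thesis .
    qed
    show "h z \<in> \<int>" if "z \<in> Zn ?N" for z using d(1,4) that by (force simp: h_def)
    show "h z0 = 1" using d(1,3) by (simp add: h_def)
    show "T \<subseteq> Zn ?N" "\<And>t. t \<in> T \<Longrightarrow> h t = 0" using T(1) by auto
    show "\<exists>t\<in>T. x - t \<in> {a + b | a b. a \<in> parallel_lattice ?N (scone (ray n) \<N>) \<and> b \<in> Zn ?N \<inter> span B0}"
      if "x \<in> Zn ?N" "h x = 0" for x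
      unfolding Q[symmetric] using T(2) that unfolding lat_rel_def by blast
    show "s = t" if "s \<in> T" "t \<in> T"
      "s - t \<in> {a + b | a b. a \<in> parallel_lattice ?N (scone (ray n) \<N>) \<and> b \<in> Zn ?N \<inter> span B0}" for s t
      using that T(1,3) unfolding Q[symmetric] lat_rel_def by blast
  qed (use n hN cN q d(2) hl in auto)
  show ?thesis using eventually_iota by blast
qed

text \<open>A common point of \<open>F\<close> and \<open>L + v\<close> would put \<open>v\<close>
  into the proper subspace \<open>V\<close>.\<close>

lemma small_generic_disjoint:
  assumes V: "subspace V" "V \<subset> Rn N" and F: "F \<subseteq> V" and L: "L \<subseteq> V"
  shows "\<forall>\<^sub>F v in small_generic N. F \<inter> (+) v ` L = {}"
  using small_generic_avoid[OF subspace_imp_affine[OF V(1)] V(2)]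
proof eventually_elim
  case (elim v)
  show ?case
  proof (rule ccontr)
    assume "F \<inter> (+) v ` L \<noteq> {}"
    then obtain x where "x \<in> L" "v + x \<in> F" by blast
    then have "(v + x) - x \<in> V" using F L by (intro subspace_diff[OF V(1)]) auto
    then show False using elim by simp
  qed
qed

text \<open>An affine space can be based at any of its points; the one needed here is a point in the
  relative interior of the wall.\<close>

lemma transversal_fan:
  assumes "transversal N k E L" "x \<in> L"
  obtains B0 where "B0 \<subseteq> Zn N" "L = (+) x ` span B0" "dim (span B0) + k = N"
proof -
  obtain p B where pB: "p \<in> Rn N" "B \<subseteq> Zn N" "L = (+) p ` span B"
    using assms(1) unfolding transversal_def integral_affine_def by blast
  then obtain b where b: "x = p + b" "b \<in> span B" using assms(2) by blast
  have "(+) p ` span B = (+) x ` span B"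
  proof (intro equalityI subsetI)
    fix y assume "y \<in> (+) p ` span B"
    then obtain c where "y = p + c" "c \<in> span B" by blast
    then have "y = x + (c - b)" "c - b \<in> span B" using b by (auto intro: span_diff)
    then show "y \<in> (+) x ` span B" by blast
  next
    fix y assume "y \<in> (+) x ` span B"
    then obtain c where "y = x + c" "c \<in> span B" by blast
    then have "y = p + (b + c)" "b + c \<in> span B" using b by (auto intro: span_add)
    then show "y \<in> (+) p ` span B" by blast
  qed
  moreover have "dim (span B) + k = N"
    using assms(1) direction_translate[OF subspace_span, of p B] unfolding transversal_def pdim_def pB(3) by simp
  ultimately show ?thesis using that pB by simp
qed

lemma balanced_fan:
  assumes n: "3 \<le> n"
  shows "balanced (amb n) (n - 3) (fan n) (\<lambda>_. 1)"
  unfolding balanced_def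
proof (intro conjI allI impI polyhedral_complex_fan[OF n])
  let ?N = "amb n"
  fix E L assume EL: "codim1_face (n - 3) (fan n) E \<and> transversal ?N (n - 3) E L"
  obtain \<N> where N: "hier n \<N>" "card \<N> + 1 = n - 3" "E = scone (ray n) \<N>"
    using codim1_face_fan[OF n] EL by blast
  obtain q where q: "q \<in> L" "q \<in> relint ?N E" using EL unfolding transversal_def by blast
  obtain B0 where B0: "B0 \<subseteq> Zn ?N" "L = (+) q ` span B0" "dim (span B0) + (n - 3) = ?N"
    using transversal_fan EL q(1) by blast
  obtain m where m: "dual_system ?N \<N> (ray n) m"
    using separator_exists[OF N(1) n] dual_rays[OF N(1) n] by blast
  have qW: "q \<in> span (ray n ` \<N>)" using q(2) unfolding N(3) relint_scone[OF m] by blast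
  show "\<exists>c. \<forall>\<^sub>F v in small_generic ?N. iota ?N (fan n) (\<lambda>_. 1) E L v = c"
  proof (cases "\<exists>S. S \<notin> \<N> \<and> hier n (insert S \<N>) \<and> Rn ?N \<subseteq> span (ray n ` insert S \<N> \<union> span B0)")
    case True
    then show ?thesis
      unfolding N(3) B0(2) using iota_constant_spanning[OF n N(1,2) _ _ B0(1,3)] q(2) N(3) by blast
  next
    \<comment> \<open>Each facet at the wall lies together with \<open>L\<close> in a proper
      subspace, so generic translates of \<open>L\<close> meet none of them and the number is
      0.\<close>
    case False
    have "\<forall>\<^sub>F v in small_generic ?N. F \<inter> (+) v ` L = {}" if F: "F \<in> adjacent_facets (fan n) E" for F
    proof -
      obtain S where S: "S \<notin> \<N>" "hier n (insert S \<N>)" "F = scone (ray n) (insert S \<N>)"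
        using F unfolding N(3) adjacent_facets_fan[OF n N(1,2)] by blast
      obtain m' where m': "dual_system ?N (insert S \<N>) (ray n) m'"
        using separator_exists[OF S(2) n] dual_rays[OF S(2) n] by blast
      let ?V = "span (ray n ` insert S \<N> \<union> span B0)"
      have "?V \<subseteq> Rn ?N"
      proof (rule span_minimal[OF _ subspace_Rn])
        have "ray n ` insert S \<N> \<subseteq> Rn ?N" using ray_Zn by (auto simp: Zn_iff)
        moreover have "span B0 \<subseteq> Rn ?N" by (rule span_minimal[OF _ subspace_Rn]) (use B0(1) in \<open>auto simp: Zn_iff\<close>)
        ultimately show "ray n ` insert S \<N> \<union> span B0 \<subseteq> Rn ?N" by blast
      qed
      then have "?V \<subset> Rn ?N" using False S by blast
      moreover have "F \<subseteq> ?V"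
        unfolding S(3) using scone_span[OF m'] span_mono[of "ray n ` insert S \<N>" "ray n ` insert S \<N> \<union> span B0"] by blast
      moreover have "L \<subseteq> ?V"
        unfolding B0(2)
      proof (rule image_subsetI)
        fix y assume "y \<in> span B0"
        then have "y \<in> ?V" by (intro span_base) blast
        moreover have "q \<in> ?V" using qW span_mono[of "ray n ` \<N>" "ray n ` insert S \<N> \<union> span B0"] by blast
        ultimately show "q + y \<in> ?V" by (intro span_add)
      qed
      ultimately show ?thesis by (rule small_generic_disjoint[OF subspace_span])
    qed
    moreover have "finite (adjacent_facets (fan n) E)"
      unfolding adjacent_facets_def fan_def using finite_facets by simp
    ultimately have "\<forall>\<^sub>F v in small_generic ?N. \<forall>F\<in>adjacent_facets (fan n) E. F \<inter> (+) v ` L = {}"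
      by (intro eventually_ball_finite) auto
    then have "\<forall>\<^sub>F v in small_generic ?N. iota ?N (fan n) (\<lambda>_. 1) E L v = 0"
    proof eventually_elim
      case (elim v)
      then have "{F \<in> adjacent_facets (fan n) E. F \<inter> (+) v ` L \<noteq> {}} = {}" by blast
      then show ?case unfolding iota_def by (simp only: sum.empty)
    qed
    then show ?thesis by blast
  qed
qed

section \<open>Simple balancing\<close>

lemma affine_line:
  fixes a b :: "'a::real_vector"
  assumes "affine A" "a + s *\<^sub>R b \<in> A" "a + t *\<^sub>R b \<in> A" "s \<noteq> t"
  shows "a + r *\<^sub>R b \<in> A"
proof -
  let ?u = "(r - t) / (s - t)"
  have "?u *\<^sub>R (a + s *\<^sub>R b) + (1 - ?u) *\<^sub>R (a + t *\<^sub>R b) \<in> A"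
    by (rule mem_affine[OF assms(1-3)]) simp
  moreover have "u *\<^sub>R (a + s *\<^sub>R b) + (1 - u) *\<^sub>R (a + t *\<^sub>R b) = a + (t + u * (s - t)) *\<^sub>R b" for u
    by (simp add: algebra_simps)
  ultimately have "a + (t + ?u * (s - t)) *\<^sub>R b \<in> A" by simp
  also have "t + ?u * (s - t) = r" using assms(4) by simp
  finally show ?thesis .
qed

lemma affine_line_finite:
  fixes a b :: "'a::real_vector"
  assumes "affine A" "a + r *\<^sub>R b \<notin> A"
  shows "finite {s. a + s *\<^sub>R b \<in> A}"
proof (cases "\<exists>s. a + s *\<^sub>R b \<in> A")
  case True
  then obtain s where s: "a + s *\<^sub>R b \<in> A" by blast
  have "{s. a + s *\<^sub>R b \<in> A} \<subseteq> {s}" using affine_line[OF assms(1) s] assms(2) by blast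
  then show ?thesis using finite_subset by blast
qed simp

text \<open>Join a point off the earlier subspaces to a point off the new one. Each subspace misses
  some point of this line, so it meets the line at finitely many parameters only.\<close>

lemma finite_affine_avoid:
  assumes "finite \<A>" "\<And>A. A \<in> \<A> \<Longrightarrow> affine A \<and> A \<subset> Rn N"
  shows "\<exists>y\<in>Rn N. y \<notin> \<Union>\<A>"
  using assms
proof (induction \<A> rule: finite_induct)
  case empty
  then show ?case using zero_Rn by blast
next
  case (insert A \<A>)
  obtain y where y: "y \<in> Rn N" "y \<notin> \<Union>\<A>" using insert by blast
  obtain z where z: "z \<in> Rn N" "z \<notin> A" using insert(4)[of A] by blast
  have "finite (\<Union>B\<in>insert A \<A>. {s. y + s *\<^sub>R (z - y) \<in> B})"
  proof (intro finite_UN_I)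
    fix B assume B: "B \<in> insert A \<A>"
    have "\<exists>r. y + r *\<^sub>R (z - y) \<notin> B"
    proof (cases "B = A")
      case True then show ?thesis using z by (intro exI[of _ 1]) simp
    next
      case False then show ?thesis using y B by (intro exI[of _ 0]) auto
    qed
    then show "finite {s. y + s *\<^sub>R (z - y) \<in> B}" using affine_line_finite insert(4)[OF B] by blast
  qed (use insert(1) in simp)
  then obtain s where s: "s \<notin> (\<Union>B\<in>insert A \<A>. {s. y + s *\<^sub>R (z - y) \<in> B})"
    using ex_new_if_finite[OF infinite_UNIV_char_0] by blast
  have "y + s *\<^sub>R (z - y) \<in> Rn N"
    using y z subspace_Rn by (intro subspace_add subspace_scale subspace_diff) auto
  then show ?case using s by blast
qed

text \<open>Take one vector \<open>y\<close> off all excluded subspaces and off the kernel of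
  \<open>h\<close>. Among its small multiples of the sign that makes \<open>h\<close> positive, only
  finitely many are excluded.\<close>

lemma frequently_small_generic_pos:
  fixes h :: "(nat \<Rightarrow> real) \<Rightarrow> real"
  assumes h: "linear h" "z0 \<in> Rn N" "h z0 \<noteq> 0"
  shows "\<exists>\<^sub>F v in small_generic N. 0 < h v"
proof (rule ccontr)
  assume "\<not> ?thesis"
  then have "\<forall>\<^sub>F v in small_generic N. \<not> 0 < h v" unfolding frequently_def by simp
  then obtain S \<A> where S: "openin (Euclidean_space N) S" "0 \<in> S" "finite \<A>"
    "\<forall>A\<in>\<A>. affine A \<and> A \<subset> Rn N" "\<forall>v\<in>S - \<Union>\<A>. \<not> 0 < h v"
    unfolding eventually_small_generic by blast
  let ?K = "{v \<in> Rn N. h v = 0}"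
  have "subspace ?K"
    using subspace_Rn[of N]
    by (auto simp: subspace_def linear_add[OF h(1)] linear_scale[OF h(1)] linear_0[OF h(1)])
  then have "affine ?K" by (rule subspace_imp_affine)
  then obtain y where y: "y \<in> Rn N" "y \<notin> \<Union>(insert ?K \<A>)"
    using finite_affine_avoid[of "insert ?K \<A>" N] S(3,4) h(2,3) by blast
  have hy: "h y \<noteq> 0" using y by blast
  obtain V where V: "open V" "S = Rn N \<inter> V"
    using S(1) unfolding Euclidean_space_eq openin_open by blast
  have "continuous_on UNIV (\<lambda>s::real. s *\<^sub>R y)"
    by (rule continuous_on_coordinatewise_then_product) (auto intro!: continuous_intros)
  then have "open ((\<lambda>s::real. s *\<^sub>R y) -` V)" using V(1) by (rule open_vimage[rotated])
  moreover have "0 \<in> (\<lambda>s::real. s *\<^sub>R y) -` V" using S(2) V by simp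
  ultimately obtain e where e: "0 < e" "ball 0 e \<subseteq> (\<lambda>s::real. s *\<^sub>R y) -` V"
    unfolding open_contains_ball by blast
  let ?B = "\<Union>A\<in>\<A>. {s. 0 + s *\<^sub>R y \<in> A}"
  have finB: "finite ?B"
  proof (intro finite_UN_I S(3))
    fix A assume A: "A \<in> \<A>"
    then have "0 + 1 *\<^sub>R y \<notin> A" using y by auto
    then show "finite {s. 0 + s *\<^sub>R y \<in> A}" using affine_line_finite S(4) A by blast
  qed
  have "infinite ((\<lambda>s. s * sgn (h y)) ` {0<..<e})"
  proof
    assume "finite ((\<lambda>s. s * sgn (h y)) ` {0<..<e})"
    moreover have "inj_on (\<lambda>s. s * sgn (h y)) {0<..<e}" using hy by (auto simp: inj_on_def sgn_if)
    ultimately have "finite {0<..<e}" by (rule finite_imageD)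
    then show False using e(1) infinite_Ioo by blast
  qed
  then have "\<not> (\<lambda>s. s * sgn (h y)) ` {0<..<e} \<subseteq> ?B" using finB finite_subset by blast
  then obtain s where "s \<in> {0<..<e}" and s': "s * sgn (h y) \<notin> ?B"
    unfolding image_subset_iff by blast
  then have s: "0 < s" "s < e" by auto
  let ?v = "(s * sgn (h y)) *\<^sub>R y"
  have "s * sgn (h y) \<in> ball 0 e" using s hy by (simp add: dist_norm abs_mult abs_sgn_eq)
  then have "?v \<in> V" using e(2) by blast
  then have "?v \<in> S" using V y(1) subspace_Rn by (auto intro: subspace_scale)
  moreover have "?v \<notin> \<Union>\<A>" using s' by auto
  moreover have "0 < h ?v"
    using s(1) hy by (simp add: linear_scale[OF h(1)] mult.assoc sgn_mult_self_eq mult.commute[of "sgn (h y)"] abs_sgn[symmetric])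
  ultimately show False using S(5) by blast
qed

text \<open>The dual coordinates are differences between a node and its cover. Adding them up
  towards the root shows that the two ultrametrics differ by one and the same constant on all
  representatives.\<close>

lemma val_chain:
  assumes h: "hier n \<P>" and n: "3 \<le> n" and p: "separator n \<P> p"
    and eq: "\<And>R. R \<in> \<P> \<Longrightarrow> pt n l (dcoord n \<P> p R) = pt n l' (dcoord n \<P> p R)"
    and R: "R \<in> insert {1..<n} \<P>"
  shows "val n l (p R) = val n l' (p R) + (val n l (p {1..<n}) - val n l' (p {1..<n}))"
  using R
proof (induction "n - card R" arbitrary: R rule: less_induct)
  case less
  show ?case
  proof (cases "R = {1..<n}")
    case False
    then have R: "R \<in> \<P>" using less(2) by blast
    note c = cover_mem[OF h n R]
    let ?M = "cover (ext n \<P>) R"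
    have sub: "?M \<subseteq> {1..<n}" using c(1) h unfolding hier_def clusters_def by auto
    then have "card R < card ?M" using c(2) finite_subset by (intro psubset_card_mono) auto
    moreover have "card ?M \<le> card {1..<n}" using sub by (intro card_mono) auto
    ultimately have "n - card ?M < n - card R" using n by simp
    from less(1)[OF this c(1)] have IH: "val n l (p ?M) = val n l' (p ?M) + (val n l (p {1..<n}) - val n l' (p {1..<n}))" .
    have "p R \<in> pairs n" "p ?M \<in> pairs n" using separator_pairs[OF p] c(1) R by auto
    then have "val n l (p R) - val n l (p ?M) = val n l' (p R) - val n l' (p ?M)"
      using eq[OF R] unfolding dcoord_def by (simp add: pt_qidx)
    then show ?thesis using IH by simp
  qed simp
qed

text \<open>Exchanging the representatives of a new cluster \<open>S\<close> and of its cover \<open>M\<close>, a spanning tree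
  for one resolution of a 4-valent vertex becomes one for a second resolution \<open>S'\<close>.\<close>

lemma separator_exchange:
  assumes n: "3 \<le> n" and h: "hier n (insert S \<N>)" "hier n (insert S' \<N>)" and S: "S \<notin> \<N>" "S' \<notin> \<N>"
    and p: "separator n (insert S \<N>) p" and M: "M = cover (ext n (insert S \<N>)) S"
    and S': "S' \<subset> M" "p M \<subseteq> S'" "\<not> p S \<subseteq> S'"
  shows "separator n (insert S' \<N>) (p(M := p S, S' := p M))"
proof -
  let ?p = "p(M := p S, S' := p M)"
  have hN: "hier n \<N>" by (rule hier_subset[OF h(1)]) blast
  note c = cover_mem[OF h(1) n, of S, folded M]
  have MN: "M \<in> insert {1..<n} \<N>" "S \<subset> M" using c by auto
  have clS': "S' \<in> clusters n" using h(2) unfolding hier_def by blast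
  have S'I: "S' \<noteq> {1..<n}" using clustersD(3)[OF clS'] .
  have S'1: "S' \<notin> ext n \<N>" using S(2) S'I clustersD(2)[OF clS'] unfolding ext_def by auto
  have S1: "S \<notin> ext n \<N>"
    using S(1) h(1) clustersD(2,3)[of S n] unfolding ext_def hier_def by auto
  have ext: "ext n (insert S \<N>) = insert S (ext n \<N>)" "ext n (insert S' \<N>) = insert S' (ext n \<N>)"
    unfolding ext_def by auto
  have pe: "p R \<subseteq> Q \<longleftrightarrow> R \<subseteq> Q" if "R \<in> insert {1..<n} (insert S \<N>)" "Q \<in> ext n \<N>" for R Q
    using separator_ext[OF p that(1), of Q] that(2) ext by blast
  \<comment> \<open>\<open>M\<close> is the cover of \<open>S\<close>, so the remaining members
    cannot tell \<open>S\<close> from \<open>M\<close>. Among them, \<open>p S\<close> represents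
    \<open>M\<close> as well.\<close>
  have SQ: "S \<subseteq> Q \<longleftrightarrow> M \<subseteq> Q" if Q: "Q \<in> ext n \<N>" for Q
  proof
    interpret full_hierarchy "{1..<n}" "ext n (insert S \<N>)" by (rule full_hierarchy_ext) (use h n in auto)
    assume "S \<subseteq> Q"
    then have "S \<subset> Q" using S1 Q by blast
    moreover have "S \<in> ext n (insert S \<N>)" "Q \<in> ext n (insert S \<N>)" using Q ext by auto
    moreover have "S \<noteq> {1..<n}" using h(1) unfolding hier_def clusters_def by blast
    ultimately show "M \<subseteq> Q" using cover(3)[of S Q] M by blast
  qed (use MN in blast)
  have Min: "M \<in> ext n \<N>" using MN(1) unfolding ext_def by blast
  interpret f: full_hierarchy "{1..<n}" "ext n (insert S' \<N>)" by (rule full_hierarchy_ext) (use h n in auto)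
  show ?thesis
    unfolding separator_def
  proof (intro ballI)
    fix R assume R: "R \<in> insert {1..<n} (insert S' \<N>)"
    have pairs: "p Q \<subseteq> {1..<n} \<and> card (p Q) = 2" if "Q \<in> insert {1..<n} (insert S \<N>)" for Q
      using separator_pairs[OF p that] unfolding pairs_def by blast
    consider "R = S'" | "R = M" "R \<noteq> S'" | "R \<noteq> M" "R \<noteq> S'" "R \<in> insert {1..<n} \<N>" using R by blast
    then show "?p R \<subseteq> {1..<n} \<and> card (?p R) = 2 \<and> (\<forall>Q\<in>ext n (insert S' \<N>). (?p R \<subseteq> Q) = (R \<subseteq> Q))"
    proof cases
      case 1
      have "(p M \<subseteq> Q) = (S' \<subseteq> Q)" if "Q \<in> insert S' (ext n \<N>)" for Q
      proof (cases "Q = S'")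
        case False
        then have "Q \<in> ext n \<N>" using that by blast
        then have "p M \<subseteq> Q \<longleftrightarrow> M \<subseteq> Q" using pe[of M Q] MN by blast
        then show ?thesis using S' by blast
      qed (use S' in blast)
      moreover have "p M \<subseteq> {1..<n} \<and> card (p M) = 2" using pairs[of M] MN(1) by blast
      ultimately show ?thesis using 1 unfolding ext by simp
    next
      case 2
      have "(p S \<subseteq> Q) = (M \<subseteq> Q)" if "Q \<in> insert S' (ext n \<N>)" for Q
      proof (cases "Q = S'")
        case False
        then have "Q \<in> ext n \<N>" using that by blast
        then show ?thesis using pe[of S Q] SQ by blast
      qed (use S' in blast)
      then show ?thesis using 2 pairs[of S] unfolding ext by simp
    next
      case 3
      have Re: "R \<in> ext n \<N>" using 3(3) unfolding ext_def by blast
      have "(p R \<subseteq> Q) = (R \<subseteq> Q)" if "Q \<in> insert S' (ext n \<N>)" for Q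
      proof (cases "Q = S'")
        case False
        then have "Q \<in> ext n \<N>" using that by blast
        then show ?thesis using pe[of R Q] 3(3) by blast
      next
        case True
        have pR: "p R \<subseteq> R" using pe[of R R] Re 3(3) by blast
        show ?thesis
          unfolding True
        proof
          assume pS': "p R \<subseteq> S'"
          have "p R \<noteq> {}" using pairs[of R] 3(3) by auto
          then obtain x where x: "x \<in> p R" by blast
          have "R \<subseteq> S' \<or> S' \<subseteq> R"
            by (rule laminarD[OF f.laminar, of _ _ x]) (use Re ext x pR pS' in auto)
          \<comment> \<open>If \<open>R\<close> contains \<open>S'\<close>, it contains
            \<open>p M\<close> and hence \<open>M\<close>; as \<open>p R\<close> lies in
            \<open>M\<close>, also \<open>R\<close> lies in \<open>M\<close>. Then
            \<open>R = M\<close>, which is excluded in this case.\<close>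
          moreover have False if "S' \<subseteq> R"
          proof -
            have "p M \<subseteq> R" using S' that by blast
            then have "M \<subseteq> R" using pe[of M R] MN Re by blast
            moreover have "R \<subseteq> M" using pS' S' pe[of R M] Min 3(3) by blast
            ultimately show False using 3(1) by blast
          qed
          ultimately show "R \<subseteq> S'" by blast
        qed (use pR in blast)
      qed
      then show ?thesis using 3 pairs[of R] unfolding ext by auto
    qed
  qed
qed

lemma dot_unit_fun_sum:
  assumes "finite A" "\<And>a. a \<in> A \<Longrightarrow> f a < N"
  shows "dot N (- (\<Sum>a\<in>A. unit_fun (f a))) x = - (\<Sum>a\<in>A. x (f a))"
proof -
  have "dot N (\<Sum>a\<in>A. unit_fun (f a)) x = (\<Sum>i<N. \<Sum>a\<in>A. unit_fun (f a) i * x i)"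
    unfolding dot_def sum_fun_apply sum_distrib_right ..
  also have "\<dots> = (\<Sum>a\<in>A. \<Sum>i<N. unit_fun (f a) i * x i)" by (rule sum.swap)
  also have "\<dots> = (\<Sum>a\<in>A. x (f a))"
  proof (rule sum.cong[OF refl])
    fix a assume "a \<in> A"
    then show "(\<Sum>i<N. unit_fun (f a) i * x i) = x (f a)"
      using assms(2) unfolding unit_fun_def by (simp add: if_distrib if_distribR cong: if_cong)
  qed
  finally have "dot N (\<Sum>a\<in>A. unit_fun (f a)) x = (\<Sum>a\<in>A. x (f a))" .
  then show ?thesis by (simp add: dot_def sum_negf)
qed

text \<open>Subtracting the value at the base pair \<open>P0\<close> removes the constant, so the
  ultrametric of the family is smallest coordinate by coordinate. Equal sums then force equal terms,
  and these determine all coordinates.\<close>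

lemma pt_minimal:
  assumes h: "hier n \<M>" and n: "3 \<le> n" and c: "card \<M> = n - 3" and p: "separator n \<M> p"
    and l: "l \<in> weights n" "{S. l S \<noteq> 0} \<subseteq> \<M>" and l': "l' \<in> weights n"
    and eq: "\<And>S. S \<in> insert {1..<n} \<M> \<Longrightarrow> val n l' (p S) = val n l (p S) + (val n l' P0 - val n l P0)"
    and P0: "P0 \<in> pairs n"
  shows "(\<Sum>P\<in>pairs n. pt n l (qidx n (P, P0))) \<le> (\<Sum>P\<in>pairs n. pt n l' (qidx n (P, P0)))"
    and "(\<Sum>P\<in>pairs n. pt n l (qidx n (P, P0))) = (\<Sum>P\<in>pairs n. pt n l' (qidx n (P, P0))) \<Longrightarrow> pt n l' = pt n l"
proof -
  have le: "pt n l (qidx n (P, P0)) \<le> pt n l' (qidx n (P, P0))" if P: "P \<in> pairs n" for P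
    using val_binary_minimal[OF h n c p l l' eq P] unfolding pt_qidx[OF P P0] by simp
  then show "(\<Sum>P\<in>pairs n. pt n l (qidx n (P, P0))) \<le> (\<Sum>P\<in>pairs n. pt n l' (qidx n (P, P0)))"
    by (rule sum_mono)
  assume s: "(\<Sum>P\<in>pairs n. pt n l (qidx n (P, P0))) = (\<Sum>P\<in>pairs n. pt n l' (qidx n (P, P0)))"
  have e: "pt n l (qidx n (P, P0)) = pt n l' (qidx n (P, P0))" if P: "P \<in> pairs n" for P
    using sum_mono_inv[OF s le P finite_pairs] .
  have "val n l P - val n l Q = val n l' P - val n l' Q" if "P \<in> pairs n" "Q \<in> pairs n" for P Q
    using e[OF that(1)] e[OF that(2)] unfolding pt_qidx[OF that(1) P0] pt_qidx[OF that(2) P0] by simp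
  then show "pt n l' = pt n l"
    unfolding pt_def using quad_mem by (intro ext) (auto simp: coords_def mem_Times_iff)
qed

locale flag =
  fixes n \<N> S p
  assumes n: "3 \<le> n" and hN: "hier n \<N>" and cN: "card \<N> + 1 = n - 3"
    and S: "S \<notin> \<N>" "hier n (insert S \<N>)" and p: "separator n (insert S \<N>) p"
begin

abbreviation "m \<equiv> dcoord n (insert S \<N>) p"
abbreviation "N \<equiv> amb n"
abbreviation "P0 \<equiv> p {1..<n}"

text \<open>All coefficients of \<open>q\<close> are 1, which leaves room for translations whose
  dual coordinates are below 1/2.\<close>

definition "q = (\<Sum>R\<in>\<N>. ray n R)"
definition "B = unit_fun ` ({..<N} - m ` insert S \<N>)"
definition "L = (+) q ` span B"

lemma m: "dual_system N (insert S \<N>) (ray n) m"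
  by (rule dual_rays[OF S(2) n p])

lemma mN: "dual_system N \<N> (ray n) m"
  by (rule dual_system_subset[OF m]) blast

lemma mless: "R \<in> insert S \<N> \<Longrightarrow> m R < N"
  using m unfolding dual_system_def by blast

lemma ray_m: "R \<in> insert S \<N> \<Longrightarrow> R' \<in> insert S \<N> \<Longrightarrow> ray n R (m R') = of_bool (R = R')"
  using m unfolding dual_system_def by blast

lemma finN: "finite \<N>" by (rule hier_finite[OF hN])

lemma q_m: "R \<in> insert S \<N> \<Longrightarrow> q (m R) = of_bool (R \<in> \<N>)"
proof -
  assume R: "R \<in> insert S \<N>"
  have "(\<Sum>i\<in>\<N>. 1 *\<^sub>R ray n i) (m R) = (if R \<in> \<N> then 1 else 0)"
    by (rule dual_coord_subset[OF m R]) blast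
  then show ?thesis unfolding q_def by simp
qed

lemma q_Rn: "q \<in> Rn N"
proof -
  have "q \<in> Zn N" unfolding q_def by (rule Zn_sum) (rule ray_Zn)
  then show ?thesis by (simp add: Zn_iff)
qed

lemma span_B: "x \<in> span B \<longleftrightarrow> x \<in> Rn N \<and> (\<forall>R\<in>insert S \<N>. x (m R) = 0)"
proof -
  have "span B = {x. \<forall>j. j \<notin> {..<N} - m ` insert S \<N> \<longrightarrow> x j = 0}"
    unfolding B_def by (rule span_unit_fun) simp
  then show ?thesis using mless unfolding Rn_iff by auto
qed

lemma inj_m: "inj_on m (insert S \<N>)"
proof (rule inj_onI)
  fix R R' assume R: "R \<in> insert S \<N>" "R' \<in> insert S \<N>" "m R = m R'"
  have "of_bool (R = R) = (of_bool (R = R') :: real)"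
    using ray_m[OF R(1,1)] ray_m[OF R(1,2)] R(3) by simp
  then show "R = R'" by (cases "R = R'") auto
qed

lemma q_relint: "q \<in> relint N (scone (ray n) \<N>)"
proof -
  have "q \<in> span (ray n ` \<N>)" unfolding q_def by (intro span_sum span_base) auto
  then show ?thesis unfolding relint_scone[OF mN] using q_m by simp
qed

lemma dim_B: "dim (span B) + (n - 3) = N"
proof -
  have "dim (span B) = card ({..<N} - m ` insert S \<N>)"
    unfolding B_def by (rule dual_dim[OF dual_system_unit]) auto
  also have "\<dots> = N - card (m ` insert S \<N>)"
    by (subst card_Diff_subset) (use mless finN in auto)
  also have "card (m ` insert S \<N>) = n - 3"
    unfolding card_image[OF inj_m] using S(1) finN cN by simp
  finally have 1: "dim (span B) = N - (n - 3)" .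
  have "card (m ` insert S \<N>) \<le> card {..<N}" by (rule card_mono) (use mless in auto)
  then show ?thesis using 1 \<open>card (m ` insert S \<N>) = n - 3\<close> by simp
qed

lemma transversal_L: "transversal N (n - 3) (scone (ray n) \<N>) L"
  unfolding transversal_def
proof (intro conjI)
  have "B \<subseteq> Zn N" unfolding B_def using unit_fun_Zn by auto
  then show "integral_affine N L" unfolding integral_affine_def L_def using q_Rn by blast
  show "pdim L + (n - 3) = N"
    unfolding pdim_def L_def direction_translate[OF subspace_span] by (rule dim_B)
  have "q \<in> L" unfolding L_def using span_zero by (intro image_eqI[of _ _ 0]) auto
  then show "L \<inter> relint N (scone (ray n) \<N>) \<noteq> {}" using q_relint by blast
qed

text \<open>All functionals are entries here, so an integral vector in the kernel of
  \<open>h\<close> splits into integral multiples of rays and an integral vector of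
  \<open>span B\<close>. Hence 0 alone represents all classes.\<close>

lemma wall_S: "wall n \<N> q (span B) (\<lambda>x. x (m S)) (\<lambda>R x. x (m R)) (ray n S) {0}"
proof (rule wall.intro)
  let ?Q = "{a + b | a b. a \<in> parallel_lattice N (scone (ray n) \<N>) \<and> b \<in> Zn N \<inter> span B}"
  have decomp: "x - (\<Sum>R\<in>\<N>. x (m R) *\<^sub>R ray n R) \<in> span B" if x: "x \<in> Rn N" "x (m S) = 0" for x
  proof -
    have "(\<Sum>R\<in>\<N>. x (m R) *\<^sub>R ray n R) \<in> Rn N"
      by (intro subspace_sum[OF subspace_Rn] subspace_scale[OF subspace_Rn]) (use ray_Zn in \<open>auto simp: Zn_iff\<close>)
    moreover have "(\<Sum>R\<in>\<N>. x (m R) *\<^sub>R ray n R) (m R') = (if R' \<in> \<N> then x (m R') else 0)"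
      if "R' \<in> insert S \<N>" for R'
      by (rule dual_coord_subset[OF m that]) blast
    ultimately show ?thesis
      unfolding span_B using x subspace_diff[OF subspace_Rn] by (auto simp del: sum_fun_apply)
  qed
  show "\<exists>t\<in>{0}. x - t \<in> ?Q" if x: "x \<in> Zn N" "x (m S) = 0" for x
  proof -
    let ?y = "\<Sum>R\<in>\<N>. x (m R) *\<^sub>R ray n R"
    have "?y \<in> parallel_lattice N (scone (ray n) \<N>)"
      unfolding parallel_lattice_scone[OF mN] using x(1) by (intro exI[of _ "\<lambda>R. x (m R)"]) (auto simp: Zn_iff)
    moreover have "x - ?y \<in> span B" using decomp x by (simp add: Zn_iff)
    moreover have "x - ?y \<in> Zn N" by (intro Zn_diff Zn_sum Zn_scale x ray_Zn) (use x in \<open>simp add: Zn_iff\<close>)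
    moreover have "x - 0 = ?y + (x - ?y)" by simp
    ultimately show ?thesis by blast
  qed
  show "x - (\<Sum>R\<in>\<N>. x (m R) *\<^sub>R ray n R) \<in> span B" if "x \<in> Rn N" "x (m S) = 0" for x
    by (rule decomp[OF that])
  show "span B \<subseteq> Rn N" using span_B by blast
  show "x (m R) \<in> \<int>" if "x \<in> Zn N" for x R using that by (simp add: Zn_iff)
  show "ray n R (m S) = 0" if "R \<in> \<N>" for R using ray_m[of R S] that S(1) by auto
  show "ray n R' (m R) = of_bool (R = R')" if "R \<in> \<N>" "R' \<in> \<N>" for R R'
    using ray_m[of R' R] that by auto
  show "ray n S (m S) = 1" using ray_m[of S S] by simp
qed (use n hN cN q_relint ray_Zn Zn_0 span_B linear_coord in \<open>auto simp: subspace_span\<close>)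

text \<open>Entries of rays are differences of two indicators, so they are -1, 0 or 1. The three
  entries at position \<open>m S\<close> add up to 0 and the one of \<open>S\<close> is 1; the other
  two can only be -1 and 0.\<close>

lemma ternary_values:
  obtains S' S'' where "{R. R \<notin> \<N> \<and> hier n (insert R \<N>)} = {S, S', S''}" "S \<noteq> S'" "S \<noteq> S''" "S' \<noteq> S''"
    "ray n S' (m S) = -1" "ray n S'' (m S) = 0" "S' \<subset> cover (ext n (insert S \<N>)) S"
proof -
  interpret w: wall n \<N> q "span B" "\<lambda>x. x (m S)" "\<lambda>R x. x (m R)" "ray n S" "{0}" by (rule wall_S)
  obtain M A B' C where M: "M \<in> insert {1..<n} \<N>" "children (ext n \<N>) M = {A, B', C}"
    "A \<noteq> B'" "A \<noteq> C" "B' \<noteq> C" "w.US = {A \<union> B', A \<union> C, B' \<union> C}"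
    by (rule ternary_node[OF hN n cN])
  interpret f: full_hierarchy "{1..<n}" "ext n \<N>" by (rule full_hierarchy_ext) (use hN n in auto)
  have ch: "A \<in> children (ext n \<N>) M" "B' \<in> children (ext n \<N>) M" "C \<in> children (ext n \<N>) M"
    using M by auto
  have disj: "A \<inter> B' = {}" "A \<inter> C = {}" "B' \<inter> C = {}" using f.children_disjoint ch M(3-5) by auto
  have ne: "A \<noteq> {}" "B' \<noteq> {}" "C \<noteq> {}" using f.nonempty f.childrenD(1) ch by blast+
  have sub: "A \<subset> M" "B' \<subset> M" "C \<subset> M" using f.childrenD(2) ch by auto
  have neq: "A \<union> B' \<noteq> A \<union> C" "A \<union> B' \<noteq> B' \<union> C" "A \<union> C \<noteq> B' \<union> C" using disj ne by blast+
  have SM: "S \<in> {A \<union> B', A \<union> C, B' \<union> C}" using S M(6) by blast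
  have USM: "R \<subset> M" if "R \<in> w.US" for R
    using that unfolding M(6) using sub disj ne by blast
  have card3: "card w.US = 3" unfolding M(6) using neq by simp
  have "S \<in> w.US" using S by blast
  then have "card (w.US - {S}) = 2" using card3 by (simp add: w.finite_US)
  then obtain X Y where XY: "w.US - {S} = {X, Y}" "X \<noteq> Y" by (auto simp: card_2_iff)
  have US: "w.US = {S, X, Y}" "S \<noteq> X" "S \<noteq> Y" using XY \<open>S \<in> w.US\<close> by blast+
  have cov: "cover (ext n (insert S \<N>)) S = M"
  proof
    interpret g: full_hierarchy "{1..<n}" "ext n (insert S \<N>)" by (rule full_hierarchy_ext) (use S n in auto)
    have Se: "S \<in> ext n (insert S \<N>)" "S \<noteq> {1..<n}"
      using S(2) unfolding ext_def hier_def clusters_def by auto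
    have Me: "M \<in> ext n (insert S \<N>)" using M(1) unfolding ext_def by blast
    show "cover (ext n (insert S \<N>)) S \<subseteq> M" by (rule g.cover(3)[OF Se Me USM[OF \<open>S \<in> w.US\<close>]])
    have "cover (ext n (insert S \<N>)) S \<in> ext n (insert S \<N>)" "S \<subset> cover (ext n (insert S \<N>)) S"
      using g.cover[OF Se] by auto
    then have c: "cover (ext n (insert S \<N>)) S \<in> ext n \<N>" "S \<subset> cover (ext n (insert S \<N>)) S"
      unfolding ext_def by auto
    obtain Z where "Z \<in> children (ext n \<N>) M" "Z \<subseteq> S" using SM ch by blast
    then show "M \<subseteq> cover (ext n (insert S \<N>)) S" using f.childrenD(3)[of Z M] c by blast
  qed
  have vals: "ray n R (m S) \<in> {-1, 0, 1}" for R unfolding ray_def by auto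
  have "(\<Sum>R\<in>w.US. ray n R (m S)) = 0" by (rule w.h_sum)
  then have s: "ray n X (m S) + ray n Y (m S) = -1"
    unfolding US(1) using US(2,3) XY(2) ray_m[of S S] by simp
  have XYM: "X \<subset> M" "Y \<subset> M" using USM US(1) by blast+
  have "(ray n X (m S) = -1 \<and> ray n Y (m S) = 0) \<or> (ray n X (m S) = 0 \<and> ray n Y (m S) = -1)"
    using s vals[of X] vals[of Y] by auto
  then show ?thesis
  proof
    assume "ray n X (m S) = -1 \<and> ray n Y (m S) = 0"
    then show ?thesis using that[of X Y] US XY(2) XYM cov by blast
  next
    assume "ray n X (m S) = 0 \<and> ray n Y (m S) = -1"
    moreover have "w.US = {S, Y, X}" using US(1) by blast
    ultimately show ?thesis by (intro that[of Y X]) (use US(2,3) XY(2) XYM cov in auto)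
  qed
qed

text \<open>Of the three rays only that of \<open>S\<close> has a positive entry at
  \<open>m S\<close>, namely 1, and the class set \<open>{0}\<close> has one element.\<close>

lemma iota_1: "\<forall>\<^sub>F v in small_generic N. iota N (fan n) (\<lambda>_. 1) (scone (ray n) \<N>) L v = 1"
proof -
  interpret w: wall n \<N> q "span B" "\<lambda>x. x (m S)" "\<lambda>R x. x (m R)" "ray n S" "{0}" by (rule wall_S)
  obtain S' S'' where S': "w.US = {S, S', S''}" "S \<noteq> S'" "S \<noteq> S''" "S' \<noteq> S''"
    "ray n S' (m S) = -1" "ray n S'' (m S) = 0"
    by (rule ternary_values)
  have "(\<Sum>R\<in>w.US. nat \<lfloor>max 0 (ray n R (m S))\<rfloor>) = 1"
    unfolding S'(1) using S'(2-6) ray_m[of S S] by simp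
  then show ?thesis using w.eventually_iota unfolding L_def by simp
qed

lemma frequently_meets: "\<exists>\<^sub>F v in small_generic N. scone (ray n) (insert S \<N>) \<inter> (+) v ` L \<noteq> {}"
proof -
  interpret w: wall n \<N> q "span B" "\<lambda>x. x (m S)" "\<lambda>R x. x (m R)" "ray n S" "{0}" by (rule wall_S)
  have S1: "ray n S (m S) = 1" using ray_m[of S S] by simp
  have "\<exists>\<^sub>F v in small_generic N. 0 < v (m S)"
    by (rule frequently_small_generic_pos[OF linear_coord, of "ray n S"]) (use ray_Zn[of n S] S1 in \<open>auto simp: Zn_iff\<close>)
  then show ?thesis
  proof (rule frequently_rev_mp)
    show "\<forall>\<^sub>F v in small_generic N. 0 < v (m S) \<longrightarrow> scone (ray n) (insert S \<N>) \<inter> (+) v ` L \<noteq> {}"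
      using w.meets_facet by eventually_elim (use S S1 in \<open>auto simp: L_def\<close>)
  qed
qed

lemma mem_translate_L:
  assumes "v \<in> Rn N"
  shows "y \<in> (+) v ` L \<longleftrightarrow> y \<in> Rn N \<and> (\<forall>R\<in>insert S \<N>. y (m R) = q (m R) + v (m R))"
proof -
  have "y \<in> (+) v ` L \<longleftrightarrow> y - v - q \<in> span B"
  proof
    assume "y - v - q \<in> span B"
    then have "v + (q + (y - v - q)) \<in> (+) v ` L" unfolding L_def by blast
    then show "y \<in> (+) v ` L" by simp
  qed (auto simp: L_def)
  also have "\<dots> \<longleftrightarrow> y \<in> Rn N \<and> (\<forall>R\<in>insert S \<N>. y (m R) = q (m R) + v (m R))"
  proof -
    have "y - v - q \<in> Rn N \<longleftrightarrow> y \<in> Rn N"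
      using assms q_Rn by (simp add: Rn_iff)
    moreover have "(y - v - q) (m R) = 0 \<longleftrightarrow> y (m R) = q (m R) + v (m R)" for R by auto
    ultimately show ?thesis unfolding span_B by simp
  qed
  finally show ?thesis .
qed

text \<open>The maximizing point lies in the facet of \<open>S\<close> when the \<open>S\<close>-coordinate of \<open>v\<close> is nonnegative,
  and in the facet of \<open>S'\<close> otherwise.\<close>

lemma extremal_point:
  assumes v: "v \<in> Rn N" "\<And>R. R \<in> insert S \<N> \<Longrightarrow> \<bar>v (m R)\<bar> < 1/2"
  obtains \<M> p' l where "hier n \<M>" "card \<M> = n - 3" "separator n \<M> p'"
    "p' ` insert {1..<n} \<M> \<subseteq> p ` insert {1..<n} (insert S \<N>)"
    "l \<in> weights n" "{R. l R \<noteq> 0} \<subseteq> \<M>" "\<And>R. R \<in> insert S \<N> \<Longrightarrow> pt n l (m R) = q (m R) + v (m R)"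
proof -
  let ?t = "\<lambda>R. q (m R) + v (m R)"
  have card: "card (insert R \<N>) = n - 3" if "R \<notin> \<N>" for R using that finN cN by simp
  show ?thesis
  proof (cases "0 \<le> v (m S)")
    case True
    let ?l = "\<lambda>R. if R \<in> insert S \<N> then ?t R else 0"
    have supp: "{R. ?l R \<noteq> 0} \<subseteq> insert S \<N>" by auto
    have nonneg: "0 \<le> ?t R" if "R \<in> insert S \<N>" for R
    proof (cases "R = S")
      case False
      then show ?thesis using v(2)[OF that] q_m[OF that] that by auto
    qed (use True q_m[of S] in auto)
    have "pt n ?l (m R) = ?t R" if "R \<in> insert S \<N>" for R
      unfolding pt_sum[OF S(2) supp] dual_coord[OF m that] using that by simp
    moreover have "?l \<in> weights n"
      unfolding weights_def using nonneg hier_subset[OF S(2) supp] by auto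
    ultimately show ?thesis using that[OF S(2) card[OF S(1)] p subset_refl _ supp] by blast
  next
    case False
    define M where "M = cover (ext n (insert S \<N>)) S"
    obtain S' S'' where S': "{R. R \<notin> \<N> \<and> hier n (insert R \<N>)} = {S, S', S''}" "S \<noteq> S'"
      "ray n S' (m S) = -1" "S' \<subset> M"
      unfolding M_def by (rule ternary_values) blast
    have hS': "S' \<notin> \<N>" "hier n (insert S' \<N>)" using S'(1) by blast+
    have MN: "M \<in> insert {1..<n} (insert S \<N>)" unfolding M_def by (rule cover_mem(1)[OF S(2) n]) blast
    have "p S \<in> pairs n" "p M \<in> pairs n" using separator_pairs[OF p] MN by auto
    \<comment> \<open>The entry -1 says that \<open>p M\<close> lies in \<open>S'\<close> and
      \<open>p S\<close> does not, which is what the exchange of representatives requires.\<close>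
    then have "of_bool (p S \<subseteq> S') - of_bool (p M \<subseteq> S') = (-1 :: real)"
      using S'(3) unfolding dcoord_def M_def[symmetric] by (simp add: ray_qidx)
    then have pS': "p M \<subseteq> S'" "\<not> p S \<subseteq> S'" by (cases "p S \<subseteq> S'"; cases "p M \<subseteq> S'"; simp)+
    let ?p = "p(M := p S, S' := p M)"
    have sep: "separator n (insert S' \<N>) ?p"
      by (rule separator_exchange[OF n S(2) hS'(2) S(1) hS'(1) p M_def S'(4) pS'])
    have im: "?p ` insert {1..<n} (insert S' \<N>) \<subseteq> p ` insert {1..<n} (insert S \<N>)"
    proof (rule image_subsetI)
      fix R assume "R \<in> insert {1..<n} (insert S' \<N>)"
      then show "?p R \<in> p ` insert {1..<n} (insert S \<N>)" using MN by (cases "R = S'"; cases "R = M") auto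
    qed
    \<comment> \<open>The weight of \<open>S'\<close> is forced by its entry -1 at
      \<open>m S\<close>. The weights of the wall then absorb the other entries of
      \<open>ray n S'\<close>.\<close>
    let ?l = "\<lambda>R. if R = S' then - ?t S else if R \<in> \<N> then ?t R + ?t S * ray n S' (m R) else 0"
    have supp: "{R. ?l R \<noteq> 0} \<subseteq> insert S' \<N>" by auto
    have tS: "?t S = v (m S)" using q_m[of S] S(1) by simp
    have "0 \<le> ?l R" for R
    proof (cases "R \<in> \<N>")
      case True
      have r: "ray n S' (m R) \<in> {-1, 0, 1}" unfolding ray_def by auto
      \<comment> \<open>The weight of \<open>R\<close> is \<open>1 + v (m R)\<close> plus an entry
        of a ray times \<open>v (m S)\<close>; two terms below 1/2 cannot outweigh the 1.\<close>
      have "\<bar>v (m R)\<bar> < 1/2" "\<bar>v (m S)\<bar> < 1/2" "q (m R) = 1" using v(2) True q_m[of R] by auto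
      then show ?thesis using r True hS' tS by auto
    qed (use False tS in auto)
    then have "?l \<in> weights n"
      unfolding weights_def using hier_subset[OF hS'(2) supp] by auto
    moreover have "pt n ?l (m R) = ?t R" if R: "R \<in> insert S \<N>" for R
    proof -
      have "pt n ?l = ?l S' *\<^sub>R ray n S' + (\<Sum>R\<in>\<N>. ?l R *\<^sub>R ray n R)"
        unfolding pt_sum[OF hS'(2) supp] using hS'(1) finN by (rule sum.insert[rotated])
      then have "pt n ?l (m R) = ?l S' * ray n S' (m R) + (\<Sum>R\<in>\<N>. ?l R *\<^sub>R ray n R) (m R)" by simp
      also have "(\<Sum>R\<in>\<N>. ?l R *\<^sub>R ray n R) (m R) = (if R \<in> \<N> then ?l R else 0)"
        by (rule dual_coord_subset[OF m R]) blast
      finally have "pt n ?l (m R) = - ?t S * ray n S' (m R) + (if R \<in> \<N> then ?l R else 0)" by simp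
      then have e: "pt n ?l (m R) = - ?t S * ray n S' (m R) + (if R \<in> \<N> then ?t R + ?t S * ray n S' (m R) else 0)"
        using hS'(1) by auto
      show ?thesis
      proof (cases "R = S")
        case True then show ?thesis unfolding e using S(1) S'(3) by simp
      next
        case False
        then have "R \<in> \<N>" using R by blast
        then show ?thesis unfolding e by (simp add: algebra_simps)
      qed
    qed
    ultimately show ?thesis using that[OF hS'(2) card[OF hS'(1)] sep im _ supp] by blast
  qed
qed

text \<open>All points of the fan in \<open>L + v\<close> have the same dual coordinates. On the
  spanning tree of the extremal facet their ultrametrics therefore agree up to constants, so the
  functional \<open>?a\<close> has its unique maximum at the extremal point.\<close>

lemma eventually_one_sided: "\<forall>\<^sub>F v in nhdsin (Euclidean_space N) 0. one_sided N (\<Union>(fan n)) L v"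
proof -
  have "\<forall>\<^sub>F v in nhdsin (Euclidean_space N) 0. \<forall>R\<in>insert S \<N>. \<bar>v (m R)\<bar> < 1/2"
    using finN by (intro eventually_ball_finite ballI eventually_linear_small linear_coord) auto
  then show ?thesis
    using eventually_Rn
  proof eventually_elim
    case (elim v)
    let ?a = "- (\<Sum>P\<in>pairs n. unit_fun (qidx n (P, P0)))"
    have P0: "P0 \<in> pairs n" using separator_pairs[OF p] by blast
    have qN: "qidx n (P, P0) < N" if "P \<in> pairs n" for P
      by (rule qidx_less) (use that P0 in \<open>simp add: coords_def\<close>)
    have dot: "dot N ?a x = - (\<Sum>P\<in>pairs n. x (qidx n (P, P0)))" for x
      by (rule dot_unit_fun_sum[OF finite_pairs qN])
    have dot_diff: "dot N a (x - y) = dot N a x - dot N a y" for a x y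
      unfolding dot_def by (simp add: right_diff_distrib sum_subtractf)
    obtain \<M> p' l where l: "hier n \<M>" "card \<M> = n - 3" "separator n \<M> p'"
      "p' ` insert {1..<n} \<M> \<subseteq> p ` insert {1..<n} (insert S \<N>)"
      "l \<in> weights n" "{R. l R \<noteq> 0} \<subseteq> \<M>" "\<And>R. R \<in> insert S \<N> \<Longrightarrow> pt n l (m R) = q (m R) + v (m R)"
      by (rule extremal_point[of v]) (use elim in auto)
    have ptR: "pt n l' \<in> Rn N" for l' by (simp add: Rn_iff pt_def)
    have min: "dot N ?a y \<le> dot N ?a (pt n l) \<and> (dot N ?a y = dot N ?a (pt n l) \<longrightarrow> y = pt n l)"
      if y: "y \<in> \<Union>(fan n)" "y \<in> (+) v ` L" for y
    proof -
      obtain l' where l': "l' \<in> weights n" "y = pt n l'" using y(1) Union_fan[OF n] by blast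
      have ym: "pt n l' (m R) = pt n l (m R)" if "R \<in> insert S \<N>" for R
        using y(2) mem_translate_L[OF elim(2)] l(7)[OF that] that unfolding l'(2) by auto
      have "val n l' (p' R) = val n l (p' R) + (val n l' P0 - val n l P0)" if "R \<in> insert {1..<n} \<M>" for R
      proof -
        \<comment> \<open>The representatives of the extremal facet are among those of the given
          facet, where the prescribed dual coordinates control \<open>val\<close>.\<close>
        have "p' R \<in> p ` insert {1..<n} (insert S \<N>)" using l(4) imageI[OF that] by (rule subsetD)
        then obtain R' where "p' R = p R'" "R' \<in> insert {1..<n} (insert S \<N>)" by (rule imageE)
        then show ?thesis using val_chain[OF S(2) n p ym, of R'] by simp
      qed
      note min = pt_minimal[OF l(1) n l(2,3,5,6) l'(1) this P0]
      show ?thesis using min unfolding dot l'(2) by simp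
    qed
    have pL: "pt n l \<in> (+) v ` L" unfolding mem_translate_L[OF elim(2)] using ptR l(7) by blast
    have pY: "pt n l \<in> \<Union>(fan n)" unfolding Union_fan[OF n] using l(5) by blast
    show ?case
      unfolding one_sided_def
    proof (rule bexI[of _ ?a], rule exI[of _ "dot N ?a (pt n l - v)"], intro conjI ballI)
      show "?a \<in> Rn N"
        by (intro subspace_neg[OF subspace_Rn] subspace_sum[OF subspace_Rn] unit_fun_Rn qN)
      \<comment> \<open>The diagonal position is not a dual one, since \<open>p R = P0\<close> would
        force \<open>R\<close> to contain \<open>{1..<n}\<close>. So \<open>?e\<close> is a
        direction of \<open>L\<close>, and the functional does not vanish on it.\<close>
      let ?e = "unit_fun (qidx n (P0, P0))"
      have "m R \<noteq> qidx n (P0, P0)" if R: "R \<in> insert S \<N>" for R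
      proof
        note c = cover_mem[OF S(2) n R]
        assume e: "m R = qidx n (P0, P0)"
        have "(p R, p (cover (ext n (insert S \<N>)) R)) \<in> coords n" "(P0, P0) \<in> coords n"
          using separator_pairs[OF p] R c(1) P0 unfolding coords_def by auto
        then have "(p R, p (cover (ext n (insert S \<N>)) R)) = (P0, P0)"
          using e quad_qidx unfolding dcoord_def by metis
        then have "P0 \<subseteq> R" using separator_sub[OF p, of R R] R by auto
        then have "{1..<n} \<subseteq> R" using separator_sub[OF p, of "{1..<n}" R] R by auto
        then show False using S(2) R unfolding hier_def clusters_def by blast
      qed
      then have "?e \<in> span B" unfolding span_B using unit_fun_Rn[OF qN[OF P0]] by (simp add: unit_fun_def)
      then have eL: "q + ?e \<in> L" "q \<in> L" unfolding L_def using span_zero by (blast, force)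
      have "dot N ?a ?e \<noteq> 0"
      proof -
        have "(\<Sum>P\<in>pairs n. ?e (qidx n (P, P0))) \<ge> ?e (qidx n (P0, P0))"
          by (rule member_le_sum[OF P0]) (auto simp: unit_fun_def finite_pairs)
        then show ?thesis unfolding dot by (simp add: unit_fun_def)
      qed
      then have "dot N ?a (q + ?e) \<noteq> dot N ?a q" using dot_diff[of ?a "q + ?e" q] by simp
      then show "\<exists>x\<in>L. \<exists>y\<in>L. dot N ?a x \<noteq> dot N ?a y" using eL by blast
      show "dot N ?a (y - v) \<le> dot N ?a (pt n l - v)" if "y \<in> \<Union>(fan n) \<inter> (+) v ` L" for y
        using min that unfolding dot_diff by simp
      show "\<exists>x. \<Union>(fan n) \<inter> (+) v ` {x \<in> L. dot N ?a x = dot N ?a (pt n l - v)} = {x}"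
      proof (intro exI equalityI subsetI)
        fix y assume "y \<in> \<Union>(fan n) \<inter> (+) v ` {x \<in> L. dot N ?a x = dot N ?a (pt n l - v)}"
        then obtain x where x: "y \<in> \<Union>(fan n)" "y = v + x" "x \<in> L" "dot N ?a x = dot N ?a (pt n l - v)" by blast
        have "dot N ?a (y - v) = dot N ?a (pt n l - v)" using x by simp
        then have "dot N ?a y = dot N ?a (pt n l)" unfolding dot_diff by simp
        then show "y \<in> {pt n l}" using min x by blast
      next
        fix y assume "y \<in> {pt n l}"
        moreover obtain x where "x \<in> L" "pt n l = v + x" using pL by blast
        ultimately show "y \<in> \<Union>(fan n) \<inter> (+) v ` {x \<in> L. dot N ?a x = dot N ?a (pt n l - v)}"
          using pY by (auto intro!: image_eqI[of _ _ x])
      qed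
    qed
  qed
qed

end

theorem simply_balanced_fan:
  assumes n: "3 \<le> n"
  shows "simply_balanced (amb n) (n - 3) (fan n) (\<lambda>_. 1)"
  unfolding simply_balanced_def
proof (intro conjI allI impI ballI balanced_fan[OF n])
  fix E F assume E: "codim1_face (n - 3) (fan n) E" and F: "F \<in> adjacent_facets (fan n) E"
  obtain \<N> where N: "hier n \<N>" "card \<N> + 1 = n - 3" "E = scone (ray n) \<N>"
    using codim1_face_fan[OF n E] .
  obtain S where SF: "S \<notin> \<N>" "hier n (insert S \<N>)" "F = scone (ray n) (insert S \<N>)"
    using F unfolding N(3) adjacent_facets_fan[OF n N(1,2)] by blast
  obtain p where p: "separator n (insert S \<N>) p" using separator_exists[OF SF(2) n] by blast
  interpret flag n \<N> S p by (rule flag.intro[OF n N(1,2) SF(1,2) p])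
  show "\<exists>L. transversal (amb n) (n - 3) E L \<and>
         (\<exists>\<^sub>F v in small_generic (amb n). F \<inter> (+) v ` L \<noteq> {}) \<and>
         (\<forall>\<^sub>F v in small_generic (amb n). iota (amb n) (fan n) (\<lambda>_. 1) E L v = 1) \<and>
         (\<forall>\<^sub>F v in nhdsin (Euclidean_space (amb n)) 0. one_sided (amb n) (\<Union>(fan n)) L v)"
    unfolding N(3) SF(3)
    using transversal_L frequently_meets iota_1 eventually_one_sided by blast
qed

section \<open>Rooted trees\<close>

definition adj :: "'a set set \<Rightarrow> ('a \<times> 'a) set" where
  "adj E = {(a, b). {a, b} \<in> E}"

lemma adj_sym: "(a, b) \<in> adj E \<Longrightarrow> (b, a) \<in> adj E"
  unfolding adj_def by (simp add: insert_commute)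

lemma adj_rtrancl_sym: "(a, b) \<in> (adj E)\<^sup>* \<Longrightarrow> (b, a) \<in> (adj E)\<^sup>*"
  using adj_sym by (metis symI sym_rtrancl symE)

lemma adj_mono: "E \<subseteq> F \<Longrightarrow> (adj E)\<^sup>* \<subseteq> (adj F)\<^sup>*"
  by (rule rtrancl_mono) (auto simp: adj_def)

text \<open>When a walk returns to a vertex already visited, it is cut back to that visit.\<close>

lemma distinct_walk:
  assumes "(u, v) \<in> (adj E)\<^sup>*"
  shows "\<exists>p. p \<noteq> [] \<and> hd p = u \<and> last p = v \<and> distinct p \<and> successively (\<lambda>a b. {a, b} \<in> E) p"
  using assms
proof (induction rule: rtrancl_induct)
  case base
  show ?case by (intro exI[of _ "[u]"]) simp
next
  case (step y z)
  then obtain p where p: "p \<noteq> []" "hd p = u" "last p = y" "distinct p" "successively (\<lambda>a b. {a, b} \<in> E) p"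
    by blast
  show ?case
  proof (cases "z \<in> set p")
    case True
    then obtain xs ys where "p = xs @ z # ys" by (meson split_list)
    then have e: "p = (xs @ [z]) @ ys" by simp
    have "hd (xs @ [z]) = u" using p(2) unfolding e by (cases xs) auto
    moreover have "successively (\<lambda>a b. {a, b} \<in> E) (xs @ [z])"
      using p(5) unfolding e successively_append_iff[of _ "xs @ [z]" ys] by blast
    ultimately show ?thesis using p(4) unfolding e by (intro exI[of _ "xs @ [z]"]) auto
  next
    case False
    have "{y, z} \<in> E" using step(2) by (simp add: adj_def)
    then have "successively (\<lambda>a b. {a, b} \<in> E) (p @ [z])"
      unfolding successively_append_iff using p by simp
    then show ?thesis using p False by (intro exI[of _ "p @ [z]"]) auto
  qed
qed

text \<open>A simple path between the ends of a removed edge closes up with this edge to a cycle. It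
  has at least three vertices, because a path with two would be the removed edge itself.\<close>

lemma bridge:
  assumes nc: "\<not> (\<exists>p. length p \<ge> 3 \<and> distinct p \<and> (\<forall>i<length p. {p ! i, p ! (Suc i mod length p)} \<in> E))"
    and uv: "{u, v} \<in> E" "u \<noteq> v"
  shows "(u, v) \<notin> (adj (E - {{u, v}}))\<^sup>*"
proof
  assume a: "(u, v) \<in> (adj (E - {{u, v}}))\<^sup>*"
  obtain p where p: "p \<noteq> []" "hd p = u" "last p = v" "distinct p"
    "successively (\<lambda>a b. {a, b} \<in> E - {{u, v}}) p" using distinct_walk[OF a] by (elim exE conjE)
  have step: "{p ! i, p ! Suc i} \<in> E - {{u, v}}" if "Suc i < length p" for i
    using p(5) that unfolding successively_conv_nth by blast
  have h: "p ! 0 = u" "p ! (length p - 1) = v" using p(1-3) by (simp_all add: hd_conv_nth last_conv_nth)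
  have "length p \<noteq> 0" "length p \<noteq> 1" using p(1) h uv(2) by auto
  moreover have "length p \<noteq> 2" using step[of 0] h by auto
  ultimately have len: "3 \<le> length p" by linarith
  have "{p ! i, p ! (Suc i mod length p)} \<in> E" if i: "i < length p" for i
  proof (cases "Suc i < length p")
    case True then show ?thesis using step[OF True] by simp
  next
    case False
    then have "i = length p - 1" "Suc i = length p" using i by auto
    then show ?thesis using h uv(1) by (simp add: insert_commute)
  qed
  then show False using nc len p(4) by blast
qed

text \<open>A rooted tree given by its parent function. The rank, which decreases towards the root,
  excludes cycles and carries the inductions.\<close>

locale rooted =
  fixes V :: "'a set" and E :: "'a set set" and r :: 'a and par :: "'a \<Rightarrow> 'a" and rk :: "'a \<Rightarrow> nat"
  assumes finite_V: "finite V" and root: "r \<in> V"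
    and par: "\<And>v. v \<in> V \<Longrightarrow> v \<noteq> r \<Longrightarrow> par v \<in> V" "\<And>v. v \<in> V \<Longrightarrow> v \<noteq> r \<Longrightarrow> rk (par v) < rk v"
    and edges_eq: "E = {{v, par v} | v. v \<in> V \<and> v \<noteq> r}"

text \<open>The rank is the distance from the root, and the parent is a neighbour closer to it.
  Parent edges already connect every vertex to the root, so a further edge would not be a
  bridge.\<close>

lemma rooted_of_tree:
  assumes t: "is_tree V E" and r: "r \<in> V"
  shows "\<exists>par rk. rooted V E r par rk"
proof -
  let ?R = "adj E"
  have conn: "(r, v) \<in> ?R\<^sup>*" if "v \<in> V" for v
    using t r that unfolding is_tree_def adj_def by blast
  have ends: "\<exists>u\<in>V. \<exists>v\<in>V. u \<noteq> v \<and> e = {u, v}" if "e \<in> E" for e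
    using t that unfolding is_tree_def by blast
  have eV: "a \<in> V \<and> b \<in> V \<and> a \<noteq> b" if "{a, b} \<in> E" for a b
    using ends[OF that] by (auto simp: doubleton_eq_iff)
  define d where "d v = (LEAST k. (r, v) \<in> ?R ^^ k)" for v
  have d: "(r, v) \<in> ?R ^^ d v" if "v \<in> V" for v
    unfolding d_def using conn[OF that] by (metis LeastI_ex rtrancl_imp_relpow)
  have d_le: "d v \<le> k" if "(r, v) \<in> ?R ^^ k" for v k
    unfolding d_def using that by (rule Least_le)
  have "\<exists>w. {v, w} \<in> E \<and> d w < d v" if v: "v \<in> V" "v \<noteq> r" for v
  proof (cases "d v")
    case 0
    then show ?thesis using d[OF v(1)] v(2) by simp
  next
    case (Suc k)
    then have "(r, v) \<in> ?R ^^ Suc k" using d[OF v(1)] by simp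
    then obtain w where w: "(r, w) \<in> ?R ^^ k" "(w, v) \<in> ?R" by (rule relpow_Suc_E)
    have "d w < d v" using d_le[OF w(1)] Suc by simp
    moreover have "{v, w} \<in> E" using w(2) by (simp add: adj_def insert_commute)
    ultimately show ?thesis by blast
  qed
  then obtain par where par: "\<And>v. v \<in> V \<Longrightarrow> v \<noteq> r \<Longrightarrow> {v, par v} \<in> E \<and> d (par v) < d v" by metis
  let ?E = "{{v, par v} | v. v \<in> V \<and> v \<noteq> r}"
  have sub: "?E \<subseteq> E" using par by blast
  have parV: "par v \<in> V" if "v \<in> V" "v \<noteq> r" for v using eV par that by blast
  have up: "(v, r) \<in> (adj ?E)\<^sup>*" if "v \<in> V" for v
    using that
  proof (induction "d v" arbitrary: v rule: less_induct)
    case less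
    show ?case
    proof (cases "v = r")
      case False
      then have "(par v, r) \<in> (adj ?E)\<^sup>*" using less par parV by blast
      moreover have "(v, par v) \<in> adj ?E" unfolding adj_def using less(2) False by blast
      ultimately show ?thesis by (rule converse_rtrancl_into_rtrancl[rotated])
    qed simp
  qed
  have "E \<subseteq> ?E"
  proof
    fix e assume e: "e \<in> E"
    then obtain u v where uv: "u \<in> V" "v \<in> V" "u \<noteq> v" "e = {u, v}" using ends by blast
    show "e \<in> ?E"
    proof (rule ccontr)
      assume ne: "e \<notin> ?E"
      have "(u, v) \<in> (adj ?E)\<^sup>*"
        using up[OF uv(1)] adj_rtrancl_sym[OF up[OF uv(2)]] by (rule rtrancl_trans)
      moreover have "?E \<subseteq> E - {{u, v}}" using sub ne uv(4) by blast
      ultimately have "(u, v) \<in> (adj (E - {{u, v}}))\<^sup>*" using adj_mono by blast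
      moreover have "(u, v) \<notin> (adj (E - {{u, v}}))\<^sup>*"
        by (rule bridge) (use t e uv in \<open>auto simp: is_tree_def\<close>)
      ultimately show False by blast
    qed
  qed
  then have "E = ?E" using sub by blast
  moreover have "finite V" using t by (simp add: is_tree_def)
  ultimately have "rooted V E r par d"
    unfolding rooted_def using r par parV by blast
  then show ?thesis by blast
qed

context rooted
begin

definition up :: "('a \<times> 'a) set" where "up = {(v, par v) | v. v \<in> V \<and> v \<noteq> r}"

definition desc :: "'a \<Rightarrow> 'a set" where "desc v = {w. (w, v) \<in> up\<^sup>*}"

lemma up_iff: "(v, w) \<in> up \<longleftrightarrow> v \<in> V \<and> v \<noteq> r \<and> w = par v"
  unfolding up_def by blast

lemma desc_refl: "v \<in> desc v"
  unfolding desc_def by simp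

lemma desc_step: "v \<in> V \<Longrightarrow> v \<noteq> r \<Longrightarrow> v \<in> desc w \<longleftrightarrow> v = w \<or> par v \<in> desc w"
  unfolding desc_def
proof -
  assume v: "v \<in> V" "v \<noteq> r"
  show "v \<in> {v. (v, w) \<in> up\<^sup>*} \<longleftrightarrow> v = w \<or> par v \<in> {v. (v, w) \<in> up\<^sup>*}"
  proof
    assume "v \<in> {v. (v, w) \<in> up\<^sup>*}"
    then have "(v, w) \<in> up\<^sup>*" by simp
    then show "v = w \<or> par v \<in> {v. (v, w) \<in> up\<^sup>*}"
      by (cases rule: converse_rtranclE) (auto simp: up_iff)
  next
    assume "v = w \<or> par v \<in> {v. (v, w) \<in> up\<^sup>*}"
    moreover have "(v, par v) \<in> up" using v by (simp add: up_iff)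
    ultimately show "v \<in> {v. (v, w) \<in> up\<^sup>*}" by (auto intro: converse_rtrancl_into_rtrancl)
  qed
qed

lemma root_desc: "r \<in> desc w \<longleftrightarrow> w = r"
proof
  assume "r \<in> desc w"
  then have "(r, w) \<in> up\<^sup>*" by (simp add: desc_def)
  then show "w = r" by (cases rule: converse_rtranclE) (auto simp: up_iff)
qed (simp add: desc_refl)

lemma desc_trans: "u \<in> desc v \<Longrightarrow> v \<in> desc w \<Longrightarrow> u \<in> desc w"
  unfolding desc_def by (auto intro: rtrancl_trans)

lemma desc_rk: "u \<in> desc v \<Longrightarrow> u \<noteq> v \<Longrightarrow> rk v < rk u"
  unfolding desc_def mem_Collect_eq
proof (induction rule: converse_rtrancl_induct)
  case (step y z)
  then have "rk z < rk y" using par(2) by (simp add: up_iff)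
  then show ?case using step by (cases "z = v") auto
qed simp

lemma desc_antisym: "u \<in> desc v \<Longrightarrow> v \<in> desc u \<Longrightarrow> u = v"
  using desc_rk by (metis less_asym)

lemma desc_root: "v \<in> V \<Longrightarrow> v \<in> desc r"
proof (induction "rk v" arbitrary: v rule: less_induct)
  case less
  then show ?case
    using desc_step[of v r] par[of v] desc_refl[of r] by (cases "v = r") auto
qed

lemma desc_linear: "w \<in> desc u \<Longrightarrow> w \<in> desc v \<Longrightarrow> u \<in> desc v \<or> v \<in> desc u"
proof -
  assume w: "w \<in> desc u" "w \<in> desc v"
  have "single_valued up" unfolding single_valued_def by (simp add: up_iff)
  then show ?thesis
    using single_valued_confluent[of up w u v] w unfolding desc_def by blast
qed

lemma par_neq: "v \<in> V \<Longrightarrow> v \<noteq> r \<Longrightarrow> par v \<noteq> v"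
  using par(2)[of v] by auto

lemma edge_inj: "v \<in> V \<Longrightarrow> v \<noteq> r \<Longrightarrow> w \<in> V \<Longrightarrow> w \<noteq> r \<Longrightarrow> {v, par v} = {w, par w} \<Longrightarrow> v = w"
  using par(2)[of v] par(2)[of w] by (auto simp: doubleton_eq_iff)

lemma edge_mem: "v \<in> V \<Longrightarrow> v \<noteq> r \<Longrightarrow> {v, par v} \<in> E"
  unfolding edges_eq by blast

lemma edge_adj: "v \<in> V \<Longrightarrow> v \<noteq> r \<Longrightarrow> (v, par v) \<in> adj E"
  unfolding adj_def using edge_mem by blast

lemma adj_cases: "(a, b) \<in> adj E \<Longrightarrow> (a \<in> V \<and> a \<noteq> r \<and> b = par a) \<or> (b \<in> V \<and> b \<noteq> r \<and> a = par b)"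
  unfolding adj_def edges_eq by (auto simp: doubleton_eq_iff)

text \<open>The edge from \<open>v\<close> to its parent is the only one that leaves the subtree
  below \<open>v\<close>.\<close>

lemma separated_invariant:
  assumes v: "v \<in> V" "v \<noteq> r" and ab: "(a, b) \<in> (adj (E - {{v, par v}}))\<^sup>*"
  shows "a \<in> desc v \<longleftrightarrow> b \<in> desc v"
  using ab
proof (induction rule: rtrancl_induct)
  case (step y z)
  have "w \<in> desc v \<longleftrightarrow> par w \<in> desc v" if "w \<in> V" "w \<noteq> r" "{w, par w} \<noteq> {v, par v}" for w
    using desc_step[OF that(1,2), of v] that(3) by blast
  note key = this
  have yz: "(y, z) \<in> adj E" "{y, z} \<noteq> {v, par v}" using step(2) unfolding adj_def by auto
  have "y \<in> desc v \<longleftrightarrow> z \<in> desc v"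
    using adj_cases[OF yz(1)]
  proof (elim disjE conjE)
    assume "y \<in> V" "y \<noteq> r" "z = par y"
    then show ?thesis using key[of y] yz(2) by simp
  next
    assume "z \<in> V" "z \<noteq> r" "y = par z"
    then show ?thesis using key[of z] yz(2) by (simp add: insert_commute)
  qed
  then show ?case using step by blast
qed simp

text \<open>From a vertex outside the subtree below \<open>v\<close>, the way up to the root never
  enters this subtree.\<close>

lemma connected_outside:
  assumes v: "v \<in> V" "v \<noteq> r" and a: "a \<in> V" "a \<notin> desc v"
  shows "(a, r) \<in> (adj (E - {{v, par v}}))\<^sup>*"
  using a
proof (induction "rk a" arbitrary: a rule: less_induct)
  case less
  show ?case
  proof (cases "a = r")
    case False
    have "par a \<notin> desc v" using desc_step[OF less(2) False] less(3) by blast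
    then have 1: "(par a, r) \<in> (adj (E - {{v, par v}}))\<^sup>*" using less(1) par[OF less(2) False] by blast
    have "a \<noteq> v" using less(3) desc_refl by blast
    then have "{a, par a} \<noteq> {v, par v}" using edge_inj[OF less(2) False v] by blast
    then have "(a, par a) \<in> adj (E - {{v, par v}})" using edge_mem[OF less(2) False] by (simp add: adj_def)
    then show ?thesis using 1 by (rule converse_rtrancl_into_rtrancl)
  qed simp
qed

lemma connected: "a \<in> V \<Longrightarrow> (a, r) \<in> (adj E)\<^sup>*"
proof (induction "rk a" arbitrary: a rule: less_induct)
  case less
  show ?case
  proof (cases "a = r")
    case False
    then have "(par a, r) \<in> (adj E)\<^sup>*" using less(1) par[OF less(2)] by blast
    then show ?thesis using edge_adj[OF less(2) False] by (rule converse_rtrancl_into_rtrancl[rotated])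
  qed simp
qed

end

lemma (in rooted) tree:
  shows "finite V \<and> V \<noteq> {} \<and> (\<forall>e\<in>E. \<exists>u\<in>V. \<exists>v\<in>V. u \<noteq> v \<and> e = {u, v}) \<and>
    (\<forall>u\<in>V. \<forall>v\<in>V. (u, v) \<in> {(a, b). {a, b} \<in> E}\<^sup>*) \<and>
    \<not> (\<exists>p. length p \<ge> 3 \<and> distinct p \<and> (\<forall>i<length p. {p ! i, p ! (Suc i mod length p)} \<in> E))"
proof (intro conjI ballI)
  show "finite V" "V \<noteq> {}" using finite_V root by auto
  show "\<exists>u\<in>V. \<exists>v\<in>V. u \<noteq> v \<and> e = {u, v}" if "e \<in> E" for e
  proof -
    obtain v where v: "v \<in> V" "v \<noteq> r" "e = {v, par v}"
      using \<open>e \<in> E\<close> unfolding edges_eq by blast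
    then show ?thesis using par(1)[of v] par_neq[of v] by metis
  qed
  show "(u, v) \<in> {(a, b). {a, b} \<in> E}\<^sup>*" if "u \<in> V" "v \<in> V" for u v
    using connected[OF that(1)] adj_rtrancl_sym[OF connected[OF that(2)]] unfolding adj_def
    by (rule rtrancl_trans)
  show "\<not> (\<exists>p. length p \<ge> 3 \<and> distinct p \<and> (\<forall>i<length p. {p ! i, p ! (Suc i mod length p)} \<in> E))"
  proof
    assume "\<exists>p. length p \<ge> 3 \<and> distinct p \<and> (\<forall>i<length p. {p ! i, p ! (Suc i mod length p)} \<in> E)"
    then obtain p where p: "3 \<le> length p" "distinct p"
      "\<And>i. i < length p \<Longrightarrow> {p ! i, p ! (Suc i mod length p)} \<in> E" by blast
    let ?n = "length p"
    \<comment> \<open>On a cycle, a vertex of maximal rank has two different neighbours, each of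
      which would have to be its parent.\<close>
    have "Max (rk ` set p) \<in> rk ` set p" using p(1) by (intro Max_in) auto
    then obtain i where i: "i < ?n" "rk (p ! i) = Max (rk ` set p)" by (auto simp: in_set_conv_nth)
    have top: "rk (p ! j) \<le> rk (p ! i)" if "j < ?n" for j
      unfolding i(2) by (rule Max_ge) (use that in auto)
    have nb: "p ! j = par (p ! i)" if j: "j < ?n" "{p ! i, p ! j} \<in> E" for j
    proof -
      have "(p ! i, p ! j) \<in> adj E" using j by (simp add: adj_def)
      then show ?thesis using adj_cases[of "p ! i" "p ! j"] par(2)[of "p ! j"] top[OF j(1)] by force
    qed
    define k where "k = (if i = 0 then ?n - 1 else i - 1)"
    have k: "k < ?n" "Suc k mod ?n = i" unfolding k_def using i(1) p(1) by auto
    let ?l = "Suc i mod ?n"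
    have l: "?l < ?n" using p(1) by (intro mod_less_divisor) auto
    have "p ! ?l = par (p ! i)" by (rule nb[OF l p(3)[OF i(1)]])
    moreover have "p ! k = par (p ! i)" using nb[OF k(1)] p(3)[OF k(1)] k(2) by (simp add: insert_commute)
    ultimately have "?l = k" using nth_eq_iff_index_eq[OF p(2) l k(1)] by simp
    moreover have "?l \<noteq> k"
      unfolding k_def using i(1) p(1) by (cases "Suc i = ?n") auto
    ultimately show False by blast
  qed
qed

section \<open>Rational curves as rooted trees\<close>

text \<open>\<open>r\<close> is the 1-valent end of leaf \<open>n\<close> and \<open>q\<close> its
  neighbour; \<open>t i\<close> is the 1-valent end of leaf \<open>i\<close>. Valence at least 3
  turns into two children for every vertex other than \<open>r\<close> and the
  \<open>t i\<close>.\<close>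

locale rooted_curve = rooted "verts C" "edges C" r par rk
  for C :: curve and r par rk +
  fixes n :: nat and q :: nat and t :: "nat \<Rightarrow> nat"
  assumes n: "3 \<le> n"
    and q: "q \<in> verts C" "q \<noteq> r" "par q = r" "\<And>v. v \<in> verts C \<Longrightarrow> v \<noteq> r \<Longrightarrow> par v = r \<Longrightarrow> v = q"
    and leaf_n: "leaf C n = {q, r}"
    and t: "\<And>i. i \<in> {1..<n} \<Longrightarrow> t i \<in> verts C" "\<And>i. i \<in> {1..<n} \<Longrightarrow> t i \<noteq> r"
      "\<And>i. i \<in> {1..<n} \<Longrightarrow> t i \<noteq> q"
      "\<And>i. i \<in> {1..<n} \<Longrightarrow> leaf C i = {t i, par (t i)}" "inj_on t {1..<n}"
      "\<And>i v. i \<in> {1..<n} \<Longrightarrow> v \<in> verts C \<Longrightarrow> v \<noteq> r \<Longrightarrow> par v \<noteq> t i"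
    and inner: "\<And>v. v \<in> verts C \<Longrightarrow> v \<noteq> r \<Longrightarrow> v \<notin> t ` {1..<n} \<Longrightarrow>
      2 \<le> card {w \<in> verts C. w \<noteq> r \<and> par w = v}"

lemma (in rooted) child_desc: "u \<in> desc v \<Longrightarrow> u \<noteq> v \<Longrightarrow> \<exists>c. c \<in> V \<and> c \<noteq> r \<and> par c = v \<and> u \<in> desc c"
proof -
  assume "u \<in> desc v" "u \<noteq> v"
  then have "(u, v) \<in> up\<^sup>*" "u \<noteq> v" by (simp_all add: desc_def)
  then show ?thesis
    by (cases rule: rtranclE) (auto simp: up_iff desc_def)
qed

lemma (in rooted) incident:
  "v \<in> V \<Longrightarrow> {e \<in> E. v \<in> e} = (\<lambda>w. {w, par w}) ` ({w \<in> V. w \<noteq> r \<and> par w = v} \<union> (if v = r then {} else {v}))"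
  unfolding edges_eq by auto

lemma (in rooted) card_incident:
  assumes v: "v \<in> V"
  shows "card {e \<in> E. v \<in> e} = card {w \<in> V. w \<noteq> r \<and> par w = v} + (if v = r then 0 else 1)"
proof -
  have "card {e \<in> E. v \<in> e} = card ({w \<in> V. w \<noteq> r \<and> par w = v} \<union> (if v = r then {} else {v}))"
    unfolding incident[OF v]
  proof (rule card_image, rule inj_onI)
    fix a b assume ab: "a \<in> {w \<in> V. w \<noteq> r \<and> par w = v} \<union> (if v = r then {} else {v})"
      "b \<in> {w \<in> V. w \<noteq> r \<and> par w = v} \<union> (if v = r then {} else {v})" "{a, par a} = {b, par b}"
    have "c \<in> V \<and> c \<noteq> r" if "c \<in> {w \<in> V. w \<noteq> r \<and> par w = v} \<union> (if v = r then {} else {v})" for c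
      using that v by (auto split: if_splits)
    then show "a = b" using edge_inj[of a b] ab by blast
  qed
  also have "\<dots> = card {w \<in> V. w \<noteq> r \<and> par w = v} + (if v = r then 0 else 1)"
    by (subst card_Un_disjoint) (use finite_V v par_neq in auto)
  finally show ?thesis .
qed

context rooted_curve
begin

text \<open>The vertices whose edge to the parent is bounded; \<open>q\<close> is excluded because
  its edge is leaf \<open>n\<close>.\<close>

definition inn :: "nat set" where
  "inn = verts C - {r, q} - t ` {1..<n}"

lemma valence_eq: "v \<in> verts C \<Longrightarrow>
    valence C v = card {w \<in> verts C. w \<noteq> r \<and> par w = v} + (if v = r then 0 else 1)"
  unfolding valence_def by (rule card_incident)

lemma valence_root: "valence C r = 1"
proof -
  have "{w \<in> verts C. w \<noteq> r \<and> par w = r} = {q}" using q by blast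
  then show ?thesis using valence_eq[OF root] by simp
qed

lemma valence_t: "i \<in> {1..<n} \<Longrightarrow> valence C (t i) = 1"
proof -
  assume i: "i \<in> {1..<n}"
  have e: "{w \<in> verts C. w \<noteq> r \<and> par w = t i} = {}" using t(6)[OF i] by blast
  show ?thesis unfolding valence_eq[OF t(1)[OF i]] e using t(2)[OF i] by simp
qed

lemma valence_inner: "v \<in> verts C \<Longrightarrow> v \<noteq> r \<Longrightarrow> v \<notin> t ` {1..<n} \<Longrightarrow> 3 \<le> valence C v"
  using inner[of v] valence_eq[of v] by simp

lemma valence_1_iff: "v \<in> verts C \<Longrightarrow> valence C v = 1 \<longleftrightarrow> v = r \<or> v \<in> t ` {1..<n}"
  using valence_root valence_t valence_inner[of v] by (cases "v = r"; cases "v \<in> t ` {1..<n}") auto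

lemma leaf_edges_iff: "v \<in> verts C \<Longrightarrow> v \<noteq> r \<Longrightarrow> {v, par v} \<in> leaf_edges C \<longleftrightarrow> v = q \<or> v \<in> t ` {1..<n}"
proof -
  assume v: "v \<in> verts C" "v \<noteq> r"
  have "{v, par v} \<in> leaf_edges C \<longleftrightarrow> valence C v = 1 \<or> valence C (par v) = 1"
    unfolding leaf_edges_def using edge_mem[OF v] by auto
  also have "\<dots> \<longleftrightarrow> v \<in> t ` {1..<n} \<or> par v = r"
  proof -
    have "par v \<notin> t ` {1..<n}" using t(6)[OF _ v] by blast
    then show ?thesis using valence_1_iff[OF v(1)] valence_1_iff[OF par(1)[OF v]] v(2) by blast
  qed
  also have "\<dots> \<longleftrightarrow> v = q \<or> v \<in> t ` {1..<n}" using q v by blast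
  finally show ?thesis .
qed

lemma leaf_edges_eq: "leaf_edges C = leaf C ` {1..n}"
proof -
  have I: "{1..n} = insert n {1..<n}" using n by auto
  have im: "leaf C ` {1..n} = (\<lambda>v. {v, par v}) ` (insert q (t ` {1..<n}))"
    unfolding I using leaf_n t(4) q(3) by (auto simp: image_iff)
  show ?thesis
  proof
    show "leaf_edges C \<subseteq> leaf C ` {1..n}"
    proof
      fix e assume e: "e \<in> leaf_edges C"
      then obtain v where v: "v \<in> verts C" "v \<noteq> r" "e = {v, par v}"
        unfolding leaf_edges_def edges_eq by blast
      then show "e \<in> leaf C ` {1..n}" unfolding im using e leaf_edges_iff by blast
    qed
    show "leaf C ` {1..n} \<subseteq> leaf_edges C"
      unfolding im using leaf_edges_iff t(1,2) q(1,2) by auto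
  qed
qed

lemma bij_leaf: "bij_betw (leaf C) {1..n} (leaf_edges C)"
  unfolding bij_betw_def leaf_edges_eq
proof (intro conjI refl inj_onI)
  fix i j assume ij: "i \<in> {1..n}" "j \<in> {1..n}" "leaf C i = leaf C j"
  define f where "f k = (if k = n then q else t k)" for k
  have f: "f k \<in> verts C" "f k \<noteq> r" "leaf C k = {f k, par (f k)}" if "k \<in> {1..n}" for k
  proof -
    have "k = n \<or> k \<in> {1..<n}" using that by auto
    then show "f k \<in> verts C" "f k \<noteq> r" "leaf C k = {f k, par (f k)}"
      using t(1,2,4)[of k] q(1-3) leaf_n unfolding f_def by (cases "k = n"; simp)+
  qed
  have "{f i, par (f i)} = {f j, par (f j)}" using f(3)[OF ij(1)] f(3)[OF ij(2)] ij(3) by simp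
  then have "f i = f j" by (rule edge_inj[OF f(1,2)[OF ij(1)] f(1,2)[OF ij(2)]])
  then show "i = j"
    using ij(1,2) t(3)[of i] t(3)[of j] inj_onD[OF t(5), of i j] unfolding f_def
    by (cases "i = n"; cases "j = n") auto
qed

lemma bounded_edges_eq: "bounded_edges C = (\<lambda>v. {v, par v}) ` inn"
proof (intro equalityI subsetI)
  fix e assume e: "e \<in> bounded_edges C"
  then obtain v where v: "v \<in> verts C" "v \<noteq> r" "e = {v, par v}"
    unfolding bounded_edges_def edges_eq by blast
  then show "e \<in> (\<lambda>v. {v, par v}) ` inn"
    using e leaf_edges_iff[OF v(1,2)] unfolding bounded_edges_def inn_def by blast
next
  fix e assume "e \<in> (\<lambda>v. {v, par v}) ` inn"
  then obtain v where v: "v \<in> inn" "e = {v, par v}" by blast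
  then show "e \<in> bounded_edges C"
    using edge_mem leaf_edges_iff[of v] unfolding bounded_edges_def inn_def by auto
qed

text \<open>The locale already encodes the tree, the valences and the marking, so only the lengths
  remain.\<close>

lemma rational_curve_iff:
  "rational_curve n C \<longleftrightarrow> (\<forall>e\<in>leaf_edges C. elen C e = \<infinity>) \<and>
    (\<forall>e\<in>bounded_edges C. 0 < elen C e \<and> elen C e < \<infinity>)"
proof -
  have "is_tree (verts C) (edges C)" unfolding is_tree_def using tree .
  moreover have "valence C v = 1 \<or> 3 \<le> valence C v" if "v \<in> verts C" for v
    using valence_1_iff[OF that] valence_inner[OF that] by blast
  ultimately show ?thesis unfolding rational_curve_def using bij_leaf by blast
qed

definition cl :: "nat \<Rightarrow> nat set" where
  "cl v = {i \<in> {1..<n}. t i \<in> desc v}"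

lemma cl_sub: "cl v \<subseteq> {1..<n}"
  unfolding cl_def by blast

lemma cl_mono: "u \<in> desc v \<Longrightarrow> cl u \<subseteq> cl v"
  unfolding cl_def using desc_trans by blast

lemma desc_t: "u \<in> desc (t i) \<Longrightarrow> i \<in> {1..<n} \<Longrightarrow> u \<in> verts C \<Longrightarrow> u = t i"
proof -
  assume u: "u \<in> desc (t i)" "i \<in> {1..<n}" "u \<in> verts C"
  show ?thesis
  proof (rule ccontr)
    assume "u \<noteq> t i"
    have "(u, t i) \<in> up\<^sup>*" using u(1) by (simp add: desc_def)
    then show False
      using \<open>u \<noteq> t i\<close> by (cases rule: rtranclE) (use t(6)[OF u(2)] in \<open>auto simp: up_iff\<close>)
  qed
qed

lemma cl_t: "i \<in> {1..<n} \<Longrightarrow> cl (t i) = {i}"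
  unfolding cl_def using desc_t[of "t _" i] t(1) t(5) desc_refl by (auto simp: inj_on_def)

text \<open>A vertex of maximal rank below \<open>v\<close> has no children, so it is the end of a
  leaf.\<close>

lemma cl_nonempty: "v \<in> verts C \<Longrightarrow> v \<noteq> r \<Longrightarrow> cl v \<noteq> {}"
proof -
  assume v: "v \<in> verts C" "v \<noteq> r"
  let ?D = "{w \<in> verts C. w \<in> desc v}"
  have fin: "finite ?D" using finite_V by simp
  have "v \<in> ?D" using v desc_refl by simp
  then have "Max (rk ` ?D) \<in> rk ` ?D" using fin by (intro Max_in) auto
  then obtain w where w: "w \<in> ?D" "rk w = Max (rk ` ?D)" by auto
  have "w \<in> t ` {1..<n}"
  proof (rule ccontr)
    assume "w \<notin> t ` {1..<n}"
    moreover have "w \<noteq> r" using w(1) root_desc[of v] v(2) by auto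
    ultimately have "2 \<le> card {u \<in> verts C. u \<noteq> r \<and> par u = w}" using inner w(1) by blast
    then have "{u \<in> verts C. u \<noteq> r \<and> par u = w} \<noteq> {}" by force
    then obtain u where u: "u \<in> verts C" "u \<noteq> r" "par u = w" by blast
    then have "u \<in> ?D" using desc_step[OF u(1,2), of v] w(1) by auto
    then have "rk u \<le> rk w" unfolding w(2) using fin by (intro Max_ge) auto
    then show False using par(2)[OF u(1,2)] u(3) by simp
  qed
  then show ?thesis using w(1) unfolding cl_def by auto
qed

lemma cl_inter: "cl u \<inter> cl v \<noteq> {} \<Longrightarrow> u \<in> desc v \<or> v \<in> desc u"
  unfolding cl_def using desc_linear by blast

text \<open>The vertex \<open>v\<close> has a second child besides the one above \<open>u\<close>,
  and the leaves beyond it are missing from \<open>cl u\<close>. Here the stability condition,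
  valence at least 3, is used.\<close>

lemma cl_strict:
  assumes "u \<in> verts C" "v \<in> verts C" "v \<noteq> r" "u \<in> desc v" "u \<noteq> v"
  shows "cl u \<noteq> cl v"
proof
  assume eq: "cl u = cl v"
  obtain c where c: "c \<in> verts C" "c \<noteq> r" "par c = v" "u \<in> desc c"
    using child_desc[OF assms(4,5)] by blast
  have "v \<notin> t ` {1..<n}" using t(6) c by blast
  then have "2 \<le> card {w \<in> verts C. w \<noteq> r \<and> par w = v}" using inner assms by blast
  then obtain a b where ab: "a \<in> {w \<in> verts C. w \<noteq> r \<and> par w = v}" "b \<in> {w \<in> verts C. w \<noteq> r \<and> par w = v}" "a \<noteq> b"
    by (rule obtain_two)
  obtain c' where c': "c' \<in> verts C" "c' \<noteq> r" "par c' = v" "c' \<noteq> c"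
  proof (cases "a = c")
    case True then show ?thesis using that[of b] ab by blast
  next
    case False then show ?thesis using that[of a] ab by blast
  qed
  have "c' \<in> desc v" using desc_step[OF c'(1,2), of v] c'(3) desc_refl by simp
  then have "cl c' \<subseteq> cl u" using cl_mono eq by blast
  moreover have "cl u \<subseteq> cl c" by (rule cl_mono[OF c(4)])
  ultimately have "cl c' \<inter> cl c \<noteq> {}" using cl_nonempty[OF c'(1,2)] by blast
  then have "c' \<in> desc c \<or> c \<in> desc c'" by (rule cl_inter)
  moreover have False if d: "x \<in> desc y" "x \<noteq> y" "x \<in> verts C" "x \<noteq> r" "par x = v" "y \<in> verts C" "y \<noteq> r" "par y = v" for x y
  proof -
    have "v \<in> desc y" using desc_step[OF d(3,4), of y] d by simp
    moreover have "y \<in> desc v" using desc_step[OF d(6,7), of v] d desc_refl by simp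
    ultimately have "y = v" by (rule desc_antisym[rotated])
    then show False using par_neq[OF d(6,7)] d(8) by simp
  qed
  ultimately show False using c c' by metis
qed

lemma cl_subset_iff:
  assumes "u \<in> verts C" "u \<noteq> r" "v \<in> verts C" "v \<noteq> r"
  shows "cl u \<subseteq> cl v \<longleftrightarrow> u \<in> desc v"
proof
  assume s: "cl u \<subseteq> cl v"
  then have "cl u \<inter> cl v \<noteq> {}" using cl_nonempty[OF assms(1,2)] by blast
  then consider "u \<in> desc v" | "v \<in> desc u" "u \<noteq> v" using cl_inter desc_refl by blast
  then show "u \<in> desc v"
  proof cases
    case 2
    then show ?thesis using cl_strict[OF assms(3,1,2)] cl_mono[OF 2(1)] s by blast
  qed
qed (rule cl_mono)

lemma cl_inj: "inj_on cl (verts C - {r})"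
proof (rule inj_onI)
  fix u v assume "u \<in> verts C - {r}" "v \<in> verts C - {r}" "cl u = cl v"
  then show "u = v" using cl_subset_iff[of u v] cl_subset_iff[of v u] desc_antisym by blast
qed

lemma below_q: "v \<in> verts C \<Longrightarrow> v \<noteq> r \<Longrightarrow> v \<in> desc q"
proof -
  assume v: "v \<in> verts C" "v \<noteq> r"
  obtain c where "c \<in> verts C" "c \<noteq> r" "par c = r" "v \<in> desc c"
    using child_desc[OF desc_root[OF v(1)] v(2)] by blast
  then show ?thesis using q(4) by blast
qed

lemma cl_q: "cl q = {1..<n}"
  unfolding cl_def using below_q t(1,2) by blast

lemma cl_inn: "v \<in> inn \<Longrightarrow> cl v \<in> clusters n"
proof -
  assume v: "v \<in> inn"
  then have v': "v \<in> verts C" "v \<noteq> r" "v \<noteq> q" unfolding inn_def by auto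
  have "cl v \<noteq> {1..<n}"
    using inj_onD[OF cl_inj, of v q] v' q(1,2) cl_q by auto
  moreover have "2 \<le> card (cl v)"
  proof (rule ccontr)
    assume "\<not> 2 \<le> card (cl v)"
    moreover have "card (cl v) \<noteq> 0"
      using cl_nonempty[OF v'(1,2)] finite_subset[OF cl_sub, of v] by simp
    ultimately have "card (cl v) = 1" by linarith
    then obtain i where i: "cl v = {i}" using card_1_singletonE by blast
    then have "i \<in> {1..<n}" using cl_sub[of v] by blast
    then have "v = t i"
      using inj_onD[OF cl_inj, of v "t i"] v' t(1,2) cl_t i by auto
    then show False using v \<open>i \<in> {1..<n}\<close> unfolding inn_def by blast
  qed
  ultimately show ?thesis unfolding clusters_def using cl_sub by blast
qed

definition tree_clusters :: "nat set set" where
  "tree_clusters = cl ` inn"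

lemma hier_tree_clusters: "hier n tree_clusters"
  unfolding hier_def laminar_def tree_clusters_def
proof (intro conjI ballI)
  show "cl ` inn \<subseteq> clusters n" using cl_inn by blast
  fix A B assume "A \<in> cl ` inn" "B \<in> cl ` inn"
  then show "A \<subseteq> B \<or> B \<subseteq> A \<or> A \<inter> B = {}" using cl_inter cl_mono by blast
qed

lemma cl_image: "cl ` (verts C - {r}) = ext n tree_clusters"
proof -
  have "verts C - {r} = insert q (inn \<union> t ` {1..<n})"
    unfolding inn_def using q t(1,2) by blast
  moreover have "cl ` t ` {1..<n} = (\<lambda>i. {i}) ` {1..<n}"
    unfolding image_image by (rule image_cong) (auto simp: cl_t)
  ultimately show ?thesis unfolding ext_def tree_clusters_def by (simp add: image_Un cl_q)
qed

end

text \<open>Connectivity alone enters, with no root or parent function, so that splits can be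
  compared across isomorphisms and contractions.\<close>

definition edge_split :: "nat \<Rightarrow> curve \<Rightarrow> nat set \<Rightarrow> nat set" where
  "edge_split n C e = {i \<in> {1..<n}. \<not> (\<exists>a\<in>leaf C n. \<exists>b\<in>leaf C i. (a, b) \<in> (adj (edges C - {e}))\<^sup>*)}"

lemma (in rooted_curve) split_edge:
  assumes v: "v \<in> inn"
  shows "edge_split n C {v, par v} = cl v"
proof -
  have v': "v \<in> verts C" "v \<noteq> r" "v \<noteq> q" using v unfolding inn_def by auto
  have rv: "r \<notin> desc v" using root_desc v'(2) by blast
  have qv: "q \<notin> desc v" using desc_step[OF q(1,2), of v] q(3) rv v'(3) by auto
  have "(\<exists>a\<in>leaf C n. \<exists>b\<in>leaf C i. (a, b) \<in> (adj (edges C - {{v, par v}}))\<^sup>*) \<longleftrightarrow> t i \<notin> desc v"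
    if i: "i \<in> {1..<n}" for i
  proof
    have side: "par (t i) \<in> desc v \<longleftrightarrow> t i \<in> desc v"
      using desc_step[OF t(1,2)[OF i], of v] v i unfolding inn_def by auto
    assume "\<exists>a\<in>leaf C n. \<exists>b\<in>leaf C i. (a, b) \<in> (adj (edges C - {{v, par v}}))\<^sup>*"
    then obtain a b where ab: "a \<in> {q, r}" "b \<in> {t i, par (t i)}" "(a, b) \<in> (adj (edges C - {{v, par v}}))\<^sup>*"
      unfolding leaf_n t(4)[OF i] by blast
    then show "t i \<notin> desc v"
      using separated_invariant[OF v'(1,2) ab(3)] rv qv side by auto
  next
    assume "t i \<notin> desc v"
    then have "(t i, r) \<in> (adj (edges C - {{v, par v}}))\<^sup>*"
      by (rule connected_outside[OF v'(1,2) t(1)[OF i]])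
    then have "(r, t i) \<in> (adj (edges C - {{v, par v}}))\<^sup>*" by (rule adj_rtrancl_sym)
    then show "\<exists>a\<in>leaf C n. \<exists>b\<in>leaf C i. (a, b) \<in> (adj (edges C - {{v, par v}}))\<^sup>*"
      unfolding leaf_n t(4)[OF i] by blast
  qed
  then show ?thesis unfolding edge_split_def cl_def by blast
qed

lemma (in rooted_curve) split_bounded: "edge_split n C ` bounded_edges C = tree_clusters"
  unfolding bounded_edges_eq tree_clusters_def image_image using split_edge by simp

lemma (in rooted_curve) inj_split: "inj_on (edge_split n C) (bounded_edges C)"
proof (rule inj_onI)
  fix e f assume ef: "e \<in> bounded_edges C" "f \<in> bounded_edges C" "edge_split n C e = edge_split n C f"
  then obtain u v where uv: "u \<in> inn" "v \<in> inn" "e = {u, par u}" "f = {v, par v}"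
    unfolding bounded_edges_eq by blast
  then have "cl u = cl v" using ef(3) split_edge by simp
  then have "u = v" using inj_onD[OF cl_inj, of u v] uv unfolding inn_def by blast
  then show "e = f" using uv by simp
qed

lemma rooted_curve_exists:
  assumes C: "rational_curve n C" and n: "3 \<le> n"
  shows "\<exists>r par rk q t. rooted_curve C r par rk n q t"
proof -
  have tree: "is_tree (verts C) (edges C)" and val: "\<And>v. v \<in> verts C \<Longrightarrow> valence C v = 1 \<or> 3 \<le> valence C v"
    and bij: "bij_betw (leaf C) {1..n} (leaf_edges C)"
    using C unfolding rational_curve_def by auto
  have leafE: "leaf C i \<in> leaf_edges C" if "i \<in> {1..n}" for i using bij_betwE[OF bij] that by blast
  have cardL: "card (leaf_edges C) = n" using bij_betw_same_card[OF bij] by simp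
  have "leaf C n \<in> leaf_edges C" using leafE n by simp
  then obtain r where r: "leaf C n \<in> edges C" "r \<in> leaf C n" "valence C r = 1"
    unfolding leaf_edges_def by blast
  have rV: "r \<in> verts C" using rational_curve_edge_sub[OF C r(1)] r(2) by blast
  obtain par rk where "rooted (verts C) (edges C) r par rk" using rooted_of_tree[OF tree rV] by blast
  then interpret rooted "verts C" "edges C" r par rk .
  let ?ch = "\<lambda>v. {w \<in> verts C. w \<noteq> r \<and> par w = v}"
  have val_eq: "valence C v = card (?ch v) + (if v = r then 0 else 1)" if "v \<in> verts C" for v
    unfolding valence_def by (rule card_incident[OF that])
  have finch: "finite (?ch v)" for v using finite_V by simp
  have "card (?ch r) = 1" using val_eq[OF rV] r(3) by simp
  then obtain q where q: "?ch r = {q}" using card_1_singletonE by blast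
  have leaf_n: "leaf C n = {q, r}"
  proof -
    obtain v where v: "v \<in> verts C" "v \<noteq> r" "leaf C n = {v, par v}" using r(1) unfolding edges_eq by blast
    then have "par v = r" using r(2) by auto
    then have "v = q" using v(1,2) q by blast
    then show ?thesis using v(3) \<open>par v = r\<close> by simp
  qed
  have qV: "q \<in> verts C" "q \<noteq> r" "par q = r" using q by auto
  \<comment> \<open>Otherwise the tree would be the single edge of leaf \<open>n\<close>, against
    \<open>n \<ge> 3\<close>.\<close>
  have qch: "?ch q \<noteq> {}"
  proof
    assume e: "?ch q = {}"
    have "verts C - {r} \<subseteq> {q}"
    proof
      fix v assume v: "v \<in> verts C - {r}"
      then obtain c where c: "c \<in> verts C" "c \<noteq> r" "par c = r" "v \<in> desc c"
        using child_desc[OF desc_root[of v]] by blast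
      then have "c = q" using q by blast
      then have "v = q" using child_desc[of v q] c(4) e by blast
      then show "v \<in> {q}" by simp
    qed
    then have "edges C \<subseteq> {{q, r}}" unfolding edges_eq using qV by auto
    then have "leaf_edges C \<subseteq> {{q, r}}" unfolding leaf_edges_def by blast
    then have "card (leaf_edges C) \<le> card {{q, r}}" by (intro card_mono) auto
    then show False using cardL n by simp
  qed
  \<comment> \<open>The 1-valent end of leaf \<open>i\<close> is its lower end: an upper end other
    than \<open>r\<close> with valence 1 would have no child, but \<open>v\<close> is one.\<close>
  have "\<exists>w. w \<in> verts C \<and> w \<noteq> r \<and> leaf C i = {w, par w} \<and> ?ch w = {}" if i: "i \<in> {1..<n}" for i
  proof -
    have "leaf C i \<in> leaf_edges C" using leafE i by simp
    then obtain x where x: "leaf C i \<in> edges C" "x \<in> leaf C i" "valence C x = 1"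
      unfolding leaf_edges_def by blast
    obtain v where v: "v \<in> verts C" "v \<noteq> r" "leaf C i = {v, par v}" using x(1) unfolding edges_eq by blast
    have ne: "leaf C i \<noteq> leaf C n" using bij_betw_imp_inj_on[OF bij] i n by (auto dest: inj_onD)
    show ?thesis
    proof (cases "x = v")
      case True
      then have "card (?ch v) = 0" using val_eq[OF v(1)] v(2) x(3) by simp
      then have "?ch v = {}" using finch by simp
      then show ?thesis using v by blast
    next
      case False
      then have xp: "x = par v" using x(2) v(3) by blast
      have vch: "v \<in> ?ch x" using v xp by blast
      have "x \<noteq> r" using ne leaf_n v q xp by auto
      then have "card (?ch x) = 0" using val_eq[of x] par(1)[OF v(1,2)] x(3) xp by simp
      then have "?ch x = {}" using finch by simp
      then show ?thesis using vch by blast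
    qed
  qed
  then have "\<exists>t. \<forall>i\<in>{1..<n}. t i \<in> verts C \<and> t i \<noteq> r \<and> leaf C i = {t i, par (t i)} \<and> ?ch (t i) = {}"
    by (intro bchoice) blast
  then obtain t where t: "\<And>i. i \<in> {1..<n} \<Longrightarrow> t i \<in> verts C \<and> t i \<noteq> r \<and> leaf C i = {t i, par (t i)} \<and> ?ch (t i) = {}"
    by blast
  have "rooted_curve C r par rk n q t"
    unfolding rooted_curve_def rooted_curve_axioms_def
  proof (intro conjI allI impI)
    show "rooted (verts C) (edges C) r par rk" by (rule rooted_axioms)
    show "v = q" if "v \<in> verts C" "v \<noteq> r" "par v = r" for v using q that by blast
    show "inj_on t {1..<n}"
    proof (rule inj_onI)
      fix i j assume ij: "i \<in> {1..<n}" "j \<in> {1..<n}" "t i = t j"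
      then have "leaf C i = leaf C j" using t by metis
      then show "i = j" using bij_betw_imp_inj_on[OF bij] ij by (auto dest: inj_onD)
    qed
    show "t i \<noteq> q" if "i \<in> {1..<n}" for i using t[OF that] qch by metis
    show "par v \<noteq> t i" if "i \<in> {1..<n}" "v \<in> verts C" "v \<noteq> r" for i v using t[OF that(1)] that by blast
    show "2 \<le> card {w \<in> verts C. w \<noteq> r \<and> par w = v}" if v: "v \<in> verts C" "v \<noteq> r" "v \<notin> t ` {1..<n}" for v
    proof (rule ccontr)
      assume "\<not> 2 \<le> card (?ch v)"
      then have "valence C v = 1" using val[OF v(1)] val_eq[OF v(1)] v(2) by simp
      then have ch0: "?ch v = {}" using val_eq[OF v(1)] v(2) finch by simp
      have "{v, par v} \<in> leaf_edges C"
        unfolding leaf_edges_def using edge_mem[OF v(1,2)] \<open>valence C v = 1\<close> by blast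
      then have "{v, par v} \<in> leaf C ` {1..n}" unfolding bij_betw_imp_surj_on[OF bij] .
      then obtain i where i': "{v, par v} = leaf C i" "i \<in> {1..n}" by (rule imageE)
      note i = i'(2) i'(1)[symmetric]
      show False
      proof (cases "i = n")
        case True
        then have "{v, par v} = {q, par q}" using i leaf_n qV by simp
        then have "v = q" using edge_inj[OF v(1,2) qV(1,2)] by blast
        then show False using ch0 qch by blast
      next
        case False
        then have "i \<in> {1..<n}" using i by simp
        then have "v = t i" using edge_inj[OF v(1,2), of "t i"] t i(2) by metis
        then show False using v(3) \<open>i \<in> {1..<n}\<close> by blast
      qed
    qed
    show "t i \<in> verts C" "t i \<noteq> r" "leaf C i = {t i, par (t i)}" if "i \<in> {1..<n}" for i
      using t[OF that] by blast+
  qed (fact n qV leaf_n)+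
  then show ?thesis by blast
qed

section \<open>Contractions\<close>

text \<open>On a rational curve each sum has at most one term, because a bounded edge is determined
  by its split. Written as a sum, the value is 0 at sets that no edge cuts off.\<close>

definition wt :: "nat \<Rightarrow> curve \<Rightarrow> nat set \<Rightarrow> real" where
  "wt n C S = (\<Sum>e\<in>{e \<in> bounded_edges C. edge_split n C e = S}. real_of_ereal (elen C e))"

definition push :: "nat \<Rightarrow> curve \<Rightarrow> (nat set \<Rightarrow> real) \<Rightarrow> nat set \<Rightarrow> real" where
  "push n G l S = (\<Sum>e\<in>{e \<in> bounded_edges G. edge_split n G e = S}. l e)"

lemma wt_eq_push: "wt n C = push n C (\<lambda>e. real_of_ereal (elen C e))"
  unfolding wt_def push_def ..

context rooted_curve
begin

lemma push_edge:
  assumes "e \<in> bounded_edges C"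
  shows "push n C l (edge_split n C e) = l e"
proof -
  have "{f \<in> bounded_edges C. edge_split n C f = edge_split n C e} = {e}"
    using inj_onD[OF inj_split] assms by blast
  then show ?thesis unfolding push_def by simp
qed

lemma push_0:
  assumes "S \<notin> tree_clusters"
  shows "push n C l S = 0"
proof -
  have "{f \<in> bounded_edges C. edge_split n C f = S} = {}"
    using assms split_bounded by blast
  then show ?thesis unfolding push_def by (simp only: sum.empty)
qed

lemma push_weights:
  assumes "\<And>e. e \<in> bounded_edges C \<Longrightarrow> 0 \<le> l e"
  shows "push n C l \<in> weights n" "{S. push n C l S \<noteq> 0} \<subseteq> tree_clusters"
proof -
  show s: "{S. push n C l S \<noteq> 0} \<subseteq> tree_clusters" using push_0 by blast
  have "0 \<le> push n C l S" for S unfolding push_def by (rule sum_nonneg) (use assms in auto)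
  then show "push n C l \<in> weights n"
    unfolding weights_def using hier_subset[OF hier_tree_clusters s] by blast
qed

end

lemma elen_pos:
  assumes "rational_curve n C" "e \<in> bounded_edges C"
  shows "0 < real_of_ereal (elen C e)" "elen C e = ereal (real_of_ereal (elen C e))"
proof -
  have "0 < elen C e" "elen C e < \<infinity>" using assms unfolding rational_curve_def by auto
  then show "0 < real_of_ereal (elen C e)" "elen C e = ereal (real_of_ereal (elen C e))"
    by (cases "elen C e"; simp)+
qed

lemma wt_weights:
  assumes "rational_curve n C" "3 \<le> n"
  shows "wt n C \<in> weights n"
proof -
  obtain r par rk q t where "rooted_curve C r par rk n q t" using rooted_curve_exists[OF assms] by blast
  then interpret rooted_curve C r par rk n q t .
  show ?thesis
    unfolding wt_eq_push by (rule push_weights) (use elen_pos(1)[OF assms(1)] less_imp_le in blast)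
qed

lemma curve_bridge:
  assumes "rational_curve n C" "{u, v} \<in> edges C" "u \<noteq> v"
  shows "(u, v) \<notin> (adj (edges C - {{u, v}}))\<^sup>*"
  by (rule bridge[OF _ assms(2,3)]) (use assms(1) in \<open>auto simp: rational_curve_def is_tree_def\<close>)

lemma curve_edgeE:
  assumes "rational_curve n C" "e \<in> edges C"
  obtains u v where "e = {u, v}" "u \<noteq> v" "u \<in> verts C" "v \<in> verts C"
proof -
  have "\<forall>e\<in>edges C. \<exists>u\<in>verts C. \<exists>v\<in>verts C. u \<noteq> v \<and> e = {u, v}"
    using assms(1) by (simp add: rational_curve_def is_tree_def)
  then show ?thesis using that assms(2) by blast
qed

lemma curve_connected:
  assumes "rational_curve n C" "u \<in> verts C" "v \<in> verts C"
  shows "(u, v) \<in> (adj (edges C))\<^sup>*"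
  using assms unfolding rational_curve_def is_tree_def adj_def by blast

text \<open>Follow a walk from \<open>c\<close>: whenever it uses the removed edge, it is restarted
  at the end where it arrives.\<close>

lemma remove_edge_sides:
  assumes "(c, x) \<in> (adj E)\<^sup>*"
  shows "(c, x) \<in> (adj (E - {{c, d}}))\<^sup>* \<or> (d, x) \<in> (adj (E - {{c, d}}))\<^sup>*"
  using assms
proof (induction rule: rtrancl_induct)
  case (step y z)
  show ?case
  proof (cases "{y, z} = {c, d}")
    case True
    then have "z = c \<or> z = d" by (auto simp: doubleton_eq_iff)
    then show ?thesis by auto
  next
    case False
    then have "(y, z) \<in> adj (E - {{c, d}})" using step(2) by (simp add: adj_def)
    then show ?thesis using step(3) by (auto intro: rtrancl_into_rtrancl)
  qed
qed simp

locale curve_contraction =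
  fixes n :: nat and G C :: curve and l :: "nat set \<Rightarrow> real" and \<pi> :: "nat \<Rightarrow> nat"
  assumes G: "rational_curve n G" and C: "rational_curve n C" and con: "contraction n G l C \<pi>"
begin

definition Z where "Z = {e \<in> bounded_edges G. l e = 0}"

lemma con': "\<pi> ` verts G = verts C"
  "\<And>u v. u \<in> verts G \<Longrightarrow> v \<in> verts G \<Longrightarrow> \<pi> u = \<pi> v \<longleftrightarrow> (u, v) \<in> (adj Z)\<^sup>*"
  "edges C = (`) \<pi> ` (edges G - Z)"
  "\<And>i. i \<in> {1..n} \<Longrightarrow> leaf C i = \<pi> ` leaf G i"
  "\<And>e. e \<in> bounded_edges G - Z \<Longrightarrow> elen C (\<pi> ` e) = ereal (l e)"
proof -
  have *: "\<pi> ` verts G = verts C \<and>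
      (\<forall>u\<in>verts G. \<forall>v\<in>verts G. \<pi> u = \<pi> v \<longleftrightarrow> (u, v) \<in> (adj Z)\<^sup>*) \<and>
      edges C = (`) \<pi> ` (edges G - Z) \<and> (\<forall>i\<in>{1..n}. leaf C i = \<pi> ` leaf G i) \<and>
      (\<forall>e\<in>bounded_edges G - Z. elen C (\<pi> ` e) = ereal (l e))"
    using con unfolding contraction_def Let_def Z_def adj_def .
  from * show "\<pi> ` verts G = verts C" by (rule conjunct1)
  from * show "edges C = (`) \<pi> ` (edges G - Z)" by (elim conjE)
  from * have "\<forall>u\<in>verts G. \<forall>v\<in>verts G. \<pi> u = \<pi> v \<longleftrightarrow> (u, v) \<in> (adj Z)\<^sup>*" by (elim conjE)
  then show "\<pi> u = \<pi> v \<longleftrightarrow> (u, v) \<in> (adj Z)\<^sup>*" if "u \<in> verts G" "v \<in> verts G" for u v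
    using that by (simp del: split_paired_All)
  from * show "leaf C i = \<pi> ` leaf G i" if "i \<in> {1..n}" for i
    using that by (elim conjE) (rule bspec)
  from * show "elen C (\<pi> ` e) = ereal (l e)" if "e \<in> bounded_edges G - Z" for e
    using that by (elim conjE) (rule bspec)
qed

lemma Z_sub: "Z \<subseteq> edges G"
  unfolding Z_def bounded_edges_def by blast

text \<open>Contracted edges joining the ends of a surviving edge would bypass a bridge.\<close>

lemma not_collapsed:
  assumes "{a, b} \<in> edges G - Z" "a \<noteq> b"
  shows "\<pi> a \<noteq> \<pi> b"
proof
  assume "\<pi> a = \<pi> b"
  moreover have "a \<in> verts G" "b \<in> verts G" using rational_curve_edge_sub[OF G, of "{a, b}"] assms by auto
  ultimately have "(a, b) \<in> (adj Z)\<^sup>*" using con'(2) by blast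
  moreover have "Z \<subseteq> edges G - {{a, b}}" using Z_sub assms by blast
  ultimately have "(a, b) \<in> (adj (edges G - {{a, b}}))\<^sup>*" using adj_mono by blast
  then show False using curve_bridge[OF G _ assms(2)] assms(1) by blast
qed

text \<open>Two edges with the same image are joined by contracted paths at both ends, so the second
  edge would bypass the first, which is a bridge.\<close>

lemma edge_inj: "inj_on ((`) \<pi>) (edges G - Z)"
proof (rule inj_onI, rule ccontr)
  fix f e assume f: "f \<in> edges G - Z" and e: "e \<in> edges G - Z" and eq: "\<pi> ` f = \<pi> ` e" and ne: "f \<noteq> e"
  obtain a b where ab: "f = {a, b}" "a \<noteq> b" "a \<in> verts G" "b \<in> verts G"
    using curve_edgeE[OF G, of f] f by blast
  obtain c0 d0 where cd0: "e = {c0, d0}" "c0 \<in> verts G" "d0 \<in> verts G"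
    using curve_edgeE[OF G, of e] e by blast
  have "{\<pi> a, \<pi> b} = {\<pi> c0, \<pi> d0}" using eq ab(1) cd0(1) by simp
  then obtain c d where cd: "e = {c, d}" "c \<in> verts G" "d \<in> verts G" "\<pi> a = \<pi> c" "\<pi> b = \<pi> d"
    using cd0 by (auto simp: doubleton_eq_iff insert_commute)
  have ZE: "(adj Z)\<^sup>* \<subseteq> (adj (edges G - {{a, b}}))\<^sup>*"
    by (rule adj_mono) (use Z_sub f ab(1) in blast)
  have "(a, c) \<in> (adj (edges G - {{a, b}}))\<^sup>*" using con'(2)[OF ab(3) cd(2)] cd(4) ZE by blast
  also have "(c, d) \<in> adj (edges G - {{a, b}})" using e ne ab(1) cd(1) by (simp add: adj_def)
  also have "(d, b) \<in> (adj (edges G - {{a, b}}))\<^sup>*" using con'(2)[OF cd(3) ab(4)] cd(5) ZE by auto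
  finally show False using curve_bridge[OF G, of a b] f ab by blast
qed

lemma image_connected:
  assumes e: "e \<in> edges G - Z" and ab: "(a, b) \<in> (adj (edges G - {e}))\<^sup>*"
  shows "(\<pi> a, \<pi> b) \<in> (adj (edges C - {\<pi> ` e}))\<^sup>*"
  using ab
proof (induction rule: rtrancl_induct)
  case (step y z)
  have yz: "{y, z} \<in> edges G" "{y, z} \<noteq> e" using step(2) by (auto simp: adj_def)
  show ?case
  proof (cases "{y, z} \<in> Z")
    case True
    then have "(y, z) \<in> (adj Z)\<^sup>*" by (auto simp: adj_def)
    moreover have "y \<in> verts G" "z \<in> verts G" using rational_curve_edge_sub[OF G yz(1)] by auto
    ultimately have "\<pi> y = \<pi> z" using con'(2) by blast
    then show ?thesis using step(3) by simp
  next
    case False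
    then have "\<pi> ` {y, z} \<noteq> \<pi> ` e" using inj_onD[OF edge_inj, of "{y, z}" e] yz e by blast
    moreover have "\<pi> ` {y, z} \<in> edges C" unfolding con'(3) using yz False by blast
    ultimately have "(\<pi> y, \<pi> z) \<in> adj (edges C - {\<pi> ` e})" by (simp add: adj_def)
    then show ?thesis using step(3) by (auto intro: rtrancl_into_rtrancl)
  qed
qed simp

text \<open>Connections survive a contraction. Conversely, if \<open>e\<close> separates two leaves
  in \<open>G\<close> but its image does not in \<open>C\<close>, then the two sides of
  \<open>e\<close> together connect the ends of the image edge around it, which is impossible in a
  tree.\<close>

lemma split_image:
  assumes e: "e \<in> edges G - Z" and n: "1 \<le> n"
  shows "edge_split n C (\<pi> ` e) = edge_split n G e"
proof -
  let ?RG = "(adj (edges G - {e}))\<^sup>*" and ?RC = "(adj (edges C - {\<pi> ` e}))\<^sup>*"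
  have "(\<exists>a\<in>leaf C n. \<exists>b\<in>leaf C i. (a, b) \<in> ?RC) \<longleftrightarrow> (\<exists>a\<in>leaf G n. \<exists>b\<in>leaf G i. (a, b) \<in> ?RG)"
    if i: "i \<in> {1..<n}" for i
  proof
    have lC: "leaf C n = \<pi> ` leaf G n" "leaf C i = \<pi> ` leaf G i" using con'(4) i n by auto
    assume "\<exists>a\<in>leaf C n. \<exists>b\<in>leaf C i. (a, b) \<in> ?RC"
    then obtain a b where ab: "a \<in> leaf G n" "b \<in> leaf G i" "(\<pi> a, \<pi> b) \<in> ?RC" unfolding lC by blast
    have "leaf G n \<subseteq> verts G" "leaf G i \<subseteq> verts G"
      using rational_curve_edge_sub[OF G rational_curve_leaf[OF G]] i n by auto
    then have abV: "a \<in> verts G" "b \<in> verts G" using ab by auto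
    obtain c d where cd: "e = {c, d}" "c \<noteq> d" "c \<in> verts G" "d \<in> verts G"
      using curve_edgeE[OF G, of e] e by blast
    have sides: "(c, x) \<in> ?RG \<or> (d, x) \<in> ?RG" if "x \<in> verts G" for x
      using remove_edge_sides[OF curve_connected[OF G cd(3) that], of d] cd(1) by simp
    have False if no: "(a, b) \<notin> ?RG"
    proof -
      have contra: False if u: "(u, a) \<in> ?RG" and w: "(w, b) \<in> ?RG" and uw: "{u, w} = e" "u \<noteq> w" for u w
      proof -
        have "(\<pi> u, \<pi> a) \<in> ?RC" "(\<pi> b, \<pi> w) \<in> ?RC"
          using image_connected[OF e u] image_connected[OF e w] adj_rtrancl_sym by auto
        then have "(\<pi> u, \<pi> w) \<in> ?RC" using ab(3) by (meson rtrancl_trans)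
        moreover have "\<pi> u \<noteq> \<pi> w" using not_collapsed[of u w] e uw by blast
        moreover have im: "\<pi> ` e = {\<pi> u, \<pi> w}" using uw by auto
        moreover have "\<pi> ` e \<in> edges C" unfolding con'(3) using e by blast
        ultimately show False using curve_bridge[OF C, of "\<pi> u" "\<pi> w"] by simp
      qed
      have same: False if "(x, a) \<in> ?RG" "(x, b) \<in> ?RG" for x
        using that adj_rtrancl_sym no by (meson rtrancl_trans)
      show False
        using sides[OF abV(1)] sides[OF abV(2)] same contra[of c d] contra[of d c] cd(1,2)
        by (metis insert_commute)
    qed
    then show "\<exists>a\<in>leaf G n. \<exists>b\<in>leaf G i. (a, b) \<in> ?RG" using ab(1,2) by blast
  next
    have lC: "leaf C n = \<pi> ` leaf G n" "leaf C i = \<pi> ` leaf G i" using con'(4) i n by auto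
    assume "\<exists>a\<in>leaf G n. \<exists>b\<in>leaf G i. (a, b) \<in> ?RG"
    then show "\<exists>a\<in>leaf C n. \<exists>b\<in>leaf C i. (a, b) \<in> ?RC"
      unfolding lC using image_connected[OF e] by blast
  qed
  then show ?thesis unfolding edge_split_def by blast
qed

lemma bounded_edges_image: "bounded_edges C = (`) \<pi> ` (bounded_edges G - Z)"
proof -
  have lG: "leaf_edges G = leaf G ` {1..n}" and lC: "leaf_edges C = leaf C ` {1..n}"
    using G C unfolding rational_curve_def bij_betw_def by auto
  have l: "leaf_edges C = (`) \<pi> ` leaf_edges G"
    unfolding lG lC image_image by (rule image_cong) (use con'(4) in auto)
  have sub: "leaf_edges G \<subseteq> edges G - Z" unfolding Z_def bounded_edges_def leaf_edges_def by blast
  have "bounded_edges C = (`) \<pi> ` (edges G - Z) - (`) \<pi> ` leaf_edges G"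
    unfolding bounded_edges_def con'(3) l ..
  also have "\<dots> = (`) \<pi> ` (edges G - Z - leaf_edges G)"
    using inj_on_image_set_diff[OF edge_inj _ sub, of "edges G - Z"] by simp
  also have "edges G - Z - leaf_edges G = bounded_edges G - Z" unfolding bounded_edges_def by blast
  finally show ?thesis .
qed

text \<open>Surviving edges keep their split and have the prescribed length, and contracted edges
  contribute 0.\<close>

lemma wt_contraction:
  assumes n: "3 \<le> n"
  shows "wt n C = push n G l"
proof
  fix S
  have sub: "bounded_edges G - Z \<subseteq> edges G - Z" unfolding bounded_edges_def by blast
  have fin: "finite (bounded_edges G)"
  proof -
    have "edges G \<subseteq> Pow (verts G)" using rational_curve_edge_sub[OF G] by blast
    moreover have "finite (verts G)" using G by (simp add: rational_curve_def is_tree_def)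
    ultimately show ?thesis unfolding bounded_edges_def by (meson finite_Diff finite_Pow_iff finite_subset)
  qed
  have "{e \<in> bounded_edges C. edge_split n C e = S} = (`) \<pi> ` {e \<in> bounded_edges G - Z. edge_split n G e = S}"
    unfolding bounded_edges_image using split_image sub n by auto
  moreover have injX: "inj_on ((`) \<pi>) {e \<in> bounded_edges G - Z. edge_split n G e = S}"
    by (rule inj_on_subset[OF edge_inj subset_trans[OF _ sub]]) (rule Collect_restrict)
  ultimately have "wt n C S = (\<Sum>e\<in>{e \<in> bounded_edges G - Z. edge_split n G e = S}. real_of_ereal (elen C (\<pi> ` e)))"
    using sum.reindex[OF injX, of "\<lambda>e. real_of_ereal (elen C e)"] unfolding wt_def comp_def by (simp only:)
  also have "\<dots> = (\<Sum>e\<in>{e \<in> bounded_edges G - Z. edge_split n G e = S}. l e)"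
    by (rule sum.cong[OF refl]) (use con'(5) in auto)
  also have "\<dots> = push n G l S"
    unfolding push_def by (rule sum.mono_neutral_left) (use fin in \<open>auto simp: Z_def\<close>)
  finally show "wt n C S = push n G l S" .
qed

end

lemma contraction_isometry:
  assumes con: "contraction n G l C \<pi>" and iso: "marked_iso n C D \<psi>" and G: "rational_curve n G"
    and len: "\<forall>e\<in>edges C. elen D (\<psi> ` e) = elen C e"
  shows "contraction n G l D (\<psi> \<circ> \<pi>)"
proof -
  let ?Z = "{e \<in> bounded_edges G. l e = 0}"
  have c: "\<pi> ` verts G = verts C"
    "\<forall>u\<in>verts G. \<forall>v\<in>verts G. \<pi> u = \<pi> v \<longleftrightarrow> (u, v) \<in> {(a, b). {a, b} \<in> ?Z}\<^sup>*"
    "edges C = (`) \<pi> ` (edges G - ?Z)" "\<forall>i\<in>{1..n}. leaf C i = \<pi> ` leaf G i"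
    "\<forall>e\<in>bounded_edges G - ?Z. elen C (\<pi> ` e) = ereal (l e)"
    using con[unfolded contraction_def Let_def] by - (elim conjE; assumption)+
  have i: "bij_betw \<psi> (verts C) (verts D)" "edges D = (`) \<psi> ` edges C" "\<forall>i\<in>{1..n}. leaf D i = \<psi> ` leaf C i"
    using iso[unfolded marked_iso_def] by - (elim conjE; assumption)+
  have inj: "\<psi> x = \<psi> y \<longleftrightarrow> x = y" if "x \<in> verts C" "y \<in> verts C" for x y
    using bij_betw_imp_inj_on[OF i(1)] that by (auto dest: inj_onD)
  have E: "\<pi> ` e \<in> edges C" if "e \<in> bounded_edges G - ?Z" for e
    unfolding c(3) using that by (auto simp: bounded_edges_def)
  show ?thesis
    unfolding contraction_def Let_def
  proof (intro conjI ballI)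
    show "(\<psi> \<circ> \<pi>) ` verts G = verts D"
      unfolding image_comp[symmetric] c(1) by (rule bij_betw_imp_surj_on[OF i(1)])
    show "(\<psi> \<circ> \<pi>) u = (\<psi> \<circ> \<pi>) v \<longleftrightarrow> (u, v) \<in> {(a, b). {a, b} \<in> ?Z}\<^sup>*" if uv: "u \<in> verts G" "v \<in> verts G" for u v
    proof -
      have "\<pi> u \<in> verts C" "\<pi> v \<in> verts C" using c(1) uv by auto
      then show ?thesis using inj c(2) uv by simp
    qed
    show "edges D = (`) (\<psi> \<circ> \<pi>) ` (edges G - ?Z)"
      unfolding i(2) c(3) image_image comp_def ..
    show "leaf D j = (\<psi> \<circ> \<pi>) ` leaf G j" if "j \<in> {1..n}" for j
      using i(3) c(4) that by (simp add: image_comp)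
    show "elen D ((\<psi> \<circ> \<pi>) ` e) = ereal (l e)" if "e \<in> bounded_edges G - ?Z" for e
      using len E[OF that] c(5) that by (simp only: image_comp[symmetric])
  qed
qed

text \<open>All lengths are positive, so nothing is contracted. Isometries thus become a special
  case of contractions.\<close>

lemma isometry_contraction:
  assumes C: "rational_curve n C" and D: "rational_curve n D"
  shows "contraction n C (\<lambda>e. real_of_ereal (elen C e)) D \<phi> \<longleftrightarrow>
    marked_iso n C D \<phi> \<and> (\<forall>e\<in>edges C. elen D (\<phi> ` e) = elen C e)" (is "?l = ?r")
proof -
  have pos: "real_of_ereal (elen C e) \<noteq> 0" if "e \<in> bounded_edges C" for e
    using elen_pos(1)[OF C that] by simp
  have Z: "{e \<in> bounded_edges C. real_of_ereal (elen C e) = 0} = {}" using pos by blast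
  have leafs: "leaf_edges C = leaf C ` {1..n}" "leaf_edges D = leaf D ` {1..n}"
    using C D unfolding rational_curve_def bij_betw_def by auto
  have E: "edges C = bounded_edges C \<union> leaf_edges C" unfolding bounded_edges_def leaf_edges_def by blast
  have b: "elen C e = ereal (real_of_ereal (elen C e))" if "e \<in> bounded_edges C" for e
    by (rule elen_pos(2)[OF C that])
  have "?l \<longleftrightarrow> \<phi> ` verts C = verts D \<and> inj_on \<phi> (verts C) \<and> edges D = (`) \<phi> ` edges C \<and>
      (\<forall>i\<in>{1..n}. leaf D i = \<phi> ` leaf C i) \<and> (\<forall>e\<in>bounded_edges C. elen D (\<phi> ` e) = elen C e)"
    unfolding contraction_def Let_def Z inj_on_def using b by auto
  also have "\<dots> \<longleftrightarrow> marked_iso n C D \<phi> \<and> (\<forall>e\<in>bounded_edges C. elen D (\<phi> ` e) = elen C e)"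
    unfolding marked_iso_def bij_betw_def by (simp only: conj_ac)
  also have "\<dots> \<longleftrightarrow> ?r"
  proof -
    have "elen D (\<phi> ` e) = elen C e" if iso: "marked_iso n C D \<phi>" and e: "e \<in> leaf_edges C" for e
    proof -
      obtain i where i: "i \<in> {1..n}" "e = leaf C i" using e leafs by blast
      then have "\<phi> ` e = leaf D i" using iso by (simp add: marked_iso_def)
      then have "\<phi> ` e \<in> leaf_edges D" using leafs(2) i(1) by blast
      then show ?thesis using C D e by (simp add: rational_curve_def)
    qed
    then show ?thesis unfolding E by blast
  qed
  finally show ?thesis .
qed

lemma isometric_wt:
  assumes "(C, D) \<in> isometry_rel n" "3 \<le> n"
  shows "wt n C = wt n D"
proof -
  obtain \<phi> where CD: "rational_curve n C" "rational_curve n D"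
    "marked_iso n C D \<phi> \<and> (\<forall>e\<in>edges C. elen D (\<phi> ` e) = elen C e)"
    using assms(1) unfolding isometry_rel_iff by blast
  interpret curve_contraction n C D "\<lambda>e. real_of_ereal (elen C e)" \<phi>
    by unfold_locales (use CD isometry_contraction[OF CD(1,2)] in auto)
  show ?thesis using wt_contraction[OF assms(2)] wt_eq_push by simp
qed

section \<open>The curve of a weighted laminar family\<close>

text \<open>The tree with prescribed weights on a laminar family: its vertices are codes of the clusters,
  and the root is \<open>{1..n}\<close>.\<close>

definition code_edge :: "nat set set \<Rightarrow> nat set \<Rightarrow> nat set" where
  "code_edge \<C> S = {set_encode S, set_encode (cover \<C> S)}"

definition canon :: "nat \<Rightarrow> (nat set \<Rightarrow> real) \<Rightarrow> curve" where
  "canon n l = (let \<C> = full n {S. l S \<noteq> 0} in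
    \<lparr>verts = set_encode ` \<C>,
     edges = code_edge \<C> ` (\<C> - {{1..n}}),
     elen = (\<lambda>e. let S = \<Inter>(set_decode ` e) in if l S \<noteq> 0 then ereal (l S) else \<infinity>),
     leaf = (\<lambda>i. code_edge \<C> (if i = n then {1..<n} else {i}))\<rparr>)"

text \<open>The additional set \<open>{1..n}\<close> contains all members of
  \<open>ext n \<N>\<close>, so it is the next larger set for the top one only.\<close>

lemma cover_full:
  assumes "hier n \<N>" "3 \<le> n"
  shows "S \<in> ext n \<N> \<Longrightarrow> S \<noteq> {1..<n} \<Longrightarrow> cover (full n \<N>) S = cover (ext n \<N>) S"
    and "cover (full n \<N>) {1..<n} = {1..n}"
proof -
  interpret e: full_hierarchy "{1..<n}" "ext n \<N>" by (rule full_hierarchy_ext) (use assms in auto)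
  have sub: "{1..<n} \<subset> {1..n}" using assms(2) by auto
  have "\<not> {1..<n} \<subset> R" if "R \<in> ext n \<N>" for R using e.sub_U[OF that] by blast
  then have "{T \<in> full n \<N>. {1..<n} \<subset> T} = {{1..n}}" unfolding full_def using sub by blast
  then show "cover (full n \<N>) {1..<n} = {1..n}" unfolding cover_def by simp
  assume S: "S \<in> ext n \<N>" "S \<noteq> {1..<n}"
  have "S \<subset> {1..n}" using e.sub_U[OF S(1)] sub by blast
  then have "{T \<in> full n \<N>. S \<subset> T} = insert {1..n} {T \<in> ext n \<N>. S \<subset> T}" unfolding full_def by blast
  then have "cover (full n \<N>) S = {1..n} \<inter> cover (ext n \<N>) S" unfolding cover_def by simp
  also have "\<dots> = cover (ext n \<N>) S" using e.cover(1)[OF S] e.sub_U sub by blast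
  finally show "cover (full n \<N>) S = cover (ext n \<N>) S" .
qed

lemma top_notin_ext: "hier n \<N> \<Longrightarrow> 3 \<le> n \<Longrightarrow> {1..n} \<notin> ext n \<N>"
proof
  assume a: "hier n \<N>" "3 \<le> n" "{1..n} \<in> ext n \<N>"
  interpret e: full_hierarchy "{1..<n}" "ext n \<N>" by (rule full_hierarchy_ext) (use a in auto)
  have "{1..n} \<subseteq> {1..<n}" by (rule e.sub_U[OF a(3)])
  moreover have "n \<in> {1..n}" using a(2) by simp
  ultimately show False by auto
qed

lemma singleton_ext: "i \<in> {1..<n} \<Longrightarrow> {i} \<in> ext n \<N>"
  unfolding ext_def by blast

lemma full_cases: "S \<in> full n \<N> \<Longrightarrow> S \<noteq> {1..n} \<Longrightarrow> S \<in> ext n \<N>"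
  unfolding full_def by blast

locale canonical =
  fixes n and l :: "nat set \<Rightarrow> real"
  assumes n: "3 \<le> n" and l: "l \<in> weights n"
begin

abbreviation "\<N> \<equiv> {S. l S \<noteq> 0}"
abbreviation "\<C> \<equiv> full n \<N>"
abbreviation "D \<equiv> canon n l"

lemma hN: "hier n \<N>" using l unfolding weights_def by blast

sublocale f: hierarchy "{1..n}" \<C>
  by (rule hierarchy_full[OF hN]) (use n in simp)

sublocale e: full_hierarchy "{1..<n}" "ext n \<N>"
  by (rule full_hierarchy_ext[OF hN]) (use n in simp)

lemma top: "{1..n} \<notin> ext n \<N>" by (rule top_notin_ext[OF hN n])

lemma decode: "S \<in> \<C> \<Longrightarrow> set_decode (set_encode S) = S"
  using f.finite_mem by simp

lemma encode_inj: "S \<in> \<C> \<Longrightarrow> T \<in> \<C> \<Longrightarrow> set_encode S = set_encode T \<longleftrightarrow> S = T"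
  using decode by metis

lemma ext_C: "S \<in> ext n \<N> \<Longrightarrow> S \<in> \<C>" unfolding full_def by blast

lemma canon_simps: "verts D = set_encode ` \<C>" "edges D = code_edge \<C> ` (\<C> - {{1..n}})"
  "i \<noteq> n \<Longrightarrow> leaf D i = code_edge \<C> {i}" "leaf D n = code_edge \<C> {1..<n}"
  by (simp_all add: canon_def Let_def)

text \<open>The ends of an edge decode to \<open>S\<close> and a larger set, so their intersection
  recovers \<open>S\<close>.\<close>

lemma elen_code_edge:
  assumes S: "S \<in> \<C>" "S \<noteq> {1..n}"
  shows "elen D (code_edge \<C> S) = (if l S \<noteq> 0 then ereal (l S) else \<infinity>)"
proof -
  have "\<Inter>(set_decode ` code_edge \<C> S) = S"
    unfolding code_edge_def using decode[OF S(1)] decode[OF f.cover(1)[OF S]] f.cover(2)[OF S] by auto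
  then show ?thesis by (simp add: canon_def Let_def)
qed

text \<open>Parents are covers, and \<open>n - card\<close> decreases upwards because covers are
  strictly larger. The two children demanded at inner vertices come from the children of a node in
  the laminar family.\<close>

sublocale rooted_curve D "set_encode {1..n}" "\<lambda>v. set_encode (cover \<C> (set_decode v))"
  "\<lambda>v. n - card (set_decode v)" n "set_encode {1..<n}" "\<lambda>i. set_encode {i}"
proof
  note simps = canon_simps
  have U: "{1..n} \<in> \<C>" by (rule f.U_mem)
  have I: "{1..<n} \<in> \<C>" "{1..<n} \<in> ext n \<N>" using ext_C e.U_mem by auto
  have IU: "{1..<n} \<noteq> {1..n}" using top I(2) by metis
  have vE: "\<exists>S. S \<in> \<C> \<and> S \<noteq> {1..n} \<and> v = set_encode S" if "v \<in> verts D" "v \<noteq> set_encode {1..n}" for v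
    using that unfolding simps by blast
  show "3 \<le> n" by (rule n)
  show "finite (verts D)" unfolding simps using f.finite_C by simp
  show "set_encode {1..n} \<in> verts D" unfolding simps using U by blast
  show "set_encode (cover \<C> (set_decode v)) \<in> verts D" if v: "v \<in> verts D" "v \<noteq> set_encode {1..n}" for v
  proof -
    obtain S where "S \<in> \<C>" "S \<noteq> {1..n}" "v = set_encode S" using vE[OF v] by blast
    then show ?thesis unfolding simps using f.cover(1) decode by auto
  qed
  show "n - card (set_decode (set_encode (cover \<C> (set_decode v)))) < n - card (set_decode v)"
    if v: "v \<in> verts D" "v \<noteq> set_encode {1..n}" for v
  proof -
    obtain S where S: "S \<in> \<C>" "S \<noteq> {1..n}" "v = set_encode S" using vE[OF v] by blast
    note c = f.cover[OF S(1,2)]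
    have "card S < card (cover \<C> S)" using c f.finite_mem by (simp add: psubset_card_mono)
    moreover have "card (cover \<C> S) \<le> n" using card_mono[OF _ f.sub_U[OF c(1)]] by simp
    ultimately show ?thesis unfolding S(3) decode[OF S(1)] decode[OF c(1)] by linarith
  qed
  show "edges D = {{v, set_encode (cover \<C> (set_decode v))} |v. v \<in> verts D \<and> v \<noteq> set_encode {1..n}}"
  proof (intro equalityI subsetI)
    fix e assume "e \<in> edges D"
    then obtain S where S: "S \<in> \<C>" "S \<noteq> {1..n}" "e = code_edge \<C> S" unfolding simps by blast
    have "e = {set_encode S, set_encode (cover \<C> (set_decode (set_encode S)))}"
      unfolding S(3) code_edge_def decode[OF S(1)] ..
    moreover have "set_encode S \<in> verts D" unfolding simps using S by blast
    moreover have "set_encode S \<noteq> set_encode {1..n}" using encode_inj[OF S(1) U] S(2) by blast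
    ultimately show "e \<in> {{v, set_encode (cover \<C> (set_decode v))} |v. v \<in> verts D \<and> v \<noteq> set_encode {1..n}}"
      by blast
  next
    fix e assume "e \<in> {{v, set_encode (cover \<C> (set_decode v))} |v. v \<in> verts D \<and> v \<noteq> set_encode {1..n}}"
    then obtain v where v: "v \<in> verts D" "v \<noteq> set_encode {1..n}" "e = {v, set_encode (cover \<C> (set_decode v))}" by blast
    obtain S where S: "S \<in> \<C>" "S \<noteq> {1..n}" "v = set_encode S" using vE[OF v(1,2)] by blast
    have "e = code_edge \<C> S" unfolding v(3) S(3) code_edge_def decode[OF S(1)] ..
    then show "e \<in> edges D" unfolding simps using S by blast
  qed
  show "set_encode {1..<n} \<in> verts D" unfolding simps using I by blast
  show "set_encode {1..<n} \<noteq> set_encode {1..n}" using encode_inj[OF I(1) U] IU by blast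
  show "set_encode (cover \<C> (set_decode (set_encode {1..<n}))) = set_encode {1..n}"
    unfolding decode[OF I(1)] cover_full(2)[OF hN n] ..
  show "v = set_encode {1..<n}"
    if v: "v \<in> verts D" "v \<noteq> set_encode {1..n}" "set_encode (cover \<C> (set_decode v)) = set_encode {1..n}" for v
  proof -
    obtain S where S: "S \<in> \<C>" "S \<noteq> {1..n}" "v = set_encode S" using vE[OF v(1,2)] by blast
    have "cover \<C> S = {1..n}"
      using v(3) encode_inj[OF f.cover(1)[OF S(1,2)] U] unfolding S(3) decode[OF S(1)] by blast
    moreover have Se: "S \<in> ext n \<N>" using full_cases S by blast
    ultimately have "S = {1..<n}" using cover_full(1)[OF hN n Se] e.cover(1)[OF Se] top by metis
    then show ?thesis using S(3) by simp
  qed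
  show "leaf D n = {set_encode {1..<n}, set_encode {1..n}}"
    unfolding simps code_edge_def cover_full(2)[OF hN n] ..
  fix i assume i: "i \<in> {1..<n}"
  have iC: "{i} \<in> \<C>" "{i} \<in> ext n \<N>" using singleton_ext[OF i] ext_C by auto
  have ci: "card {1..n} = n" "card {1..<n} = n - 1" "card {i} = 1" by simp_all
  have inU: "{i} \<noteq> {1..n}" using top iC(2) by metis
  have inI: "{i} \<noteq> {1..<n}"
  proof
    assume "{i} = {1..<n}"
    then have "card {i} = card {1..<n}" by simp
    then show False using ci n by simp
  qed
  show "set_encode {i} \<in> verts D" unfolding simps using iC by blast
  show "set_encode {i} \<noteq> set_encode {1..n}" using encode_inj[OF iC(1) U] inU by blast
  show "set_encode {i} \<noteq> set_encode {1..<n}" using encode_inj[OF iC(1) I(1)] inI by blast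
  show "leaf D i = {set_encode {i}, set_encode (cover \<C> (set_decode (set_encode {i})))}"
    unfolding decode[OF iC(1)] using simps(3)[of i] i by (simp add: code_edge_def)
  show "set_encode (cover \<C> (set_decode v)) \<noteq> set_encode {i}"
    if v: "v \<in> verts D" "v \<noteq> set_encode {1..n}" for v
  proof -
    obtain S where S: "S \<in> \<C>" "S \<noteq> {1..n}" "v = set_encode S" using vE[OF v] by blast
    note c = f.cover[OF S(1,2)]
    have "cover \<C> S \<noteq> {i}" using c(2) f.nonempty[OF S(1)] by (auto simp: psubset_eq subset_singleton_iff)
    then show ?thesis using encode_inj[OF c(1) iC(1)] unfolding S(3) decode[OF S(1)] by blast
  qed
next
  have U: "{1..n} \<in> \<C>" by (rule f.U_mem)
  show "inj_on (\<lambda>i. set_encode {i}) {1..<n}"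
  proof (rule inj_onI)
    fix i j assume ij: "i \<in> {1..<n}" "j \<in> {1..<n}" "set_encode {i} = set_encode {j}"
    have "{i} \<in> \<C>" "{j} \<in> \<C>" using singleton_ext ext_C ij(1,2) by auto
    then show "i = j" using encode_inj ij(3) by blast
  qed
  show "2 \<le> card {w \<in> verts D. w \<noteq> set_encode {1..n} \<and> set_encode (cover \<C> (set_decode w)) = v}"
    if v: "v \<in> verts D" "v \<noteq> set_encode {1..n}" "v \<notin> (\<lambda>i. set_encode {i}) ` {1..<n}" for v
  proof -
    obtain S where S: "S \<in> \<C>" "S \<noteq> {1..n}" "v = set_encode S"
      using v(1,2) unfolding canon_simps by blast
    have Se: "S \<in> ext n \<N>" by (rule full_cases[OF S(1,2)])
    have "S \<notin> (\<lambda>i. {i}) ` {1..<n}" using v(3) S(3) by blast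
    then have "S \<in> insert {1..<n} \<N>" using Se unfolding ext_def by blast
    then have 2: "2 \<le> card (children (ext n \<N>) S)" by (rule sum_children_hier(3)[OF hN n])
    have inj: "inj_on set_encode (children (ext n \<N>) S)"
      using encode_inj e.childrenD(1) ext_C by (intro inj_onI) blast
    have "set_encode ` children (ext n \<N>) S \<subseteq> {w \<in> verts D. w \<noteq> set_encode {1..n} \<and> set_encode (cover \<C> (set_decode w)) = v}"
    proof (rule image_subsetI)
      fix T assume T: "T \<in> children (ext n \<N>) S"
      have Te: "T \<in> ext n \<N>" by (rule e.childrenD(1)[OF T])
      have "T \<noteq> {1..<n}" using e.childrenD(2)[OF T] e.sub_U[OF Se] by blast
      then have "cover \<C> T = S"
        using cover_full(1)[OF hN n Te] e.cover_eq_iff[OF Te] T by blast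
      moreover have "T \<noteq> {1..n}" using Te top by metis
      then have "set_encode T \<noteq> set_encode {1..n}" using encode_inj[OF ext_C[OF Te] U] by blast
      ultimately show "set_encode T \<in> {w \<in> verts D. w \<noteq> set_encode {1..n} \<and> set_encode (cover \<C> (set_decode w)) = v}"
        unfolding canon_simps mem_Collect_eq decode[OF ext_C[OF Te]] S(3) using ext_C[OF Te] by blast
    qed
    then have "card (set_encode ` children (ext n \<N>) S) \<le> card {w \<in> verts D. w \<noteq> set_encode {1..n} \<and> set_encode (cover \<C> (set_decode w)) = v}"
      by (rule card_mono[rotated]) (simp add: canon_simps f.finite_C)
    then show ?thesis using 2 card_image[OF inj] by simp
  qed
qed

text \<open>The iterated covers of \<open>S\<close> run through all members that contain it.\<close>

lemma desc_encode:
  assumes "S \<in> \<C>" "T \<in> \<C>"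
  shows "set_encode S \<in> desc (set_encode T) \<longleftrightarrow> S \<subseteq> T"
  using assms
proof (induction "n - card S" arbitrary: S rule: less_induct)
  case less
  show ?case
  proof (cases "S = {1..n}")
    case True
    have "{1..n} \<subseteq> T \<longleftrightarrow> T = {1..n}" using f.sub_U[OF less(3)] by blast
    moreover have "set_encode T = set_encode {1..n} \<longleftrightarrow> T = {1..n}" by (rule encode_inj[OF less(3) f.U_mem])
    ultimately show ?thesis unfolding True root_desc by blast
  next
    case False
    note c = f.cover[OF less(2) False]
    have "card S < card (cover \<C> S)" using c f.finite_mem by (simp add: psubset_card_mono)
    moreover have "card (cover \<C> S) \<le> n" using card_mono[OF _ f.sub_U[OF c(1)]] by simp
    ultimately have "n - card (cover \<C> S) < n - card S" by linarith
    then have IH: "set_encode (cover \<C> S) \<in> desc (set_encode T) \<longleftrightarrow> cover \<C> S \<subseteq> T"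
      using less(1)[OF _ c(1) less(3)] by blast
    have v: "set_encode S \<in> verts D" unfolding canon_simps using less(2) by blast
    have ne: "set_encode S \<noteq> set_encode {1..n}" using encode_inj[OF less(2) f.U_mem] False by blast
    have "set_encode S \<in> desc (set_encode T) \<longleftrightarrow> S = T \<or> cover \<C> S \<subseteq> T"
      unfolding desc_step[OF v ne] decode[OF less(2)] IH encode_inj[OF less(2,3)] ..
    also have "\<dots> \<longleftrightarrow> S \<subseteq> T" using c less(3) by blast
    finally show ?thesis .
  qed
qed

lemma cl_encode: "S \<in> ext n \<N> \<Longrightarrow> cl (set_encode S) = S"
proof -
  assume S: "S \<in> ext n \<N>"
  have "set_encode {i} \<in> desc (set_encode S) \<longleftrightarrow> i \<in> S" if "i \<in> {1..<n}" for i
    using desc_encode[OF ext_C[OF singleton_ext[OF that]] ext_C[OF S]] by simp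
  then show ?thesis unfolding cl_def using e.sub_U[OF S] by blast
qed

lemma inn_encode: "inn = set_encode ` \<N>"
proof -
  have ins: "set_encode S \<in> inn \<longleftrightarrow> S \<in> \<N>" if S: "S \<in> \<C>" for S
  proof -
    have 1: "set_encode S \<in> verts D" unfolding canon_simps using S by blast
    have 2: "set_encode S = set_encode {1..n} \<longleftrightarrow> S = {1..n}" "set_encode S = set_encode {1..<n} \<longleftrightarrow> S = {1..<n}"
      using encode_inj[OF S f.U_mem] encode_inj[OF S ext_C[OF e.U_mem]] by auto
    have 3: "set_encode S \<in> (\<lambda>i. set_encode {i}) ` {1..<n} \<longleftrightarrow> S \<in> (\<lambda>i. {i}) ` {1..<n}"
      unfolding image_iff by (rule bex_cong[OF refl]) (rule encode_inj[OF S ext_C[OF singleton_ext]])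
    have 4: "S \<in> \<N> \<longleftrightarrow> S \<noteq> {1..n} \<and> S \<noteq> {1..<n} \<and> S \<notin> (\<lambda>i. {i}) ` {1..<n}"
    proof
      assume SN: "S \<in> \<N>"
      then have "S \<in> clusters n" "S \<in> ext n \<N>" using hN unfolding hier_def ext_def by blast+
      then have "S \<noteq> {1..n}" "S \<noteq> {1..<n}" "2 \<le> card S" using top clustersD by metis+
      then show "S \<noteq> {1..n} \<and> S \<noteq> {1..<n} \<and> S \<notin> (\<lambda>i. {i}) ` {1..<n}" by auto
    next
      assume "S \<noteq> {1..n} \<and> S \<noteq> {1..<n} \<and> S \<notin> (\<lambda>i. {i}) ` {1..<n}"
      then show "S \<in> \<N>" using full_cases[OF S] unfolding ext_def by blast
    qed
    show ?thesis unfolding inn_def using 1 2 3 4 by blast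
  qed
  have "inn \<subseteq> set_encode ` \<C>" unfolding inn_def canon_simps by blast
  moreover have "\<N> \<subseteq> \<C>" unfolding full_def ext_def by blast
  ultimately show ?thesis using ins by blast
qed

lemma tree_clusters_canon: "tree_clusters = \<N>"
proof -
  have "cl (set_encode S) = S" if "S \<in> \<N>" for S using cl_encode that unfolding ext_def by blast
  then show ?thesis unfolding tree_clusters_def inn_encode image_image by simp
qed

lemma bounded_edges_canon: "bounded_edges D = code_edge \<C> ` \<N>"
proof -
  have "S \<in> \<C>" if "S \<in> \<N>" for S using that unfolding full_def ext_def by blast
  then show ?thesis
    unfolding bounded_edges_eq inn_encode image_image code_edge_def by (intro image_cong refl) (simp add: decode)
qed

lemma rational_canon: "rational_curve n D"
  unfolding rational_curve_iff
proof (intro conjI ballI)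
  have NC: "S \<in> \<C> \<and> S \<noteq> {1..n}" if "S \<in> \<N>" for S
    using that top unfolding full_def ext_def by blast
  fix e assume e: "e \<in> bounded_edges D"
  then obtain S where S: "S \<in> \<N>" "e = code_edge \<C> S" unfolding bounded_edges_canon by blast
  have "0 < l S" using S(1) l unfolding weights_def by (simp add: order_less_le)
  then show "0 < elen D e" "elen D e < \<infinity>" using elen_code_edge NC[OF S(1)] S by auto
next
  fix e assume e: "e \<in> leaf_edges D"
  then obtain S where S: "S \<in> \<C>" "S \<noteq> {1..n}" "e = code_edge \<C> S"
    unfolding leaf_edges_def canon_simps(2) by blast
  have "e \<notin> bounded_edges D" using e unfolding bounded_edges_def by blast
  then have "S \<notin> \<N>" using S(3) unfolding bounded_edges_canon by blast
  then show "elen D e = \<infinity>" unfolding S(3) elen_code_edge[OF S(1,2)] by simp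
qed

lemma wt_canon: "wt n D = l"
proof
  fix S
  show "wt n D S = l S"
  proof (cases "S \<in> \<N>")
    case True
    have SC: "S \<in> \<C>" "S \<noteq> {1..n}" "S \<in> ext n \<N>" using True top unfolding full_def ext_def by blast+
    have b: "code_edge \<C> S \<in> bounded_edges D" unfolding bounded_edges_canon using True by blast
    have "set_encode S \<in> inn" unfolding inn_encode using True by blast
    from split_edge[OF this] have "edge_split n D (code_edge \<C> S) = S"
      unfolding code_edge_def decode[OF SC(1)] cl_encode[OF SC(3)] .
    then show ?thesis
      unfolding wt_eq_push using push_edge[OF b, of "\<lambda>e. real_of_ereal (elen D e)"] elen_code_edge[OF SC(1,2)] True by simp
  next
    case False
    then show ?thesis unfolding wt_eq_push using push_0 tree_clusters_canon by simp
  qed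
qed

end

text \<open>A curve \<open>G\<close> with lengths that may be 0, to be contracted onto the canonical
  curve of its weights \<open>l'\<close>. The family \<open>\<F>\<close> has one set for each vertex
  of \<open>G\<close>, the smaller family \<open>\<C>\<close> one for each vertex that
  remains.\<close>

locale canonical_contraction = rooted_curve G r par rk n q t
  for G r par rk n q t +
  fixes l :: "nat set \<Rightarrow> real"
  assumes rational_G: "rational_curve n G" and l_nonneg: "\<And>e. e \<in> bounded_edges G \<Longrightarrow> 0 \<le> l e"
begin

abbreviation "l' \<equiv> push n G l"

sublocale D: canonical n l'
  by (rule canonical.intro[OF n push_weights(1)[OF l_nonneg]])

abbreviation "\<N> \<equiv> {S. l' S \<noteq> 0}"
abbreviation "\<C> \<equiv> full n \<N>"
abbreviation "\<F> \<equiv> full n tree_clusters"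

definition Cl :: "nat \<Rightarrow> nat set" where "Cl v = (if v = r then {1..n} else cl v)"

lemma sub: "\<N> \<subseteq> tree_clusters"
  by (rule push_weights(2)[OF l_nonneg])

lemma full_sub: "\<C> \<subseteq> \<F>"
  using sub unfolding full_def ext_def by blast

sublocale F: hierarchy "{1..n}" \<F>
  by (rule hierarchy_full[OF hier_tree_clusters]) (use n in simp)

lemma Cl_root: "Cl v = {1..n} \<longleftrightarrow> v = r" if "v \<in> verts G"
proof -
  have "n \<notin> cl v" using cl_sub[of v] by auto
  moreover have "n \<in> {1..n}" using n by simp
  ultimately show ?thesis unfolding Cl_def by auto
qed

lemma Cl_image: "Cl ` verts G = \<F>"
proof -
  have "Cl ` verts G = insert {1..n} (cl ` (verts G - {r}))"
    using root unfolding Cl_def by auto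
  then show ?thesis unfolding cl_image full_def .
qed

lemma Cl_inj: "inj_on Cl (verts G)"
proof (rule inj_onI)
  fix u v assume uv: "u \<in> verts G" "v \<in> verts G" "Cl u = Cl v"
  show "u = v"
  proof (cases "u = r \<or> v = r")
    case True
    then show ?thesis using Cl_root uv by metis
  next
    case False
    then show ?thesis using inj_onD[OF cl_inj, of u v] uv unfolding Cl_def by auto
  qed
qed

text \<open>Inclusion of the sets \<open>Cl\<close> is the descendant order, so the next vertex
  upwards corresponds to the next larger set.\<close>

lemma Cl_par:
  assumes v: "v \<in> verts G" "v \<noteq> r"
  shows "Cl (par v) = cover \<F> (Cl v)"
proof
  have CF: "Cl w \<in> \<F>" if "w \<in> verts G" for w using that Cl_image by blast
  have top: "Cl v \<noteq> {1..n}" using Cl_root v by blast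
  note c = F.cover[OF CF[OF v(1)] top]
  have mono: "Cl u \<subseteq> Cl w \<longleftrightarrow> u \<in> desc w" if u: "u \<in> verts G" and w: "w \<in> verts G" for u w
  proof (cases "u = r \<or> w = r")
    case True
    have "{1..n} \<subseteq> Cl w \<longleftrightarrow> w = r" using F.sub_U[OF CF[OF w]] Cl_root[OF w] by blast
    moreover have "Cl u \<subseteq> {1..n}" by (rule F.sub_U[OF CF[OF u]])
    ultimately show ?thesis using True root_desc desc_root[OF u] unfolding Cl_def by auto
  next
    case False
    then show ?thesis using cl_subset_iff[of u w] u w unfolding Cl_def by auto
  qed
  have p: "par v \<in> verts G" by (rule par(1)[OF v])
  have "v \<in> desc (par v)" using desc_step[OF v, of "par v"] desc_refl by blast
  then have "Cl v \<subseteq> Cl (par v)" using mono[OF v(1) p] by blast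
  moreover have "Cl v \<noteq> Cl (par v)" using inj_onD[OF Cl_inj _ v(1) p] par_neq[OF v] by metis
  ultimately show "cover \<F> (Cl v) \<subseteq> Cl (par v)" using c(3)[OF CF[OF p]] by blast
  obtain w where w: "w \<in> verts G" "cover \<F> (Cl v) = Cl w" using c(1) Cl_image by blast
  have "v \<in> desc w" using mono[OF v(1) w(1)] c(2) w(2) by blast
  moreover have "v \<noteq> w" using c(2) w(2) by blast
  ultimately have "par v \<in> desc w" using desc_step[OF v, of w] by blast
  then show "Cl (par v) \<subseteq> cover \<F> (Cl v)" using mono[OF p w(1)] w(2) by blast
qed

definition env :: "nat set \<Rightarrow> nat set" where "env S = envelope \<C> S"

text \<open>A vertex goes to the smallest surviving set around its own. In the tree this is the
  first surviving vertex on the way up.\<close>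

definition \<pi> :: "nat \<Rightarrow> nat" where "\<pi> v = set_encode (env (Cl v))"

lemma env:
  assumes "S \<in> \<F>"
  shows "env S \<in> \<C>" "S \<subseteq> env S" "\<And>R. R \<in> \<C> \<Longrightarrow> S \<subseteq> R \<Longrightarrow> env S \<subseteq> R"
  using D.f.envelope[of S] F.sub_U[OF assms] F.nonempty[OF assms] unfolding env_def by blast+

lemma env_mem: "S \<in> \<C> \<Longrightarrow> env S = S"
  unfolding env_def by (rule D.f.envelope_mem)

lemma env_cover_collapsed:
  assumes "S \<in> \<F>" "S \<notin> \<C>"
  shows "env (cover \<F> S) = env S"
proof -
  have "S \<noteq> {1..n}" using assms(2) D.f.U_mem by blast
  note c = F.cover[OF assms(1) this]
  have "R \<in> \<C> \<Longrightarrow> S \<subseteq> R \<longleftrightarrow> cover \<F> S \<subseteq> R" for R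
    using c assms full_sub by blast
  then have "{R \<in> \<C>. S \<subseteq> R} = {R \<in> \<C>. cover \<F> S \<subseteq> R}" by blast
  then show ?thesis unfolding env_def envelope_def by simp
qed

lemma env_cover:
  assumes "S \<in> \<C>" "S \<noteq> {1..n}"
  shows "env (cover \<F> S) = cover \<C> S"
proof
  have SF: "S \<in> \<F>" using assms full_sub by blast
  note c = D.f.cover[OF assms] and cF = F.cover[OF SF assms(2)]
  have "cover \<F> S \<subseteq> cover \<C> S" using cF(3)[of "cover \<C> S"] c full_sub by blast
  then show "env (cover \<F> S) \<subseteq> cover \<C> S" using env(3)[OF cF(1) c(1)] by blast
  have "S \<subset> env (cover \<F> S)" using cF(2) env(2)[OF cF(1)] by blast
  then show "cover \<C> S \<subseteq> env (cover \<F> S)" using c(3)[OF env(1)[OF cF(1)]] by blast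
qed

definition Z where "Z = {e \<in> bounded_edges G. l e = 0}"

text \<open>The length of a bounded edge is the weight of the set of its lower vertex. The sets of
  the ends of leaves survive in any case.\<close>

lemma edge_Z:
  assumes v: "v \<in> verts G" "v \<noteq> r"
  shows "{v, par v} \<in> Z \<longleftrightarrow> Cl v \<notin> \<C>"
proof (cases "v \<in> inn")
  case True
  have b: "{v, par v} \<in> bounded_edges G" unfolding bounded_edges_eq using True by blast
  have cc: "cl v \<in> clusters n" by (rule cl_inn[OF True])
  have "cl v \<noteq> {1..n}" using Cl_root[OF v(1)] v(2) unfolding Cl_def by simp
  moreover have "cl v \<noteq> {1..<n}" by (rule clustersD(3)[OF cc])
  moreover have "cl v \<noteq> {i}" for i using clustersD(2)[OF cc] by auto
  ultimately have "Cl v \<in> \<C> \<longleftrightarrow> l' (cl v) \<noteq> 0" unfolding Cl_def full_def ext_def using v(2) by auto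
  also have "l' (cl v) = l {v, par v}" using push_edge[OF b, of l] split_edge[OF True] by simp
  finally show ?thesis using b unfolding Z_def by blast
next
  case False
  have "{v, par v} \<notin> bounded_edges G"
  proof
    assume "{v, par v} \<in> bounded_edges G"
    then obtain w where w: "w \<in> inn" "{v, par v} = {w, par w}" unfolding bounded_edges_eq by blast
    then have "v = w" using edge_inj[OF v, of w] unfolding inn_def by blast
    then show False using w False by blast
  qed
  moreover have "Cl v \<in> \<C>"
  proof -
    consider "v = q" | i where "i \<in> {1..<n}" "v = t i" using False v unfolding inn_def by blast
    then show ?thesis
    proof cases
      case 1 then show ?thesis using cl_q v(2) unfolding Cl_def full_def ext_def by simp
    next
      case 2 then show ?thesis using cl_t[OF 2(1)] v(2) unfolding Cl_def full_def ext_def by simp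
    qed
  qed
  ultimately show ?thesis unfolding Z_def by blast
qed

text \<open>Climb as long as the set of the vertex does not survive; every edge on the way has
  length 0, and the envelope stays the same.\<close>

lemma representative:
  "v \<in> verts G \<Longrightarrow> \<exists>w\<in>verts G. Cl w = env (Cl v) \<and> (v, w) \<in> (adj Z)\<^sup>*"
proof (induction "rk v" arbitrary: v rule: less_induct)
  case less
  show ?case
  proof (cases "Cl v \<in> \<C>")
    case True
    then show ?thesis using env_mem less(2) by auto
  next
    case False
    then have vr: "v \<noteq> r" using D.f.U_mem unfolding Cl_def by auto
    obtain w where w: "w \<in> verts G" "Cl w = env (Cl (par v))" "(par v, w) \<in> (adj Z)\<^sup>*"
      using less(1)[OF par(2)[OF less(2) vr] par(1)[OF less(2) vr]] by blast
    have "env (Cl (par v)) = env (Cl v)"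
      unfolding Cl_par[OF less(2) vr] by (rule env_cover_collapsed) (use less(2) Cl_image False in auto)
    moreover have "(v, par v) \<in> adj Z" unfolding adj_def using edge_Z[OF less(2) vr] False by blast
    ultimately show ?thesis using w by (metis converse_rtrancl_into_rtrancl)
  qed
qed

lemma Z_collapsed:
  assumes "(u, v) \<in> (adj Z)\<^sup>*"
  shows "\<pi> u = \<pi> v"
  using assms
proof (induction rule: rtrancl_induct)
  case (step y z)
  have key: "\<pi> (par v) = \<pi> v" if v: "v \<in> verts G" "v \<noteq> r" "{v, par v} \<in> Z" for v
  proof -
    have "Cl v \<in> \<F>" using Cl_image v(1) by blast
    then show ?thesis
      unfolding \<pi>_def Cl_par[OF v(1,2)] using env_cover_collapsed edge_Z[OF v(1,2)] v(3) by simp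
  qed
  have yz: "{y, z} \<in> Z" using step(2) by (simp add: adj_def)
  then have "(y, z) \<in> adj (edges G)" unfolding Z_def bounded_edges_def adj_def by blast
  from adj_cases[OF this] have "\<pi> y = \<pi> z"
  proof (elim disjE conjE)
    assume "y \<in> verts G" "y \<noteq> r" "z = par y"
    then show ?thesis using key[of y] yz by simp
  next
    assume "z \<in> verts G" "z \<noteq> r" "y = par z"
    then show ?thesis using key[of z] yz by (simp add: insert_commute)
  qed
  then show ?case using step(3) by simp
qed simp

lemma \<pi>_edge:
  assumes v: "v \<in> verts G" "v \<noteq> r" and C: "Cl v \<in> \<C>"
  shows "\<pi> ` {v, par v} = code_edge \<C> (Cl v)"
proof -
  have "Cl v \<noteq> {1..n}" using Cl_root v by blast
  then have "env (Cl (par v)) = cover \<C> (Cl v)" unfolding Cl_par[OF v] by (rule env_cover[OF C])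
  then show ?thesis unfolding code_edge_def \<pi>_def using env_mem[OF C] by simp
qed

lemma contraction_canon: "contraction n G l (canon n l') \<pi>"
  unfolding contraction_def Let_def Z_def[symmetric] adj_def[symmetric]
proof (intro conjI ballI)
  have "env ` \<F> = \<C>" using env(1) env_mem full_sub by force
  then show "\<pi> ` verts G = verts (canon n l')"
    unfolding D.canon_simps \<pi>_def using Cl_image by (metis image_image)
  show "\<pi> u = \<pi> v \<longleftrightarrow> (u, v) \<in> (adj Z)\<^sup>*" if uv: "u \<in> verts G" "v \<in> verts G" for u v
  proof
    assume eq: "\<pi> u = \<pi> v"
    obtain w where w: "w \<in> verts G" "Cl w = env (Cl u)" "(u, w) \<in> (adj Z)\<^sup>*"
      using representative[OF uv(1)] by blast
    obtain x where x: "x \<in> verts G" "Cl x = env (Cl v)" "(v, x) \<in> (adj Z)\<^sup>*"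
      using representative[OF uv(2)] by blast
    have "env (Cl u) \<in> \<C>" "env (Cl v) \<in> \<C>" using env(1) Cl_image uv by blast+
    then have "env (Cl u) = env (Cl v)" using D.encode_inj eq unfolding \<pi>_def by blast
    then have "w = x" using inj_onD[OF Cl_inj _ w(1) x(1)] w(2) x(2) by simp
    then show "(u, v) \<in> (adj Z)\<^sup>*" using w(3) adj_rtrancl_sym[OF x(3)] by (meson rtrancl_trans)
  qed (rule Z_collapsed)
  have E: "edges G - Z = (\<lambda>v. {v, par v}) ` {v \<in> verts G. v \<noteq> r \<and> Cl v \<in> \<C>}"
    unfolding edges_eq using edge_Z by blast
  have "Cl ` {v \<in> verts G. v \<noteq> r \<and> Cl v \<in> \<C>} = \<C> - {{1..n}}"
  proof (intro equalityI subsetI)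
    fix S assume "S \<in> \<C> - {{1..n}}"
    moreover from this obtain v where "v \<in> verts G" "S = Cl v" using Cl_image full_sub by blast
    ultimately show "S \<in> Cl ` {v \<in> verts G. v \<noteq> r \<and> Cl v \<in> \<C>}" using Cl_root by blast
  qed (use Cl_root in auto)
  then have "edges (canon n l') = code_edge \<C> ` Cl ` {v \<in> verts G. v \<noteq> r \<and> Cl v \<in> \<C>}"
    unfolding D.canon_simps by simp
  also have "\<dots> = (`) \<pi> ` (edges G - Z)"
    unfolding E image_image by (rule image_cong[OF refl]) (use \<pi>_edge in auto)
  finally show "edges (canon n l') = (`) \<pi> ` (edges G - Z)" .
  show "leaf (canon n l') i = \<pi> ` leaf G i" if i: "i \<in> {1..n}" for i
  proof (cases "i = n")
    case True
    have "Cl q = {1..<n}" using cl_q q(2) unfolding Cl_def by simp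
    moreover have "{1..<n} \<in> \<C>" unfolding full_def ext_def by blast
    ultimately show ?thesis using \<pi>_edge[OF q(1,2)] q(3) leaf_n True by (simp add: D.canon_simps)
  next
    case False
    then have i': "i \<in> {1..<n}" using i by simp
    have "Cl (t i) = {i}" using cl_t[OF i'] t(2)[OF i'] unfolding Cl_def by simp
    moreover have "{i} \<in> \<C>" unfolding full_def ext_def using i' by blast
    ultimately show ?thesis using \<pi>_edge[OF t(1,2)[OF i']] t(4)[OF i'] False by (simp add: D.canon_simps)
  qed
  fix e assume e: "e \<in> bounded_edges G - Z"
  then obtain v where v: "v \<in> inn" "e = {v, par v}" unfolding bounded_edges_eq by blast
  then have v': "v \<in> verts G" "v \<noteq> r" unfolding inn_def by auto
  have C: "Cl v \<in> \<C>" using edge_Z[OF v'] e v(2) by blast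
  have "Cl v \<noteq> {1..n}" using Cl_root v' by blast
  moreover have "l' (Cl v) = l e"
    using push_edge[of e l] split_edge[OF v(1)] e v(2) v'(2) unfolding Cl_def by simp
  moreover have "l e \<noteq> 0" using e unfolding Z_def by blast
  ultimately show "elen (canon n l') (\<pi> ` e) = ereal (l e)"
    unfolding v(2) \<pi>_edge[OF v' C] using D.elen_code_edge[OF C] v(2) by simp
qed

end

lemma contraction_canon_exists:
  assumes "3 \<le> n" "rational_curve n G" "\<And>e. e \<in> bounded_edges G \<Longrightarrow> 0 \<le> l e"
  shows "\<exists>\<pi>. contraction n G l (canon n (push n G l)) \<pi>"
proof -
  obtain r par rk q t where "rooted_curve G r par rk n q t" using rooted_curve_exists[OF assms(2,1)] by blast
  then interpret canonical_contraction G r par rk n q t l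
    by (intro canonical_contraction.intro canonical_contraction_axioms.intro assms)
  show ?thesis using contraction_canon by blast
qed

lemma rational_canon': "3 \<le> n \<Longrightarrow> l \<in> weights n \<Longrightarrow> rational_curve n (canon n l) \<and> wt n (canon n l) = l"
proof -
  assume a: "3 \<le> n" "l \<in> weights n"
  interpret canonical n l by (rule canonical.intro[OF a])
  show ?thesis using rational_canon wt_canon by blast
qed

lemma isometric_canon:
  assumes "3 \<le> n" "rational_curve n C"
  shows "(C, canon n (wt n C)) \<in> isometry_rel n"
proof -
  have w: "wt n C \<in> weights n" by (rule wt_weights[OF assms(2,1)])
  have D: "rational_curve n (canon n (wt n C))" using rational_canon' assms(1) w by blast
  have "\<exists>\<phi>. contraction n C (\<lambda>e. real_of_ereal (elen C e)) (canon n (wt n C)) \<phi>"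
    unfolding wt_eq_push
    by (rule contraction_canon_exists[OF assms]) (use elen_pos(1)[OF assms(2)] less_imp_le in blast)
  then show ?thesis unfolding isometry_rel_iff using isometry_contraction[OF assms(2) D] assms(2) D by blast
qed

lemma isometric_iff_wt:
  assumes "3 \<le> n" "rational_curve n C" "rational_curve n D"
  shows "(C, D) \<in> isometry_rel n \<longleftrightarrow> wt n C = wt n D"
proof
  assume eq: "wt n C = wt n D"
  have "(D, canon n (wt n C)) \<in> isometry_rel n" using isometric_canon[OF assms(1,3)] eq by simp
  then have "(canon n (wt n C), D) \<in> isometry_rel n"
    using equivE[OF equiv_isometry_rel[of n]] by (metis symE)
  then show "(C, D) \<in> isometry_rel n"
    using isometric_canon[OF assms(1,2)] equivE[OF equiv_isometry_rel[of n]] by (metis transE)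
qed (rule isometric_wt[OF _ assms(1)])

text \<open>Contractions preserve weights. Conversely, the canonical curve is one contraction, and
  composing with isometries reaches every curve with the same weights.\<close>

lemma cone_point_eq:
  assumes n: "3 \<le> n" and G: "rational_curve n G" and l: "\<And>e. e \<in> bounded_edges G \<Longrightarrow> 0 \<le> l e"
  shows "cone_point n G l = {C. rational_curve n C \<and> wt n C = push n G l}"
proof (intro equalityI subsetI)
  fix C assume "C \<in> cone_point n G l"
  then obtain \<pi> where C: "rational_curve n C" "contraction n G l C \<pi>" unfolding cone_point_def by blast
  interpret curve_contraction n G C l \<pi> by (rule curve_contraction.intro[OF G C])
  show "C \<in> {C. rational_curve n C \<and> wt n C = push n G l}" using C(1) wt_contraction[OF n] by blast
next
  fix C assume "C \<in> {C. rational_curve n C \<and> wt n C = push n G l}"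
  then have C: "rational_curve n C" "wt n C = push n G l" by auto
  obtain \<pi> where \<pi>: "contraction n G l (canon n (push n G l)) \<pi>"
    using contraction_canon_exists[where l=l, OF n G l] by blast
  have "(canon n (push n G l), C) \<in> isometry_rel n"
    using isometric_canon[OF n C(1)] C(2) equivE[OF equiv_isometry_rel[of n]] by (metis symE)
  then obtain \<psi> where "marked_iso n (canon n (push n G l)) C \<psi>"
    "\<forall>e\<in>edges (canon n (push n G l)). elen C (\<psi> ` e) = elen (canon n (push n G l)) e"
    unfolding isometry_rel_iff by blast
  then have "contraction n G l C (\<psi> \<circ> \<pi>)" by (intro contraction_isometry[OF \<pi> _ G])
  then show "C \<in> cone_point n G l" unfolding cone_point_def using C(1) by blast
qed

section \<open>The moduli set as the set of weight vectors\<close>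

definition curves_of :: "nat \<Rightarrow> (nat set \<Rightarrow> real) \<Rightarrow> curve set" where
  "curves_of n l = {C. rational_curve n C \<and> wt n C = l}"

lemma moduli_eq: "3 \<le> n \<Longrightarrow> moduli n = curves_of n ` weights n"
proof -
  assume n: "3 \<le> n"
  have cls: "isometry_rel n `` {C} = curves_of n (wt n C)" if C: "rational_curve n C" for C
  proof -
    have r: "rational_curve n D" if "(C, D) \<in> isometry_rel n" for D using that unfolding isometry_rel_iff by blast
    have "(C, D) \<in> isometry_rel n \<longleftrightarrow> rational_curve n D \<and> wt n D = wt n C" for D
      using isometric_iff_wt[OF n C, of D] r[of D] by metis
    then show ?thesis unfolding curves_of_def by blast
  qed
  show ?thesis
  proof (intro equalityI subsetI)
    fix x assume "x \<in> moduli n"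
    then obtain C where "rational_curve n C" "x = isometry_rel n `` {C}"
      unfolding moduli_def by (auto elim: quotientE)
    then show "x \<in> curves_of n ` weights n" using cls wt_weights[OF _ n] by auto
  next
    fix x assume "x \<in> curves_of n ` weights n"
    then obtain l where l: "l \<in> weights n" "x = curves_of n l" by blast
    have "rational_curve n (canon n l)" "wt n (canon n l) = l" using rational_canon'[OF n l(1)] by auto
    then have "x = isometry_rel n `` {canon n l}" using cls l(2) by metis
    then show "x \<in> moduli n" unfolding moduli_def using \<open>rational_curve n (canon n l)\<close> by (auto intro: quotientI)
  qed
qed

definition wt_class :: "nat \<Rightarrow> curve set \<Rightarrow> nat set \<Rightarrow> real" where
  "wt_class n x = wt n (SOME C. C \<in> x)"

lemma wt_class_curves_of:
  assumes "3 \<le> n" "l \<in> weights n"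
  shows "wt_class n (curves_of n l) = l"
proof -
  have "canon n l \<in> curves_of n l" using rational_canon'[OF assms] unfolding curves_of_def by simp
  then have "(SOME C. C \<in> curves_of n l) \<in> curves_of n l" by (metis someI_ex)
  then show ?thesis unfolding wt_class_def curves_of_def by simp
qed

lemma moduli_class:
  assumes "3 \<le> n" "x \<in> moduli n"
  shows "wt_class n x \<in> weights n" "x = curves_of n (wt_class n x)"
  using assms moduli_eq wt_class_curves_of by auto

lemma wt_class_mem:
  assumes "3 \<le> n" "x \<in> moduli n" "C \<in> x"
  shows "wt_class n x = wt n C" "rational_curve n C"
proof -
  have "C \<in> curves_of n (wt_class n x)" using assms(3) moduli_class(2)[OF assms(1,2)] by blast
  then show "wt_class n x = wt n C" "rational_curve n C" unfolding curves_of_def by auto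
qed

lemma type_cone_nonneg: "l \<in> topspace (type_cone G) \<Longrightarrow> e \<in> bounded_edges G \<Longrightarrow> 0 \<le> l e"
  unfolding type_cone_def by (auto simp: topspace_product_topology PiE_iff)

lemma cone_point_curves_of:
  assumes "3 \<le> n" "rational_curve n G" "l \<in> topspace (type_cone G)"
  shows "cone_point n G l = curves_of n (push n G l)" "push n G l \<in> weights n"
proof -
  have l: "\<And>e. e \<in> bounded_edges G \<Longrightarrow> 0 \<le> l e" using type_cone_nonneg[OF assms(3)] .
  show "cone_point n G l = curves_of n (push n G l)"
    unfolding curves_of_def by (rule cone_point_eq[OF assms(1,2) l])
  obtain r par rk q t where "rooted_curve G r par rk n q t" using rooted_curve_exists[OF assms(2,1)] by blast
  then interpret rooted_curve G r par rk n q t .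
  show "push n G l \<in> weights n" by (rule push_weights(1)[OF l])
qed

lemma topspace_moduli:
  assumes "3 \<le> n"
  shows "topspace (moduli_top n) = moduli n"
proof -
  have "openin (moduli_top n) (moduli n)"
    unfolding openin_moduli_top
  proof (intro conjI allI impI subset_refl)
    fix G assume G: "rational_curve n G"
    have "{l \<in> topspace (type_cone G). cone_point n G l \<in> moduli n} = topspace (type_cone G)"
      using cone_point_curves_of[OF assms G] moduli_eq[OF assms] by auto
    then show "openin (type_cone G) {l \<in> topspace (type_cone G). cone_point n G l \<in> moduli n}" by simp
  qed
  then have "moduli n \<subseteq> topspace (moduli_top n)" by (rule openin_subset)
  moreover have "topspace (moduli_top n) \<subseteq> moduli n"
    using openin_topspace[of "moduli_top n"] unfolding openin_moduli_top by blast
  ultimately show ?thesis by blast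
qed

section \<open>Sheaves\<close>

lemma is_sheafD:
  assumes "is_sheaf X \<O>" "openin X U" "f \<in> \<O> U"
  shows "x \<in> U \<Longrightarrow> f x \<noteq> \<infinity>" "(\<And>x. x \<in> U \<Longrightarrow> f x = g x) \<Longrightarrow> g \<in> \<O> U"
    "openin X V \<Longrightarrow> V \<subseteq> U \<Longrightarrow> f \<in> \<O> V"
proof -
  note * = bspec[OF conjunct1[OF mp[OF spec[OF assms(1)[unfolded is_sheaf_def], of U] assms(2)]] assms(3)]
  from * show "x \<in> U \<Longrightarrow> f x \<noteq> \<infinity>" by (elim conjE) (rule bspec)
  from * have "\<forall>g. (\<forall>x\<in>U. f x = g x) \<longrightarrow> g \<in> \<O> U" by (elim conjE)
  then show "(\<And>x. x \<in> U \<Longrightarrow> f x = g x) \<Longrightarrow> g \<in> \<O> U" by simp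
  from * have "\<forall>V. openin X V \<and> V \<subseteq> U \<longrightarrow> f \<in> \<O> V" by (elim conjE)
  then show "openin X V \<Longrightarrow> V \<subseteq> U \<Longrightarrow> f \<in> \<O> V" by simp
qed

lemma is_sheaf_glue:
  assumes "is_sheaf X \<O>" "openin X U" "\<And>x. x \<in> U \<Longrightarrow> \<exists>V. openin X V \<and> x \<in> V \<and> V \<subseteq> U \<and> f \<in> \<O> V"
  shows "f \<in> \<O> U"
proof -
  note * = conjunct2[OF mp[OF spec[OF assms(1)[unfolded is_sheaf_def], of U] assms(2)]]
  show ?thesis by (rule mp[OF spec[OF *]]) (use assms(3) in blast)
qed

lemma is_sheafI:
  assumes "\<And>U f x. openin X U \<Longrightarrow> f \<in> \<O> U \<Longrightarrow> x \<in> U \<Longrightarrow> f x \<noteq> \<infinity>"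
    "\<And>U f g. openin X U \<Longrightarrow> f \<in> \<O> U \<Longrightarrow> (\<And>x. x \<in> U \<Longrightarrow> f x = g x) \<Longrightarrow> g \<in> \<O> U"
    "\<And>U V f. openin X U \<Longrightarrow> f \<in> \<O> U \<Longrightarrow> openin X V \<Longrightarrow> V \<subseteq> U \<Longrightarrow> f \<in> \<O> V"
    "\<And>U f. openin X U \<Longrightarrow> (\<And>x. x \<in> U \<Longrightarrow> \<exists>V. openin X V \<and> x \<in> V \<and> V \<subseteq> U \<and> f \<in> \<O> V) \<Longrightarrow> f \<in> \<O> U"
  shows "is_sheaf X \<O>"
  unfolding is_sheaf_def
proof (intro allI impI conjI ballI)
  fix U assume U: "openin X U"
  show "f x \<noteq> \<infinity>" if "f \<in> \<O> U" "x \<in> U" for f x by (rule assms(1)[OF U that])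
  show "g \<in> \<O> U" if "f \<in> \<O> U" "\<forall>x\<in>U. f x = g x" for f g
    by (rule assms(2)[OF U that(1)]) (use that(2) in blast)
  show "f \<in> \<O> V" if "f \<in> \<O> U" "openin X V \<and> V \<subseteq> U" for f V
    using assms(3)[OF U that(1)] that(2) by blast
  show "f \<in> \<O> U" if "\<forall>x\<in>U. \<exists>V. openin X V \<and> x \<in> V \<and> V \<subseteq> U \<and> f \<in> \<O> V" for f
    by (rule assms(4)[OF U]) (use that in blast)
qed

lemma regular_subset:
  assumes "regular N V f" "W \<subseteq> V"
  shows "regular N W f"
proof -
  have "continuous_map (subtopology (trop_space N) W) (top_of_set (- {\<infinity>})) f"
    using assms unfolding regular_def by (blast intro: continuous_map_from_subtopology_mono)
  then show ?thesis using assms unfolding regular_def by blast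
qed

lemma regular_cong:
  assumes "regular N V f" "\<And>x. x \<in> V \<Longrightarrow> f x = g x"
  shows "regular N V g"
proof -
  have "continuous_map (subtopology (trop_space N) V) (top_of_set (- {\<infinity>})) g"
    by (rule continuous_map_eq[of _ _ f]) (use assms in \<open>auto simp: regular_def\<close>)
  moreover obtain p where "laurent_polynomial N p" "\<forall>x\<in>Rn N. emb x \<in> V \<longrightarrow> f (emb x) = ereal (p x)"
    using assms(1) unfolding regular_def by blast
  ultimately show ?thesis using assms(2) unfolding regular_def by metis
qed

lemma is_sheaf_trop: "is_sheaf (trop_space N) (trop_sheaf N)"
proof (rule is_sheafI)
  fix U f x assume U: "openin (trop_space N) U" "f \<in> trop_sheaf N U" "x \<in> U"
  then obtain V where V: "openin (trop_space N) V" "x \<in> V" "regular N V f" unfolding trop_sheaf_def by blast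
  then have "continuous_map (subtopology (trop_space N) V) (top_of_set (- {\<infinity>})) f" unfolding regular_def by blast
  moreover have "x \<in> topspace (subtopology (trop_space N) V)" using V(1,2) openin_subset by auto
  ultimately have "f x \<in> topspace (top_of_set (- {\<infinity>}))" by (rule continuous_map_image_subset_topspace[THEN subsetD, OF _ imageI])
  then show "f x \<noteq> \<infinity>" by simp
next
  fix U f g assume U: "f \<in> trop_sheaf N U" "\<And>x. x \<in> U \<Longrightarrow> f x = g x"
  show "g \<in> trop_sheaf N U"
    unfolding trop_sheaf_def
  proof (intro CollectI ballI)
    fix x assume "x \<in> U"
    then obtain V where V: "openin (trop_space N) V" "x \<in> V" "V \<subseteq> U" "regular N V f"
      using U(1) unfolding trop_sheaf_def by blast
    moreover have "regular N V g" by (rule regular_cong[OF V(4)]) (use U(2) V(3) in blast)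
    ultimately show "\<exists>V. openin (trop_space N) V \<and> x \<in> V \<and> V \<subseteq> U \<and> regular N V g" by blast
  qed
next
  fix U V f assume U: "f \<in> trop_sheaf N U" "openin (trop_space N) V" "V \<subseteq> U"
  show "f \<in> trop_sheaf N V"
    unfolding trop_sheaf_def
  proof (intro CollectI ballI)
    fix x assume x: "x \<in> V"
    then obtain W where W: "openin (trop_space N) W" "x \<in> W" "regular N W f"
      using U unfolding trop_sheaf_def by blast
    then have "openin (trop_space N) (W \<inter> V)" "regular N (W \<inter> V) f"
      using U(2) regular_subset[OF W(3), of "W \<inter> V"] by auto
    then show "\<exists>W. openin (trop_space N) W \<and> x \<in> W \<and> W \<subseteq> V \<and> regular N W f" using W(2) x by blast
  qed
next
  fix U f assume "\<And>x. x \<in> U \<Longrightarrow> \<exists>V. openin (trop_space N) V \<and> x \<in> V \<and> V \<subseteq> U \<and> f \<in> trop_sheaf N V"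
  note loc = this
  show "f \<in> trop_sheaf N U"
    unfolding trop_sheaf_def
  proof (intro CollectI ballI)
    fix x assume "x \<in> U"
    then obtain V where V: "x \<in> V" "V \<subseteq> U" "f \<in> trop_sheaf N V" using loc by blast
    then obtain W where "openin (trop_space N) W" "x \<in> W" "W \<subseteq> V" "regular N W f"
      unfolding trop_sheaf_def by blast
    then show "\<exists>W. openin (trop_space N) W \<and> x \<in> W \<and> W \<subseteq> U \<and> regular N W f" using V(2) by blast
  qed
qed

lemma is_sheaf_restrict:
  assumes O: "is_sheaf X \<O>"
  shows "is_sheaf (subtopology X S) (restrict_sheaf X \<O> S)"
proof (rule is_sheafI)
  fix U f x assume U: "openin (subtopology X S) U" "f \<in> restrict_sheaf X \<O> S U" "x \<in> U"
  then obtain V g where V: "openin X V" "x \<in> V" "g \<in> \<O> V" "\<forall>y\<in>V \<inter> S. f y = g y"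
    unfolding restrict_sheaf_def by blast
  have "x \<in> S" using U(1,3) openin_imp_subset by blast
  then show "f x \<noteq> \<infinity>" using is_sheafD(1)[OF O V(1,3,2)] V(2,4) by simp
next
  fix U f g assume U: "openin (subtopology X S) U" "f \<in> restrict_sheaf X \<O> S U" "\<And>x. x \<in> U \<Longrightarrow> f x = g x"
  show "g \<in> restrict_sheaf X \<O> S U"
    unfolding restrict_sheaf_def
  proof (intro CollectI ballI)
    fix x assume "x \<in> U"
    then obtain V k where V: "openin X V" "x \<in> V" "V \<inter> S \<subseteq> U" "k \<in> \<O> V" "\<forall>y\<in>V \<inter> S. f y = k y"
      using U(2) unfolding restrict_sheaf_def by blast
    then have "\<forall>y\<in>V \<inter> S. g y = k y" using U(3) by (metis subsetD)
    then show "\<exists>V k. openin X V \<and> x \<in> V \<and> V \<inter> S \<subseteq> U \<and> k \<in> \<O> V \<and> (\<forall>y\<in>V \<inter> S. g y = k y)"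
      using V by blast
  qed
next
  fix U V f assume U: "f \<in> restrict_sheaf X \<O> S U" "openin (subtopology X S) V" "V \<subseteq> U"
  obtain V' where V': "openin X V'" "V = V' \<inter> S" using U(2) unfolding openin_subtopology by blast
  show "f \<in> restrict_sheaf X \<O> S V"
    unfolding restrict_sheaf_def
  proof (intro CollectI ballI)
    fix x assume x: "x \<in> V"
    then obtain W k where W: "openin X W" "x \<in> W" "W \<inter> S \<subseteq> U" "k \<in> \<O> W" "\<forall>y\<in>W \<inter> S. f y = k y"
      using U unfolding restrict_sheaf_def by blast
    have o: "openin X (W \<inter> V')" using W(1) V'(1) by blast
    have "k \<in> \<O> (W \<inter> V')" by (rule is_sheafD(3)[OF O W(1,4) o]) blast
    moreover have "W \<inter> V' \<inter> S \<subseteq> V" using V'(2) by blast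
    ultimately show "\<exists>W k. openin X W \<and> x \<in> W \<and> W \<inter> S \<subseteq> V \<and> k \<in> \<O> W \<and> (\<forall>y\<in>W \<inter> S. f y = k y)"
      using o W V'(2) x by (intro exI[of _ "W \<inter> V'"] exI[of _ k]) auto
  qed
next
  fix U f assume U: "\<And>x. x \<in> U \<Longrightarrow> \<exists>V. openin (subtopology X S) V \<and> x \<in> V \<and> V \<subseteq> U \<and> f \<in> restrict_sheaf X \<O> S V"
  show "f \<in> restrict_sheaf X \<O> S U"
    unfolding restrict_sheaf_def
  proof (intro CollectI ballI)
    fix x assume "x \<in> U"
    then obtain V where V: "x \<in> V" "V \<subseteq> U" "f \<in> restrict_sheaf X \<O> S V" using U by blast
    then obtain W g where "openin X W" "x \<in> W" "W \<inter> S \<subseteq> V" "g \<in> \<O> W" "\<forall>y\<in>W \<inter> S. f y = g y"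
      unfolding restrict_sheaf_def by blast
    then show "\<exists>V g. openin X V \<and> x \<in> V \<and> V \<inter> S \<subseteq> U \<and> g \<in> \<O> V \<and> (\<forall>y\<in>V \<inter> S. f y = g y)"
      using V(2) by (intro exI[of _ W] exI[of _ g]) auto
  qed
qed

text \<open>A chart is an open part of the closure of a complex in the tropical space. Restricting
  the sheaf first to the closure and then to this part must agree with restricting it at
  once.\<close>

lemma restrict_restrict_sheaf:
  assumes "V \<subseteq> Y" "W \<subseteq> V"
  shows "restrict_sheaf (subtopology X Y) (restrict_sheaf X \<O> Y) V W = restrict_sheaf X \<O> V W"
proof (intro equalityI subsetI)
  fix f assume f: "f \<in> restrict_sheaf (subtopology X Y) (restrict_sheaf X \<O> Y) V W"
  show "f \<in> restrict_sheaf X \<O> V W"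
    unfolding restrict_sheaf_def
  proof (intro CollectI ballI)
    fix x assume "x \<in> W"
    then obtain V1 g where V1: "x \<in> V1" "V1 \<inter> V \<subseteq> W" "g \<in> restrict_sheaf X \<O> Y V1" "\<forall>y\<in>V1 \<inter> V. f y = g y"
      using f unfolding restrict_sheaf_def[of "subtopology X Y"] by blast
    obtain V2 k where V2: "openin X V2" "x \<in> V2" "V2 \<inter> Y \<subseteq> V1" "k \<in> \<O> V2" "\<forall>y\<in>V2 \<inter> Y. g y = k y"
      using V1(1,3) unfolding restrict_sheaf_def by blast
    have "f y = k y" if "y \<in> V2 \<inter> V" for y
    proof -
      have "y \<in> V1 \<inter> V" "y \<in> V2 \<inter> Y" using that V2(3) assms(1) by blast+
      then show ?thesis using V1(4) V2(5) by simp
    qed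
    moreover have "V2 \<inter> V \<subseteq> W" using V1(2) V2(3) assms(1) by blast
    ultimately have "V2 \<inter> V \<subseteq> W" "\<forall>y\<in>V2 \<inter> V. f y = k y" by blast+
    then show "\<exists>V2 k. openin X V2 \<and> x \<in> V2 \<and> V2 \<inter> V \<subseteq> W \<and> k \<in> \<O> V2 \<and> (\<forall>y\<in>V2 \<inter> V. f y = k y)"
      using V2 by blast
  qed
next
  fix f assume f: "f \<in> restrict_sheaf X \<O> V W"
  show "f \<in> restrict_sheaf (subtopology X Y) (restrict_sheaf X \<O> Y) V W"
    unfolding restrict_sheaf_def[of "subtopology X Y"]
  proof (intro CollectI ballI)
    fix x assume "x \<in> W"
    then obtain V2 k where V2: "openin X V2" "x \<in> V2" "V2 \<inter> V \<subseteq> W" "k \<in> \<O> V2" "\<forall>y\<in>V2 \<inter> V. f y = k y"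
      using f unfolding restrict_sheaf_def by blast
    show "\<exists>V1 g. openin (subtopology X Y) V1 \<and> x \<in> V1 \<and> V1 \<inter> V \<subseteq> W \<and> g \<in> restrict_sheaf X \<O> Y V1 \<and> (\<forall>y\<in>V1 \<inter> V. f y = g y)"
    proof (intro exI conjI)
      show "openin (subtopology X Y) (V2 \<inter> Y)" using V2(1) unfolding openin_subtopology by blast
      show "k \<in> restrict_sheaf X \<O> Y (V2 \<inter> Y)" unfolding restrict_sheaf_def using V2(1,4) by blast
      show "x \<in> V2 \<inter> Y" using V2(2) \<open>x \<in> W\<close> assms by blast
      show "V2 \<inter> Y \<inter> V \<subseteq> W" "\<forall>y\<in>V2 \<inter> Y \<inter> V. f y = k y" using V2(3,5) by auto
    qed
  qed
qed

lemma restrict_sheaf_topspace: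
  assumes "is_sheaf X \<O>" "openin X U"
  shows "restrict_sheaf X \<O> (topspace X) U = \<O> U"
proof (intro equalityI subsetI)
  fix f assume f: "f \<in> restrict_sheaf X \<O> (topspace X) U"
  show "f \<in> \<O> U"
  proof (rule is_sheaf_glue[OF assms])
    fix x assume "x \<in> U"
    then obtain V g where V: "openin X V" "x \<in> V" "V \<inter> topspace X \<subseteq> U" "g \<in> \<O> V" "\<forall>y\<in>V \<inter> topspace X. f y = g y"
      using f unfolding restrict_sheaf_def by blast
    have VX: "V \<subseteq> topspace X" by (rule openin_subset[OF V(1)])
    have "f \<in> \<O> V" by (rule is_sheafD(2)[OF assms(1) V(1,4)]) (use V(5) VX in auto)
    then show "\<exists>V. openin X V \<and> x \<in> V \<and> V \<subseteq> U \<and> f \<in> \<O> V" using V VX by blast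
  qed
next
  fix f assume "f \<in> \<O> U"
  then show "f \<in> restrict_sheaf X \<O> (topspace X) U" unfolding restrict_sheaf_def using assms(2) by blast
qed

lemma sheaf_iso_cong:
  assumes "sheaf_iso X \<O> Y \<O>' \<phi>" "\<And>U. openin X U \<Longrightarrow> \<O>1 U = \<O> U" "\<And>V. openin Y V \<Longrightarrow> \<O>1' V = \<O>' V"
  shows "sheaf_iso X \<O>1 Y \<O>1' \<phi>"
proof -
  have h: "homeomorphic_map X Y \<phi>" using assms(1) unfolding sheaf_iso_def by blast
  then have "openin X {x \<in> topspace X. \<phi> x \<in> V}" if "openin Y V" for V
    using openin_continuous_map_preimage[OF homeomorphic_imp_continuous_map that] by blast
  then show ?thesis using assms unfolding sheaf_iso_def by simp
qed

definition transport_sheaf :: "'a topology \<Rightarrow> ('a \<Rightarrow> 'b) \<Rightarrow> 'b fun_sheaf \<Rightarrow> 'a fun_sheaf" where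
  "transport_sheaf X h \<O> U = {f. f \<circ> inv_into (topspace X) h \<in> \<O> (h ` U)}"

lemma transport_sheaf:
  fixes X :: "'a topology" and Y :: "'b topology"
  assumes h: "homeomorphic_map X Y h" and O: "is_sheaf Y \<O>"
  shows "is_sheaf X (transport_sheaf X h \<O>)" "sheaf_iso X (transport_sheaf X h \<O>) Y \<O> h"
proof -
  let ?g = "inv_into (topspace X) h"
  have inj: "inj_on h (topspace X)" and im: "h ` topspace X = topspace Y"
    using homeomorphic_imp_injective_map[OF h] homeomorphic_imp_surjective_map[OF h] by auto
  have op: "openin Y (h ` U)" if "openin X U" for U
    using homeomorphic_imp_open_map[OF h] that unfolding open_map_def by blast
  have g: "?g (h x) = x" if "openin X U" "x \<in> U" for U x
    using inv_into_f_f[OF inj] openin_subset[OF that(1)] that(2) by blast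
  show "is_sheaf X (transport_sheaf X h \<O>)"
  proof (rule is_sheafI)
    fix U f x assume U: "openin X U" "f \<in> transport_sheaf X h \<O> U" "x \<in> U"
    then have "(f \<circ> ?g) (h x) \<noteq> \<infinity>"
      using is_sheafD(1)[OF O op[OF U(1)], of "f \<circ> ?g" "h x"] unfolding transport_sheaf_def by blast
    then show "f x \<noteq> \<infinity>" using g[OF U(1,3)] by simp
  next
    fix U f k assume U: "openin X U" "f \<in> transport_sheaf X h \<O> U" "\<And>x. x \<in> U \<Longrightarrow> f x = k x"
    have f: "f \<circ> ?g \<in> \<O> (h ` U)" using U(2) unfolding transport_sheaf_def by blast
    have "k \<circ> ?g \<in> \<O> (h ` U)"
      by (rule is_sheafD(2)[OF O op[OF U(1)] f]) (use U(3) g[OF U(1)] in auto)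
    then show "k \<in> transport_sheaf X h \<O> U" unfolding transport_sheaf_def by blast
  next
    fix U V f assume U: "openin X U" "f \<in> transport_sheaf X h \<O> U" "openin X V" "V \<subseteq> U"
    have f: "f \<circ> ?g \<in> \<O> (h ` U)" using U(2) unfolding transport_sheaf_def by blast
    have "f \<circ> ?g \<in> \<O> (h ` V)" by (rule is_sheafD(3)[OF O op[OF U(1)] f op[OF U(3)]]) (use U(4) in blast)
    then show "f \<in> transport_sheaf X h \<O> V" unfolding transport_sheaf_def by blast
  next
    fix U f assume U: "openin X U"
      "\<And>x. x \<in> U \<Longrightarrow> \<exists>V. openin X V \<and> x \<in> V \<and> V \<subseteq> U \<and> f \<in> transport_sheaf X h \<O> V"
    have "f \<circ> ?g \<in> \<O> (h ` U)"
    proof (rule is_sheaf_glue[OF O op[OF U(1)]])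
      fix y assume "y \<in> h ` U"
      then obtain x where x: "x \<in> U" "y = h x" by blast
      obtain V where V: "openin X V" "x \<in> V" "V \<subseteq> U" "f \<in> transport_sheaf X h \<O> V" using U(2)[OF x(1)] by blast
      then show "\<exists>W. openin Y W \<and> y \<in> W \<and> W \<subseteq> h ` U \<and> f \<circ> ?g \<in> \<O> W"
        using op[OF V(1)] x(2) unfolding transport_sheaf_def by blast
    qed
    then show "f \<in> transport_sheaf X h \<O> U" unfolding transport_sheaf_def by blast
  qed
  show "sheaf_iso X (transport_sheaf X h \<O>) Y \<O> h"
    unfolding sheaf_iso_def
  proof (intro conjI h allI impI)
    fix V and f :: "'b \<Rightarrow> ereal" assume V: "openin Y V"
    have VY: "V \<subseteq> topspace Y" by (rule openin_subset[OF V])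
    have imV: "h ` {x \<in> topspace X. h x \<in> V} = V"
    proof (intro equalityI subsetI)
      fix y assume y: "y \<in> V"
      then have "y \<in> h ` topspace X" unfolding im using VY by blast
      then show "y \<in> h ` {x \<in> topspace X. h x \<in> V}" using y by blast
    qed blast
    have eq: "(f \<circ> h \<circ> ?g) y = f y" if "y \<in> V" for y
    proof -
      have "y \<in> h ` topspace X" unfolding im using that VY by blast
      then show ?thesis by (simp add: f_inv_into_f)
    qed
    have "f \<circ> h \<in> transport_sheaf X h \<O> {x \<in> topspace X. h x \<in> V} \<longleftrightarrow> f \<circ> h \<circ> ?g \<in> \<O> V"
      unfolding transport_sheaf_def imV by simp
    also have "\<dots> \<longleftrightarrow> f \<in> \<O> V"
      using is_sheafD(2)[OF O V, of "f \<circ> h \<circ> ?g" f] is_sheafD(2)[OF O V, of f "f \<circ> h \<circ> ?g"] eq by metis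
    finally show "f \<in> \<O> V \<longleftrightarrow> f \<circ> h \<in> transport_sheaf X h \<O> {x \<in> topspace X. h x \<in> V}" by simp
  qed
qed

lemma topspace_trop: "topspace (trop_space N) = {x. (\<forall>i. x i \<noteq> \<infinity>) \<and> (\<forall>i\<ge>N. x i = 0)}"
  unfolding trop_space_def by simp

lemma emb_trop: "x \<in> Rn N \<Longrightarrow> emb x \<in> topspace (trop_space N)"
  unfolding topspace_trop emb_def by (simp add: Rn_iff zero_ereal_def)

lemma continuous_map_trop_coord: "continuous_map (trop_space N) euclidean (\<lambda>x. x i)"
  unfolding trop_space_def
  by (intro continuous_map_from_subtopology continuous_map_product_projection) simp

lemma continuous_map_into_trop:
  "continuous_map X (trop_space N) f \<longleftrightarrow>
    (\<forall>i. continuous_map X euclidean (\<lambda>x. f x i)) \<and> f ` topspace X \<subseteq> topspace (trop_space N)"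
  unfolding trop_space_def continuous_map_in_subtopology continuous_map_componentwise_UNIV by auto

text \<open>A coordinate is a tropical Laurent polynomial with the single monomial
  \<open>unit_fun m\<close> and coefficient 0.\<close>

lemma coordinate_regular:
  assumes "m < N"
  shows "(\<lambda>x. x m) \<in> trop_sheaf N (topspace (trop_space N))"
proof -
  have "continuous_map (trop_space N) (top_of_set (- {\<infinity>})) (\<lambda>x. x m)"
    unfolding continuous_map_in_subtopology using continuous_map_trop_coord by (auto simp: topspace_trop)
  moreover have "laurent_polynomial N (\<lambda>x. x m)"
    unfolding laurent_polynomial_def
  proof (intro exI[of _ "{unit_fun m}"] exI[of _ "\<lambda>_. 0"] conjI ballI)
    fix x :: "nat \<Rightarrow> real"
    have "dot N (unit_fun m) x = x m"
      using assms unfolding dot_def unit_fun_def by (simp add: if_distrib if_distribR cong: if_cong)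
    then show "x m = Max ((\<lambda>j. 0 + dot N j x) ` {unit_fun m})" by simp
  qed (use unit_fun_Zn[OF assms] in auto)
  ultimately have "regular N (topspace (trop_space N)) (\<lambda>x. x m)"
    unfolding regular_def by (auto simp: emb_def)
  then show ?thesis unfolding trop_sheaf_def using openin_topspace by blast
qed

lemma coordinate_restrict_regular:
  assumes "m < N" "Y \<subseteq> topspace (trop_space N)"
  shows "(\<lambda>x. x m) \<in> restrict_sheaf (trop_space N) (trop_sheaf N) Y Y"
  unfolding restrict_sheaf_def
proof (intro CollectI ballI)
  fix x assume x: "x \<in> Y"
  show "\<exists>V g. openin (trop_space N) V \<and> x \<in> V \<and> V \<inter> Y \<subseteq> Y \<and> g \<in> trop_sheaf N V \<and> (\<forall>y\<in>V \<inter> Y. y m = g y)"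
    using x assms(2) coordinate_regular[OF assms(1)]
    by (intro exI[of _ "topspace (trop_space N)"] exI[of _ "\<lambda>x. x m"]) auto
qed

section \<open>The moduli space and the fan\<close>

definition finite_part :: "(nat \<Rightarrow> ereal) \<Rightarrow> nat \<Rightarrow> real" where
  "finite_part y = (\<lambda>i. real_of_ereal (y i))"

lemma finite_part_emb [simp]: "finite_part (emb x) = x"
  unfolding finite_part_def emb_def by simp

lemma emb_inj: "emb x = emb y \<longleftrightarrow> x = y"
  using finite_part_emb by metis

definition finite_points :: "nat \<Rightarrow> (nat \<Rightarrow> ereal) set" where
  "finite_points N = emb ` Rn N"

lemma finite_points_iff: "y \<in> finite_points N \<longleftrightarrow> y \<in> topspace (trop_space N) \<and> (\<forall>i. y i \<noteq> -\<infinity>)"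
proof
  assume "y \<in> finite_points N"
  then obtain x where "x \<in> Rn N" "y = emb x" unfolding finite_points_def by blast
  then show "y \<in> topspace (trop_space N) \<and> (\<forall>i. y i \<noteq> -\<infinity>)"
    using emb_trop by (auto simp: emb_def)
next
  assume y: "y \<in> topspace (trop_space N) \<and> (\<forall>i. y i \<noteq> -\<infinity>)"
  then have fin: "y i \<noteq> \<infinity>" "y i \<noteq> -\<infinity>" for i by (auto simp: topspace_trop)
  have "ereal (real_of_ereal (y i)) = y i" for i using fin[of i] by (cases "y i") auto
  then have "y = emb (finite_part y)" unfolding emb_def finite_part_def by simp
  moreover have "finite_part y \<in> Rn N" using y by (simp add: finite_part_def Rn_iff topspace_trop)
  ultimately show "y \<in> finite_points N" unfolding finite_points_def by blast
qed

lemma emb_finite_part: "y \<in> finite_points N \<Longrightarrow> emb (finite_part y) = y"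
  unfolding finite_points_def by auto

text \<open>Only the first \<open>N\<close> entries can be infinite, so finitely many open
  conditions describe the set.\<close>

lemma openin_finite_points: "openin (trop_space N) (finite_points N)"
proof -
  have "openin (trop_space N) {y \<in> topspace (trop_space N). y i \<in> - {-\<infinity>}}" for i
    by (rule openin_continuous_map_preimage[OF continuous_map_trop_coord]) (simp add: open_Compl)
  then have "openin (trop_space N) (topspace (trop_space N) \<inter> (\<Inter>i<N. {y \<in> topspace (trop_space N). y i \<in> - {-\<infinity>}}))"
    by (cases "N = 0") (auto intro!: openin_Int openin_INT)
  also have "topspace (trop_space N) \<inter> (\<Inter>i<N. {y \<in> topspace (trop_space N). y i \<in> - {-\<infinity>}}) = finite_points N"
  proof (intro equalityI subsetI)
    fix y assume y: "y \<in> topspace (trop_space N) \<inter> (\<Inter>i<N. {y \<in> topspace (trop_space N). y i \<in> - {-\<infinity>}})"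
    have "y i \<noteq> -\<infinity>" for i
      using y by (cases "i < N") (auto simp: topspace_trop)
    then show "y \<in> finite_points N" unfolding finite_points_iff using y by blast
  qed (auto simp: finite_points_iff)
  finally show ?thesis .
qed

text \<open>\<open>real_of_ereal\<close> is continuous away from the infinite values, hence the
  restriction to finite points.\<close>

lemma continuous_map_finite_part:
  assumes "Y \<subseteq> finite_points N"
  shows "continuous_map (subtopology (trop_space N) Y) euclidean finite_part"
proof -
  have "continuous_map (subtopology (trop_space N) Y) euclideanreal (\<lambda>y. real_of_ereal (y i))" for i
  proof -
    have "continuous_map (subtopology (trop_space N) Y) (top_of_set (UNIV - {\<infinity>, -\<infinity>})) (\<lambda>y. y i)"
      unfolding continuous_map_in_subtopology
      using assms continuous_map_from_subtopology[OF continuous_map_trop_coord]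
      by (auto simp: finite_points_iff topspace_trop subset_iff)
    moreover have "continuous_map (top_of_set (UNIV - {\<infinity>, -\<infinity>})) euclideanreal real_of_ereal"
      using continuous_on_real by simp
    ultimately show ?thesis using continuous_map_compose[unfolded comp_def] by blast
  qed
  then have "continuous_map (subtopology (trop_space N) Y) (powertop_real UNIV) finite_part"
    unfolding continuous_map_componentwise_UNIV finite_part_def by simp
  then show ?thesis by (simp add: euclidean_product_topology)
qed

text \<open>Two closed conditions describe the cone: all entries are those predicted by the
  coefficients, and the coefficients are nonnegative.\<close>

lemma closed_scone:
  assumes "dual_system N A r m"
  shows "closed (scone r A)"
proof -
  have c: "continuous_on UNIV (\<lambda>x::nat \<Rightarrow> real. x j)" for j by (rule continuous_on_product_coordinates)
  have "closed {x::nat \<Rightarrow> real. x j = (\<Sum>i\<in>A. x (m i) * r i j)}" for j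
    by (intro closed_Collect_eq continuous_intros c)
  then have "closed (\<Inter>j. {x::nat \<Rightarrow> real. x j = (\<Sum>i\<in>A. x (m i) * r i j)})" by blast
  moreover have "closed (\<Inter>i\<in>A. {x::nat \<Rightarrow> real. 0 \<le> x (m i)})"
    by (intro closed_INT ballI closed_Collect_le continuous_intros c)
  moreover have "scone r A = (\<Inter>j. {x. x j = (\<Sum>i\<in>A. x (m i) * r i j)}) \<inter> (\<Inter>i\<in>A. {x. 0 \<le> x (m i)})"
  proof -
    have "x = (\<Sum>i\<in>A. x (m i) *\<^sub>R r i) \<longleftrightarrow> (\<forall>j. x j = (\<Sum>i\<in>A. x (m i) * r i j))" for x
      unfolding fun_eq_iff sum_fun_apply by simp
    then show ?thesis using scone_iff[OF assms] by blast
  qed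
  ultimately show ?thesis by (simp add: closed_Int)
qed

definition moduli_map :: "nat \<Rightarrow> curve set \<Rightarrow> nat \<Rightarrow> ereal" where
  "moduli_map n x = emb (pt n (wt_class n x))"

definition moduli_image :: "nat \<Rightarrow> (nat \<Rightarrow> ereal) set" where
  "moduli_image n = emb ` \<Union>(fan n)"

lemma pt_Rn: "pt n l \<in> Rn (amb n)"
  by (simp add: Rn_iff pt_def)

lemma moduli_image_eq: "3 \<le> n \<Longrightarrow> moduli_image n = (\<lambda>l. emb (pt n l)) ` weights n"
  unfolding moduli_image_def Union_fan image_image ..

lemma moduli_image_finite: "3 \<le> n \<Longrightarrow> moduli_image n \<subseteq> finite_points (amb n)"
  unfolding moduli_image_eq finite_points_def using pt_Rn by blast

lemma moduli_image_trop: "3 \<le> n \<Longrightarrow> moduli_image n \<subseteq> topspace (trop_space (amb n))"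
  using moduli_image_finite finite_points_iff by blast

lemma moduli_map_curves_of: "3 \<le> n \<Longrightarrow> l \<in> weights n \<Longrightarrow> moduli_map n (curves_of n l) = emb (pt n l)"
  unfolding moduli_map_def by (simp add: wt_class_curves_of)

lemma moduli_map_image: "3 \<le> n \<Longrightarrow> moduli_map n ` moduli n = moduli_image n"
  unfolding moduli_eq moduli_image_eq image_image by (rule image_cong) (simp_all add: moduli_map_curves_of)

lemma moduli_map_inj: "3 \<le> n \<Longrightarrow> inj_on (moduli_map n) (moduli n)"
proof (rule inj_onI)
  fix x y assume n: "3 \<le> n" and xy: "x \<in> moduli n" "y \<in> moduli n" "moduli_map n x = moduli_map n y"
  have "pt n (wt_class n x) = pt n (wt_class n y)" using xy(3) unfolding moduli_map_def emb_inj .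
  then have "wt_class n x = wt_class n y"
    using pt_inj[OF n moduli_class(1)[OF n xy(1)] moduli_class(1)[OF n xy(2)]] by blast
  then show "x = y" using moduli_class(2)[OF n xy(1)] moduli_class(2)[OF n xy(2)] by metis
qed

section \<open>The embedding is a homeomorphism onto the fan\<close>

lemma finite_bounded_edges: "rational_curve n G \<Longrightarrow> finite (bounded_edges G)"
proof -
  assume G: "rational_curve n G"
  have "edges G \<subseteq> Pow (verts G)" using rational_curve_edge_sub[OF G] by blast
  moreover have "finite (verts G)" using G by (simp add: rational_curve_def is_tree_def)
  ultimately have "finite (edges G)" by (meson finite_Pow_iff finite_subset)
  then show ?thesis unfolding bounded_edges_def by simp
qed

lemma continuous_map_type_cone: "e \<in> bounded_edges G \<Longrightarrow> continuous_map (type_cone G) euclideanreal (\<lambda>l. l e)"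
  unfolding type_cone_def
  using continuous_map_product_projection[of e "bounded_edges G" "\<lambda>_. top_of_set {0::real..}"]
  by (simp add: continuous_map_in_subtopology)

lemma continuous_map_push:
  assumes "rational_curve n G"
  shows "continuous_map (type_cone G) (trop_space (amb n)) (\<lambda>l. emb (pt n (push n G l)))"
proof -
  have p: "continuous_map (type_cone G) euclideanreal (\<lambda>l. push n G l S)" for S
    unfolding push_def
    by (intro continuous_map_sum continuous_map_type_cone) (use finite_bounded_edges[OF assms] in auto)
  have v: "continuous_map (type_cone G) euclideanreal (\<lambda>l. val n (push n G l) P)" for P
    unfolding val_def by (intro continuous_map_sum p) (use finite_clusters in auto)
  have "continuous_map (type_cone G) euclideanreal (\<lambda>l. pt n (push n G l) i)" for i
    unfolding pt_def by (cases "i < amb n") (auto intro!: continuous_map_diff v)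
  moreover have "continuous_map euclideanreal euclidean ereal" by (simp add: continuous_on_ereal continuous_on_id)
  ultimately have "continuous_map (type_cone G) euclidean (\<lambda>l. ereal (pt n (push n G l) i))" for i
    using continuous_map_compose[unfolded comp_def] by blast
  then show ?thesis
    unfolding continuous_map_into_trop using emb_trop[OF pt_Rn] by (auto simp: emb_def)
qed

text \<open>For a final topology it suffices to look at each cone of lengths, where the coordinates
  are differences of sums of edge lengths.\<close>

lemma continuous_moduli_map:
  assumes n: "3 \<le> n"
  shows "continuous_map (moduli_top n) (subtopology (trop_space (amb n)) (moduli_image n)) (moduli_map n)"
proof -
  have "continuous_map (moduli_top n) (trop_space (amb n)) (moduli_map n)"
    unfolding continuous_map_def topspace_moduli[OF n]
  proof (intro conjI allI impI)
    show "moduli_map n \<in> moduli n \<rightarrow> topspace (trop_space (amb n))"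
      using moduli_map_image[OF n] moduli_image_trop[OF n] by blast
    fix U assume U: "openin (trop_space (amb n)) U"
    show "openin (moduli_top n) {x \<in> moduli n. moduli_map n x \<in> U}"
      unfolding openin_moduli_top
    proof (intro conjI allI impI)
      fix G assume G: "rational_curve n G"
      have "{l \<in> topspace (type_cone G). cone_point n G l \<in> {x \<in> moduli n. moduli_map n x \<in> U}}
          = {l \<in> topspace (type_cone G). emb (pt n (push n G l)) \<in> U}"
        using cone_point_curves_of[OF n G] moduli_map_curves_of[OF n] moduli_eq[OF n] by auto
      then show "openin (type_cone G) {l \<in> topspace (type_cone G). cone_point n G l \<in> {x \<in> moduli n. moduli_map n x \<in> U}}"
        using openin_continuous_map_preimage[OF continuous_map_push[OF G] U] by simp
    qed blast
  qed
  then show ?thesis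
    unfolding continuous_map_in_subtopology using moduli_map_image[OF n] topspace_moduli[OF n] by auto
qed

text \<open>The canonical curve with all weights equal to 1.\<close>

lemma curve_of_type:
  assumes n: "3 \<le> n" and h: "hier n \<N>"
  obtains G where "rational_curve n G" "inj_on (edge_split n G) (bounded_edges G)"
    "edge_split n G ` bounded_edges G = \<N>"
proof -
  let ?l = "\<lambda>S. of_bool (S \<in> \<N>) :: real"
  have s: "{S. ?l S \<noteq> 0} = \<N>" by auto
  interpret canonical n ?l
    by (rule canonical.intro[OF n]) (use h s in \<open>simp add: weights_def\<close>)
  show ?thesis
    by (rule that[OF rational_canon inj_split]) (use split_bounded tree_clusters_canon s in simp)
qed

lemma push_of_weights:
  assumes inj: "inj_on (edge_split n G) (bounded_edges G)" and im: "edge_split n G ` bounded_edges G = \<N>"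
    and l: "{S. l S \<noteq> 0} \<subseteq> \<N>"
  shows "push n G (\<lambda>e\<in>bounded_edges G. l (edge_split n G e)) = l"
proof
  fix S
  show "push n G (\<lambda>e\<in>bounded_edges G. l (edge_split n G e)) S = l S"
  proof (cases "S \<in> \<N>")
    case True
    then obtain e where e: "e \<in> bounded_edges G" "S = edge_split n G e" using im by blast
    have "{f \<in> bounded_edges G. edge_split n G f = S} = {e}" using e inj_onD[OF inj] by blast
    then show ?thesis unfolding push_def using e by simp
  next
    case False
    then have "{f \<in> bounded_edges G. edge_split n G f = S} = {}" using im by blast
    then have "push n G (\<lambda>e\<in>bounded_edges G. l (edge_split n G e)) S = 0"
      unfolding push_def by (simp only: sum.empty)
    moreover have "l S = 0" using l False by blast
    ultimately show ?thesis by simp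
  qed
qed

text \<open>The final topology speaks of preimages in cones, not of images. The image of the moduli
  space is a union of finitely many closed cones. On each of them the dual coordinates give a
  continuous map back to the lengths on a curve \<open>G\<close>, so the complement of the image of
  \<open>U\<close> is closed there.\<close>

lemma open_moduli_map:
  assumes n: "3 \<le> n"
  shows "open_map (moduli_top n) (subtopology (trop_space (amb n)) (moduli_image n)) (moduli_map n)"
  unfolding open_map_def
proof (intro allI impI)
  let ?N = "amb n"
  let ?T = "subtopology (trop_space ?N) (moduli_image n)"
  have topT: "topspace ?T = moduli_image n" using moduli_image_trop[OF n] by auto
  fix U assume U: "openin (moduli_top n) U"
  then have UM: "U \<subseteq> moduli n" unfolding openin_moduli_top by blast
  have closed: "closedin ?T (emb ` scone (ray n) \<N> - moduli_map n ` U)" if N: "\<N> \<in> facets n" for \<N>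
  proof -
    have h: "hier n \<N>" using N unfolding facets_def by blast
    obtain p where p: "separator n \<N> p" using separator_exists[OF h n] by blast
    let ?m = "dcoord n \<N> p"
    note d = dual_rays[OF h n p]
    let ?K = "emb ` scone (ray n) \<N>"
    have KI: "?K \<subseteq> moduli_image n" unfolding moduli_image_def fan_def using N by blast
    have cf: "continuous_map ?T euclidean finite_part"
      by (rule continuous_map_finite_part[OF moduli_image_finite[OF n]])
    have "?K = {y \<in> topspace ?T. finite_part y \<in> scone (ray n) \<N>}"
    proof (intro equalityI subsetI)
      fix y assume "y \<in> {y \<in> topspace ?T. finite_part y \<in> scone (ray n) \<N>}"
      then have "y \<in> finite_points ?N" "finite_part y \<in> scone (ray n) \<N>"
        unfolding topT using moduli_image_finite[OF n] by auto
      then show "y \<in> ?K" using emb_finite_part by (metis imageI)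
    qed (use KI topT in auto)
    then have Kc: "closedin ?T ?K"
      using closedin_continuous_map_preimage[OF cf, of "scone (ray n) \<N>"] closed_scone[OF d] by simp
    obtain G where G: "rational_curve n G" "inj_on (edge_split n G) (bounded_edges G)"
      "edge_split n G ` bounded_edges G = \<N>" by (rule curve_of_type[OF n h])
    \<comment> \<open>The inverse on one cone: the length of an edge is the dual coordinate of its
      split.\<close>
    let ?lam = "\<lambda>y. \<lambda>e\<in>bounded_edges G. real_of_ereal (y (?m (edge_split n G e)))"
    have topK: "topspace (subtopology ?T ?K) = ?K" using KI topT by auto
    have nonneg: "0 \<le> real_of_ereal (y (?m S))" if "y \<in> ?K" "S \<in> \<N>" for y S
    proof -
      obtain x where x: "x \<in> scone (ray n) \<N>" "y = emb x" using \<open>y \<in> ?K\<close> by blast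
      then have "0 \<le> x (?m S)" using scone_iff[OF d, of x] \<open>S \<in> \<N>\<close> by blast
      then show ?thesis using x(2) by (simp add: emb_def)
    qed
    have cont: "continuous_map (subtopology ?T ?K) (type_cone G) ?lam"
      unfolding type_cone_def continuous_map_componentwise
    proof (intro conjI ballI)
      show "?lam ` topspace (subtopology ?T ?K) \<subseteq> extensional (bounded_edges G)" by auto
      fix e assume e: "e \<in> bounded_edges G"
      have "continuous_map ?T euclideanreal (\<lambda>y. finite_part y i)" for i
        using continuous_map_compose[OF cf, of euclideanreal "\<lambda>x. x i"] continuous_on_product_coordinates[of i]
        by (simp add: comp_def)
      then have "continuous_map (subtopology ?T ?K) euclideanreal (\<lambda>y. real_of_ereal (y (?m (edge_split n G e))))"
        unfolding finite_part_def by (rule continuous_map_from_subtopology)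
      then have "continuous_map (subtopology ?T ?K) (top_of_set {0..}) (\<lambda>y. real_of_ereal (y (?m (edge_split n G e))))"
        unfolding continuous_map_in_subtopology topK using nonneg e G(3) by blast
      then show "continuous_map (subtopology ?T ?K) (top_of_set {0..}) (\<lambda>y. ?lam y e)" using e by simp
    qed
    let ?W = "{l \<in> topspace (type_cone G). cone_point n G l \<in> U}"
    have W: "openin (type_cone G) ?W" using U G(1) unfolding openin_moduli_top by blast
    have "{y \<in> topspace (subtopology ?T ?K). ?lam y \<in> ?W} = ?K \<inter> moduli_map n ` U"
    proof -
      have "?lam y \<in> ?W \<longleftrightarrow> y \<in> moduli_map n ` U" if y: "y \<in> ?K" for y
      proof -
        obtain x where x: "x \<in> scone (ray n) \<N>" "y = emb x" using y by blast
        obtain l where l: "l \<in> weights n" "{S. l S \<noteq> 0} \<subseteq> \<N>" "x = pt n l"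
          using x(1) scone_pt[OF h, of x] by blast
        have yl: "y = emb (pt n l)" using x(2) l(3) by simp
        have lm: "pt n l (?m S) = l S" if "S \<in> \<N>" for S
          unfolding pt_sum[OF h l(2)] by (rule dual_coord[OF d that])
        have "?lam y = (\<lambda>e\<in>bounded_edges G. l (edge_split n G e))"
          unfolding yl emb_def using lm G(3) by (intro restrict_ext) auto
        then have push: "push n G (?lam y) = l" using push_of_weights[OF G(2,3) l(2)] by simp
        have yt: "?lam y \<in> topspace (type_cone G)"
          using continuous_map_image_subset_topspace[OF cont] y topK by blast
        have "?lam y \<in> ?W \<longleftrightarrow> curves_of n l \<in> U"
          using cone_point_curves_of(1)[OF n G(1) yt] push yt by simp
        also have "\<dots> \<longleftrightarrow> y \<in> moduli_map n ` U"
        proof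
          assume "curves_of n l \<in> U"
          then show "y \<in> moduli_map n ` U" using moduli_map_curves_of[OF n l(1)] yl by (metis imageI)
        next
          assume "y \<in> moduli_map n ` U"
          then obtain x where x: "x \<in> U" "y = moduli_map n x" by blast
          have "moduli_map n x = moduli_map n (curves_of n l)"
            using x(2) yl moduli_map_curves_of[OF n l(1)] by simp
          moreover have "curves_of n l \<in> moduli n" unfolding moduli_eq[OF n] using l(1) by blast
          ultimately have "x = curves_of n l" using inj_onD[OF moduli_map_inj[OF n]] x(1) UM by blast
          then show "curves_of n l \<in> U" using x(1) by simp
        qed
        finally show ?thesis .
      qed
      then show ?thesis unfolding topK by blast
    qed
    then have "openin (subtopology ?T ?K) (?K \<inter> moduli_map n ` U)"
      using openin_continuous_map_preimage[OF cont W] by simp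
    then have "closedin (subtopology ?T ?K) (topspace (subtopology ?T ?K) - ?K \<inter> moduli_map n ` U)"
      by (rule closedin_diff[OF closedin_topspace])
    also have "topspace (subtopology ?T ?K) - ?K \<inter> moduli_map n ` U = ?K - moduli_map n ` U"
      unfolding topK by blast
    finally show ?thesis using Kc closedin_trans_full by blast
  qed
  have "moduli_image n - moduli_map n ` U = (\<Union>\<N>\<in>facets n. emb ` scone (ray n) \<N> - moduli_map n ` U)"
    unfolding moduli_image_def fan_def by blast
  moreover have "closedin ?T (\<Union>\<N>\<in>facets n. emb ` scone (ray n) \<N> - moduli_map n ` U)"
    by (rule closedin_Union) (use finite_facets closed in auto)
  ultimately have "closedin ?T (topspace ?T - moduli_map n ` U)" unfolding topT by simp
  moreover have "moduli_map n ` U \<subseteq> topspace ?T" unfolding topT using UM moduli_map_image[OF n] by blast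
  ultimately show "openin ?T (moduli_map n ` U)" by (simp add: openin_closedin_eq)
qed

lemma homeomorphic_moduli_map:
  assumes n: "3 \<le> n"
  shows "homeomorphic_map (moduli_top n) (subtopology (trop_space (amb n)) (moduli_image n)) (moduli_map n)"
proof (rule bijective_open_imp_homeomorphic_map)
  show "moduli_map n ` topspace (moduli_top n) = topspace (subtopology (trop_space (amb n)) (moduli_image n))"
    unfolding topspace_moduli[OF n] moduli_map_image[OF n] using moduli_image_trop[OF n] by auto
  show "inj_on (moduli_map n) (topspace (moduli_top n))"
    unfolding topspace_moduli[OF n] by (rule moduli_map_inj[OF n])
qed (rule continuous_moduli_map[OF n] open_moduli_map[OF n])+

text \<open>Charts of a tropical variety live in the closure of the complex in the tropical space.
  The fan is closed among the finite points and these form an open set, so the fan is an open part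
  of its closure.\<close>

lemma openin_moduli_image_closure:
  assumes n: "3 \<le> n"
  shows "openin (subtopology (trop_space (amb n)) (trop_space (amb n) closure_of moduli_image n)) (moduli_image n)"
proof -
  let ?X = "trop_space (amb n)"
  let ?Y = "\<Union>(fan n)"
  have "closed ?Y"
  proof (rule closed_Union)
    show "finite (fan n)" unfolding fan_def using finite_facets by simp
    show "\<forall>F\<in>fan n. closed F"
    proof
      fix F assume "F \<in> fan n"
      then obtain \<N> where N: "hier n \<N>" "F = scone (ray n) \<N>" unfolding fan_def facets_def by blast
      obtain p where "separator n \<N> p" using separator_exists[OF N(1) n] by blast
      then show "closed F" unfolding N(2) by (rule closed_scone[OF dual_rays[OF N(1) n]])
    qed
  qed
  then have "openin euclidean (- ?Y)" by (simp add: open_Compl)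
  then have "openin (subtopology ?X (finite_points (amb n)))
      {y \<in> topspace (subtopology ?X (finite_points (amb n))). finite_part y \<in> - ?Y}"
    by (rule openin_continuous_map_preimage[OF continuous_map_finite_part[OF subset_refl]])
  then have o: "openin ?X {y \<in> topspace (subtopology ?X (finite_points (amb n))). finite_part y \<in> - ?Y}"
    using openin_trans_full[OF _ openin_finite_points] by blast
  have "moduli_image n = finite_points (amb n) \<inter> ?X closure_of moduli_image n"
  proof (intro equalityI subsetI)
    fix y assume "y \<in> moduli_image n"
    then show "y \<in> finite_points (amb n) \<inter> ?X closure_of moduli_image n"
      using moduli_image_finite[OF n] closure_of_subset[OF moduli_image_trop[OF n]] by blast
  next
    fix y assume y: "y \<in> finite_points (amb n) \<inter> ?X closure_of moduli_image n"
    show "y \<in> moduli_image n"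
    proof (rule ccontr)
      assume ny: "y \<notin> moduli_image n"
      have "finite_part y \<notin> ?Y"
        using ny emb_finite_part[of y "amb n"] y unfolding moduli_image_def by (metis IntD1 imageI)
      moreover have "y \<in> topspace (subtopology ?X (finite_points (amb n)))"
        using y by (auto simp: finite_points_iff)
      ultimately have m: "y \<in> {y \<in> topspace (subtopology ?X (finite_points (amb n))). finite_part y \<in> - ?Y}" by blast
      have "y \<in> ?X closure_of moduli_image n" using y by blast
      then have "\<forall>T. y \<in> T \<and> openin ?X T \<longrightarrow> (\<exists>z. z \<in> moduli_image n \<and> z \<in> T)"
        unfolding in_closure_of by (rule conjunct2)
      from mp[OF spec[OF this] conjI[OF m o]] obtain z where "z \<in> moduli_image n" "finite_part z \<in> - ?Y"
        by blast
      then show False unfolding moduli_image_def by auto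
    qed
  qed
  then show ?thesis unfolding openin_subtopology using openin_finite_points by blast
qed

text \<open>An isomorphism of marked trees is a contraction without contracted edges once
  \<open>G\<close> carries the lengths pulled back from \<open>C\<close>.\<close>

lemma marked_iso_length:
  assumes n: "3 \<le> n" and G: "rational_curve n G" and C: "rational_curve n C" and iso: "marked_iso n G C \<phi>"
    and e: "e \<in> bounded_edges G"
  shows "elen C (\<phi> ` e) = ereal (wt n C (edge_split n G e))"
    and "{S. wt n C S \<noteq> 0} \<subseteq> edge_split n G ` bounded_edges G"
proof -
  have i: "edges C = (`) \<phi> ` edges G" "\<forall>i\<in>{1..n}. leaf C i = \<phi> ` leaf G i" "bij_betw \<phi> (verts G) (verts C)"
    using iso by (simp_all add: marked_iso_def)
  have leafs: "leaf_edges G = leaf G ` {1..n}" "leaf_edges C = leaf C ` {1..n}"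
    using G C unfolding rational_curve_def bij_betw_def by auto
  have b: "\<phi> ` f \<in> bounded_edges C" if f: "f \<in> bounded_edges G" for f
  proof -
    have fE: "f \<in> edges G" using f unfolding bounded_edges_def by blast
    have "\<phi> ` f \<notin> leaf_edges C"
    proof
      assume "\<phi> ` f \<in> leaf_edges C"
      then obtain j where j: "j \<in> {1..n}" "\<phi> ` f = \<phi> ` leaf G j" using leafs(2) i(2) by auto
      have "f = leaf G j"
        using marked_iso_inverse(2)[OF G iso fE] marked_iso_inverse(2)[OF G iso rational_curve_leaf[OF G j(1)]] j(2)
        by metis
      then show False using f j(1) leafs(1) unfolding bounded_edges_def by blast
    qed
    then show ?thesis unfolding bounded_edges_def using i(1) fE by blast
  qed
  let ?l = "\<lambda>f. real_of_ereal (elen C (\<phi> ` f))"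
  have Z: "{f \<in> bounded_edges G. ?l f = 0} = {}" using elen_pos(1)[OF C b] by force
  have len: "elen C (\<phi> ` f) = ereal (?l f)" if "f \<in> bounded_edges G" for f by (rule elen_pos(2)[OF C b[OF that]])
  have "inj_on \<phi> (verts G)" "\<phi> ` verts G = verts C" using i(3) by (auto simp: bij_betw_def)
  then have "contraction n G ?l C \<phi>"
    unfolding contraction_def Let_def Z using i len by (auto simp: inj_on_eq_iff)
  then interpret curve_contraction n G C ?l \<phi> by (rule curve_contraction.intro[OF G C])
  have wt: "wt n C = push n G ?l" by (rule wt_contraction[OF n])
  obtain r par rk q t where "rooted_curve G r par rk n q t" using rooted_curve_exists[OF G n] by blast
  then interpret r: rooted_curve G r par rk n q t .
  show "elen C (\<phi> ` e) = ereal (wt n C (edge_split n G e))"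
    unfolding wt r.push_edge[OF e] by (rule len[OF e])
  show "{S. wt n C S \<noteq> 0} \<subseteq> edge_split n G ` bounded_edges G"
    unfolding wt r.split_bounded using r.push_0 by blast
qed

text \<open>The length of an edge is the weight of its split, which is a dual coordinate for the
  laminar family of the type. The position is the same for all curves of the type.\<close>

lemma edge_length_coordinate:
  assumes n: "3 \<le> n" and \<Gamma>: "\<Gamma> \<in> comb_types n" and G: "G \<in> \<Gamma>" and e: "e \<in> bounded_edges G"
  shows "\<exists>m<amb n. \<forall>x\<in>stratum n \<Gamma>. edge_length n G e x = moduli_map n x m"
proof -
  have rel: "(C, D) \<in> type_rel n" if "C \<in> \<Gamma>" "D \<in> \<Gamma>" for C D
    using quotient_eq_iff[OF equiv_type_rel, of \<Gamma> n \<Gamma> C D] \<Gamma> that unfolding comb_types_def by blast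
  have rG: "rational_curve n G" using rel[OF G G] by (simp add: type_rel_iff)
  obtain r par rk q t where "rooted_curve G r par rk n q t" using rooted_curve_exists[OF rG n] by blast
  then interpret rooted_curve G r par rk n q t .
  let ?S = "edge_split n G e"
  have S: "?S \<in> tree_clusters" using split_bounded e by blast
  obtain p where p: "separator n tree_clusters p" using separator_exists[OF hier_tree_clusters n] by blast
  note d = dual_rays[OF hier_tree_clusters n p]
  let ?m = "dcoord n tree_clusters p ?S"
  have "edge_length n G e x = moduli_map n x ?m" if x: "x \<in> stratum n \<Gamma>" for x
  proof -
    have xM: "x \<in> moduli n" "x \<subseteq> \<Gamma>" using x unfolding stratum_def by auto
    let ?l = "wt_class n x"
    have len: "elen C (\<phi> ` e) = ereal (?l ?S) \<and> {S. ?l S \<noteq> 0} \<subseteq> tree_clusters"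
      if C: "C \<in> x" "marked_iso n G C \<phi>" for C \<phi>
      using marked_iso_length[OF n rG wt_class_mem(2)[OF n xM(1) C(1)] C(2) e]
      unfolding wt_class_mem(1)[OF n xM(1) C(1)] split_bounded by blast
    have "canon n ?l \<in> curves_of n ?l"
      using rational_canon'[OF n moduli_class(1)[OF n xM(1)]] unfolding curves_of_def by blast
    then have C: "canon n ?l \<in> x" using moduli_class(2)[OF n xM(1)] by blast
    then obtain \<phi> where \<phi>: "marked_iso n G (canon n ?l) \<phi>"
      using rel[OF G, of "canon n ?l"] xM(2) by (auto simp: type_rel_iff)
    have "edge_length n G e x = ereal (?l ?S)"
      unfolding edge_length_def
    proof (rule the_equality)
      show "\<exists>C\<in>x. \<exists>\<phi>. marked_iso n G C \<phi> \<and> ereal (?l ?S) = elen C (\<phi> ` e)"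
        using C \<phi> len[OF C \<phi>] by (intro bexI[of _ "canon n ?l"] exI[of _ \<phi>]) auto
      show "a = ereal (?l ?S)" if "\<exists>C\<in>x. \<exists>\<phi>. marked_iso n G C \<phi> \<and> a = elen C (\<phi> ` e)" for a
        using that len by blast
    qed
    moreover have "pt n ?l ?m = ?l ?S"
      using len[OF C \<phi>] pt_sum[OF hier_tree_clusters, of ?l] dual_coord[OF d S, of ?l] by simp
    ultimately show ?thesis unfolding moduli_map_def emb_def by simp
  qed
  moreover have "?m < amb n" using d S unfolding dual_system_def by blast
  ultimately show ?thesis by blast
qed

theorem theorem1:
  fixes n :: nat
  assumes "n \<ge> 3"
  shows "topspace (moduli_top n) = moduli n \<and>
    (\<exists>\<O> :: curve set fun_sheaf.
       tropical_variety (n - 3) (moduli_top n) \<O> \<and>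
       (\<forall>\<Gamma>\<in>comb_types n. \<forall>G\<in>\<Gamma>. \<forall>e\<in>bounded_edges G.
          edge_length n G e \<in> restrict_sheaf (moduli_top n) \<O> (stratum n \<Gamma>) (stratum n \<Gamma>)) \<and>
       (\<exists>N \<F> w \<phi>. simply_balanced N (n - 3) \<F> w \<and>
          (let Y = emb ` \<Union>\<F> in
             sheaf_iso (moduli_top n) \<O>
               (subtopology (trop_space N) Y) (restrict_sheaf (trop_space N) (trop_sheaf N) Y) \<phi>)))"
proof (intro conjI exI)
  note n = assms
  let ?X = "moduli_top n" and ?T = "trop_space (amb n)" and ?S = "trop_sheaf (amb n)" and ?Y = "moduli_image n"
  let ?OY = "restrict_sheaf ?T ?S ?Y"
  let ?\<phi> = "moduli_map n"
  \<comment> \<open>The structure sheaf is pulled back along the embedding, so that being an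
    isomorphism onto the fan holds by construction.\<close>
  let ?O = "transport_sheaf ?X ?\<phi> ?OY"
  show "topspace ?X = moduli n" by (rule topspace_moduli[OF n])
  note tr = transport_sheaf[OF homeomorphic_moduli_map[OF n] is_sheaf_restrict[OF is_sheaf_trop]]
  note sheafO = tr(1) and iso = tr(2)
  show "simply_balanced (amb n) (n - 3) (fan n) (\<lambda>_. 1)" by (rule simply_balanced_fan[OF n])
  show "let Y = emb ` \<Union>(fan n) in sheaf_iso ?X ?O (subtopology ?T Y) (restrict_sheaf ?T ?S Y) ?\<phi>"
    using iso unfolding Let_def moduli_image_def .
  have topY: "topspace (subtopology ?T ?Y) = ?Y" using moduli_image_trop[OF n] by auto
  let ?B = "?T closure_of ?Y"
  have YB: "?Y \<subseteq> ?B" by (rule closure_of_subset[OF moduli_image_trop[OF n]])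
  have subT: "subtopology (subtopology ?T ?B) ?Y = subtopology ?T ?Y"
    unfolding subtopology_subtopology using YB by (simp add: Int_absorb1)
  \<comment> \<open>The whole space is a single chart; only the iterated restrictions demanded by
    the definition have to be resolved.\<close>
  have "sheaf_iso (subtopology ?X (topspace ?X)) (restrict_sheaf ?X ?O (topspace ?X))
      (subtopology (subtopology ?T ?B) ?Y) (restrict_sheaf (subtopology ?T ?B) (restrict_sheaf ?T ?S ?B) ?Y) ?\<phi>"
    unfolding subT subtopology_topspace
  proof (rule sheaf_iso_cong[OF iso])
    show "restrict_sheaf ?X ?O (topspace ?X) U = ?O U" if "openin ?X U" for U
      by (rule restrict_sheaf_topspace[OF sheafO that])
    show "restrict_sheaf (subtopology ?T ?B) (restrict_sheaf ?T ?S ?B) ?Y V = ?OY V"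
      if "openin (subtopology ?T ?Y) V" for V
      by (rule restrict_restrict_sheaf[OF YB]) (use openin_subset[OF that] topY in blast)
  qed
  then show "tropical_variety (n - 3) ?X ?O"
    unfolding tropical_variety_def Let_def
  proof (intro conjI ballI exI)
    show "is_sheaf ?X ?O" by (rule sheafO)
    show "openin ?X (topspace ?X)" by (rule openin_topspace)
    show "simply_balanced (amb n) (n - 3) (fan n) (\<lambda>_. 1)" by (rule simply_balanced_fan[OF n])
    show "openin (subtopology ?T (?T closure_of emb ` \<Union>(fan n))) ?Y"
      using openin_moduli_image_closure[OF n] unfolding moduli_image_def .
  qed (simp_all add: moduli_image_def)
  \<comment> \<open>Coordinates of the fan pull back to global sections, and edge lengths are
    restrictions of such sections to strata.\<close>
  have coord: "(\<lambda>y. y m) \<circ> ?\<phi> \<in> ?O (topspace ?X)" if m: "m < amb n" for m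
  proof -
    have "openin (subtopology ?T ?Y) ?Y" using openin_topspace[of "subtopology ?T ?Y"] unfolding topY .
    moreover have "{x \<in> topspace ?X. ?\<phi> x \<in> ?Y} = topspace ?X"
      unfolding topspace_moduli[OF n] using moduli_map_image[OF n] by blast
    moreover have "(\<lambda>y. y m) \<in> ?OY ?Y" by (rule coordinate_restrict_regular[OF m moduli_image_trop[OF n]])
    moreover have "\<forall>V. openin (subtopology ?T ?Y) V \<longrightarrow>
        (\<forall>f. f \<in> ?OY V \<longleftrightarrow> f \<circ> ?\<phi> \<in> ?O {x \<in> topspace ?X. ?\<phi> x \<in> V})"
      using iso unfolding sheaf_iso_def by (rule conjunct2)
    ultimately show ?thesis by (simp only: simp_thms)
  qed
  show "\<forall>\<Gamma>\<in>comb_types n. \<forall>G\<in>\<Gamma>. \<forall>e\<in>bounded_edges G.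
      edge_length n G e \<in> restrict_sheaf ?X ?O (stratum n \<Gamma>) (stratum n \<Gamma>)"
  proof (intro ballI)
    fix \<Gamma> G e assume "\<Gamma> \<in> comb_types n" "G \<in> \<Gamma>" "e \<in> bounded_edges G"
    then obtain m where m: "m < amb n" "\<forall>x\<in>stratum n \<Gamma>. edge_length n G e x = ?\<phi> x m"
      using edge_length_coordinate[OF n] by blast
    have "stratum n \<Gamma> \<subseteq> topspace ?X" unfolding topspace_moduli[OF n] stratum_def by blast
    then show "edge_length n G e \<in> restrict_sheaf ?X ?O (stratum n \<Gamma>) (stratum n \<Gamma>)"
      unfolding restrict_sheaf_def[of ?X] using coord[OF m(1)] m(2) openin_topspace[of ?X]
      by (intro CollectI ballI exI[of _ "topspace ?X"] exI[of _ "(\<lambda>y. y m) \<circ> ?\<phi>"] conjI) auto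
  qed
qed

end
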